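(* Let $\epsilon>0$. The IncShrink view update protocol consisting of the Transform protocol (with lifetime contribution budget $b$ per record) together with the timer-based Shrink protocol sDPTimer (with privacy parameter $\epsilon$, contribution budget $b$, update interval $T$, and cache flush interval $f$ and size $s$), as described in the context, is an $\epsilon$-SIM-CDP view update protocol.
   Context: Growing database: an insertion-only collection $\mathcal{D}=\{u_i\}_{i\ge0}$ of time-stamped logical updates (records); $\mathcal{D}_t$ is its instance at time $t$. Two growing databases $\mathcal{D},\mathcal{D}'$ are neighboring if for some $\tau\ge0$: $\mathcal{D}_t=\mathcal{D}'_t$ for all $t\le\tau$, and for all $t>\tau$, $\mathcal{D}_t$ and $\mathcal{D}'_t$ differ by the addition or removal of a single logical update. A mechanism $F$ on growing databases is $\epsilon$-DP if $\Pr[F(\mathcal{D})\in O]\le e^{\epsilon}\Pr[F(\mathcal{D}')\in O]$ for all neighboring $\mathcal{D},\mathcal{D}'$ and all output sets $O$. Adversary model: there are data owners and two servers $\mathcal{S}_0,\mathcal{S}_1$. A semi-honest probabilistic polynomial time (p.p.t.) adversary may corrupt any subset of the owners and at most one of the two servers. $\epsilon$-SIM-CDP: a view update protocol $\Pi$ is $\epsilon$-SIM-CDP if there exist a mechanism $F$ on growing databases that is $\epsilon$-DP and a p.p.t. simulator $\mathcal{S}$ with access only to public parameters $\mathsf{pp}$ and the output of $F$, such that for every growing database $\mathcal{D}$ and every p.p.t. adversary $\mathcal{A}$, $$\Pr[\mathcal{A}(\mathrm{VIEW}^{\Pi}(\mathcal{D},\mathsf{pp}))=1]\le\Pr[\mathcal{A}(\mathrm{VIEW}^{\mathcal{S}}(F(\mathcal{D}),\mathsf{pp}))=1]+\mathrm{negl}(\kappa),$$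 where $\mathrm{VIEW}^{\Pi}$ is the adversary's view of the protocol execution, $\mathrm{VIEW}^{\mathcal{S}}$ is the simulator's output, and $\mathrm{negl}$ is negligible in the security parameter $\kappa$. Cryptographic setting: all data are shared between $\mathcal{S}_0,\mathcal{S}_1$ by XOR-based $(2,2)$-secret sharing over $\mathbb{Z}_m$, $m=2^{32}$ (shares of $x$ are $x_1$ uniform in $\mathbb{Z}_m$ and $x_2=x\oplus x_1$), and Transform and Shrink are evaluated by two-party computation protocols secure against semi-honest adversaries (for each party there is a p.p.t. simulator which, from that party's input and output, produces, jointly with the functionality output, a transcript computationally indistinguishable from the real view and output). Protocol. At each time step the owners upload a secret-shared batch of fixed public size $C_r$ (padded with dummy records). Transform: computes from the outsourced data the new view tuples, obliviously and truncated with a bound $\omega$, so that each input record affects at most $\omega$ rows of the output; the output is padded with dummy tuples to a fixed public maximal size ($bC_r$), each tuple carrying a hidden bit telling whether it is real. Each record has total contribution budget $b$, of which $\omega$ is consumed each time it is used as input to Transform; records with exhausted budget are no longer used, so each record contributes at most $b$ rows over the whole execution (the composed transformation over time is $b$-stable: changing one input record changes at most $b$ output rows). The padded output is appended, in secret-shared form, to a cache, and a secret-shared counter $c$ is increased by the number of real tuples in it and re-shared inside the computation with randomness contributed by both servers. sDPTimer: at each $t$ divisible by $T$, inside two-party computation, $c$ is recovered; noise $Y\sim\mathrm{Lap}(b/\epsilon)$ (Laplace, mean $0$, scale $b/\epsilon$) is generated from the XOR of uniform values contributed by the two servers (treated as an exact Laplace sample unknown to either server); $\mathrm{sz}=c+Y$;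 the cache is obliviously sorted with real tuples before dummies; the first $\mathrm{sz}$ tuples are removed and appended to the secret-shared materialized view; $c$ is reset to $0$ and re-shared. Thus the volume $\mathrm{sz}$ is visible to the servers. Cache flush: every $f$ time steps the cache is obliviously sorted, its first $s$ tuples are appended to the view, and the rest is discarded. Public parameters: $\epsilon,\ \mathbb{Z}_m,\ C_r,\ b,\ s,\ f,\ T$.
   Formalization: Assumes T·b·C_r < 2^32, so that the counter shared over Z_m cannot wrap between updates; and when owners are corrupted, the simulator is also given those owners' own data (otherwise no simulator could exist). *)

theory Defs
  imports "HOL-Probability.Probability" "HOL-Library.Word"
begin

section \<open>Probabilistic polynomial time\<close>

text \<open>
  The machine model is a structured multi-stack machine over bits: finitely many instructions,
  each touching only the top of one stack, each costing one step. Up to polynomial overhead this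
  is the probabilistic multi-tape Turing machine. A configuration consists of the pending
  instructions and the stacks; stack 0 holds the input at the start and the output at the end.
\<close>

datatype com =
    Push nat bool
  | Pop nat
  | Flip nat
  | Seq com com
  | Cond nat com com com  (* top bit 1, top bit 0, empty stack *)
  | While nat com         (* while the stack is nonempty *)

type_synonym config = "com list \<times> (nat \<Rightarrow> bool list)"

fun step :: "config \<Rightarrow> config pmf" where
  "step ([], s) = return_pmf ([], s)"
| "step (Push r b # k, s) = return_pmf (k, s(r := b # s r))"
| "step (Pop r # k, s) = return_pmf (k, s(r := tl (s r)))"
| "step (Flip r # k, s) = map_pmf (\<lambda>b. (k, s(r := b # s r))) (bernoulli_pmf (1/2))"
| "step (Seq c d # k, s) = return_pmf (c # d # k, s)"
| "step (Cond r c d e # k, s) =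
     return_pmf ((case s r of [] \<Rightarrow> e | b # _ \<Rightarrow> if b then c else d) # k, s)"
| "step (While r c # k, s) =
     return_pmf (if s r = [] then (k, s) else (c # While r c # k, s))"

fun steps :: "nat \<Rightarrow> config \<Rightarrow> config pmf" where
  "steps 0 cfg = return_pmf cfg"
| "steps (Suc n) cfg = bind_pmf (step cfg) (steps n)"

definition init_config :: "com \<Rightarrow> bool list \<Rightarrow> config" where
  "init_config c x = ([c], (\<lambda>_. [])(0 := x))"

definition halts_within :: "com \<Rightarrow> bool list \<Rightarrow> nat \<Rightarrow> bool" where
  "halts_within c x n \<longleftrightarrow> (\<forall>cfg \<in> set_pmf (steps n (init_config c x)). fst cfg = [])"

definition ppt :: "com \<Rightarrow> bool" where
  "ppt c \<longleftrightarrow> (\<exists>k. \<forall>x. halts_within c x (length x ^ k + k))"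

text \<open>Output distribution; meaningful for programs with a worst-case time bound, such as those
  satisfying \<^const>\<open>ppt\<close>.\<close>

definition exec :: "com \<Rightarrow> bool list \<Rightarrow> bool list pmf" where
  "exec c x = map_pmf (\<lambda>cfg. snd cfg 0) (steps (LEAST n. halts_within c x n) (init_config c x))"


section \<open>Self-delimiting encodings\<close>

definition enc_nat :: "nat \<Rightarrow> bool list" where
  "enc_nat n = replicate n True @ [False]"

definition enc_list :: "('a \<Rightarrow> bool list) \<Rightarrow> 'a list \<Rightarrow> bool list" where
  "enc_list e xs = concat (map (\<lambda>x. True # e x) xs) @ [False]"

definition enc_bits :: "bool list \<Rightarrow> bool list" where
  "enc_bits = enc_list (\<lambda>b. [b])"

type_synonym zm = "32 word"

definition enc_zm :: "zm \<Rightarrow> bool list" where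
  "enc_zm w = map (bit w) [0..<32]"

text \<open>Records, view rows and their shares are lists of elements of \<open>\<int>\<^sub>m\<close>.\<close>

type_synonym tuple = "zm list"

definition enc_tuples :: "tuple list \<Rightarrow> bool list" where
  "enc_tuples = enc_list (enc_list enc_zm)"


section \<open>Negligible functions and adversaries\<close>

definition negligible :: "(nat \<Rightarrow> real) \<Rightarrow> bool" where
  "negligible \<mu> \<longleftrightarrow> (\<forall>c::nat. \<forall>\<^sub>F \<kappa> in sequentially. \<bar>\<mu> \<kappa>\<bar> < 1 / real \<kappa> ^ c)"

text \<open>Adversaries are non-uniform: a program that always runs in polynomial time, together with
  one advice string of polynomial length for each value of the security parameter.\<close>

definition poly_advice :: "(nat \<Rightarrow> bool list) \<Rightarrow> bool" where
  "poly_advice a \<longleftrightarrow> (\<exists>k. \<forall>\<kappa>. length (a \<kappa>) \<le> \<kappa> ^ k + k)"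

definition adversary :: "com \<times> (nat \<Rightarrow> bool list) \<Rightarrow> bool" where
  "adversary A \<longleftrightarrow> ppt (fst A) \<and> poly_advice (snd A)"

definition prob_one :: "com \<times> (nat \<Rightarrow> bool list) \<Rightarrow> nat \<Rightarrow> bool list pmf \<Rightarrow> real" where
  "prob_one A \<kappa> V =
     pmf (bind_pmf V (\<lambda>v. exec (fst A) (enc_nat \<kappa> @ enc_bits (snd A \<kappa>) @ v))) [True]"


section \<open>Two-party computation against semi-honest adversaries\<close>

datatype server = S0 | S1

fun pick :: "server \<Rightarrow> 'a \<times> 'a \<Rightarrow> 'a" where
  "pick S0 p = fst p"
| "pick S1 p = snd p"

text \<open>A protocol is represented by the joint distribution of both parties' views and outputs, given
  the security parameter and both inputs.\<close>

type_synonym ('i, 'o) two_pc =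
  "nat \<Rightarrow> 'i \<Rightarrow> 'i \<Rightarrow> ((bool list \<times> bool list) \<times> ('o \<times> 'o)) pmf"

text \<open>Security is required on inputs of equal public shape only. The length bound on views is
  what remains visible of the parties being polynomial-time.\<close>

definition secure_2pc ::
  "('i \<Rightarrow> 'h) \<Rightarrow> ('i \<Rightarrow> bool list) \<Rightarrow> ('o \<Rightarrow> bool list) \<Rightarrow>
   ('i \<Rightarrow> 'i \<Rightarrow> ('o \<times> 'o) pmf) \<Rightarrow> ('i, 'o) two_pc \<Rightarrow> bool" where
  "secure_2pc shape enc_in enc_out f \<pi> \<longleftrightarrow>
     (\<exists>k. \<forall>\<kappa> x0 x1 v0 v1 y.
        shape x0 = shape x1 \<longrightarrow> ((v0, v1), y) \<in> set_pmf (\<pi> \<kappa> x0 x1) \<longrightarrow>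
        length v0 + length v1 \<le> (\<kappa> + length (enc_in x0) + length (enc_in x1)) ^ k + k) \<and>
     (\<forall>i. \<exists>Sim. ppt Sim \<and>
        (\<forall>x0 x1 A. shape x0 = shape x1 \<longrightarrow> adversary A \<longrightarrow>
           (\<exists>\<mu>. negligible \<mu> \<and> (\<forall>\<kappa>.
              \<bar>prob_one A \<kappa>
                  (do { (v, (y0, y1)) \<leftarrow> \<pi> \<kappa> x0 x1;
                        return_pmf (enc_bits (pick i v) @ enc_out y0 @ enc_out y1) })
               - prob_one A \<kappa>
                  (do { (y0, y1) \<leftarrow> f x0 x1;
                        v \<leftarrow> exec Sim (enc_nat \<kappa> @ enc_in (pick i (x0, x1))
                                               @ enc_out (pick i (y0, y1)));
                        return_pmf (enc_bits v @ enc_out y0 @ enc_out y1) })\<bar> \<le> \<mu> \<kappa>))))"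


section \<open>Growing databases and differential privacy\<close>

text \<open>A logical update is a record together with the owner it comes from. A growing database maps
  each time step \<open>t \<ge> 1\<close> to the updates with time stamp \<open>t\<close>; its value at \<open>0\<close> is irrelevant.\<close>

type_synonym update = "nat \<times> tuple"
type_synonym gdb = "nat \<Rightarrow> update multiset"

definition instance_at :: "gdb \<Rightarrow> nat \<Rightarrow> (nat \<times> update) multiset" where
  "instance_at D t = (\<Sum>i = 1..t. image_mset (Pair i) (D i))"

definition neighboring :: "gdb \<Rightarrow> gdb \<Rightarrow> bool" where
  "neighboring D D' \<longleftrightarrow> (\<exists>\<tau>.
     (\<forall>t \<le> \<tau>. instance_at D t = instance_at D' t) \<and>
     (\<forall>t > \<tau>. \<exists>u. instance_at D t = add_mset u (instance_at D' t) \<or>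
                  instance_at D' t = add_mset u (instance_at D t)))"

definition eps_dp :: "real \<Rightarrow> (gdb \<Rightarrow> 'o pmf) \<Rightarrow> bool" where
  "eps_dp \<epsilon> F \<longleftrightarrow> (\<forall>D D' Out. neighboring D D' \<longrightarrow>
     measure_pmf.prob (F D) Out \<le> exp \<epsilon> * measure_pmf.prob (F D') Out)"


section \<open>View update protocols and SIM-CDP\<close>

datatype party = Owner nat | Server server

definition admissible :: "party set \<Rightarrow> bool" where
  "admissible C \<longleftrightarrow> \<not> (Server S0 \<in> C \<and> Server S1 \<in> C)"

text \<open>A protocol is given by the distribution of all parties' views after \<open>N\<close> time steps on a
  growing database. With \<open>n\<close> owners, the adversary corrupting \<open>C\<close> sees:\<close>

definition adversary_view :: "nat \<Rightarrow> party set \<Rightarrow> (party \<Rightarrow> bool list) \<Rightarrow> bool list" where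
  "adversary_view n C v =
     concat (map v (filter (\<lambda>p. p \<in> C) (map Owner [0..<n] @ [Server S0, Server S1])))"

text \<open>
  \<open>own N D j\<close> is the data that owner \<open>j\<close> itself contributes to the first \<open>N\<close> steps. The simulator is
  given the data of the corrupted owners, which is part of the adversary's view by definition;
  if no owner is corrupted, it gets the output of \<open>F\<close> and nothing else. It is
  chosen after the public parameters, which do not depend on the security parameter and can
  therefore be built into it.
\<close>

definition sim_cdp ::
  "real \<Rightarrow> nat \<Rightarrow> gdb set \<Rightarrow> (nat \<Rightarrow> gdb \<Rightarrow> nat \<Rightarrow> bool list) \<Rightarrow>
   (nat \<Rightarrow> nat \<Rightarrow> gdb \<Rightarrow> (party \<Rightarrow> bool list) pmf) \<Rightarrow> bool" where
  "sim_cdp \<epsilon> n DB own prot \<longleftrightarrow>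
     (\<exists>(F :: nat \<Rightarrow> gdb \<Rightarrow> bool list pmf) (Sim :: party set \<Rightarrow> com).
        (\<forall>N. eps_dp \<epsilon> (F N)) \<and>
        (\<forall>C. admissible C \<longrightarrow> ppt (Sim C)) \<and>
        (\<forall>C N A. \<forall>D \<in> DB. admissible C \<longrightarrow> adversary A \<longrightarrow>
           (\<exists>\<mu>. negligible \<mu> \<and> (\<forall>\<kappa>.
              prob_one A \<kappa> (map_pmf (adversary_view n C) (prot \<kappa> N D))
              \<le> prob_one A \<kappa>
                  (do { out \<leftarrow> F N D;
                        exec (Sim C) (enc_nat \<kappa> @ enc_bits out @
                          concat (map (own N D) (filter (\<lambda>j. Owner j \<in> C) [0..<n]))) })
                + \<mu> \<kappa>))))"


section \<open>Secret sharing\<close>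

definition xor_tuples :: "tuple list \<Rightarrow> tuple list \<Rightarrow> tuple list" where
  "xor_tuples = map2 (map2 xor)"

definition share_zm :: "zm \<Rightarrow> (zm \<times> zm) pmf" where
  "share_zm x = map_pmf (\<lambda>r. (r, xor x r)) (pmf_of_set UNIV)"

definition share :: "tuple list \<Rightarrow> (tuple list \<times> tuple list) pmf" where
  "share X = map_pmf (\<lambda>R. (R, xor_tuples X R)) (pmf_of_set {R. map length R = map length X})"

fun share_each :: "tuple list list \<Rightarrow> (tuple list \<times> tuple list) list pmf" where
  "share_each [] = return_pmf []"
| "share_each (X # Xs) = do { p \<leftarrow> share X; ps \<leftarrow> share_each Xs; return_pmf (p # ps) }"


section \<open>IncShrink with the timer-based Shrink protocol\<close>

record params =
  eps :: real
  caps :: "nat list"      (* number of record slots each owner uploads per time step *)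
  budget :: nat           (* b *)
  trunc :: nat            (* omega *)
  flush_size :: nat       (* s *)
  flush_interval :: nat   (* f *)
  interval :: nat         (* T *)
  rec_width :: nat        (* words per record *)
  row_width :: nat        (* words per view row *)

definition num_owners :: "params \<Rightarrow> nat" where
  "num_owners pp = length (caps pp)"

definition batch_size :: "params \<Rightarrow> nat" where
  "batch_size pp = sum_list (caps pp)"

definition out_size :: "params \<Rightarrow> nat" where
  "out_size pp = budget pp * batch_size pp"

definition valid_dbs :: "params \<Rightarrow> gdb set" where
  "valid_dbs pp = {D. \<forall>t \<ge> 1.
     (\<forall>u \<in># D t. fst u < num_owners pp \<and> length (snd u) = rec_width pp) \<and>
     (\<forall>j < num_owners pp. size {#u \<in># D t. fst u = j#} \<le> caps pp ! j)}"

text \<open>The first word of a tuple is the hidden bit telling whether the tuple is real.\<close>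

definition real_tuple :: "tuple \<Rightarrow> tuple" where
  "real_tuple x = 1 # x"

definition dummy_tuple :: "nat \<Rightarrow> tuple" where
  "dummy_tuple w = replicate (Suc w) 0"

definition is_real :: "tuple \<Rightarrow> bool" where
  "is_real x \<longleftrightarrow> x \<noteq> [] \<and> hd x = 1"

text \<open>The order in which a collection is laid out is immaterial; an arbitrary one is fixed.\<close>

definition padded :: "nat \<Rightarrow> nat \<Rightarrow> tuple multiset \<Rightarrow> tuple list" where
  "padded n w M =
     take n (map real_tuple (SOME xs. mset xs = M) @ replicate n (dummy_tuple w))"

definition reals_of :: "tuple list \<Rightarrow> tuple multiset" where
  "reals_of X = mset (map tl (filter is_real X))"

definition sort_cache :: "tuple list \<Rightarrow> tuple list" where
  "sort_cache X = filter is_real X @ filter (\<lambda>x. \<not> is_real x) X"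

definition owner_batch :: "params \<Rightarrow> gdb \<Rightarrow> nat \<Rightarrow> nat \<Rightarrow> tuple list" where
  "owner_batch pp D t j =
     padded (caps pp ! j) (rec_width pp) (image_mset snd {#u \<in># D t. fst u = j#})"

definition owner_data :: "params \<Rightarrow> nat \<Rightarrow> gdb \<Rightarrow> nat \<Rightarrow> bool list" where
  "owner_data pp N D j = enc_list enc_tuples (map (\<lambda>t. owner_batch pp D t j) [1..<Suc N])"


subsection \<open>The view query\<close>

text \<open>A query maps the batches in use, oldest first and the new one last, to the new view rows.
  It is truncated with bound \<open>\<omega>\<close> if one input record more or less changes at most \<open>\<omega>\<close> rows.\<close>

type_synonym query = "tuple multiset list \<Rightarrow> tuple multiset"

definition truncated_query :: "nat \<Rightarrow> nat \<Rightarrow> query \<Rightarrow> bool" where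
  "truncated_query \<omega> w q \<longleftrightarrow>
     (\<forall>W. \<forall>x \<in># q W. length x = w) \<and>
     (\<forall>Ws M x Ws'. let P = q (Ws @ add_mset x M # Ws'); Q = q (Ws @ M # Ws')
                   in size (P - Q) + size (Q - P) \<le> \<omega>)"


subsection \<open>Ideal functionalities of the two-party computations\<close>

text \<open>Server inputs to Transform: shares of the batches in use, share of the counter, and the
  server's random contribution to the re-sharing of the counter.\<close>

type_synonym transform_in = "tuple list list \<times> zm \<times> zm"
type_synonym transform_out = "tuple list \<times> zm"

fun transform_shape :: "transform_in \<Rightarrow> nat list list" where
  "transform_shape (W, c, z) = map (map length) W"

fun enc_transform_in :: "transform_in \<Rightarrow> bool list" where
  "enc_transform_in (W, c, z) = enc_list enc_tuples W @ enc_zm c @ enc_zm z"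

fun enc_transform_out :: "transform_out \<Rightarrow> bool list" where
  "enc_transform_out (X, c) = enc_tuples X @ enc_zm c"

fun transform_fun :: "params \<Rightarrow> query \<Rightarrow> transform_in \<Rightarrow> transform_in \<Rightarrow>
    (transform_out \<times> transform_out) pmf" where
  "transform_fun pp q (W0, c0, z0) (W1, c1, z1) =
     (let rows = padded (out_size pp) (row_width pp) (q (map reals_of (map2 xor_tuples W0 W1)));
          c = xor c0 c1 + of_nat (length (filter is_real rows));
          r = xor z0 z1
      in do { (X0, X1) \<leftarrow> share rows; return_pmf ((X0, r), (X1, xor c r)) })"

definition laplace :: "real \<Rightarrow> real measure" where
  "laplace \<beta> = density lborel (\<lambda>y. ennreal (exp (- \<bar>y\<bar> / \<beta>) / (2 * \<beta>)))"

text \<open>Number of tuples among the first \<open>c + Y\<close> of a cache of \<open>len\<close> tuples, \<open>Y\<close> Laplace distributed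
  with scale \<open>\<beta>\<close>.\<close>

definition volume :: "real \<Rightarrow> nat \<Rightarrow> nat \<Rightarrow> nat pmf" where
  "volume \<beta> c len =
     Abs_pmf (distr (laplace \<beta>) (count_space UNIV) (\<lambda>y. min len (nat \<lfloor>real c + y\<rfloor>)))"

lemma prob_space_laplace:
  assumes "\<beta> > 0"
  shows "prob_space (laplace \<beta>)"
proof
  let ?d = "exponential_density (1/\<beta>)"
  have nn: "?d y \<ge> 0" for y
    using assms by (simp add: exponential_density_def)
  have e: "(\<integral>\<^sup>+y. ennreal (?d y) \<partial>lborel) = 1"
    using prob_space.emeasure_space_1[OF prob_space_exponential_density[of "1/\<beta>"]] assms
    by (simp add: emeasure_density)
  have e': "(\<integral>\<^sup>+y. ennreal (?d (- y)) \<partial>lborel) = 1"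
    using nn_integral_real_affine[of "\<lambda>y. ennreal (?d y)" "-1" 0] e by simp
  have eq: "ennreal (exp (- \<bar>y\<bar> / \<beta>) / (2 * \<beta>)) = ennreal (1/2) * (ennreal (?d y) + ennreal (?d (- y)))"
    if "y \<noteq> 0" for y
  proof -
    have "exp (- \<bar>y\<bar> / \<beta>) / (2 * \<beta>) = 1/2 * (?d y + ?d (- y))"
      using that by (cases "y < 0") (auto simp: exponential_density_def)
    then show ?thesis
      using nn by (simp only: ennreal_mult ennreal_plus add_nonneg_nonneg zero_le_divide_1_iff zero_le_numeral)
  qed
  have "(\<integral>\<^sup>+y. ennreal (exp (- \<bar>y\<bar> / \<beta>) / (2 * \<beta>)) \<partial>lborel) =
      (\<integral>\<^sup>+y. ennreal (1/2) * (ennreal (?d y) + ennreal (?d (- y))) \<partial>lborel)"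
    by (rule nn_integral_cong_AE, rule AE_mp[OF AE_lborel_singleton[of 0]]) (rule AE_I2, rule impI, rule eq)
  also have "\<dots> = ennreal (1/2) * (1 + 1)"
    by (subst nn_integral_cmult, simp, subst nn_integral_add) (simp_all add: e e')
  also have "\<dots> = ennreal (1/2) * ennreal 2"
    by simp
  also have "\<dots> = 1"
    by (subst ennreal_mult[symmetric]) simp_all
  finally show "emeasure (laplace \<beta>) (space (laplace \<beta>)) = 1"
    by (simp add: laplace_def emeasure_density)
qed

lemma measure_pmf_volume:
  assumes "\<beta> > 0"
  shows "measure_pmf (volume \<beta> c len) =
    distr (laplace \<beta>) (count_space UNIV) (\<lambda>y. min len (nat \<lfloor>real c + y\<rfloor>))"
proof -
  let ?f = "\<lambda>y. min len (nat \<lfloor>real c + y\<rfloor>)"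
  have "?f \<in> measurable (laplace \<beta>) (count_space UNIV)"
    by (simp add: laplace_def)
  from prob_space.prob_space_distr[OF prob_space_laplace[OF assms] this]
  have P: "prob_space (distr (laplace \<beta>) (count_space UNIV) ?f)" .
  have "\<exists>S. countable S \<and> (AE x in distr (laplace \<beta>) (count_space UNIV) ?f. x \<in> S)"
    by (intro exI[of _ UNIV]) simp
  then have "AE x in distr (laplace \<beta>) (count_space UNIV) ?f.
      measure (distr (laplace \<beta>) (count_space UNIV) ?f) {x} \<noteq> 0"
    by (rule iffD2[OF finite_measure.AE_support_countable[OF prob_space.finite_measure[OF P]], rotated])
      simp
  then show ?thesis
    unfolding volume_def by (intro Abs_pmf_inverse CollectI conjI P) simp
qed

text \<open>Shrink: the random contributions to the noise are subsumed by an exact Laplace sample drawn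
  inside the functionality; the servers learn the number \<open>n\<close> of tuples fetched.\<close>

type_synonym shrink_in = "tuple list \<times> zm \<times> zm"
type_synonym shrink_out = "nat \<times> tuple list \<times> tuple list \<times> zm"

fun shrink_shape :: "shrink_in \<Rightarrow> nat list" where
  "shrink_shape (X, c, z) = map length X"

fun enc_shrink_in :: "shrink_in \<Rightarrow> bool list" where
  "enc_shrink_in (X, c, z) = enc_tuples X @ enc_zm c @ enc_zm z"

fun enc_shrink_out :: "shrink_out \<Rightarrow> bool list" where
  "enc_shrink_out (n, V, X, c) = enc_nat n @ enc_tuples V @ enc_tuples X @ enc_zm c"

fun shrink_fun :: "params \<Rightarrow> shrink_in \<Rightarrow> shrink_in \<Rightarrow> (shrink_out \<times> shrink_out) pmf" where
  "shrink_fun pp (X0, c0, z0) (X1, c1, z1) =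
     (let X = sort_cache (xor_tuples X0 X1);
          r = xor z0 z1
      in do { n \<leftarrow> volume (real (budget pp) / eps pp) (unat (xor c0 c1)) (length X);
              (V0, V1) \<leftarrow> share (take n X);
              (Y0, Y1) \<leftarrow> share (drop n X);
              return_pmf ((n, V0, Y0, r), (n, V1, Y1, xor 0 r)) })"

definition flush_fun :: "params \<Rightarrow> tuple list \<Rightarrow> tuple list \<Rightarrow> (tuple list \<times> tuple list) pmf" where
  "flush_fun pp X0 X1 = share (take (flush_size pp) (sort_cache (xor_tuples X0 X1)))"


subsection \<open>Protocol execution\<close>

text \<open>State of one server. All records of a batch are used together, so their remaining budget is
  stored once per batch.\<close>

record sstate =
  store :: "(nat \<times> tuple list) list"
  cache :: "tuple list"
  counter :: zm
  mview :: "tuple list"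

type_synonym exec_state = "(sstate \<times> sstate) \<times> (party \<Rightarrow> bool list)"

definition observe :: "(server \<Rightarrow> bool list) \<Rightarrow> (party \<Rightarrow> bool list) \<Rightarrow> party \<Rightarrow> bool list" where
  "observe g v p = (case p of Owner j \<Rightarrow> v p | Server i \<Rightarrow> v p @ g i)"

definition start :: "exec_state pmf" where
  "start = do {
     c \<leftarrow> share_zm 0;
     return_pmf
       ((\<lparr>store = [], cache = [], counter = fst c, mview = []\<rparr>,
         \<lparr>store = [], cache = [], counter = snd c, mview = []\<rparr>),
        observe (\<lambda>i. enc_zm (pick i c)) (\<lambda>_. [])) }"

definition receive :: "params \<Rightarrow> tuple list \<Rightarrow> sstate \<Rightarrow> sstate" where
  "receive pp B \<sigma> = \<sigma>\<lparr>store := store \<sigma> @ [(budget pp, B)]\<rparr>"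

definition upload :: "params \<Rightarrow> gdb \<Rightarrow> nat \<Rightarrow> exec_state \<Rightarrow> exec_state pmf" where
  "upload pp D t = (\<lambda>((\<sigma>0, \<sigma>1), v). do {
     ps \<leftarrow> share_each (map (owner_batch pp D t) [0..<num_owners pp]);
     let B = (concat (map fst ps), concat (map snd ps));
     return_pmf
       ((receive pp (fst B) \<sigma>0, receive pp (snd B) \<sigma>1),
        (\<lambda>p. v p @ (case p of
             Owner j \<Rightarrow> enc_tuples (owner_batch pp D t j) @
                        enc_tuples (fst (ps ! j)) @ enc_tuples (snd (ps ! j))
           | Server i \<Rightarrow> enc_tuples (pick i B)))) })"

definition usable :: "params \<Rightarrow> sstate \<Rightarrow> (nat \<times> tuple list) list" where
  "usable pp \<sigma> = filter (\<lambda>(r, B). trunc pp \<le> r) (store \<sigma>)"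

definition after_transform :: "params \<Rightarrow> transform_out \<Rightarrow> sstate \<Rightarrow> sstate" where
  "after_transform pp y \<sigma> = \<sigma>
     \<lparr>store := map (\<lambda>(r, B). (r - trunc pp, B)) (usable pp \<sigma>),
      cache := cache \<sigma> @ fst y, counter := snd y\<rparr>"

definition transform ::
  "params \<Rightarrow> (transform_in, transform_out) two_pc \<Rightarrow> nat \<Rightarrow> exec_state \<Rightarrow> exec_state pmf" where
  "transform pp \<pi> \<kappa> = (\<lambda>((\<sigma>0, \<sigma>1), v). do {
     z0 \<leftarrow> pmf_of_set UNIV;
     z1 \<leftarrow> pmf_of_set UNIV;
     (tr, (y0, y1)) \<leftarrow> \<pi> \<kappa> (map snd (usable pp \<sigma>0), counter \<sigma>0, z0)
                            (map snd (usable pp \<sigma>1), counter \<sigma>1, z1);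
     return_pmf
       ((after_transform pp y0 \<sigma>0, after_transform pp y1 \<sigma>1),
        observe (\<lambda>i. enc_zm (pick i (z0, z1)) @ enc_bits (pick i tr) @
                     enc_transform_out (pick i (y0, y1))) v) })"

fun after_shrink :: "shrink_out \<Rightarrow> sstate \<Rightarrow> sstate" where
  "after_shrink (n, V, X, c) \<sigma> = \<sigma>\<lparr>cache := X, counter := c, mview := mview \<sigma> @ V\<rparr>"

definition shrink_timer ::
  "(shrink_in, shrink_out) two_pc \<Rightarrow> nat \<Rightarrow> exec_state \<Rightarrow> exec_state pmf" where
  "shrink_timer \<pi> \<kappa> = (\<lambda>((\<sigma>0, \<sigma>1), v). do {
     z0 \<leftarrow> pmf_of_set UNIV;
     z1 \<leftarrow> pmf_of_set UNIV;
     (tr, (y0, y1)) \<leftarrow> \<pi> \<kappa> (cache \<sigma>0, counter \<sigma>0, z0) (cache \<sigma>1, counter \<sigma>1, z1);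
     return_pmf
       ((after_shrink y0 \<sigma>0, after_shrink y1 \<sigma>1),
        observe (\<lambda>i. enc_zm (pick i (z0, z1)) @ enc_bits (pick i tr) @
                     enc_shrink_out (pick i (y0, y1))) v) })"

definition after_flush :: "tuple list \<Rightarrow> sstate \<Rightarrow> sstate" where
  "after_flush V \<sigma> = \<sigma>\<lparr>cache := [], mview := mview \<sigma> @ V\<rparr>"

definition flush_cache ::
  "(tuple list, tuple list) two_pc \<Rightarrow> nat \<Rightarrow> exec_state \<Rightarrow> exec_state pmf" where
  "flush_cache \<pi> \<kappa> = (\<lambda>((\<sigma>0, \<sigma>1), v). do {
     (tr, (y0, y1)) \<leftarrow> \<pi> \<kappa> (cache \<sigma>0) (cache \<sigma>1);
     return_pmf
       ((after_flush y0 \<sigma>0, after_flush y1 \<sigma>1),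
        observe (\<lambda>i. enc_bits (pick i tr) @ enc_tuples (pick i (y0, y1))) v) })"

definition time_step ::
  "params \<Rightarrow> (transform_in, transform_out) two_pc \<Rightarrow> (shrink_in, shrink_out) two_pc \<Rightarrow>
   (tuple list, tuple list) two_pc \<Rightarrow> nat \<Rightarrow> gdb \<Rightarrow> nat \<Rightarrow> exec_state \<Rightarrow> exec_state pmf" where
  "time_step pp \<pi>T \<pi>S \<pi>F \<kappa> D t e = do {
     e \<leftarrow> upload pp D t e;
     e \<leftarrow> transform pp \<pi>T \<kappa> e;
     e \<leftarrow> (if interval pp dvd t then shrink_timer \<pi>S \<kappa> e else return_pmf e);
     (if flush_interval pp dvd t then flush_cache \<pi>F \<kappa> e else return_pmf e) }"

fun run ::
  "params \<Rightarrow> (transform_in, transform_out) two_pc \<Rightarrow> (shrink_in, shrink_out) two_pc \<Rightarrow>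
   (tuple list, tuple list) two_pc \<Rightarrow> nat \<Rightarrow> nat \<Rightarrow> gdb \<Rightarrow> exec_state pmf" where
  "run pp \<pi>T \<pi>S \<pi>F \<kappa> 0 D = start"
| "run pp \<pi>T \<pi>S \<pi>F \<kappa> (Suc t) D =
     bind_pmf (run pp \<pi>T \<pi>S \<pi>F \<kappa> t D) (time_step pp \<pi>T \<pi>S \<pi>F \<kappa> D (Suc t))"

definition incshrink_timer ::
  "params \<Rightarrow> (transform_in, transform_out) two_pc \<Rightarrow> (shrink_in, shrink_out) two_pc \<Rightarrow>
   (tuple list, tuple list) two_pc \<Rightarrow> nat \<Rightarrow> nat \<Rightarrow> gdb \<Rightarrow> (party \<Rightarrow> bool list) pmf" where
  "incshrink_timer pp \<pi>T \<pi>S \<pi>F \<kappa> N D = map_pmf snd (run pp \<pi>T \<pi>S \<pi>F \<kappa> N D)"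

end

theory Submission
  imports Defs
begin

text \<open>
  The database and the number of steps are fixed while the security parameter grows, so the states
  of the servers range over a finite set that does not depend on it. A hybrid argument replaces the
  two-party computations one by one, the first ones last, by the functionality together with its
  simulator. The remaining idealized phases only append to the views, with a distribution that
  depends on the output of the current computation but not on its transcript; by averaging, the
  best completion for each of the finitely many outputs goes into the advice of the distinguisher,
  which therefore only has to compare the output with a constant and to splice strings.

  In the ideal execution one server sees uniformly distributed shares, and apart from these only
  the fetched volumes depend on the data. The mechanism thus samples everything that one server
  sees except the simulated transcripts, which depend on the security parameter. It outputs this in
  the form of a script for a small interpreter; the simulator runs the script, which calls the
  simulators of the two-party computations and one-time-pads the data of the corrupted owners.

  Privacy is the Laplace mechanism under adaptive composition: a record changes the counter by at
  most the part of its budget that is spent, hence the total change over all updates is at most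
  the budget.
\<close>

section \<open>Polynomial bounds\<close>

text \<open>A two-party protocol is a bare family of distributions with a bound on the length of its
  views; a reduction cannot run it, so whatever surrounds the attacked computation has to be frozen
  into advice. The security hypothesis gives one negligible function per pair of inputs and per
  adversary. Uniformity over inputs comes from the finite state sets, uniformity over contexts from
  picking, for each \<open>\<kappa>\<close>, one within a factor two of the worst. Idealized phases
  stand behind the attacked computation because they keep states in a finite set and views
  polynomially long with certainty, while a real computation may, with negligible probability,
  return an unexpected output. The other server's output is never seen, but it determines what
  follows; the distinguisher therefore needs both outputs, as the security notion provides. Being an
  arbitrary distribution, the mechanism can draw the Laplace volumes, which a machine with fair
  coins and a worst-case time bound in general cannot. Its output is part of the simulator's input,
  so long scripts do not endanger polynomial time.\<close>

definition polyb :: "(nat \<Rightarrow> nat) \<Rightarrow> bool" where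
  "polyb f \<longleftrightarrow> (\<exists>k. \<forall>n. f n \<le> n ^ k + k)"

lemma polybI: "(\<And>n. f n \<le> n ^ k + k) \<Longrightarrow> polyb f"
  unfolding polyb_def by blast

lemma polyb_mono: "polyb g \<Longrightarrow> (\<And>n. f n \<le> g n) \<Longrightarrow> polyb f"
  unfolding polyb_def by (meson order_trans)

lemma pow_add_le_Suc_pow: "(n::nat) ^ k + k \<le> (n + 2) ^ Suc k"
proof -
  have "n ^ k \<le> (n + 2) ^ k" by (intro power_mono) auto
  moreover have "k < 2 ^ k" by (rule less_exp)
  moreover have "(2::nat) ^ k \<le> (n + 2) ^ k" by (intro power_mono) auto
  ultimately have "n ^ k + k \<le> 2 * (n + 2) ^ k" by linarith
  also have "\<dots> \<le> (n + 2) ^ Suc k" by simp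
  finally show ?thesis .
qed

lemma polyb_shifted_power: "polyb (\<lambda>n. (n + 2) ^ k)"
proof (rule polybI)
  fix n :: nat
  \<comment> \<open>One number must be both exponent and additive constant: \<open>2 * k\<close> is
    the exponent needed for \<open>n \<ge> 2\<close>, and \<open>4 ^ k\<close> the constant needed
    below 2.\<close>
  show "(n + 2) ^ k \<le> n ^ (2 * k + 4 ^ k) + (2 * k + 4 ^ k)"
  proof (cases "n \<ge> 2")
    case True
    have "n + 2 \<le> n\<^sup>2"
    proof -
      have "2 * n \<le> n * n" using True by (rule mult_le_mono1)
      thus ?thesis using True unfolding power2_eq_square by linarith
    qed
    hence "(n + 2) ^ k \<le> (n\<^sup>2) ^ k" by (intro power_mono) auto
    also have "\<dots> = n ^ (2 * k)" by (simp add: power_mult)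
    also have "\<dots> \<le> n ^ (2 * k + 4 ^ k)" using True by (intro power_increasing) auto
    finally show ?thesis by simp
  next
    case False
    hence "(n + 2) ^ k \<le> 4 ^ k" by (intro power_mono) auto
    thus ?thesis by simp
  qed
qed

text \<open>A base of at least 2 absorbs the additive constant and a factor 2, so this one-term form
  is visibly closed under products and successors; sums are then reduced to products of
  successors.\<close>

lemma polyb_iff: "polyb f \<longleftrightarrow> (\<exists>k. \<forall>n. f n \<le> (n + 2) ^ k)"
proof
  assume "polyb f"
  then obtain k where "\<And>n. f n \<le> n ^ k + k" unfolding polyb_def by blast
  hence "\<And>n. f n \<le> (n + 2) ^ Suc k" using pow_add_le_Suc_pow order_trans by blast
  thus "\<exists>k. \<forall>n. f n \<le> (n + 2) ^ k" by blast
next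
  assume "\<exists>k. \<forall>n. f n \<le> (n + 2) ^ k"
  thus "polyb f" using polyb_mono polyb_shifted_power by blast
qed

lemma polyb_const [intro!, simp]: "polyb (\<lambda>n. c)"
  by (rule polybI[of _ c]) simp

lemma polyb_id [intro!, simp]: "polyb (\<lambda>n. n)"
  by (rule polybI[of _ 1]) simp

lemma polyb_mult [intro]:
  assumes "polyb f" "polyb g" shows "polyb (\<lambda>n. f n * g n)"
proof -
  obtain k l where "\<And>n. f n \<le> (n + 2) ^ k" "\<And>n. g n \<le> (n + 2) ^ l"
    using assms unfolding polyb_iff by blast
  hence "f n * g n \<le> (n + 2) ^ (k + l)" for n by (simp add: power_add mult_le_mono)
  thus ?thesis unfolding polyb_iff by blast
qed

lemma polyb_Suc [intro]:
  assumes "polyb f" shows "polyb (\<lambda>n. Suc (f n))"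
proof -
  obtain k where k: "\<And>n. f n \<le> (n + 2) ^ k" using assms unfolding polyb_iff by blast
  have "Suc (f n) \<le> (n + 2) ^ Suc k" for n
  proof -
    have "1 \<le> (n + 2) ^ k" by simp
    hence "Suc (f n) \<le> 2 * (n + 2) ^ k" using k[of n] by linarith
    thus ?thesis by simp
  qed
  thus ?thesis unfolding polyb_iff by blast
qed

lemma polyb_add [intro]:
  assumes "polyb f" "polyb g" shows "polyb (\<lambda>n. f n + g n)"
proof -
  have "polyb (\<lambda>n. Suc (f n) * Suc (g n))" using assms by (intro polyb_mult polyb_Suc)
  thus ?thesis by (rule polyb_mono) simp
qed

lemma polyb_power [intro]: "polyb f \<Longrightarrow> polyb (\<lambda>n. f n ^ k)"
  by (induction k) auto

lemma polyb_comp: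
  assumes "polyb f" "polyb g" shows "polyb (\<lambda>n. f (g n))"
proof -
  obtain k where k: "\<And>n. f n \<le> n ^ k + k" using assms unfolding polyb_def by blast
  have "polyb (\<lambda>n. g n ^ k + k)" using assms by (intro polyb_add polyb_power) auto
  thus ?thesis by (rule polyb_mono) (rule k)
qed

lemma polyb_sum: "finite A \<Longrightarrow> (\<And>a. a \<in> A \<Longrightarrow> polyb (f a)) \<Longrightarrow> polyb (\<lambda>n. \<Sum>a\<in>A. f a n)"
  by (induction A rule: finite_induct) auto

lemma polyb_uniform:
  assumes "finite A" "\<And>a. a \<in> A \<Longrightarrow> polyb (f a)"
  obtains g where "polyb g" "\<And>a n. a \<in> A \<Longrightarrow> f a n \<le> g n"
proof
  show "polyb (\<lambda>n. \<Sum>a\<in>A. f a n)" using assms by (rule polyb_sum)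
  show "a \<in> A \<Longrightarrow> f a n \<le> (\<Sum>a\<in>A. f a n)" for a n
    using assms by (intro member_le_sum) auto
qed

text \<open>Time bounds are instantiated at the length of the input; monotone majorants make them
  compose.\<close>

lemma polyb_mono_majorant:
  assumes "polyb f" obtains g where "polyb g" "mono g" "\<And>n. f n \<le> g n"
proof -
  obtain k where "\<And>n. f n \<le> (n + 2) ^ k" using assms unfolding polyb_iff by blast
  moreover have "mono (\<lambda>n::nat. (n + 2) ^ k)" by (intro monoI power_mono) auto
  ultimately show ?thesis using that[of "\<lambda>n. (n+2)^k"] polyb_shifted_power by blast
qed


section \<open>Big-step semantics of the machine\<close>

type_synonym stacks = "nat \<Rightarrow> bool list"

definition halts :: "nat \<Rightarrow> config \<Rightarrow> bool" where
  "halts n cfg \<longleftrightarrow> (\<forall>c \<in> set_pmf (steps n cfg). fst c = [])"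

lemma steps_halted [simp]: "steps n ([], s) = return_pmf ([], s)"
  by (induction n) (auto simp: bind_return_pmf)

lemma steps_add: "steps (m + n) cfg = bind_pmf (steps m cfg) (steps n)"
proof (induction m arbitrary: cfg)
  case (Suc m)
  have "steps (Suc m + n) cfg = bind_pmf (step cfg) (\<lambda>c. bind_pmf (steps m c) (steps n))"
    by (simp add: Suc.IH[abs_def])
  then show ?case by (simp add: bind_assoc_pmf)
qed (simp add: bind_return_pmf)

text \<open>Halted configurations are fixed by \<open>step\<close>, so surplus steps change
  nothing.\<close>

lemma halts_mono:
  assumes "halts n cfg" "n \<le> m" shows "halts m cfg \<and> steps m cfg = steps n cfg"
proof -
  have "steps m cfg = bind_pmf (steps n cfg) (steps (m - n))"
    using assms steps_add[of n "m - n" cfg] by simp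
  also have "\<dots> = bind_pmf (steps n cfg) return_pmf"
  proof (rule bind_pmf_cong[OF refl])
    fix c assume "c \<in> set_pmf (steps n cfg)"
    then show "steps (m - n) c = return_pmf c" using assms(1)
      by (cases c) (auto simp: halts_def)
  qed
  finally show ?thesis using assms(1) by (simp add: bind_return_pmf' halts_def)
qed

text \<open>Termination, time bound and final distribution form one judgment, so that all three
  compose together. It speaks of a list of commands because a step of \<open>Seq\<close> or
  \<open>While\<close> lengthens the pending list.\<close>

definition evl :: "com list \<Rightarrow> stacks \<Rightarrow> nat \<Rightarrow> stacks pmf \<Rightarrow> bool" where
  "evl ks s n P \<longleftrightarrow> halts n (ks, s) \<and> map_pmf snd (steps n (ks, s)) = P"

abbreviation ev :: "com \<Rightarrow> stacks \<Rightarrow> nat \<Rightarrow> stacks pmf \<Rightarrow> bool" where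
  "ev c \<equiv> evl [c]"

lemma evl_mono: "evl ks s n P \<Longrightarrow> n \<le> m \<Longrightarrow> evl ks s m P"
  unfolding evl_def using halts_mono by metis

lemma evl_Nil [simp]: "evl [] s n P \<longleftrightarrow> P = return_pmf s"
  by (auto simp: evl_def halts_def)

lemma evl_Suc:
  assumes "\<And>c. c \<in> set_pmf (step (ks, s)) \<Longrightarrow> evl (fst c) (snd c) n (Q c)"
  shows "evl ks s (Suc n) (bind_pmf (step (ks, s)) Q)"
proof -
  have "bind_pmf (step (ks, s)) (\<lambda>c. map_pmf snd (steps n c)) = bind_pmf (step (ks, s)) Q"
    using assms by (intro bind_pmf_cong) (auto simp: evl_def)
  moreover have "halts (Suc n) (ks, s)"
    using assms unfolding evl_def halts_def by fastforce
  ultimately show ?thesis by (simp add: evl_def map_bind_pmf)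
qed

lemma evl_Suc_iff:
  "evl ks s (Suc n) P \<longleftrightarrow>
     (\<forall>c \<in> set_pmf (step (ks, s)). evl (fst c) (snd c) n (map_pmf snd (steps n c))) \<and>
     P = bind_pmf (step (ks, s)) (\<lambda>c. map_pmf snd (steps n c))"
  unfolding evl_def halts_def by (auto simp: map_bind_pmf)

lemma step_append:
  "ks \<noteq> [] \<Longrightarrow> step (ks @ ls, s) = map_pmf (\<lambda>c. (fst c @ ls, snd c)) (step (ks, s))"
  by (cases "(ks, s)" rule: step.cases) (auto simp: map_pmf_comp)

text \<open>The commands \<open>ls\<close> do not influence the run before \<open>ks\<close> is used
  up. Branches of \<open>ks\<close> that finish early just idle, so the two time bounds add.\<close>

lemma evl_append:
  assumes "evl ks s n P" "\<And>s'. s' \<in> set_pmf P \<Longrightarrow> evl ls s' m (Q s')"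
  shows "evl (ks @ ls) s (n + m) (bind_pmf P Q)"
  using assms
proof (induction n arbitrary: ks s P)
  case 0
  then have "ks = []" "P = return_pmf s" by (auto simp: evl_def halts_def)
  with 0 show ?case by (simp add: bind_return_pmf)
next
  case (Suc n)
  show ?case
  proof (cases "ks = []")
    case True
    with Suc.prems(1) have P: "P = return_pmf s" by (auto simp: evl_def)
    have "evl ls s m (Q s)" by (rule Suc.prems(2)) (simp add: P)
    then have "evl ls s (Suc n + m) (Q s)" by (rule evl_mono) simp
    then show ?thesis using True by (simp add: P bind_return_pmf)
  next
    case False
    let ?R = "\<lambda>c. map_pmf snd (steps n c)"
    have P: "P = bind_pmf (step (ks, s)) ?R"
      and E: "\<And>c. c \<in> set_pmf (step (ks, s)) \<Longrightarrow> evl (fst c) (snd c) n (?R c)"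
      using Suc.prems(1) by (auto simp: evl_Suc_iff)
    have "evl (fst c @ ls) (snd c) (n + m) (bind_pmf (?R c) Q)" if c: "c \<in> set_pmf (step (ks, s))" for c
    proof (rule Suc.IH[OF E[OF c]])
      fix s' assume "s' \<in> set_pmf (?R c)"
      then have "s' \<in> set_pmf P" using c P by auto
      then show "evl ls s' m (Q s')" by (rule Suc.prems(2))
    qed
    \<comment> \<open>\<open>evl_Suc\<close> wants the result as a function of the successor
      configuration; cutting off the last \<open>length ls\<close> commands recovers the
      configuration of \<open>ks\<close> alone.\<close>
    then have "evl (ks @ ls) s (Suc (n + m))
        (bind_pmf (step (ks @ ls, s)) (\<lambda>c. bind_pmf (?R (take (length (fst c) - length ls) (fst c), snd c)) Q))"
      by (intro evl_Suc) (auto simp: step_append[OF False])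
    then show ?thesis
      by (simp add: step_append[OF False] bind_map_pmf P bind_assoc_pmf)
  qed
qed

lemma evl_Cons:
  assumes "ev c s n P" "\<And>s'. s' \<in> set_pmf P \<Longrightarrow> evl ks s' m (Q s')"
  shows "evl (c # ks) s (n + m) (bind_pmf P Q)"
  using evl_append[OF assms] by simp

lemma evl_step:
  assumes "step (ks, s) = return_pmf (ks', s')" "evl ks' s' n P" "Suc n \<le> m"
  shows "evl ks s m P"
proof -
  have "evl ks s (Suc n) P"
    using evl_Suc[of ks s n "\<lambda>_. P"] assms by (simp add: bind_return_pmf)
  then show ?thesis using assms(3) evl_mono by blast
qed

lemma ev_Push: "1 \<le> n \<Longrightarrow> ev (Push r b) s n (return_pmf (s(r := b # s r)))"
  by (rule evl_step[where n=0]) auto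

lemma ev_Pop: "1 \<le> n \<Longrightarrow> ev (Pop r) s n (return_pmf (s(r := tl (s r))))"
  by (rule evl_step[where n=0]) auto

lemma ev_Seq:
  assumes "ev c s n P" "\<And>s'. s' \<in> set_pmf P \<Longrightarrow> ev d s' m (Q s')" "Suc (n + m) \<le> k"
  shows "ev (Seq c d) s k (bind_pmf P Q)"
  by (rule evl_step[OF _ evl_Cons[OF assms(1,2)] assms(3)]) auto

lemma ev_Cond:
  assumes "ev (case s r of [] \<Rightarrow> e | b # _ \<Rightarrow> if b then c else d) s n P" "Suc n \<le> k"
  shows "ev (Cond r c d e) s k P"
  by (rule evl_step[OF _ assms]) auto

lemma ev_While_stop: "s r = [] \<Longrightarrow> 1 \<le> n \<Longrightarrow> ev (While r c) s n (return_pmf s)"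
  by (rule evl_step[where n=0]) auto

lemma ev_While_step:
  assumes "s r \<noteq> []" "ev c s n P" "\<And>s'. s' \<in> set_pmf P \<Longrightarrow> ev (While r c) s' m (Q s')"
    "Suc (n + m) \<le> k"
  shows "ev (While r c) s k (bind_pmf P Q)"
  by (rule evl_step[OF _ evl_Cons[OF assms(2,3)] assms(4)]) (auto simp: assms(1))

abbreviation dev :: "com \<Rightarrow> stacks \<Rightarrow> nat \<Rightarrow> stacks \<Rightarrow> bool" where
  "dev c s n s' \<equiv> ev c s n (return_pmf s')"

lemma dev_Seq: "dev c s n s' \<Longrightarrow> ev d s' m P \<Longrightarrow> Suc (n + m) \<le> k \<Longrightarrow> ev (Seq c d) s k P"
  using ev_Seq[of c s n "return_pmf s'" d m "\<lambda>_. P" k] by (simp add: bind_return_pmf)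

lemma dev_While_step:
  "s r \<noteq> [] \<Longrightarrow> dev c s n s' \<Longrightarrow> ev (While r c) s' m P \<Longrightarrow> Suc (n + m) \<le> k \<Longrightarrow>
   ev (While r c) s k P"
  using ev_While_step[of s r c n "return_pmf s'" m "\<lambda>_. P" k] by (simp add: bind_return_pmf)


subsection \<open>Relation to \<^const>\<open>exec\<close> and \<^const>\<open>ppt\<close>\<close>

definition ini :: "bool list \<Rightarrow> stacks" where
  "ini x = (\<lambda>_. [])(0 := x)"

lemma halts_within_evl: "halts_within c x n \<longleftrightarrow> (\<exists>P. ev c (ini x) n P)"
  by (auto simp: halts_within_def evl_def halts_def init_config_def ini_def)

text \<open>\<open>exec\<close> stops at the least time bound, but a halted run no longer changes,
  so every bound yields the same output.\<close>

lemma exec_ev: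
  assumes e: "ev c (ini x) n P"
  shows "exec c x = map_pmf (\<lambda>s. s 0) P"
proof -
  define m where "m = (LEAST n. halts_within c x n)"
  have h: "halts_within c x n" using e halts_within_evl by blast
  have "halts_within c x m" unfolding m_def using h by (rule LeastI)
  then have m: "halts m ([c], ini x)"
    by (simp add: halts_within_def halts_def init_config_def ini_def)
  have "m \<le> n" unfolding m_def using h by (rule Least_le)
  from halts_mono[OF m this] e have "map_pmf snd (steps m ([c], ini x)) = P"
    by (simp add: evl_def)
  moreover have "exec c x = map_pmf (\<lambda>s. s 0) (map_pmf snd (steps m ([c], ini x)))"
    by (simp add: exec_def m_def init_config_def ini_def map_pmf_comp)
  ultimately show ?thesis by simp
qed

lemma pptI: "polyb T \<Longrightarrow> (\<And>x. \<exists>P. ev c (ini x) (T (length x)) P) \<Longrightarrow> ppt c"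
  unfolding ppt_def
proof -
  assume "polyb T" and e: "\<And>x. \<exists>P. ev c (ini x) (T (length x)) P"
  then obtain k where k: "\<And>n. T n \<le> n ^ k + k" unfolding polyb_def by blast
  have "halts_within c x (length x ^ k + k)" for x
    using e[of x] evl_mono[OF _ k[of "length x"]] unfolding halts_within_evl by blast
  then show "\<exists>k. \<forall>x. halts_within c x (length x ^ k + k)" by blast
qed

lemma pptE:
  assumes "ppt c"
  obtains T P where "polyb T" "mono T" "\<And>x. ev c (ini x) (T (length x)) (P x)"
proof -
  obtain k where k: "\<And>x. halts_within c x (length x ^ k + k)" using assms unfolding ppt_def by blast
  have "polyb (\<lambda>n. n ^ k + k)" by (rule polybI) auto
  then obtain T where T: "polyb T" "mono T" "\<And>n. n ^ k + k \<le> T n"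
    using polyb_mono_majorant by blast
  have "\<forall>x. \<exists>P. ev c (ini x) (T (length x)) P"
    using k T(3) evl_mono unfolding halts_within_evl by blast
  then obtain P where "\<And>x. ev c (ini x) (T (length x)) (P x)" by metis
  with T show ?thesis using that by blast
qed

section \<open>Running time bounds the size of the stacks\<close>

lemma step_length:
  "(ks', s') \<in> set_pmf (step (ks, s)) \<Longrightarrow> length (s' r) \<le> Suc (length (s r))"
  by (cases "(ks, s)" rule: step.cases) (auto split: if_splits)

lemma steps_length:
  "(ks', s') \<in> set_pmf (steps n (ks, s)) \<Longrightarrow> length (s' r) \<le> n + length (s r)"
proof (induction n arbitrary: ks s)
  case (Suc n)
  then obtain ks1 s1 where 1: "(ks1, s1) \<in> set_pmf (step (ks, s))" "(ks', s') \<in> set_pmf (steps n (ks1, s1))"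
    by auto
  from step_length[OF 1(1), of r] Suc.IH[OF 1(2)] show ?case by simp
qed auto

lemma ev_length: "evl c s n P \<Longrightarrow> s' \<in> set_pmf P \<Longrightarrow> length (s' r) \<le> n + length (s r)"
  unfolding evl_def using steps_length by fastforce

text \<open>A step pushes at most one bit on a stack. This is what makes the transcripts written by
  a simulator polynomially long.\<close>

lemma exec_length:
  assumes "ppt c"
  obtains T where "polyb T" "mono T" "\<And>x y. y \<in> set_pmf (exec c x) \<Longrightarrow> length y \<le> T (length x)"
proof -
  obtain T P where T: "polyb T" "mono T" "\<And>x. ev c (ini x) (T (length x)) (P x)"
    using pptE[OF assms] by blast
  have "length y \<le> T (length x) + length x" if y: "y \<in> set_pmf (exec c x)" for x y
  proof -
    from y exec_ev[OF T(3)[of x]] obtain s where "s \<in> set_pmf (P x)" "y = s 0" by auto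
    then show ?thesis using ev_length[OF T(3)[of x], of s 0] by (simp add: ini_def)
  qed
  moreover have "polyb (\<lambda>n. T n + n)" using T by auto
  moreover have "mono (\<lambda>n. T n + n)" using T(2) by (auto simp: mono_def add_mono)
  ultimately show ?thesis using that by blast
qed

subsection \<open>Renaming stacks\<close>

text \<open>Relocates a subprogram above the \<open>k\<close> stacks that belong to its caller;
  \<open>glue\<close> joins the two groups of stacks.\<close>

fun shift_com :: "nat \<Rightarrow> com \<Rightarrow> com" where
  "shift_com k (Push r b) = Push (r + k) b"
| "shift_com k (Pop r) = Pop (r + k)"
| "shift_com k (Flip r) = Flip (r + k)"
| "shift_com k (Seq c d) = Seq (shift_com k c) (shift_com k d)"
| "shift_com k (Cond r c d e) = Cond (r + k) (shift_com k c) (shift_com k d) (shift_com k e)"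
| "shift_com k (While r c) = While (r + k) (shift_com k c)"

text \<open>Stacks beyond this index keep their contents, so a caller knows which finitely many
  stacks to clear after a call.\<close>

fun max_stack :: "com \<Rightarrow> nat" where
  "max_stack (Push r b) = r"
| "max_stack (Pop r) = r"
| "max_stack (Flip r) = r"
| "max_stack (Seq c d) = max (max_stack c) (max_stack d)"
| "max_stack (Cond r c d e) = max r (max (max_stack c) (max (max_stack d) (max_stack e)))"
| "max_stack (While r c) = max r (max_stack c)"

definition glue :: "nat \<Rightarrow> stacks \<Rightarrow> stacks \<Rightarrow> stacks" where
  "glue k s s' = (\<lambda>r. if r < k then s r else s' (r - k))"

lemma glue_upd: "(glue k s s')(r + k := x) = glue k s (s'(r := x))"
  by (auto simp: glue_def fun_eq_iff)

lemma glue_at [simp]: "glue k s s' (r + k) = s' r"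
  by (simp add: glue_def)

lemma glue_base [simp]: "glue k s s' k = s' 0"
  by (simp add: glue_def)

lemma step_shift:
  "step (map (shift_com k) ks, glue k s s') =
   map_pmf (\<lambda>c. (map (shift_com k) (fst c), glue k s (snd c))) (step (ks, s'))"
  by (cases "(ks, s')" rule: step.cases)
     (auto simp: glue_upd map_pmf_comp split: list.splits)

lemma steps_shift:
  "steps n (map (shift_com k) ks, glue k s s') =
   map_pmf (\<lambda>c. (map (shift_com k) (fst c), glue k s (snd c))) (steps n (ks, s'))"
proof (induction n arbitrary: ks s')
  case (Suc n)
  then show ?case
    by (auto simp: step_shift bind_map_pmf map_bind_pmf intro!: bind_pmf_cong)
qed auto

lemma ev_shift: "ev c s' n P \<Longrightarrow> ev (shift_com k c) (glue k s s') n (map_pmf (glue k s) P)"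
  using steps_shift[of n k "[c]" s s'] by (auto simp: evl_def halts_def map_pmf_comp)

lemma step_above:
  "(ks', s') \<in> set_pmf (step (ks, s)) \<Longrightarrow> (\<forall>c \<in> set ks. max_stack c < r) \<Longrightarrow>
   s' r = s r \<and> (\<forall>c \<in> set ks'. max_stack c < r)"
  by (cases "(ks, s)" rule: step.cases) (auto split: if_splits list.splits)

lemma steps_above:
  "(ks', s') \<in> set_pmf (steps n (ks, s)) \<Longrightarrow> (\<forall>c \<in> set ks. max_stack c < r) \<Longrightarrow> s' r = s r"
proof (induction n arbitrary: ks s)
  case (Suc n)
  then obtain ks1 s1 where 1: "(ks1, s1) \<in> set_pmf (step (ks, s))" "(ks', s') \<in> set_pmf (steps n (ks1, s1))"
    by auto
  from step_above[OF 1(1) Suc.prems(2)] Suc.IH[OF 1(2)] show ?case by auto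
qed auto

lemma ev_above: "ev c s n P \<Longrightarrow> s' \<in> set_pmf P \<Longrightarrow> max_stack c < r \<Longrightarrow> s' r = s r"
  unfolding evl_def using steps_above by fastforce


section \<open>Programs\<close>

definition nop :: com where "nop = Seq (Push 0 True) (Pop 0)"

lemma dev_nop: "3 \<le> n \<Longrightarrow> dev nop s n s"
  using dev_Seq[OF ev_Push[of 1 0 True s] ev_Pop[of 1 0 "s(0 := True # s 0)"], of n]
  by (simp add: nop_def)

fun pushes :: "(nat \<times> bool) list \<Rightarrow> com" where
  "pushes [] = nop"
| "pushes ((r, b) # l) = Seq (Push r b) (pushes l)"

lemma dev_pushes:
  "3 + 2 * length l \<le> n \<Longrightarrow> dev (pushes l) s n (fold (\<lambda>(r, b) s. s(r := b # s r)) l s)"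
proof (induction l arbitrary: s n)
  case (Cons p l)
  obtain r b where p: "p = (r, b)" by force
  have "dev (pushes l) (s(r := b # s r)) (3 + 2 * length l) (fold (\<lambda>(r, b) s. s(r := b # s r)) l (s(r := b # s r)))"
    by (rule Cons.IH) simp
  from dev_Seq[OF ev_Push[of 1] this, of n] show ?case using Cons.prems by (simp add: p del: fun_upd_apply)
qed (auto intro: dev_nop)

text \<open>The one loop behind moving, copying and encoding, which differ only in what is pushed
  for a popped bit. The contents arrive in reverse order.\<close>

definition drain :: "nat \<Rightarrow> (bool \<Rightarrow> (nat \<times> bool) list) \<Rightarrow> com" where
  "drain r L = While r (Cond r (Seq (Pop r) (pushes (L True))) (Seq (Pop r) (pushes (L False))) nop)"

lemma dev_drain_Cons:
  assumes "s r = b # xs"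
    and "ev (drain r L) (fold (\<lambda>(r, b) s. s(r := b # s r)) (L b) (s(r := xs))) n P"
    and "length (L b) \<le> 2" "n + 12 \<le> m"
  shows "ev (drain r L) s m P"
proof -
  let ?s = "fold (\<lambda>(r, b) s. s(r := b # s r)) (L b) (s(r := xs))"
  have "dev (pushes (L b)) (s(r := xs)) 7 ?s" using assms(3) by (intro dev_pushes) simp
  then have "dev (Seq (Pop r) (pushes (L b))) s 9 ?s"
    using assms(1) by (intro dev_Seq[OF ev_Pop[of 1]]) auto
  then have "dev (Cond r (Seq (Pop r) (pushes (L True))) (Seq (Pop r) (pushes (L False))) nop) s 10 ?s"
    using assms(1) by (intro ev_Cond[of _ _ _ _ _ 9]) (auto split: bool.splits)
  then show ?thesis unfolding drain_def
    by (rule dev_While_step[rotated]) (use assms in \<open>auto simp: drain_def\<close>)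
qed

lemma dev_drain_Nil: "s r = [] \<Longrightarrow> 1 \<le> n \<Longrightarrow> dev (drain r L) s n s"
  unfolding drain_def by (rule ev_While_stop)

lemma dev_move:
  assumes "q \<noteq> r" "12 * length (s r) + 1 \<le> n"
  shows "dev (drain r (\<lambda>b. [(q, b)])) s n (s(r := [], q := rev (s r) @ s q))"
  using assms(2)
proof (induction "s r" arbitrary: s n)
  case Nil
  then have eq: "s(r := [], q := rev (s r) @ s q) = s" by (auto simp: fun_eq_iff)
  show ?case unfolding eq using Nil by (intro dev_drain_Nil) auto
next
  case (Cons b xs)
  let ?s = "s(r := xs, q := b # s q)"
  have "dev (drain r (\<lambda>b. [(q, b)])) ?s (12 * length xs + 1) (?s(r := [], q := rev (?s r) @ ?s q))"
    using assms(1) by (intro Cons.hyps(1)) auto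
  moreover have "?s(r := [], q := rev (?s r) @ ?s q) = s(r := [], q := rev (s r) @ s q)"
    using assms(1) Cons.hyps(2)[symmetric] by (auto simp: fun_eq_iff)
  ultimately show ?case using assms(1) Cons.hyps(2)[symmetric] Cons.prems
    by (intro dev_drain_Cons[of s r b xs]) auto
qed

lemma dev_copy:
  assumes "q \<noteq> r" "p \<noteq> r" "p \<noteq> q" "12 * length (s r) + 1 \<le> n"
  shows "dev (drain r (\<lambda>b. [(q, b), (p, b)])) s n
           (s(r := [], q := rev (s r) @ s q, p := rev (s r) @ s p))"
  using assms(4)
proof (induction "s r" arbitrary: s n)
  case Nil
  then have eq: "s(r := [], q := rev (s r) @ s q, p := rev (s r) @ s p) = s" by (auto simp: fun_eq_iff)
  show ?case unfolding eq using Nil by (intro dev_drain_Nil) auto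
next
  case (Cons b xs)
  let ?s = "s(r := xs, q := b # s q, p := b # s p)"
  have "dev (drain r (\<lambda>b. [(q, b), (p, b)])) ?s (12 * length xs + 1)
      (?s(r := [], q := rev (?s r) @ ?s q, p := rev (?s r) @ ?s p))"
    using assms(1-3) by (intro Cons.hyps(1)) auto
  moreover have "?s(r := [], q := rev (?s r) @ ?s q, p := rev (?s r) @ ?s p) =
      s(r := [], q := rev (s r) @ s q, p := rev (s r) @ s p)"
    using assms(1-3) Cons.hyps(2)[symmetric] by (auto simp: fun_eq_iff)
  ultimately show ?case using assms(1-3) Cons.hyps(2)[symmetric] Cons.prems
    by (intro dev_drain_Cons[of s r b xs]) auto
qed

lemma enc_bits_Nil [simp]: "enc_bits [] = [False]"
  and enc_bits_Cons [simp]: "enc_bits (b # bs) = True # b # enc_bits bs"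
  by (simp_all add: enc_bits_def enc_list_def)

text \<open>The output stack is built from its last bit to its first, so the encoding of a reversed
  stack comes out in the right order.\<close>

definition emit :: "nat \<Rightarrow> nat \<Rightarrow> com" where
  "emit r q = Seq (Push q False) (drain r (\<lambda>b. [(q, b), (q, True)]))"

lemma dev_emit:
  assumes "q \<noteq> r" "12 * length (s r) + 3 \<le> n"
  shows "dev (emit r q) s n (s(r := [], q := enc_bits (rev (s r)) @ s q))"
proof -
  have "dev (drain r (\<lambda>b. [(q, b), (q, True)])) s n
      (s(r := [], q := concat (map (\<lambda>b. [True, b]) (rev (s r))) @ s q))"
    if "12 * length (s r) + 1 \<le> n" for s n
    using that
  proof (induction "s r" arbitrary: s n)
    case Nil
    then have eq: "s(r := [], q := concat (map (\<lambda>b. [True, b]) (rev (s r))) @ s q) = s" by (auto simp: fun_eq_iff)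
    show ?case unfolding eq using Nil by (intro dev_drain_Nil) auto
  next
    case (Cons b xs)
    let ?s = "s(r := xs, q := True # b # s q)"
    let ?f = "\<lambda>s. s(r := [], q := concat (map (\<lambda>b. [True, b]) (rev (s r))) @ s q)"
    have "dev (drain r (\<lambda>b. [(q, b), (q, True)])) ?s (12 * length xs + 1) (?f ?s)"
      using assms(1) by (intro Cons.hyps(1)) auto
    moreover have "?f ?s = ?f s"
      using assms(1) Cons.hyps(2)[symmetric] by (auto simp: fun_eq_iff)
    ultimately show ?case using assms(1) Cons.hyps(2)[symmetric] Cons.prems
      by (intro dev_drain_Cons[of s r b xs]) auto
  qed
  from this[of "s(q := False # s q)" "12 * length (s r) + 1"]
  have "dev (emit r q) s n (s(q := False # s q, r := [],
      q := concat (map (\<lambda>b. [True, b]) (rev (s r))) @ False # s q))"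
    using assms unfolding emit_def by (intro dev_Seq[OF ev_Push[of 1]]) auto
  moreover have "enc_bits ys = concat (map (\<lambda>b. [True, b]) ys) @ [False]" for ys
    by (induction ys) auto
  ultimately show ?thesis using assms(1) by (simp add: fun_upd_twist)
qed

fun clears :: "nat list \<Rightarrow> com" where
  "clears [] = nop"
| "clears (r # rs) = Seq (While r (Pop r)) (clears rs)"

lemma dev_clear: "2 * length (s r) + 1 \<le> n \<Longrightarrow> dev (While r (Pop r)) s n (s(r := []))"
proof (induction "s r" arbitrary: s n)
  case Nil
  then have eq: "s(r := []) = s" by (auto simp: fun_eq_iff)
  show ?case unfolding eq using Nil by (intro ev_While_stop) auto
next
  case (Cons b xs)
  let ?s = "s(r := xs)"
  have "dev (While r (Pop r)) ?s (2 * length (?s r) + 1) (?s(r := []))"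
    by (rule Cons.hyps(1)) auto
  moreover have "dev (Pop r) s 1 ?s"
    using ev_Pop[of 1 r s] by (simp flip: Cons.hyps(2))
  moreover have "Suc (1 + (2 * length (?s r) + 1)) \<le> n"
    using Cons.prems by (simp flip: Cons.hyps(2))
  moreover have "s r \<noteq> []" by (simp flip: Cons.hyps(2))
  ultimately have "dev (While r (Pop r)) s n (?s(r := []))" using dev_While_step by blast
  then show ?case by simp
qed

lemma dev_clears:
  assumes "\<And>r. r \<in> set rs \<Longrightarrow> length (s r) \<le> m" "(2 * m + 5) * length rs + 3 \<le> n"
  shows "dev (clears rs) s n (\<lambda>r. if r \<in> set rs then [] else s r)"
  using assms
proof (induction rs arbitrary: s n)
  case Nil
  then show ?case by (simp add: dev_nop)
next
  case (Cons r rs)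
  let ?s = "\<lambda>q. if q \<in> set rs then [] else (s(r := [])) q"
  have "dev (clears rs) (s(r := [])) ((2 * m + 5) * length rs + 3) ?s"
    using Cons.prems(1) by (intro Cons.IH) auto
  moreover have "dev (While r (Pop r)) s (2 * m + 1) (s(r := []))"
    using Cons.prems(1)[of r] by (intro dev_clear) auto
  moreover have "Suc (2 * m + 1 + ((2 * m + 5) * length rs + 3)) \<le> n"
    using Cons.prems(2) by (simp add: algebra_simps)
  ultimately have "dev (clears (r # rs)) s n ?s" unfolding clears.simps using dev_Seq by blast
  moreover have "?s = (\<lambda>q. if q \<in> set (r # rs) then [] else s q)" by auto
  ultimately show ?case by simp
qed


subsection \<open>Parsing\<close>

text \<open>\<open>While\<close> can only test for emptiness, so a one-bit flag on stack
  \<open>f\<close> keeps the loop running until the delimiter. Running out of input clears the flag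
  too: \<open>ppt\<close> quantifies over all inputs, malformed ones included.\<close>

definition parse_nat :: "nat \<Rightarrow> nat \<Rightarrow> com" where
  "parse_nat q f = Seq (Push f True) (While f
     (Cond 0 (Seq (Pop 0) (Push q True)) (Seq (Pop 0) (Pop f)) (Pop f)))"

lemma dev_While_step':
  "s r \<noteq> [] \<Longrightarrow> dev c s n s' \<Longrightarrow> dev (While r c) s' m t \<Longrightarrow> t = t' \<Longrightarrow> Suc (n + m) \<le> k \<Longrightarrow>
   dev (While r c) s k t'"
  using dev_While_step by blast

lemma dev_parse_nat:
  assumes "q \<noteq> 0" "f \<noteq> 0" "f \<noteq> q" "s f = []" "6 * length (s 0) + 9 \<le> n"
  shows "dev (parse_nat q f) s n
    (s(0 := tl (dropWhile id (s 0)), q := replicate (length (takeWhile id (s 0))) True @ s q))"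
proof -
  let ?c = "Cond 0 (Seq (Pop 0) (Push q True)) (Seq (Pop 0) (Pop f)) (Pop f)"
  let ?r = "\<lambda>s. s(f := [], 0 := tl (dropWhile id (s 0)), q := replicate (length (takeWhile id (s 0))) True @ s q)"
  have w: "dev (While f ?c) s n (?r s)" if "s f = [True]" "6 * length (s 0) + 7 \<le> n" for s n
    using that
  proof (induction "s 0" arbitrary: s n)
    case Nil
    have "dev ?c s 2 (s(f := []))"
      using Nil ev_Pop[of 1 f s] by (intro ev_Cond[of _ _ _ _ _ 1]) auto
    moreover have "dev (While f ?c) (s(f := [])) 1 (s(f := []))"
      by (intro ev_While_stop) auto
    moreover have "s(f := []) = ?r s" using Nil.hyps[symmetric] assms by (auto simp: fun_eq_iff)
    ultimately show ?case by (rule dev_While_step'[rotated]) (use Nil.prems in auto)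
  next
    case (Cons b xs)
    show ?case
    proof (cases b)
      case True
      let ?s = "s(0 := xs, q := True # s q)"
      have "dev (Seq (Pop 0) (Push q True)) s 3 ?s"
        using ev_Push[of 1 q True "s(0 := xs)"] Cons.hyps(2)[symmetric] assms(1)
        by (intro dev_Seq[OF ev_Pop[of 1]]) auto
      then have "dev ?c s 4 ?s" using Cons.hyps(2)[symmetric] True by (intro ev_Cond[of _ _ _ _ _ 3]) auto
      moreover have "dev (While f ?c) ?s (6 * length xs + 7) (?r ?s)"
        using assms Cons.prems by (intro Cons.hyps(1)) auto
      moreover have "?r ?s = ?r s" using Cons.hyps(2)[symmetric] assms True
        by (auto simp: fun_eq_iff replicate_app_Cons_same)
      ultimately show ?thesis by (rule dev_While_step'[rotated]) (use Cons.prems Cons.hyps(2)[symmetric] in auto)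
    next
      case False
      let ?s = "s(0 := xs, f := [])"
      have "dev (Seq (Pop 0) (Pop f)) s 3 ?s"
        using ev_Pop[of 1 f "s(0 := xs)"] Cons.hyps(2)[symmetric] Cons.prems assms(2)
        by (intro dev_Seq[OF ev_Pop[of 1]]) auto
      then have "dev ?c s 4 ?s" using Cons.hyps(2)[symmetric] False by (intro ev_Cond[of _ _ _ _ _ 3]) auto
      moreover have "dev (While f ?c) ?s 1 ?s" by (intro ev_While_stop) auto
      moreover have "?s = ?r s" using Cons.hyps(2)[symmetric] assms False by (auto simp: fun_eq_iff)
      ultimately show ?thesis by (rule dev_While_step'[rotated]) (use Cons.prems Cons.hyps(2)[symmetric] in auto)
    qed
  qed
  have "dev (parse_nat q f) s n (?r (s(f := [True])))"
    unfolding parse_nat_def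
    using assms dev_Seq[OF ev_Push[of 1 f True s] w[where n = "6 * length (s 0) + 7"], of n] by simp
  moreover have "?r (s(f := [True])) = s(0 := tl (dropWhile id (s 0)), q := replicate (length (takeWhile id (s 0))) True @ s q)"
    using assms by (auto simp: fun_eq_iff)
  ultimately show ?thesis by simp
qed

text \<open>Total on purpose: it also describes what the parser does with truncated encodings, which
  is needed for the time bound on arbitrary inputs.\<close>

fun dec_bits :: "bool list \<Rightarrow> bool list \<times> bool list" where
  "dec_bits [] = ([], [])"
| "dec_bits (False # r) = ([], r)"
| "dec_bits [True] = ([], [])"
| "dec_bits (True # b # r) = (b # fst (dec_bits r), snd (dec_bits r))"

lemma dec_enc_bits [simp]: "dec_bits (enc_bits v @ r) = (v, r)"
  by (induction v) auto

lemma dec_bits_length: "length (fst (dec_bits x)) + length (snd (dec_bits x)) \<le> length x"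
  by (induction x rule: dec_bits.induct) auto

definition parse_bits :: "nat \<Rightarrow> nat \<Rightarrow> com" where
  "parse_bits q f = Seq (Push f True) (While f
     (Cond 0 (Seq (Pop 0) (Cond 0 (Seq (Pop 0) (Push q True)) (Seq (Pop 0) (Push q False)) (Pop f)))
             (Seq (Pop 0) (Pop f)) (Pop f)))"

lemma dev_parse_bits:
  assumes "q \<noteq> 0" "f \<noteq> 0" "f \<noteq> q" "s f = []" "9 * length (s 0) + 11 \<le> n"
  shows "dev (parse_bits q f) s n
    (s(0 := snd (dec_bits (s 0)), q := rev (fst (dec_bits (s 0))) @ s q))"
proof -
  let ?d = "Cond 0 (Seq (Pop 0) (Push q True)) (Seq (Pop 0) (Push q False)) (Pop f)"
  let ?c = "Cond 0 (Seq (Pop 0) ?d) (Seq (Pop 0) (Pop f)) (Pop f)"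
  let ?r = "\<lambda>s. s(f := [], 0 := snd (dec_bits (s 0)), q := rev (fst (dec_bits (s 0))) @ s q)"
  have w: "dev (While f ?c) s n (?r s)" if "s f = [True]" "9 * length (s 0) + 9 \<le> n" for s n
    using that
  proof (induction "s 0" arbitrary: s n rule: dec_bits.induct)
    case 1
    have "dev ?c s 2 (s(f := []))"
      using 1 ev_Pop[of 1 f s] by (intro ev_Cond[of _ _ _ _ _ 1]) auto
    moreover have "dev (While f ?c) (s(f := [])) 1 (s(f := []))"
      by (intro ev_While_stop) auto
    moreover have "s(f := []) = ?r s" using 1(1)[symmetric] assms by (auto simp: fun_eq_iff)
    ultimately show ?case by (rule dev_While_step'[rotated]) (use 1 in auto)
  next
    case (2 xs)
    let ?s = "s(0 := xs, f := [])"
    have "dev (Seq (Pop 0) (Pop f)) s 3 ?s"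
      using ev_Pop[of 1 f "s(0 := xs)"] 2(1)[symmetric] 2(2-) assms(2)
      by (intro dev_Seq[OF ev_Pop[of 1]]) auto
    then have "dev ?c s 4 ?s" using 2(1)[symmetric] by (intro ev_Cond[of _ _ _ _ _ 3]) auto
    moreover have "dev (While f ?c) ?s 1 ?s" by (intro ev_While_stop) auto
    moreover have "?s = ?r s" using 2(1)[symmetric] assms by (auto simp: fun_eq_iff)
    ultimately show ?case by (rule dev_While_step'[rotated]) (use 2(2-) 2(1)[symmetric] in auto)
  next
    case 3
    let ?s = "s(0 := [], f := [])"
    have "dev ?d (s(0 := [])) 2 ?s"
      using 3(1)[symmetric] 3(2-) ev_Pop[of 1 f "s(0 := [])"] assms(2) by (intro ev_Cond[of _ _ _ _ _ 1]) auto
    then have "dev (Seq (Pop 0) ?d) s 4 ?s"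
      using 3(1)[symmetric] by (intro dev_Seq[OF ev_Pop[of 1]]) auto
    then have "dev ?c s 5 ?s" using 3(1)[symmetric] by (intro ev_Cond[of _ _ _ _ _ 4]) auto
    moreover have "dev (While f ?c) ?s 1 ?s" by (intro ev_While_stop) auto
    moreover have "?s = ?r s" using 3(1)[symmetric] assms by (auto simp: fun_eq_iff)
    ultimately show ?case by (rule dev_While_step'[rotated]) (use 3(2-) 3(1)[symmetric] in auto)
  next
    case (4 b xs)
    let ?s = "s(0 := xs, q := b # s q)"
    have "dev (Seq (Pop 0) (Push q b)) (s(0 := b # xs)) 3 ?s"
      using ev_Push[of 1 q b "s(0 := xs)"] assms(1)
      by (intro dev_Seq[OF ev_Pop[of 1]]) auto
    then have "dev ?d (s(0 := b # xs)) 4 ?s"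
      by (intro ev_Cond[of _ _ _ _ _ 3]) (auto split: if_splits)
    then have "dev (Seq (Pop 0) ?d) s 6 ?s"
      using 4(3)[symmetric] by (intro dev_Seq[OF ev_Pop[of 1]]) auto
    then have "dev ?c s 7 ?s" using 4(3)[symmetric] by (intro ev_Cond[of _ _ _ _ _ 6]) auto
    moreover have "dev (While f ?c) ?s (9 * length xs + 9) (?r ?s)"
      using assms 4 by (intro 4(1)) auto
    moreover have "?r ?s = ?r s" using 4(3)[symmetric] assms by (auto simp: fun_eq_iff)
    ultimately show ?case by (rule dev_While_step'[rotated]) (use 4(4-) 4(3)[symmetric] in auto)
  qed
  have "dev (parse_bits q f) s n (?r (s(f := [True])))"
    unfolding parse_bits_def
    using assms dev_Seq[OF ev_Push[of 1 f True s] w[where n = "9 * length (s 0) + 9"], of n] by simp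
  moreover have "?r (s(f := [True])) = s(0 := snd (dec_bits (s 0)), q := rev (fst (dec_bits (s 0))) @ s q)"
    using assms by (auto simp: fun_eq_iff)
  ultimately show ?thesis by simp
qed


section \<open>A script interpreter\<close>

text \<open>Stack 0 is the output, 1 the script, 2 a data stack, 3 the data bits already used (so that
  they can be used twice), 4 the security parameter in unary, 5 and 6 are scratch, and from 7 on
  live the subprograms, with 7 collecting the argument of the next call.\<close>

type_synonym istate = "bool list \<times> bool list \<times> bool list \<times> bool list"

fun conc :: "nat \<Rightarrow> istate \<Rightarrow> bool list \<Rightarrow> stacks" where
  "conc \<kappa> (out, own, sav, arg) scr =
     (\<lambda>_. [])(0 := out, 1 := scr, 2 := own, 3 := sav, 4 := replicate \<kappa> True, 7 := arg)"

text \<open>The output grows towards its front, so data are consumed from the last bit on.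
  \<open>XorOp\<close> saves each bit that it consumes and \<open>BackOp\<close> returns it, so that
  a batch can be used twice. \<open>EmitOp\<close> serves the distinguisher, \<open>CallOp\<close>
  the simulator.\<close>

datatype op = LitOp bool | XorOp bool | BackOp | SkipOp | ArgOp bool | EmitOp | CallOp com | NopOp

fun op_com :: "op \<Rightarrow> com" where
  "op_com (LitOp b) = Push 0 b"
| "op_com (XorOp m) = Cond 2 (Seq (Pop 2) (Seq (Push 3 True) (Push 0 (\<not> m))))
                             (Seq (Pop 2) (Seq (Push 3 False) (Push 0 m))) nop"
| "op_com BackOp = Cond 3 (Seq (Pop 3) (Push 2 True)) (Seq (Pop 3) (Push 2 False)) nop"
| "op_com SkipOp = Pop 2"
| "op_com (ArgOp b) = Push 7 b"
| "op_com EmitOp = emit 2 0"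
| "op_com (CallOp c) =
     Seq (Push 7 False) (Seq (drain 4 (\<lambda>b. [(5, b)])) (Seq (drain 5 (\<lambda>b. [(4, b), (7, b)]))
       (Seq (shift_com 7 c) (Seq (drain 7 (\<lambda>b. [(5, b)])) (Seq (emit 5 0)
         (clears [8..<8 + max_stack c]))))))"
| "op_com NopOp = nop"

fun op_sem :: "nat \<Rightarrow> op \<Rightarrow> istate \<Rightarrow> istate pmf" where
  "op_sem \<kappa> (LitOp b) (out, own, sav, arg) = return_pmf (b # out, own, sav, arg)"
| "op_sem \<kappa> (XorOp m) (out, own, sav, arg) = return_pmf
     (case own of [] \<Rightarrow> (out, own, sav, arg) | b # own' \<Rightarrow> ((b \<noteq> m) # out, own', b # sav, arg))"
| "op_sem \<kappa> BackOp (out, own, sav, arg) = return_pmf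
     (case sav of [] \<Rightarrow> (out, own, sav, arg) | b # sav' \<Rightarrow> (out, b # own, sav', arg))"
| "op_sem \<kappa> SkipOp (out, own, sav, arg) = return_pmf (out, tl own, sav, arg)"
| "op_sem \<kappa> (ArgOp b) (out, own, sav, arg) = return_pmf (out, own, sav, b # arg)"
| "op_sem \<kappa> EmitOp (out, own, sav, arg) = return_pmf (enc_bits (rev own) @ out, [], sav, arg)"
| "op_sem \<kappa> (CallOp c) (out, own, sav, arg) =
     map_pmf (\<lambda>v. (enc_bits v @ out, own, sav, [])) (exec c (enc_nat \<kappa> @ arg))"
| "op_sem \<kappa> NopOp a = return_pmf a"

fun op_ok :: "op \<Rightarrow> bool" where
  "op_ok (CallOp c) \<longleftrightarrow> ppt c"
| "op_ok _ \<longleftrightarrow> True"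

text \<open>The output is left out because no operation reads it. Hence even a call with a long
  answer raises the measure by at most one; otherwise the time bounds of successive calls would be
  nested in each other instead of added up.\<close>

fun isize :: "istate \<Rightarrow> nat" where
  "isize (out, own, sav, arg) = length own + length sav + length arg"

lemma op_sem_isize: "a' \<in> set_pmf (op_sem \<kappa> op a) \<Longrightarrow> isize a' \<le> Suc (isize a)"
  by (cases "(\<kappa>, op, a)" rule: op_sem.cases) (auto split: list.splits)

lemma ev_call:
  assumes "ppt c"
  obtains B where "polyb B" "mono B"
    "\<And>\<kappa> a scr. ev (op_com (CallOp c)) (conc \<kappa> a scr) (B (\<kappa> + isize a))
        (map_pmf (\<lambda>a'. conc \<kappa> a' scr) (op_sem \<kappa> (CallOp c) a))"
proof -
  obtain T P where T: "polyb T" "mono T" "\<And>x. ev c (ini x) (T (length x)) (P x)"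
    using pptE[OF assms] by blast
  \<comment> \<open>\<open>U n\<close> bounds each stack of the callee when it ends: running time
    plus input length, where the input \<open>enc_nat \<kappa> @ arg\<close> has at most
    \<open>Suc n\<close> bits.\<close>
  define U where "U n = T (Suc n) + Suc n" for n
  define B where "B n = 24 * n + 24 * U n + T (Suc n) + (2 * U n + 5) * max_stack c + 40" for n
  have pT: "polyb (\<lambda>n. T (Suc n))" by (rule polyb_comp[OF T(1)]) auto
  then have pU: "polyb U" unfolding U_def by (intro polyb_add) auto
  have mU: "mono U" unfolding U_def using T(2) by (auto simp: mono_def intro!: add_mono)
  have "polyb B" unfolding B_def using pU pT by (intro polyb_add polyb_mult) auto
  moreover have "mono B"
    using mU T(2) unfolding B_def by (intro monoI add_mono mult_mono) (auto simp: mono_def)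
  moreover have "ev (op_com (CallOp c)) (conc \<kappa> a scr) (B (\<kappa> + isize a))
        (map_pmf (\<lambda>a'. conc \<kappa> a' scr) (op_sem \<kappa> (CallOp c) a))" for \<kappa> a scr
  proof -
    obtain out own sav arg where a: "a = (out, own, sav, arg)" using prod_cases4 by blast
    let ?n = "\<kappa> + isize a"
    let ?x = "enc_nat \<kappa> @ arg"
    let ?s0 = "conc \<kappa> a scr"
    let ?s1 = "?s0(7 := False # arg)"
    let ?s2 = "?s1(4 := [], 5 := replicate \<kappa> True)"
    let ?s3 = "?s1(7 := ?x)"
    have lx: "length ?x \<le> Suc ?n" by (simp add: enc_nat_def a)
    have 1: "dev (Push 7 False) ?s0 1 ?s1"
      using ev_Push[of 1 7 False ?s0] by (simp add: a)
    have 2: "dev (drain 4 (\<lambda>b. [(5, b)])) ?s1 (12 * ?n + 1) ?s2"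
      using dev_move[of 5 4 ?s1 "12 * ?n + 1"] by (simp add: a)
    have "?s2(5 := [], 4 := replicate \<kappa> True, 7 := ?x) = ?s3"
      by (auto simp: a fun_eq_iff)
    then have 3: "dev (drain 5 (\<lambda>b. [(4, b), (7, b)])) ?s2 (12 * ?n + 1) ?s3"
      using dev_copy[of 4 5 7 ?s2 "12 * ?n + 1"]
      by (simp add: a enc_nat_def del: fun_upd_apply) (simp add: fun_upd_def cong: if_cong)
    \<comment> \<open>From stack 7 on there is only the argument, so the callee starts in a proper
      initial state.\<close>
    have g3: "?s3 = glue 7 ?s3 (ini ?x)" by (auto simp: glue_def ini_def a fun_eq_iff)
    have T': "T (length ?x) \<le> T (Suc ?n)" using T(2) lx by (rule monoD)
    have 4: "ev (shift_com 7 c) ?s3 (T (Suc ?n)) (map_pmf (glue 7 ?s3) (P ?x))"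
      using evl_mono[OF ev_shift[OF T(3)[of ?x], of 7 ?s3] T'] g3 by simp
    let ?f = "\<lambda>s'. conc \<kappa> (enc_bits (s' 0) @ out, own, sav, []) scr"
    let ?rest = "Seq (drain 7 (\<lambda>b. [(5, b)])) (Seq (emit 5 0) (clears [8..<8 + max_stack c]))"
    have 5: "dev ?rest (glue 7 ?s3 s') (24 * U ?n + (2 * U ?n + 5) * max_stack c + 10) (?f s')"
      if s': "s' \<in> set_pmf (P ?x)" for s'
    proof -
      let ?g = "glue 7 ?s3 s'"
      have l: "length (s' r) \<le> U ?n" for r
        using ev_length[OF T(3) s', of r] T' lx by (simp add: U_def ini_def split: if_splits)
      let ?g1 = "?g(7 := [], 5 := rev (s' 0))"
      let ?g2 = "?g1(5 := [], 0 := enc_bits (s' 0) @ out)"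
      have "dev (drain 7 (\<lambda>b. [(5, b)])) ?g (12 * U ?n + 1) ?g1"
        using dev_move[of 5 7 ?g "12 * U ?n + 1"] l[of 0] by (simp add: glue_def a)
      moreover have "dev (emit 5 0) ?g1 (12 * U ?n + 3) ?g2"
        using dev_emit[of 0 5 ?g1 "12 * U ?n + 3"] l[of 0] by (simp add: glue_def a)
      \<comment> \<open>Stack 7 has just been drained; beyond it the callee can have written only up
        to stack \<open>7 + max_stack c\<close>.\<close>
      moreover have "dev (clears [8..<8 + max_stack c]) ?g2 ((2 * U ?n + 5) * max_stack c + 3)
          (\<lambda>r. if r \<in> set [8..<8 + max_stack c] then [] else ?g2 r)"
        using l by (intro dev_clears[of _ _ "U ?n"]) (auto simp: glue_def)
      moreover have "(\<lambda>r. if r \<in> set [8..<8 + max_stack c] then [] else ?g2 r) = ?f s'"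
      proof
        fix r
        have "s' (r - 7) = []" if "8 + max_stack c \<le> r"
          using ev_above[OF T(3) s', of "r - 7"] that by (auto simp: ini_def)
        then show "(if r \<in> set [8..<8 + max_stack c] then [] else ?g2 r) = ?f s' r"
          by (auto simp: glue_def a)
      qed
      ultimately have "dev (drain 7 (\<lambda>b. [(5, b)])) ?g (12 * U ?n + 1) ?g1"
        "dev (emit 5 0) ?g1 (12 * U ?n + 3) ?g2"
        "dev (clears [8..<8 + max_stack c]) ?g2 ((2 * U ?n + 5) * max_stack c + 3) (?f s')"
        by simp_all
      from dev_Seq[OF this(1) dev_Seq[OF this(2,3) order_refl] order_refl]
      show ?thesis by (rule evl_mono) simp
    qed
    have "ev (Seq (shift_com 7 c) ?rest) ?s3
        (T (Suc ?n) + 24 * U ?n + (2 * U ?n + 5) * max_stack c + 11)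
        (bind_pmf (map_pmf (glue 7 ?s3) (P ?x)) (\<lambda>s. return_pmf (?f (\<lambda>r. s (r + 7)))))"
      by (rule ev_Seq[OF 4, where m = "24 * U ?n + (2 * U ?n + 5) * max_stack c + 10"])
         (use 5 in auto)
    then have "ev (op_com (CallOp c)) ?s0 (B ?n)
       (bind_pmf (map_pmf (glue 7 ?s3) (P ?x)) (\<lambda>s. return_pmf (?f (\<lambda>r. s (r + 7)))))"
      unfolding op_com.simps
      by (rule dev_Seq[OF 1 dev_Seq[OF 2 dev_Seq[OF 3 _ order_refl] order_refl]])
         (simp add: B_def)
    moreover have "bind_pmf (map_pmf (glue 7 ?s3) (P ?x)) (\<lambda>s. return_pmf (?f (\<lambda>r. s (r + 7)))) =
        map_pmf (\<lambda>a'. conc \<kappa> a' scr) (op_sem \<kappa> (CallOp c) a)"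
      using exec_ev[OF T(3)[of ?x]] by (simp add: a bind_map_pmf map_pmf_comp bind_return_pmf' map_pmf_def[symmetric] o_def)
    ultimately show ?thesis by simp
  qed
  ultimately show ?thesis using that by blast
qed

lemma ev_op:
  assumes "op_ok op"
  obtains B where "polyb B" "mono B"
    "\<And>\<kappa> a scr. ev (op_com op) (conc \<kappa> a scr) (B (\<kappa> + isize a))
        (map_pmf (\<lambda>a'. conc \<kappa> a' scr) (op_sem \<kappa> op a))"
proof (cases "\<exists>c. op = CallOp c")
  case True
  then obtain c where c: "op = CallOp c" by blast
  then have "ppt c" using assms by simp
  from ev_call[OF this] show ?thesis using that unfolding c by blast
next
  case False
  define B where "B = (\<lambda>n::nat. 12 * n + 20)"
  have "polyb B" "mono B" by (auto simp: B_def mono_def)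
  moreover have "ev (op_com op) (conc \<kappa> a scr) (B (\<kappa> + isize a))
        (map_pmf (\<lambda>a'. conc \<kappa> a' scr) (op_sem \<kappa> op a))" for \<kappa> a scr
  proof -
    obtain out own sav arg where a: "a = (out, own, sav, arg)" using prod_cases4 by blast
    let ?s = "conc \<kappa> a scr"
    have B: "20 \<le> B m" for m by (simp add: B_def)
    show ?thesis
    proof (cases op)
      case (LitOp b)
      have "dev (Push 0 b) ?s (B (\<kappa> + isize a)) (?s(0 := b # ?s 0))"
        using B[of "\<kappa> + isize a"] by (intro ev_Push) auto
      moreover have "?s(0 := b # ?s 0) = conc \<kappa> (b # out, own, sav, arg) scr"
        by (auto simp: a fun_eq_iff)
      ultimately show ?thesis by (simp add: LitOp a)
    next
      case (XorOp m)
      show ?thesis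
      proof (cases own)
        case Nil
        have "dev (op_com op) ?s 20 ?s" unfolding XorOp op_com.simps
          by (rule ev_Cond[of _ _ _ _ _ 19]) (auto simp: a Nil intro: dev_nop)
        then show ?thesis using evl_mono[OF _ B] by (simp add: XorOp a Nil)
      next
        case (Cons b own')
        have *: "dev (Seq (Pop 2) (Seq (Push 3 b) (Push 0 (b \<noteq> m)))) ?s 5
            (?s(2 := own', 3 := b # sav, 0 := (b \<noteq> m) # out))"
          using dev_Seq[OF ev_Pop[of 1 2 ?s] dev_Seq[OF ev_Push[of 1 3 b] ev_Push[of 1 0 "b \<noteq> m"] order_refl], of 5]
          by (simp add: a Cons)
        have "?s(2 := own', 3 := b # sav, 0 := (b \<noteq> m) # out) = conc \<kappa> ((b \<noteq> m) # out, own', b # sav, arg) scr"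
          by (auto simp: a fun_eq_iff)
        then have "dev (op_com op) ?s 20 (conc \<kappa> ((b \<noteq> m) # out, own', b # sav, arg) scr)"
          unfolding XorOp op_com.simps
          using * by (intro ev_Cond[of _ _ _ _ _ 5]) (auto simp: a Cons)
        then show ?thesis using evl_mono[OF _ B] by (simp add: XorOp a Cons)
      qed
    next
      case BackOp
      show ?thesis
      proof (cases sav)
        case Nil
        have "dev (op_com op) ?s 20 ?s" unfolding BackOp op_com.simps
          by (rule ev_Cond[of _ _ _ _ _ 19]) (auto simp: a Nil intro: dev_nop)
        then show ?thesis using evl_mono[OF _ B] by (simp add: BackOp a Nil)
      next
        case (Cons b sav')
        have *: "dev (Seq (Pop 3) (Push 2 b)) ?s 3 (?s(3 := sav', 2 := b # own))"
          using dev_Seq[OF ev_Pop[of 1 3 ?s] ev_Push[of 1 2 b], of 3]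
          by (simp add: a Cons)
        have "?s(3 := sav', 2 := b # own) = conc \<kappa> (out, b # own, sav', arg) scr"
          by (auto simp: a fun_eq_iff)
        then have "dev (op_com op) ?s 20 (conc \<kappa> (out, b # own, sav', arg) scr)"
          unfolding BackOp op_com.simps
          using * by (intro ev_Cond[of _ _ _ _ _ 3]) (auto simp: a Cons)
        then show ?thesis using evl_mono[OF _ B] by (simp add: BackOp a Cons)
      qed
    next
      case SkipOp
      have "dev (Pop 2) ?s (B (\<kappa> + isize a)) (?s(2 := tl (?s 2)))"
        using B[of "\<kappa> + isize a"] by (intro ev_Pop) auto
      moreover have "?s(2 := tl (?s 2)) = conc \<kappa> (out, tl own, sav, arg) scr"
        by (auto simp: a fun_eq_iff)
      ultimately show ?thesis by (simp add: SkipOp a)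
    next
      case (ArgOp b)
      have "dev (Push 7 b) ?s (B (\<kappa> + isize a)) (?s(7 := b # ?s 7))"
        using B[of "\<kappa> + isize a"] by (intro ev_Push) auto
      moreover have "?s(7 := b # ?s 7) = conc \<kappa> (out, own, sav, b # arg) scr"
        by (auto simp: a fun_eq_iff)
      ultimately show ?thesis by (simp add: ArgOp a)
    next
      case EmitOp
      have "dev (emit 2 0) ?s (B (\<kappa> + isize a)) (?s(2 := [], 0 := enc_bits (rev (?s 2)) @ ?s 0))"
        by (intro dev_emit) (auto simp: a B_def)
      moreover have "?s(2 := [], 0 := enc_bits (rev (?s 2)) @ ?s 0) =
          conc \<kappa> (enc_bits (rev own) @ out, [], sav, arg) scr"
        by (auto simp: a fun_eq_iff)
      ultimately show ?thesis by (simp add: EmitOp a)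
    next
      case NopOp
      then show ?thesis using B[of "\<kappa> + isize a"] by (auto intro: dev_nop)
    qed (use False in auto)
  qed
  ultimately show ?thesis using that by blast
qed


text \<open>A script is a sequence of operation numbers in unary.\<close>

fun dispatch :: "com list \<Rightarrow> com" where
  "dispatch [] = nop"
| "dispatch (c # cs) = Cond 1 (Seq (Pop 1) (dispatch cs)) (Seq (Pop 1) c) nop"

definition interp :: "op list \<Rightarrow> com" where
  "interp ops = While 1 (dispatch (map op_com ops))"

text \<open>Follows \<open>dispatch\<close> on every bit string: a number that reaches
  \<open>L\<close> falls through to \<open>nop\<close> and counting restarts at 0, and an unfinished
  number at the end is dropped.\<close>

fun decode :: "nat \<Rightarrow> nat \<Rightarrow> bool list \<Rightarrow> nat list" where
  "decode L j [] = []"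
| "decode L j (True # bs) = decode L (if Suc j < L then Suc j else 0) bs"
| "decode L j (False # bs) = j # decode L 0 bs"

fun run_ops :: "nat \<Rightarrow> op list \<Rightarrow> nat list \<Rightarrow> istate \<Rightarrow> istate pmf" where
  "run_ops \<kappa> ops [] a = return_pmf a"
| "run_ops \<kappa> ops (i # is) a = bind_pmf (op_sem \<kappa> (ops ! i) a) (run_ops \<kappa> ops is)"

lemma conc_script [simp]: "conc \<kappa> a scr (Suc 0) = scr" "(conc \<kappa> a scr)(Suc 0 := x) = conc \<kappa> a x"
  by (cases a; auto simp: fun_eq_iff)+

text \<open>The invariant of the interpreter is stated inside the loop body, where a number may be
  half read. This leads to it from the loop head, which stops instead of dispatching when the script
  is empty.\<close>

lemma interp_resume:
  assumes "evl [dispatch (map op_com ops), interp ops] (conc \<kappa> a bs) n P"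
    and "bs = [] \<Longrightarrow> P = return_pmf (conc \<kappa> a bs)" and "Suc n \<le> m"
  shows "ev (interp ops) (conc \<kappa> a bs) m P"
proof (cases "bs = []")
  case True
  then show ?thesis using assms ev_While_stop[of "conc \<kappa> a bs" 1 m] by (simp add: interp_def)
next
  case False
  have "step ([interp ops], conc \<kappa> a bs) = return_pmf ([dispatch (map op_com ops), interp ops], conc \<kappa> a bs)"
    using False by (simp add: interp_def)
  then show ?thesis using assms(1,3) by (rule evl_step)
qed

text \<open>Each script bit starts at most one operation. An operation raises \<open>isize\<close>
  by at most one while its number uses up at least one bit, so \<open>M\<close> stays a bound and
  every operation costs at most \<open>B M\<close>.\<close>

lemma evl_interp:
  assumes op: "\<And>op \<kappa> a scr. op \<in> set ops \<Longrightarrow> ev (op_com op) (conc \<kappa> a scr) (B (\<kappa> + isize a))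
        (map_pmf (\<lambda>a'. conc \<kappa> a' scr) (op_sem \<kappa> op a))"
    and "mono B"
  shows "j < length ops \<Longrightarrow> \<kappa> + isize a + length bs \<le> M \<Longrightarrow>
    evl [dispatch (map op_com (drop j ops)), interp ops] (conc \<kappa> a bs) ((B M + 12) * length bs + 6)
      (map_pmf (\<lambda>a. conc \<kappa> a []) (run_ops \<kappa> ops (decode (length ops) j bs) a))"
proof (induction bs arbitrary: j a)
  case Nil
  have d: "drop j ops = ops ! j # drop (Suc j) ops" using Nil by (simp add: Cons_nth_drop_Suc)
  have "dev (dispatch (map op_com (drop j ops))) (conc \<kappa> a []) 4 (conc \<kappa> a [])"
    unfolding d list.map dispatch.simps by (rule ev_Cond[of _ _ _ _ _ 3]) (auto intro: dev_nop)
  from evl_Cons[OF this, of "[interp ops]" 1 return_pmf]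
  have "evl [dispatch (map op_com (drop j ops)), interp ops] (conc \<kappa> a []) 5 (return_pmf (conc \<kappa> a []))"
    by (auto simp: interp_def bind_return_pmf ev_While_stop)
  from evl_mono[OF this] show ?case by simp
next
  case (Cons b bs)
  have d: "drop j ops = ops ! j # drop (Suc j) ops" using Cons.prems by (simp add: Cons_nth_drop_Suc)
  have ne: "ops \<noteq> []" using Cons.prems by auto
  let ?s = "conc \<kappa> a bs"
  let ?m = "(B M + 12) * length bs + 6"
  show ?case
  proof (cases b)
    case True
    let ?P = "map_pmf (\<lambda>a. conc \<kappa> a []) (run_ops \<kappa> ops (decode (length ops) j (b # bs)) a)"
    have "evl [dispatch (map op_com (drop (Suc j) ops)), interp ops] ?s (?m + 5) ?P"
    proof (cases "Suc j < length ops")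
      case l: True
      have "evl [dispatch (map op_com (drop (Suc j) ops)), interp ops] ?s ?m ?P"
        using Cons.IH[of "Suc j" a] Cons.prems l True by simp
      then show ?thesis by (rule evl_mono) simp
    next
      case l: False
      then have n: "dispatch (map op_com (drop (Suc j) ops)) = nop" by simp
      have "evl [dispatch (map op_com ops), interp ops] ?s ?m ?P"
        using Cons.IH[of 0 a] Cons.prems l True ne by simp
      then have "ev (interp ops) ?s (Suc ?m) ?P"
        by (rule interp_resume) (use l True in auto)
      from evl_Cons[OF dev_nop[OF order_refl], where ks = "[interp ops]" and m = "Suc ?m" and Q = "\<lambda>_. ?P"] this
      have "evl [nop, interp ops] ?s (3 + Suc ?m) ?P" by (simp add: bind_return_pmf)
      then show ?thesis unfolding n by (rule evl_mono) simp
    qed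
    then have "evl [Pop 1, dispatch (map op_com (drop (Suc j) ops)), interp ops] (conc \<kappa> a (b # bs)) (?m + 6) ?P"
      by (rule evl_step[rotated]) auto
    then have "evl [Seq (Pop 1) (dispatch (map op_com (drop (Suc j) ops))), interp ops] (conc \<kappa> a (b # bs)) (?m + 7) ?P"
      by (rule evl_step[rotated]) auto
    then have "evl [dispatch (map op_com (drop j ops)), interp ops] (conc \<kappa> a (b # bs)) (?m + 8) ?P"
      unfolding d list.map dispatch.simps by (rule evl_step[rotated]) (auto simp: True)
    then show ?thesis by (rule evl_mono) simp
  next
    case False
    let ?R = "\<lambda>a. map_pmf (\<lambda>a. conc \<kappa> a []) (run_ops \<kappa> ops (decode (length ops) 0 bs) a)"
    have o: "ops ! j \<in> set ops" using Cons.prems by simp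
    have "B (\<kappa> + isize a) \<le> B M" using Cons.prems by (intro monoD[OF \<open>mono B\<close>]) simp
    from evl_mono[OF op[OF o] this]
    have 1: "ev (op_com (ops ! j)) ?s (B M) (map_pmf (\<lambda>a'. conc \<kappa> a' bs) (op_sem \<kappa> (ops ! j) a))" .
    have 2: "ev (interp ops) (conc \<kappa> a' bs) (Suc ?m) (?R a')" if "a' \<in> set_pmf (op_sem \<kappa> (ops ! j) a)" for a'
    proof (rule interp_resume)
      show "evl [dispatch (map op_com ops), interp ops] (conc \<kappa> a' bs) ?m (?R a')"
        using Cons.IH[of 0 a'] Cons.prems op_sem_isize[OF that] ne by simp
    qed auto
    \<comment> \<open>\<open>evl_Cons\<close> wants the continuation as a function of the stacks, so
      the abstract state is read back from them.\<close>
    let ?c = "\<lambda>s::stacks. (s 0, s 2, s 3, s 7)"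
    have c: "?c (conc \<kappa> a' bs) = a'" for a' by (cases a') auto
    have "evl [op_com (ops ! j), interp ops] ?s (B M + Suc ?m)
        (bind_pmf (map_pmf (\<lambda>a'. conc \<kappa> a' bs) (op_sem \<kappa> (ops ! j) a)) (\<lambda>s. ?R (?c s)))"
    proof (rule evl_Cons[OF 1])
      fix s' assume "s' \<in> set_pmf (map_pmf (\<lambda>a'. conc \<kappa> a' bs) (op_sem \<kappa> (ops ! j) a))"
      then obtain a' where a': "a' \<in> set_pmf (op_sem \<kappa> (ops ! j) a)" "s' = conc \<kappa> a' bs" by auto
      show "ev (interp ops) s' (Suc ?m) (?R (?c s'))" unfolding a'(2) c by (rule 2[OF a'(1)])
    qed
    also have "bind_pmf (map_pmf (\<lambda>a'. conc \<kappa> a' bs) (op_sem \<kappa> (ops ! j) a)) (\<lambda>s. ?R (?c s)) =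
        map_pmf (\<lambda>a. conc \<kappa> a []) (run_ops \<kappa> ops (decode (length ops) j (b # bs)) a)"
      unfolding bind_map_pmf c using False by (simp add: map_bind_pmf)
    finally have "evl [op_com (ops ! j), interp ops] ?s (B M + Suc ?m)
        (map_pmf (\<lambda>a. conc \<kappa> a []) (run_ops \<kappa> ops (decode (length ops) j (b # bs)) a))" (is "evl _ _ _ ?P") .
    then have "evl [Pop 1, op_com (ops ! j), interp ops] (conc \<kappa> a (b # bs)) (B M + ?m + 2) ?P"
      by (rule evl_step[rotated]) auto
    then have "evl [Seq (Pop 1) (op_com (ops ! j)), interp ops] (conc \<kappa> a (b # bs)) (B M + ?m + 3) ?P"
      by (rule evl_step[rotated]) auto
    then have "evl [dispatch (map op_com (drop j ops)), interp ops] (conc \<kappa> a (b # bs)) (B M + ?m + 4) ?P"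
      unfolding d list.map dispatch.simps by (rule evl_step[rotated]) (auto simp: False)
    then show ?thesis by (rule evl_mono) simp
  qed
qed

lemma ev_interp:
  assumes "ops \<noteq> []" "\<forall>op \<in> set ops. op_ok op"
  obtains T where "polyb T" "mono T"
    "\<And>\<kappa> a scr. ev (interp ops) (conc \<kappa> a scr) (T (\<kappa> + isize a + length scr))
        (map_pmf (\<lambda>a. conc \<kappa> a []) (run_ops \<kappa> ops (decode (length ops) 0 scr) a))"
proof -
  have "\<exists>B. \<forall>op \<in> set ops. polyb (B op) \<and> (\<forall>\<kappa> a scr. ev (op_com op) (conc \<kappa> a scr)
      (B op (\<kappa> + isize a)) (map_pmf (\<lambda>a'. conc \<kappa> a' scr) (op_sem \<kappa> op a)))"
  proof (intro bchoice ballI)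
    fix op assume "op \<in> set ops"
    then have "op_ok op" using assms(2) by blast
    then obtain B where "polyb B" "mono B" "\<And>\<kappa> a scr. ev (op_com op) (conc \<kappa> a scr)
      (B (\<kappa> + isize a)) (map_pmf (\<lambda>a'. conc \<kappa> a' scr) (op_sem \<kappa> op a))"
      by (rule ev_op) (rule that)
    then show "\<exists>B. polyb B \<and> (\<forall>\<kappa> a scr. ev (op_com op) (conc \<kappa> a scr)
      (B (\<kappa> + isize a)) (map_pmf (\<lambda>a'. conc \<kappa> a' scr) (op_sem \<kappa> op a)))" by blast
  qed
  then obtain B where B: "\<And>op. op \<in> set ops \<Longrightarrow> polyb (B op)" "\<And>op \<kappa> a scr. op \<in> set ops \<Longrightarrow>
      ev (op_com op) (conc \<kappa> a scr) (B op (\<kappa> + isize a)) (map_pmf (\<lambda>a'. conc \<kappa> a' scr) (op_sem \<kappa> op a))"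
    by blast
  obtain B1 where B1: "polyb B1" "\<And>op n. op \<in> set ops \<Longrightarrow> B op n \<le> B1 n"
    using polyb_uniform[of "set ops" B] B(1) by auto
  obtain B2 where B2: "polyb B2" "mono B2" "\<And>n. B1 n \<le> B2 n"
    using polyb_mono_majorant[OF B1(1)] by blast
  have op: "ev (op_com op) (conc \<kappa> a scr) (B2 (\<kappa> + isize a)) (map_pmf (\<lambda>a'. conc \<kappa> a' scr) (op_sem \<kappa> op a))"
    if "op \<in> set ops" for op \<kappa> a scr
  proof (rule evl_mono[OF B(2)[OF that]])
    show "B op (\<kappa> + isize a) \<le> B2 (\<kappa> + isize a)" using B1(2)[OF that] B2(3) by (rule order_trans)
  qed
  define T where "T n = (B2 n + 12) * n + 7" for n
  have "polyb T" unfolding T_def using B2(1) by (intro polyb_add polyb_mult) auto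
  moreover have "mono T" using B2(2) unfolding T_def
    by (intro monoI add_mono mult_mono) (auto simp: mono_def)
  moreover have "ev (interp ops) (conc \<kappa> a scr) (T (\<kappa> + isize a + length scr))
        (map_pmf (\<lambda>a. conc \<kappa> a []) (run_ops \<kappa> ops (decode (length ops) 0 scr) a))" for \<kappa> a scr
  proof -
    let ?M = "\<kappa> + isize a + length scr"
    have e: "evl [dispatch (map op_com (drop 0 ops)), interp ops] (conc \<kappa> a scr) ((B2 ?M + 12) * length scr + 6)
      (map_pmf (\<lambda>a. conc \<kappa> a []) (run_ops \<kappa> ops (decode (length ops) 0 scr) a))"
      by (rule evl_interp[where B = B2, OF op B2(2)]) (use assms(1) in auto)
    have "(B2 ?M + 12) * length scr \<le> (B2 ?M + 12) * ?M" by (intro mult_le_mono2) simp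
    then have "Suc ((B2 ?M + 12) * length scr + 6) \<le> T ?M" by (simp add: T_def)
    then show ?thesis by (rule interp_resume[OF e[unfolded drop_0], rotated]) simp
  qed
  ultimately show ?thesis using that by blast
qed

definition unary :: "nat list \<Rightarrow> bool list" where
  "unary is = concat (map (\<lambda>i. replicate i True @ [False]) is)"

lemma decode_unary:
  assumes "\<forall>i \<in> set is. i < L" shows "decode L 0 (unary is) = is"
  using assms
proof (induction "is")
  case (Cons i "is")
  have "decode L (i - k) (replicate k True @ False # bs) = i # decode L 0 bs" if "k \<le> i" "i < L" for k bs
    using that by (induction k) (auto simp: Suc_diff_Suc)
  from this[of i "unary is"] Cons show ?case by (simp add: unary_def)
qed (simp add: unary_def)


subsection \<open>Programs around the interpreter\<close>

definition interp_prog :: "op list \<Rightarrow> com" where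
  "interp_prog ops = Seq (parse_nat 4 6) (Seq (parse_bits 1 6) (Seq (drain 0 (\<lambda>b. [(2, b)])) (interp ops)))"

lemma takeWhile_enc_nat [simp]:
  "takeWhile id (enc_nat n @ x) = replicate n True" "dropWhile id (enc_nat n @ x) = False # x"
  by (induction n) (auto simp: enc_nat_def)

text \<open>Parsing reverses script and data. For the data this is wanted, as they are consumed from
  the end; for the script it is undone by supplying reversed scripts.\<close>

lemma interp_prog:
  assumes "ops \<noteq> []" "\<forall>op \<in> set ops. op_ok op"
  shows "ppt (interp_prog ops)"
    and "exec (interp_prog ops) (enc_nat \<kappa> @ enc_bits scr @ x) =
      map_pmf fst (run_ops \<kappa> ops (decode (length ops) 0 (rev scr)) ([], rev x, [], []))"
proof -
  obtain T where T: "polyb T" "mono T"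
    "\<And>\<kappa> a scr. ev (interp ops) (conc \<kappa> a scr) (T (\<kappa> + isize a + length scr))
        (map_pmf (\<lambda>a. conc \<kappa> a []) (run_ops \<kappa> ops (decode (length ops) 0 scr) a))"
    using ev_interp[OF assms] by blast
  define U where "U n = 27 * n + T n + 30" for n
  \<comment> \<open>Arbitrary inputs are covered, as \<open>ppt\<close> requires; the well-formed
    one is substituted afterwards.\<close>
  have main: "ev (interp_prog ops) (ini y) (U (length y)) (map_pmf (\<lambda>a. conc k a [])
      (run_ops k ops (decode (length ops) 0 (rev (fst (dec_bits z)))) ([], rev (snd (dec_bits z)), [], [])))"
    if k: "k = length (takeWhile id y)" and z: "z = tl (dropWhile id y)" for y k z
  proof -
    let ?n = "length y"
    let ?s1 = "(ini y)(0 := z, 4 := replicate k True)"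
    let ?s2 = "?s1(0 := snd (dec_bits z), 1 := rev (fst (dec_bits z)))"
    let ?a = "([], rev (snd (dec_bits z)), [], [])"
    let ?s3 = "conc k ?a (rev (fst (dec_bits z)))"
    have "length (takeWhile id y) + length (dropWhile id y) = length y"
      by (metis length_append takeWhile_dropWhile_id)
    then have lz: "k + length z \<le> ?n" by (simp add: k z)
    have 1: "dev (parse_nat 4 6) (ini y) (6 * ?n + 9) ?s1"
      using dev_parse_nat[of 4 6 "ini y" "6 * ?n + 9"] by (simp add: ini_def k z)
    have 2: "dev (parse_bits 1 6) ?s1 (9 * ?n + 11) ?s2"
      using dev_parse_bits[of 1 6 ?s1 "9 * ?n + 11"] lz by (simp add: ini_def)
    have "?s2(0 := [], 2 := rev (snd (dec_bits z))) = ?s3"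
      by (auto simp: ini_def fun_eq_iff)
    then have 3: "dev (drain 0 (\<lambda>b. [(2, b)])) ?s2 (12 * ?n + 1) ?s3"
      using dev_move[of 2 0 ?s2 "12 * ?n + 1"] lz dec_bits_length[of z] by (simp add: ini_def)
    have "k + isize ?a + length (rev (fst (dec_bits z))) \<le> ?n"
      using lz dec_bits_length[of z] by simp
    from evl_mono[OF T(3) monoD[OF T(2) this]]
    have 4: "ev (interp ops) ?s3 (T ?n) (map_pmf (\<lambda>a. conc k a [])
      (run_ops k ops (decode (length ops) 0 (rev (fst (dec_bits z)))) ?a))" .
    from dev_Seq[OF 1 dev_Seq[OF 2 dev_Seq[OF 3 4 order_refl] order_refl] order_refl]
    show ?thesis unfolding interp_prog_def by (rule evl_mono) (simp add: U_def)
  qed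
  have "polyb U" unfolding U_def using T(1) by (intro polyb_add polyb_mult) auto
  then show "ppt (interp_prog ops)" using main by (intro pptI) blast+
  have "exec (interp_prog ops) (enc_nat \<kappa> @ enc_bits scr @ x) = map_pmf (\<lambda>s. s 0) (map_pmf (\<lambda>a. conc \<kappa> a [])
      (run_ops \<kappa> ops (decode (length ops) 0 (rev (fst (dec_bits (enc_bits scr @ x)))))
        ([], rev (snd (dec_bits (enc_bits scr @ x))), [], [])))"
    by (rule exec_ev[OF main]) simp_all
  also have "\<dots> = map_pmf fst (run_ops \<kappa> ops (decode (length ops) 0 (rev scr)) ([], rev x, [], []))"
    unfolding map_pmf_comp dec_enc_bits fst_conv snd_conv
    by (intro map_pmf_cong refl) auto
  finally show "exec (interp_prog ops) (enc_nat \<kappa> @ enc_bits scr @ x) =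
      map_pmf fst (run_ops \<kappa> ops (decode (length ops) 0 (rev scr)) ([], rev x, [], []))" .
qed


section \<open>Comparison with a fixed word, and splicing a transcript into a stored context\<close>

fun test :: "bool list \<Rightarrow> com \<Rightarrow> com \<Rightarrow> com" where
  "test [] c d = Cond 0 d d c"
| "test (b # bs) c d = (if b then Cond 0 (Seq (Pop 0) (test bs c d)) d d
                              else Cond 0 d (Seq (Pop 0) (test bs c d)) d)"

lemma ev_test_eq:
  "s 0 = ys \<Longrightarrow> ev c (s(0 := [])) n P \<Longrightarrow> n + 3 * length ys + 1 \<le> m \<Longrightarrow> ev (test ys c d) s m P"
proof (induction ys arbitrary: s m)
  case Nil
  then have "s(0 := []) = s" by (auto simp: fun_eq_iff)
  with Nil have "ev (case s 0 of [] \<Rightarrow> c | b # _ \<Rightarrow> if b then d else d) s n P" by simp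
  then show ?case unfolding test.simps by (rule ev_Cond) (use Nil in simp)
next
  case (Cons b ys)
  have "ev (test ys c d) (s(0 := ys)) (n + 3 * length ys + 1) P"
    using Cons.prems by (intro Cons.IH) (simp_all del: fun_upd_apply add: fun_upd_same)
  from dev_Seq[OF ev_Pop[of 1 0 s] _ order_refl, of "test ys c d"] this Cons.prems(1)
  have *: "ev (Seq (Pop 0) (test ys c d)) s (n + 3 * length ys + 3) P"
    by (simp add: eval_nat_numeral)
  show ?case
  proof (cases b)
    case True
    then have "ev (Cond 0 (Seq (Pop 0) (test ys c d)) d d) s m P"
      using * Cons.prems by (intro ev_Cond[of _ _ _ _ _ "n + 3 * length ys + 3"]) auto
    then show ?thesis using True by simp
  next
    case False
    then have "ev (Cond 0 d (Seq (Pop 0) (test ys c d)) d) s m P"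
      using * Cons.prems by (intro ev_Cond[of _ _ _ _ _ "n + 3 * length ys + 3"]) auto
    then show ?thesis using False by simp
  qed
qed

lemma ev_test_neq:
  "s 0 \<noteq> ys \<Longrightarrow> 5 * length (s 0) + 5 \<le> m \<Longrightarrow> dev (test ys c (While 0 (Pop 0))) s m (s(0 := []))"
proof (induction ys arbitrary: s m)
  let ?d = "While 0 (Pop 0)"
  have d: "dev ?d s (2 * length (s 0) + 1) (s(0 := []))" for s by (rule dev_clear) simp
  {
    case Nil
    then have "dev (case s 0 of [] \<Rightarrow> c | b # _ \<Rightarrow> if b then ?d else ?d) s (2 * length (s 0) + 1) (s(0 := []))"
      using d[of s] by (auto split: list.splits)
    then show ?case unfolding test.simps by (rule ev_Cond) (use Nil in simp)
  next
    case (Cons b ys)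
    show ?case
    proof (cases "\<exists>xs. s 0 = b # xs")
      case True
      then obtain xs where xs: "s 0 = b # xs" by blast
      have "dev (test ys c ?d) (s(0 := xs)) (5 * length xs + 5) (s(0 := []))"
        using Cons.IH[of "s(0 := xs)" "5 * length xs + 5"] Cons.prems xs by (simp del: fun_upd_apply add: fun_upd_same)
      from dev_Seq[OF ev_Pop[of 1 0 s] _ order_refl, of "test ys c ?d"] this xs
      have *: "dev (Seq (Pop 0) (test ys c ?d)) s (5 * length xs + 7) (s(0 := []))"
        by (simp add: eval_nat_numeral)
      show ?thesis
      proof (cases b)
        case True
        then have "dev (Cond 0 (Seq (Pop 0) (test ys c ?d)) ?d ?d) s m (s(0 := []))"
          using * Cons.prems xs by (intro ev_Cond[of _ _ _ _ _ "5 * length xs + 7"]) auto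
        then show ?thesis using True by (simp del: fun_upd_apply)
      next
        case False
        then have "dev (Cond 0 ?d (Seq (Pop 0) (test ys c ?d)) ?d) s m (s(0 := []))"
          using * Cons.prems xs by (intro ev_Cond[of _ _ _ _ _ "5 * length xs + 7"]) auto
        then show ?thesis using False by (simp del: fun_upd_apply)
      qed
    next
      case False
      let ?e = "Seq (Pop 0) (test ys c ?d)"
      have "dev (case s 0 of [] \<Rightarrow> ?d | b' # _ \<Rightarrow> if b' then (if b then ?e else ?d) else (if b then ?d else ?e)) s
         (2 * length (s 0) + 1) (s(0 := []))"
        using d[of s] False by (auto split: list.splits)
      then have "dev (Cond 0 (if b then ?e else ?d) (if b then ?d else ?e) ?d) s m (s(0 := []))"
        by (rule ev_Cond) (use Cons.prems in simp)
      then show ?thesis by (cases b) (simp_all del: fun_upd_apply)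
    qed
  }
qed

definition splice_ops :: "op list" where
  "splice_ops = [LitOp False, LitOp True, EmitOp]"

text \<open>The distinguisher of the hybrid argument: the prefix and suffix of the string handed to
  the original adversary are stored, as a script, in the advice.\<close>

definition splice_prog :: "com \<Rightarrow> bool list \<Rightarrow> com" where
  "splice_prog A y = Seq (parse_nat 4 6) (Seq (parse_bits 1 6) (Seq (parse_bits 2 6)
     (test y (Seq (interp splice_ops) (Seq (Push 0 False) (Seq (drain 4 (\<lambda>b. [(0, b)]))
        (Seq (clears [2, 3, 7]) A)))) (While 0 (Pop 0)))))"

text \<open>The suffix comes first because the output is built from its end. The number 2 is that of
  \<open>EmitOp\<close>, which inserts the transcript.\<close>

definition splice_script :: "bool list \<Rightarrow> bool list \<Rightarrow> nat list" where
  "splice_script p r = map of_bool (rev r) @ [2] @ map of_bool (rev p)"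

lemma run_ops_append: "run_ops \<kappa> ops (xs @ ys) a = bind_pmf (run_ops \<kappa> ops xs a) (run_ops \<kappa> ops ys)"
proof (induction xs arbitrary: a)
  case (Cons x xs)
  show ?case by (simp add: Cons.IH[abs_def] bind_assoc_pmf)
qed (simp add: bind_return_pmf)

lemma run_ops_splice_lits:
  "run_ops \<kappa> splice_ops (map of_bool (rev p)) (out, own, sav, arg) = return_pmf (p @ out, own, sav, arg)"
proof (induction p arbitrary: out)
  case (Cons b p)
  then show ?case by (cases b) (auto simp: run_ops_append bind_return_pmf splice_ops_def)
qed simp

lemma run_ops_splice_script:
  "run_ops \<kappa> splice_ops (splice_script p r) ([], own, [], []) =
     return_pmf (p @ enc_bits (rev own) @ r, [], [], [])"
  by (simp add: splice_script_def run_ops_append run_ops_splice_lits bind_return_pmf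
      splice_ops_def[THEN arg_cong[of _ _ "\<lambda>l. l ! 2"]])

text \<open>The word \<open>y\<close> is compiled into the program, which is affordable because it
  does not depend on \<open>\<kappa>\<close>; the context \<open>p\<close>, \<open>r\<close> does,
  and arrives as a script. For any other output the run rejects, since its output differs from
  \<open>[True]\<close>.\<close>

lemma splice_prog:
  assumes "ppt A"
  shows "ppt (splice_prog A y)"
    and "exec (splice_prog A y) (enc_nat \<kappa> @ enc_bits (rev (unary (splice_script p r))) @ enc_bits v @ w) =
      (if w = y then exec A (enc_nat \<kappa> @ p @ enc_bits v @ r) else return_pmf [])"
proof -
  obtain TA PA where TA: "polyb TA" "mono TA" "\<And>x. ev A (ini x) (TA (length x)) (PA x)"
    using pptE[OF assms] by blast
  obtain T where T: "polyb T" "mono T"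
    "\<And>\<kappa> a scr. ev (interp splice_ops) (conc \<kappa> a scr) (T (\<kappa> + isize a + length scr))
        (map_pmf (\<lambda>a. conc \<kappa> a []) (run_ops \<kappa> splice_ops (decode (length splice_ops) 0 scr) a))"
    using ev_interp[of splice_ops] by (auto simp: splice_ops_def)
  \<comment> \<open>Bounds the input of \<open>A\<close>: what the interpreter can have written,
    preceded by the security parameter in unary.\<close>
  define V where "V n = T n + 2 * n + 1" for n
  define W where "W n = 100 * n + 3 * length y + T n + 6 * V n + TA (V n) + 200" for n
  have pV: "polyb V" unfolding V_def using T(1) by (intro polyb_add polyb_mult) auto
  have pW: "polyb W" unfolding W_def using T(1) pV polyb_comp[OF TA(1) pV]
    by (intro polyb_add polyb_mult) auto
  define R where "R k z1 z2 = run_ops k splice_ops (decode (length splice_ops) 0 (rev (fst (dec_bits z1))))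
      ([], rev (fst (dec_bits z2)), [], [])" for k z1 z2
  \<comment> \<open>Again for arbitrary \<open>x\<close>, so that the same statement yields
    \<open>ppt\<close>.\<close>
  have main: "ev (splice_prog A y) (ini x) (W (length x))
      (if snd (dec_bits z2) = y
       then bind_pmf (R k z1 z2) (\<lambda>a. PA (enc_nat k @ fst a))
       else return_pmf (\<lambda>r. if r = 1 then rev (fst (dec_bits z1)) else if r = 2 then rev (fst (dec_bits z2))
          else if r = 4 then replicate k True else []))" (is "ev _ _ _ ?P")
    if k: "k = length (takeWhile id x)" and z1: "z1 = tl (dropWhile id x)" and z2: "z2 = snd (dec_bits z1)"
    for x k z1 z2
  proof -
    let ?n = "length x"
    let ?s1 = "(ini x)(0 := z1, 4 := replicate k True)"
    let ?s2 = "?s1(0 := z2, 1 := rev (fst (dec_bits z1)))"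
    let ?s3 = "?s2(0 := snd (dec_bits z2), 2 := rev (fst (dec_bits z2)))"
    let ?a = "([], rev (fst (dec_bits z2)), [], [])"
    let ?s4 = "conc k ?a (rev (fst (dec_bits z1)))"
    have "length (takeWhile id x) + length (dropWhile id x) = length x"
      by (metis length_append takeWhile_dropWhile_id)
    then have lz: "k + length z1 \<le> ?n" by (simp add: k z1)
    have l1: "length (fst (dec_bits z1)) + length z2 \<le> length z1"
      using dec_bits_length[of z1] by (simp add: z2)
    have l2: "length (fst (dec_bits z2)) + length (snd (dec_bits z2)) \<le> length z2"
      by (rule dec_bits_length)
    have 1: "dev (parse_nat 4 6) (ini x) (6 * ?n + 9) ?s1"
      using dev_parse_nat[of 4 6 "ini x" "6 * ?n + 9"] by (simp add: ini_def k z1)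
    have 2: "dev (parse_bits 1 6) ?s1 (9 * ?n + 11) ?s2"
      using dev_parse_bits[of 1 6 ?s1 "9 * ?n + 11"] lz by (simp add: ini_def z2)
    have 3: "dev (parse_bits 2 6) ?s2 (9 * ?n + 11) ?s3"
      using dev_parse_bits[of 2 6 ?s2 "9 * ?n + 11"] lz l1 by (simp add: ini_def)
    have s4: "?s3(0 := []) = ?s4" by (auto simp: ini_def fun_eq_iff)
    let ?c = "Seq (Push 0 False) (Seq (drain 4 (\<lambda>b. [(0, b)])) (Seq (clears [2, 3, 7]) A))"
    let ?m = "3 * length y + 12 * ?n + T ?n + 6 * V ?n + TA (V ?n) + 60"
    have 4: "ev (test y (Seq (interp splice_ops) ?c) (While 0 (Pop 0))) ?s3 ?m ?P"
    proof (cases "snd (dec_bits z2) = y")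
      case True
      have "k + isize ?a + length (rev (fst (dec_bits z1))) \<le> ?n" using lz l1 l2 by simp
      from evl_mono[OF T(3) monoD[OF T(2) this]]
      have i: "ev (interp splice_ops) ?s4 (T ?n) (map_pmf (\<lambda>a. conc k a []) (R k z1 z2))"
        by (simp add: R_def)
      have c: "ev ?c s' (12 * ?n + 6 * V ?n + TA (V ?n) + 30) (PA (enc_nat k @ s' 0))"
        if s': "s' \<in> set_pmf (map_pmf (\<lambda>a. conc k a []) (R k z1 z2))" for s'
      proof -
        obtain out own sav arg where s'eq: "s' = conc k (out, own, sav, arg) []"
          using s' by (auto simp del: conc.simps)
        have l: "length (s' r) \<le> T ?n + ?n" for r
          using ev_length[OF i s', of r] lz l1 l2 by (auto simp: split: if_splits)
        let ?t1 = "s'(0 := False # out)"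
        let ?t2 = "?t1(4 := [], 0 := enc_nat k @ out)"
        have t1: "dev (Push 0 False) s' 1 ?t1" using ev_Push[of 1 0 False s'] by (simp add: s'eq)
        have t2: "dev (drain 4 (\<lambda>b. [(0, b)])) ?t1 (12 * ?n + 1) ?t2"
          using dev_move[of 0 4 ?t1 "12 * ?n + 1"] lz by (simp add: s'eq enc_nat_def)
        have "dev (clears [2, 3, 7]) ?t2 ((2 * (T ?n + ?n) + 5) * 3 + 3)
           (\<lambda>r. if r \<in> set [2, 3, 7] then [] else ?t2 r)"
          using l by (intro dev_clears[of _ _ "T ?n + ?n"]) auto
        moreover have "(\<lambda>r. if r \<in> set [2, 3, 7] then [] else ?t2 r) = ini (enc_nat k @ out)"
          by (auto simp: s'eq ini_def fun_eq_iff)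
        ultimately have t3: "dev (clears [2, 3, 7]) ?t2 ((2 * (T ?n + ?n) + 5) * 3 + 3) (ini (enc_nat k @ out))"
          by simp
        have "length (out) \<le> T ?n + ?n" using l[of 0] by (simp add: s'eq)
        then have "length (enc_nat k @ out) \<le> V ?n"
          using lz by (simp add: enc_nat_def V_def)
        from evl_mono[OF TA(3) monoD[OF TA(2) this]]
        have t4: "ev A (ini (enc_nat k @ out)) (TA (V ?n)) (PA (enc_nat k @ out))" .
        from dev_Seq[OF t1 dev_Seq[OF t2 dev_Seq[OF t3 t4 order_refl] order_refl] order_refl]
        have "ev ?c s' (12 * ?n + 6 * V ?n + TA (V ?n) + 30) (PA (enc_nat k @ out))"
          by (rule evl_mono) (simp add: V_def)
        then show ?thesis by (simp add: s'eq)
      qed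
      have "bind_pmf (map_pmf (\<lambda>a. conc k a []) (R k z1 z2)) (\<lambda>s'. PA (enc_nat k @ s' 0)) = ?P"
        using True unfolding bind_map_pmf by (auto intro!: bind_pmf_cong)
      with ev_Seq[OF i c order_refl]
      have "ev (Seq (interp splice_ops) ?c) ?s4 (Suc (T ?n + (12 * ?n + 6 * V ?n + TA (V ?n) + 30))) ?P"
        by simp
      then show ?thesis
        using True unfolding s4[symmetric] by (intro ev_test_eq[where n = "Suc (T ?n + (12 * ?n + 6 * V ?n + TA (V ?n) + 30))"]) (simp_all del: fun_upd_apply add: fun_upd_same fun_upd_other)
    next
      case False
      have "?s3(0 := []) = (\<lambda>r. if r = 1 then rev (fst (dec_bits z1)) else if r = 2 then rev (fst (dec_bits z2))
          else if r = 4 then replicate k True else [])"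
        by (auto simp: ini_def fun_eq_iff)
      moreover have "dev (test y (Seq (interp splice_ops) ?c) (While 0 (Pop 0))) ?s3 ?m (?s3(0 := []))"
        using False lz l1 l2 by (intro ev_test_neq) auto
      ultimately show ?thesis using False by simp
    qed
    from dev_Seq[OF 1 dev_Seq[OF 2 dev_Seq[OF 3 4 order_refl] order_refl] order_refl]
    show ?thesis unfolding splice_prog_def by (rule evl_mono) (simp add: W_def)
  qed
  show "ppt (splice_prog A y)" using main by (intro pptI[OF pW]) blast
  show "exec (splice_prog A y) (enc_nat \<kappa> @ enc_bits (rev (unary (splice_script p r))) @ enc_bits v @ w) =
      (if w = y then exec A (enc_nat \<kappa> @ p @ enc_bits v @ r) else return_pmf [])"
  proof -
    let ?scr = "rev (unary (splice_script p r))"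
    let ?x = "enc_nat \<kappa> @ enc_bits ?scr @ enc_bits v @ w"
    have "\<forall>i \<in> set (splice_script p r). i < length splice_ops"
      by (auto simp: splice_script_def splice_ops_def)
    then have R: "R \<kappa> (enc_bits ?scr @ enc_bits v @ w) (enc_bits v @ w) = return_pmf (p @ enc_bits v @ r, [], [], [])"
      by (simp add: R_def decode_unary run_ops_splice_script)
    have "exec (splice_prog A y) ?x = map_pmf (\<lambda>s. s 0) (if snd (dec_bits (enc_bits v @ w)) = y
       then bind_pmf (R \<kappa> (enc_bits ?scr @ enc_bits v @ w) (enc_bits v @ w)) (\<lambda>a. PA (enc_nat \<kappa> @ fst a))
       else return_pmf (\<lambda>r. if r = 1 then rev (fst (dec_bits (enc_bits ?scr @ enc_bits v @ w)))
          else if r = 2 then rev (fst (dec_bits (enc_bits v @ w)))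
          else if r = 4 then replicate \<kappa> True else []))"
      by (rule exec_ev[OF main]) simp_all
    then show ?thesis
      unfolding R bind_return_pmf dec_enc_bits fst_conv snd_conv
      using exec_ev[OF TA(3)[of "enc_nat \<kappa> @ p @ enc_bits v @ r"]] by simp
  qed
qed


section \<open>Expectations and negligible functions\<close>

abbreviation E :: "'a pmf \<Rightarrow> ('a \<Rightarrow> real) \<Rightarrow> real" where
  "E p g \<equiv> measure_pmf.expectation p g"

definition unit_fun :: "('a \<Rightarrow> real) \<Rightarrow> bool" where
  "unit_fun g \<longleftrightarrow> (\<forall>x. 0 \<le> g x \<and> g x \<le> 1)"

lemma integrable_bounded_pmf: "(\<And>x. \<bar>g x\<bar> \<le> (B::real)) \<Longrightarrow> integrable (measure_pmf p) g"
  by (rule measure_pmf.integrable_const_bound[where B = B]) auto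

lemma unit_fun_integrable: "unit_fun g \<Longrightarrow> integrable (measure_pmf p) g"
  by (rule integrable_bounded_pmf[of _ 1]) (metis unit_fun_def abs_of_nonneg)

lemma E_unit: "unit_fun g \<Longrightarrow> 0 \<le> E p g \<and> E p g \<le> 1"
proof
  assume u: "unit_fun g"
  then show "0 \<le> E p g" by (intro integral_nonneg_AE) (auto simp: unit_fun_def)
  have "E p g \<le> E p (\<lambda>_. 1)"
    using u by (intro integral_mono unit_fun_integrable) (auto simp: unit_fun_def)
  then show "E p g \<le> 1" by simp
qed

lemma unit_fun_E: "(\<And>x. unit_fun (g x)) \<Longrightarrow> unit_fun (\<lambda>x. E (p x) (g x))"
  using E_unit by (auto simp: unit_fun_def[of "\<lambda>x. E (p x) (g x)"])

text \<open>Averaging a test is tossing a coin with its value as bias. The monad laws for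
  \<open>pmf\<close> then give \<open>E_bind\<close> and \<open>E_swap\<close>.\<close>

lemma E_eq_pmf: "unit_fun g \<Longrightarrow> E p g = pmf (bind_pmf p (\<lambda>x. bernoulli_pmf (g x))) True"
  by (simp add: pmf_bind unit_fun_def)

lemma E_bind:
  assumes "unit_fun g" shows "E (bind_pmf p f) g = E p (\<lambda>x. E (f x) g)"
proof -
  have "E (bind_pmf p f) g = pmf (bind_pmf p (\<lambda>x. bind_pmf (f x) (\<lambda>x. bernoulli_pmf (g x)))) True"
    by (simp add: E_eq_pmf[OF assms] bind_assoc_pmf)
  also have "\<dots> = E p (\<lambda>x. E (f x) g)"
    by (simp add: pmf_bind[of p] E_eq_pmf[OF assms])
  finally show ?thesis .
qed

lemma E_return [simp]: "E (return_pmf x) g = g x"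
  by (simp add: return_pmf.rep_eq integral_return)

lemma E_map [simp]: "E (map_pmf f p) g = E p (\<lambda>x. g (f x))"
  by (rule integral_map_pmf)

lemma E_swap:
  assumes "\<And>x. unit_fun (g x)"
  shows "E p (\<lambda>x. E q (g x)) = E q (\<lambda>y. E p (\<lambda>x. g x y))"
proof -
  have u: "unit_fun (\<lambda>x. g x y)" for y using assms by (simp add: unit_fun_def)
  have "E p (\<lambda>x. E q (g x)) = pmf (bind_pmf p (\<lambda>x. bind_pmf q (\<lambda>y. bernoulli_pmf (g x y)))) True"
    by (simp add: pmf_bind[of p] E_eq_pmf[OF assms])
  also have "\<dots> = pmf (bind_pmf q (\<lambda>y. bind_pmf p (\<lambda>x. bernoulli_pmf (g x y)))) True"
    by (subst bind_commute_pmf) simp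
  also have "\<dots> = E q (\<lambda>y. E p (\<lambda>x. g x y))"
    by (simp add: pmf_bind[of q] E_eq_pmf[OF u])
  finally show ?thesis .
qed

lemma E_cong: "(\<And>x. x \<in> set_pmf p \<Longrightarrow> f x = g x) \<Longrightarrow> E p f = E p g"
  by (intro integral_cong_AE) (auto simp: AE_measure_pmf_iff)

lemma E_of_bool: "E p (\<lambda>x. of_bool (P x)) = measure_pmf.prob p {x. P x}"
proof -
  have "(\<lambda>x. of_bool (P x)) = (indicator {x. P x} :: _ \<Rightarrow> real)" by (auto simp: indicator_def)
  then show ?thesis by simp
qed

lemma abs_E_le: "(\<And>x. x \<in> set_pmf p \<Longrightarrow> \<bar>g x\<bar> \<le> B) \<Longrightarrow> \<bar>E p g\<bar> \<le> B"
proof -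
  assume b: "\<And>x. x \<in> set_pmf p \<Longrightarrow> \<bar>g x\<bar> \<le> B"
  have i: "integrable (measure_pmf p) g"
    using b by (intro measure_pmf.integrable_const_bound[where B = B]) (auto simp: AE_measure_pmf_iff)
  have "\<bar>E p g\<bar> \<le> E p (\<lambda>x. \<bar>g x\<bar>)" by (rule integral_abs_bound)
  also have "\<dots> \<le> E p (\<lambda>_. B)"
    using b i by (intro integral_mono_AE) (auto simp: AE_measure_pmf_iff)
  finally show ?thesis by simp
qed

lemma E_diff_le:
  assumes "unit_fun f" "unit_fun g" "\<And>x. x \<in> set_pmf p \<Longrightarrow> \<bar>f x - g x\<bar> \<le> B"
  shows "\<bar>E p f - E p g\<bar> \<le> B"
proof -
  have "E p f - E p g = E p (\<lambda>x. f x - g x)"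
    using assms by (simp add: unit_fun_integrable)
  then show ?thesis using abs_E_le[OF assms(3)] by simp
qed

text \<open>Two tests differ by at most 1 anywhere, so the bad event costs only its probability. It
  covers the case that a real computation leaves the finite set of states.\<close>

lemma E_diff_le_bad:
  assumes "unit_fun f" "unit_fun g" "\<And>x. x \<in> set_pmf p \<Longrightarrow> \<not> bad x \<Longrightarrow> \<bar>f x - g x\<bar> \<le> B" "B \<ge> 0"
  shows "\<bar>E p f - E p g\<bar> \<le> B + measure_pmf.prob p {x. bad x}"
proof -
  have i: "integrable (measure_pmf p) (\<lambda>x. of_bool (bad x) :: real)"
    by (rule integrable_bounded_pmf[of _ 1]) auto
  have "\<bar>E p f - E p g\<bar> = \<bar>E p (\<lambda>x. f x - g x)\<bar>"
    using assms by (simp add: unit_fun_integrable)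
  also have "\<dots> \<le> E p (\<lambda>x. \<bar>f x - g x\<bar>)" by (rule integral_abs_bound)
  also have "\<dots> \<le> E p (\<lambda>x. B + of_bool (bad x))"
  proof (rule integral_mono_AE)
    show "integrable (measure_pmf p) (\<lambda>x. \<bar>f x - g x\<bar>)"
      using assms(1,2) by (intro integrable_abs Bochner_Integration.integrable_diff unit_fun_integrable)
    show "integrable (measure_pmf p) (\<lambda>x. B + of_bool (bad x))" using i by simp
    have "\<bar>f x - g x\<bar> \<le> 1" for x using assms(1,2) unfolding unit_fun_def abs_le_iff
      by (smt (verit))
    then have "\<bar>f x - g x\<bar> \<le> B + of_bool (bad x)" if "x \<in> set_pmf p" for x
      using assms(3)[OF that] assms(4) by (cases "bad x") (auto intro: order_trans[of _ 1])
    then show "AE x in measure_pmf p. \<bar>f x - g x\<bar> \<le> B + of_bool (bad x)"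
      by (simp add: AE_measure_pmf_iff)
  qed
  also have "\<dots> = B + measure_pmf.prob p {x. bad x}"
    using i by (simp add: E_of_bool)
  finally show ?thesis .
qed

section \<open>Closure properties of negligible functions\<close>

lemma negligible_mono: "negligible \<nu> \<Longrightarrow> (\<And>\<kappa>. \<bar>\<mu> \<kappa>\<bar> \<le> \<bar>\<nu> \<kappa>\<bar>) \<Longrightarrow> negligible \<mu>"
  unfolding negligible_def
proof
  fix c
  assume "\<forall>c. \<forall>\<^sub>F \<kappa> in sequentially. \<bar>\<nu> \<kappa>\<bar> < 1 / real \<kappa> ^ c" and le: "\<And>\<kappa>. \<bar>\<mu> \<kappa>\<bar> \<le> \<bar>\<nu> \<kappa>\<bar>"
  then have "\<forall>\<^sub>F \<kappa> in sequentially. \<bar>\<nu> \<kappa>\<bar> < 1 / real \<kappa> ^ c" by blast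
  then show "\<forall>\<^sub>F \<kappa> in sequentially. \<bar>\<mu> \<kappa>\<bar> < 1 / real \<kappa> ^ c"
    by (rule eventually_mono) (rule le_less_trans[OF le])
qed

lemma negligible_zero [simp]: "negligible (\<lambda>_. 0)"
  unfolding negligible_def by (auto intro!: eventually_mono[OF eventually_gt_at_top[of 0]])

lemma negligible_add [intro]:
  assumes "negligible \<mu>" "negligible \<nu>" shows "negligible (\<lambda>\<kappa>. \<mu> \<kappa> + \<nu> \<kappa>)"
  unfolding negligible_def
proof
  fix c
  have "\<forall>\<^sub>F \<kappa> in sequentially. \<bar>\<mu> \<kappa>\<bar> < 1 / real \<kappa> ^ Suc c \<and> \<bar>\<nu> \<kappa>\<bar> < 1 / real \<kappa> ^ Suc c \<and> \<kappa> \<ge> 2"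
    using assms unfolding negligible_def by (intro eventually_conj eventually_ge_at_top) blast+
  then show "\<forall>\<^sub>F \<kappa> in sequentially. \<bar>\<mu> \<kappa> + \<nu> \<kappa>\<bar> < 1 / real \<kappa> ^ c"
  proof (rule eventually_mono)
    fix \<kappa> :: nat
    assume a: "\<bar>\<mu> \<kappa>\<bar> < 1 / real \<kappa> ^ Suc c \<and> \<bar>\<nu> \<kappa>\<bar> < 1 / real \<kappa> ^ Suc c \<and> \<kappa> \<ge> 2"
    \<comment> \<open>One more power of \<open>\<kappa>\<close> pays for the factor 2, once
      \<open>\<kappa> \<ge> 2\<close>.\<close>
    then have "1 / real \<kappa> ^ Suc c \<le> 1 / (2 * real \<kappa> ^ c)"
      by (intro divide_left_mono mult_pos_pos) auto
    then have "1 / real \<kappa> ^ Suc c \<le> (1 / real \<kappa> ^ c) / 2" by simp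
    moreover have "\<bar>m + n\<bar> < b" if "\<bar>m\<bar> < d" "\<bar>n\<bar> < d" "d \<le> b / 2" for m n b d :: real
      using that by linarith
    ultimately show "\<bar>\<mu> \<kappa> + \<nu> \<kappa>\<bar> < 1 / real \<kappa> ^ c" using a by blast
  qed
qed

lemma negligible_sum:
  "finite S \<Longrightarrow> (\<And>s. s \<in> S \<Longrightarrow> negligible (\<mu> s)) \<Longrightarrow> negligible (\<lambda>\<kappa>. \<Sum>s\<in>S. \<mu> s \<kappa>)"
  by (induction S rule: finite_induct) auto

lemma negligible_abs: "negligible \<mu> \<Longrightarrow> negligible (\<lambda>\<kappa>. \<bar>\<mu> \<kappa>\<bar>)"
  by (simp add: negligible_def)

text \<open>The sum of the absolute values dominates each of finitely many bounds; \<open>Q\<close>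
  need only be closed under enlarging the bound.\<close>

lemma negligible_finite_uniform:
  assumes "finite S" "\<And>s. s \<in> S \<Longrightarrow> \<exists>\<mu>. negligible \<mu> \<and> (\<forall>\<kappa>. Q s \<kappa> (\<mu> \<kappa>))"
    and mono: "\<And>s \<kappa> a b. Q s \<kappa> a \<Longrightarrow> a \<le> b \<Longrightarrow> Q s \<kappa> (b::real)"
  shows "\<exists>\<mu>. negligible \<mu> \<and> (\<forall>\<kappa>. 0 \<le> \<mu> \<kappa>) \<and> (\<forall>s\<in>S. \<forall>\<kappa>. Q s \<kappa> (\<mu> \<kappa>))"
proof -
  obtain \<mu> where \<mu>: "\<And>s. s \<in> S \<Longrightarrow> negligible (\<mu> s)" "\<And>s \<kappa>. s \<in> S \<Longrightarrow> Q s \<kappa> (\<mu> s \<kappa>)"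
    using assms(2) by metis
  let ?m = "\<lambda>\<kappa>. \<Sum>s\<in>S. \<bar>\<mu> s \<kappa>\<bar>"
  have "negligible ?m" using assms(1) \<mu>(1) by (intro negligible_sum negligible_abs)
  moreover have "Q s \<kappa> (?m \<kappa>)" if "s \<in> S" for s \<kappa>
  proof (rule mono[OF \<mu>(2)[OF that]])
    have "\<bar>\<mu> s \<kappa>\<bar> \<le> ?m \<kappa>" using that assms(1) by (intro member_le_sum) auto
    then show "\<mu> s \<kappa> \<le> ?m \<kappa>" by linarith
  qed
  ultimately show ?thesis by (intro exI[of _ ?m]) (auto intro: sum_nonneg)
qed

text \<open>A bound that is negligible along every choice function is negligible uniformly: choose a
  point that attains half of the supremum.\<close>

lemma negligible_uniform:
  fixes g :: "nat \<Rightarrow> 'a \<Rightarrow> real"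
  assumes bd: "\<And>\<kappa> x. \<bar>g \<kappa> x\<bar> \<le> K"
    and ne: "\<And>\<kappa>. \<exists>x. P \<kappa> x"
    and neg: "\<And>f. (\<And>\<kappa>. P \<kappa> (f \<kappa>)) \<Longrightarrow> negligible (\<lambda>\<kappa>. g \<kappa> (f \<kappa>))"
  shows "\<exists>\<mu>. negligible \<mu> \<and> (\<forall>\<kappa> x. P \<kappa> x \<longrightarrow> \<bar>g \<kappa> x\<bar> \<le> \<mu> \<kappa>)"
proof -
  define \<mu> where "\<mu> \<kappa> = (SUP x\<in>{x. P \<kappa> x}. \<bar>g \<kappa> x\<bar>)" for \<kappa>
  have bdd: "bdd_above ((\<lambda>x. \<bar>g \<kappa> x\<bar>) ` {x. P \<kappa> x})" for \<kappa>
    using bd by (intro bdd_aboveI[of _ K]) auto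
  have up: "\<bar>g \<kappa> x\<bar> \<le> \<mu> \<kappa>" if "P \<kappa> x" for \<kappa> x
    unfolding \<mu>_def using that by (intro cSUP_upper bdd) auto
  have "\<exists>x. P \<kappa> x \<and> \<mu> \<kappa> \<le> 2 * \<bar>g \<kappa> x\<bar>" for \<kappa>
  proof (cases "\<mu> \<kappa> > 0")
    case True
    then have "\<mu> \<kappa> / 2 < \<mu> \<kappa>" by simp
    then obtain x where "P \<kappa> x" "\<mu> \<kappa> / 2 < \<bar>g \<kappa> x\<bar>"
      unfolding \<mu>_def using ne[of \<kappa>] by (subst (asm) less_cSUP_iff[OF _ bdd]) auto
    then show ?thesis by (intro exI[of _ x]) auto
  next
    case False
    then show ?thesis using ne[of \<kappa>] by (metis abs_ge_zero linorder_not_less mult_nonneg_nonneg order_trans zero_le_numeral)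
  qed
  then obtain f where f: "\<And>\<kappa>. P \<kappa> (f \<kappa>)" "\<And>\<kappa>. \<mu> \<kappa> \<le> 2 * \<bar>g \<kappa> (f \<kappa>)\<bar>" by metis
  have "negligible (\<lambda>\<kappa>. \<bar>g \<kappa> (f \<kappa>)\<bar> + \<bar>g \<kappa> (f \<kappa>)\<bar>)"
    using neg[OF f(1)] by (intro negligible_add negligible_abs)
  then have "negligible \<mu>"
  proof (rule negligible_mono)
    fix \<kappa>
    have "0 \<le> \<mu> \<kappa>" using up[OF f(1)[of \<kappa>]] by linarith
    then show "\<bar>\<mu> \<kappa>\<bar> \<le> \<bar>\<bar>g \<kappa> (f \<kappa>)\<bar> + \<bar>g \<kappa> (f \<kappa>)\<bar>\<bar>" using f(2)[of \<kappa>] by linarith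
  qed
  then show ?thesis using up by blast
qed


section \<open>Distinguishers for a single two-party computation\<close>

definition acc :: "com \<times> (nat \<Rightarrow> bool list) \<Rightarrow> nat \<Rightarrow> bool list \<Rightarrow> real" where
  "acc A \<kappa> x = pmf (exec (fst A) (enc_nat \<kappa> @ enc_bits (snd A \<kappa>) @ x)) [True]"

lemma unit_acc: "unit_fun (\<lambda>x. acc A \<kappa> (f x))"
  by (simp add: unit_fun_def acc_def pmf_le_1)

lemma prob_one_E: "prob_one A \<kappa> V = E V (acc A \<kappa>)"
  by (simp add: prob_one_def pmf_bind acc_def[abs_def])

lemma poly_advice_iff: "poly_advice a \<longleftrightarrow> polyb (\<lambda>\<kappa>. length (a \<kappa>))"
  by (simp add: poly_advice_def polyb_def)

lemma length_enc_bits [simp]: "length (enc_bits x) = 2 * length x + 1"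
  by (induction x) auto

lemma length_unary_splice: "length (unary (splice_script p r)) \<le> 2 * (length p + length r) + 3"
proof -
  have "length (unary (map of_bool xs)) \<le> 2 * length xs" for xs :: "bool list"
    by (induction xs) (auto simp: unary_def)
  from this[of "rev p"] this[of "rev r"] show ?thesis
    by (simp add: unary_def splice_script_def)
qed

text \<open>Non-uniformity enters here: \<open>p\<close> and \<open>r\<close> may depend on
  \<open>\<kappa>\<close> in any way, as long as they are polynomially long. In unary a bit of them
  takes at most two script bits, so the advice stays polynomial.\<close>

lemma splice_adversary:
  assumes "adversary A" "polyb L" "\<And>\<kappa>. length (p \<kappa>) + length (r \<kappa>) \<le> L \<kappa>"
  obtains D where "adversary D"
    "\<And>\<kappa> v w. acc D \<kappa> (enc_bits v @ w) = of_bool (w = y) * acc A \<kappa> (p \<kappa> @ enc_bits v @ r \<kappa>)"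
proof
  let ?D = "(splice_prog (fst A) y, \<lambda>\<kappa>. rev (unary (splice_script (enc_bits (snd A \<kappa>) @ p \<kappa>) (r \<kappa>))))"
  have A: "ppt (fst A)" "polyb (\<lambda>\<kappa>. length (snd A \<kappa>))"
    using assms(1) by (auto simp: adversary_def poly_advice_iff)
  have "polyb (\<lambda>\<kappa>. 2 * (2 * length (snd A \<kappa>) + 1 + L \<kappa>) + 3)"
    using A(2) assms(2) by (intro polyb_add polyb_mult) auto
  then have "polyb (\<lambda>\<kappa>. length (snd ?D \<kappa>))"
  proof (rule polyb_mono)
    fix \<kappa>
    show "length (snd ?D \<kappa>) \<le> 2 * (2 * length (snd A \<kappa>) + 1 + L \<kappa>) + 3"
      using length_unary_splice[of "enc_bits (snd A \<kappa>) @ p \<kappa>" "r \<kappa>"] assms(3)[of \<kappa>] by simp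
  qed
  then show "adversary ?D" using splice_prog(1)[OF A(1)] by (simp add: adversary_def poly_advice_iff)
  show "acc ?D \<kappa> (enc_bits v @ w) = of_bool (w = y) * acc A \<kappa> (p \<kappa> @ enc_bits v @ r \<kappa>)" for \<kappa> v w
    using splice_prog(2)[OF A(1), of y \<kappa> "enc_bits (snd A \<kappa>) @ p \<kappa>" "r \<kappa>" v w]
    by (simp add: acc_def)
qed

text \<open>Only the view of server \<open>i\<close> is simulated. It fills both places to fit the
  type \<open>two_pc\<close>; the other copy never reaches an adversary that corrupts no server but
  \<open>i\<close>.\<close>

definition ideal_2pc :: "server \<Rightarrow> ('i \<Rightarrow> bool list) \<Rightarrow> ('o \<Rightarrow> bool list) \<Rightarrow>
    ('i \<Rightarrow> 'i \<Rightarrow> ('o \<times> 'o) pmf) \<Rightarrow> com \<Rightarrow> ('i, 'o) two_pc" where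
  "ideal_2pc i enc_in enc_out f Sim \<kappa> x0 x1 = do {
     y \<leftarrow> f x0 x1;
     v \<leftarrow> exec Sim (enc_nat \<kappa> @ enc_in (pick i (x0, x1)) @ enc_out (pick i y));
     return_pmf ((v, v), y) }"

definition simulates :: "server \<Rightarrow> ('i \<Rightarrow> 'h) \<Rightarrow> ('i \<Rightarrow> bool list) \<Rightarrow> ('o \<Rightarrow> bool list) \<Rightarrow>
    ('i \<Rightarrow> 'i \<Rightarrow> ('o \<times> 'o) pmf) \<Rightarrow> ('i, 'o) two_pc \<Rightarrow> com \<Rightarrow> bool" where
  "simulates i shape enc_in enc_out f \<pi> Sim \<longleftrightarrow> ppt Sim \<and>
     (\<forall>x0 x1 A. shape x0 = shape x1 \<longrightarrow> adversary A \<longrightarrow> (\<exists>\<mu>. negligible \<mu> \<and> (\<forall>\<kappa>.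
        \<bar>E (\<pi> \<kappa> x0 x1) (\<lambda>(v, y). acc A \<kappa> (enc_bits (pick i v) @ enc_out (fst y) @ enc_out (snd y)))
         - E (ideal_2pc i enc_in enc_out f Sim \<kappa> x0 x1)
             (\<lambda>(v, y). acc A \<kappa> (enc_bits (pick i v) @ enc_out (fst y) @ enc_out (snd y)))\<bar> \<le> \<mu> \<kappa>)))"

lemma pick_same [simp]: "pick i (v, v) = v"
  by (cases i) auto

lemma secure_2pc_simulates:
  assumes "secure_2pc shape enc_in enc_out f \<pi>"
  shows "\<exists>Sim. simulates i shape enc_in enc_out f \<pi> Sim"
proof -
  have real: "prob_one A \<kappa> (do { (v, (y0, y1)) \<leftarrow> \<pi> \<kappa> x0 x1;
                        return_pmf (enc_bits (pick i v) @ enc_out y0 @ enc_out y1) }) =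
    E (\<pi> \<kappa> x0 x1) (\<lambda>(v, y). acc A \<kappa> (enc_bits (pick i v) @ enc_out (fst y) @ enc_out (snd y)))"
    for A \<kappa> x0 x1
  proof -
    have "(do { (v, (y0, y1)) \<leftarrow> \<pi> \<kappa> x0 x1; return_pmf (enc_bits (pick i v) @ enc_out y0 @ enc_out y1) }) =
      map_pmf (\<lambda>(v, y). enc_bits (pick i v) @ enc_out (fst y) @ enc_out (snd y)) (\<pi> \<kappa> x0 x1)"
      by (simp add: map_pmf_def case_prod_unfold)
    then show ?thesis by (simp add: prob_one_E case_prod_unfold)
  qed
  have ideal: "prob_one A \<kappa> (do { (y0, y1) \<leftarrow> f x0 x1;
                        v \<leftarrow> exec Sim (enc_nat \<kappa> @ enc_in (pick i (x0, x1)) @ enc_out (pick i (y0, y1)));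
                        return_pmf (enc_bits v @ enc_out y0 @ enc_out y1) }) =
    E (ideal_2pc i enc_in enc_out f Sim \<kappa> x0 x1)
             (\<lambda>(v, y). acc A \<kappa> (enc_bits (pick i v) @ enc_out (fst y) @ enc_out (snd y)))"
    for A \<kappa> x0 x1 Sim
  proof -
    have "(do { (y0, y1) \<leftarrow> f x0 x1;
                        v \<leftarrow> exec Sim (enc_nat \<kappa> @ enc_in (pick i (x0, x1)) @ enc_out (pick i (y0, y1)));
                        return_pmf (enc_bits v @ enc_out y0 @ enc_out y1) }) =
      map_pmf (\<lambda>(v, y). enc_bits (pick i v) @ enc_out (fst y) @ enc_out (snd y))
        (ideal_2pc i enc_in enc_out f Sim \<kappa> x0 x1)"
      by (simp add: ideal_2pc_def map_bind_pmf case_prod_unfold)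
    then show ?thesis by (simp add: prob_one_E case_prod_unfold)
  qed
  show ?thesis
    using conjunct2[OF assms[unfolded secure_2pc_def], rule_format, of i]
    unfolding real ideal simulates_def by blast
qed

text \<open>Splicing for an adversary that accepts everything leaves a test of the output
  alone.\<close>

lemma ppt_always_true: "ppt (Seq (While 0 (Pop 0)) (Push 0 True))"
  and exec_always_true: "exec (Seq (While 0 (Pop 0)) (Push 0 True)) x = return_pmf [True]"
proof -
  have "dev (Seq (While 0 (Pop 0)) (Push 0 True)) (ini x) (2 * length x + 3) (ini [True])" for x
    using dev_Seq[OF dev_clear[of "ini x" 0, OF order_refl] ev_Push[of 1 0 True], of "2 * length x + 3"]
    by (simp add: ini_def)
  note * = this
  show "ppt (Seq (While 0 (Pop 0)) (Push 0 True))"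
    by (rule pptI[of "\<lambda>n. 2 * n + 3"]) (use * in \<open>auto intro!: polyb_add polyb_mult\<close>)
  show "exec (Seq (While 0 (Pop 0)) (Push 0 True)) x = return_pmf [True]"
    using exec_ev[OF *[of x]] by (simp add: ini_def)
qed

text \<open>Unique decodability in front of any continuation: comparing concatenated encodings then
  compares the outputs themselves.\<close>

definition inj_enc :: "('o \<Rightarrow> bool list) \<Rightarrow> bool" where
  "inj_enc e \<longleftrightarrow> (\<forall>x y r s. e x @ r = e y @ s \<longrightarrow> x = y \<and> r = s)"

lemma inj_encD: "inj_enc e \<Longrightarrow> e x @ r = e y @ s \<longleftrightarrow> x = y \<and> r = s"
  unfolding inj_enc_def by blast

text \<open>For any choice of a context for each \<open>\<kappa>\<close>, the spliced adversary is
  covered by the security hypothesis; \<open>negligible_uniform\<close> turns this into one bound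
  for all contexts of length at most \<open>L \<kappa>\<close>.\<close>

lemma single_output_indist:
  assumes sim: "simulates i shape enc_in enc_out f \<pi> Sim" and sh: "shape x0 = shape x1"
    and A: "adversary A" and l: "polyb L" and inj: "inj_enc enc_out"
  shows "\<exists>\<mu>. negligible \<mu> \<and> (\<forall>\<kappa> x. length (fst x) + length (snd x) \<le> L \<kappa> \<longrightarrow>
     \<bar>E (\<pi> \<kappa> x0 x1) (\<lambda>(v, y'). of_bool (y' = y) * acc A \<kappa> (fst x @ enc_bits (pick i v) @ snd x))
      - E (ideal_2pc i enc_in enc_out f Sim \<kappa> x0 x1)
          (\<lambda>(v, y'). of_bool (y' = y) * acc A \<kappa> (fst x @ enc_bits (pick i v) @ snd x))\<bar> \<le> \<mu> \<kappa>)"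
proof (rule negligible_uniform[where K = 1])
  let ?h = "\<lambda>\<kappa> x (v, y'). of_bool (y' = y) * acc A \<kappa> (fst x @ enc_bits (pick i v) @ snd x)"
  have u: "unit_fun (?h \<kappa> x)" for \<kappa> x
    using unit_acc[of A \<kappa> "\<lambda>x. x"] by (auto simp: unit_fun_def)
  show "\<bar>E (\<pi> \<kappa> x0 x1) (?h \<kappa> x) - E (ideal_2pc i enc_in enc_out f Sim \<kappa> x0 x1) (?h \<kappa> x)\<bar> \<le> 1" for \<kappa> x
    using E_unit[OF u[of \<kappa> x], of "\<pi> \<kappa> x0 x1"] E_unit[OF u[of \<kappa> x], of "ideal_2pc i enc_in enc_out f Sim \<kappa> x0 x1"]
    by linarith
  show "\<exists>x::bool list \<times> bool list. length (fst x) + length (snd x) \<le> L \<kappa>" for \<kappa>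
    by (rule exI[of _ "([], [])"]) simp
  fix g :: "nat \<Rightarrow> bool list \<times> bool list"
  assume g: "\<And>\<kappa>. length (fst (g \<kappa>)) + length (snd (g \<kappa>)) \<le> L \<kappa>"
  obtain D where D: "adversary D" "\<And>\<kappa> v w. acc D \<kappa> (enc_bits v @ w) =
      of_bool (w = enc_out (fst y) @ enc_out (snd y)) * acc A \<kappa> (fst (g \<kappa>) @ enc_bits v @ snd (g \<kappa>))"
    using splice_adversary[OF A l, of "\<lambda>\<kappa>. fst (g \<kappa>)" "\<lambda>\<kappa>. snd (g \<kappa>)" "enc_out (fst y) @ enc_out (snd y)"] g by blast
  have inj': "enc_out (fst y') @ enc_out (snd y') = enc_out (fst y) @ enc_out (snd y) \<longleftrightarrow> y' = y" for y'
    using inj_encD[OF inj, of "fst y'" _ "fst y"] inj_encD[OF inj, of "snd y'" "[]" "snd y" "[]"]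
    by (auto simp: prod_eq_iff)
  obtain \<mu> where \<mu>: "negligible \<mu>" "\<And>\<kappa>. \<bar>E (\<pi> \<kappa> x0 x1) (\<lambda>(v, y). acc D \<kappa> (enc_bits (pick i v) @ enc_out (fst y) @ enc_out (snd y)))
         - E (ideal_2pc i enc_in enc_out f Sim \<kappa> x0 x1)
             (\<lambda>(v, y). acc D \<kappa> (enc_bits (pick i v) @ enc_out (fst y) @ enc_out (snd y)))\<bar> \<le> \<mu> \<kappa>"
    using sim sh D(1) unfolding simulates_def by blast
  have "negligible (\<lambda>\<kappa>. E (\<pi> \<kappa> x0 x1) (?h \<kappa> (g \<kappa>)) - E (ideal_2pc i enc_in enc_out f Sim \<kappa> x0 x1) (?h \<kappa> (g \<kappa>)))"
    using \<mu>(2) unfolding D(2) inj' by (intro negligible_mono[OF \<mu>(1)]) (meson abs_ge_self order_trans)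
  then show "negligible (\<lambda>\<kappa>. E (\<pi> \<kappa> x0 x1) (?h \<kappa> (g \<kappa>)) - E (ideal_2pc i enc_in enc_out f Sim \<kappa> x0 x1) (?h \<kappa> (g \<kappa>)))" .
qed

lemma set_ideal_2pc: "((u, v), y) \<in> set_pmf (ideal_2pc i enc_in enc_out f Sim \<kappa> x0 x1) \<Longrightarrow>
    y \<in> set_pmf (f x0 x1) \<and> u = v \<and> v \<in> set_pmf (exec Sim (enc_nat \<kappa> @ enc_in (pick i (x0, x1)) @ enc_out (pick i y)))"
  by (auto simp: ideal_2pc_def)

text \<open>In the ideal world finitely many outputs carry all the mass. The probability of each of
  them changes negligibly in the real world, which leaves negligible mass for everything
  else.\<close>

lemma bad_output_negligible:
  assumes sim: "simulates i shape enc_in enc_out f \<pi> Sim" and sh: "shape x0 = shape x1"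
    and inj: "inj_enc enc_out" and fin: "finite (set_pmf (f x0 x1))"
  shows "\<exists>\<mu>. negligible \<mu> \<and> (\<forall>\<kappa>. measure_pmf.prob (\<pi> \<kappa> x0 x1) {(v, y). y \<notin> set_pmf (f x0 x1)} \<le> \<mu> \<kappa>)"
proof -
  let ?Y = "set_pmf (f x0 x1)"
  let ?I = "\<lambda>\<kappa>. ideal_2pc i enc_in enc_out f Sim \<kappa> x0 x1"
  let ?A = "(Seq (While 0 (Pop 0)) (Push 0 True), \<lambda>_::nat. [] :: bool list)"
  have A: "adversary ?A" using ppt_always_true by (simp add: adversary_def poly_advice_iff)
  have acc1: "acc ?A \<kappa> x = 1" for \<kappa> x by (simp add: acc_def exec_always_true)
  have "\<exists>\<mu>. negligible \<mu> \<and> (\<forall>\<kappa>. \<bar>E (\<pi> \<kappa> x0 x1) (\<lambda>(v, y'). of_bool (y' = y)) - E (?I \<kappa>) (\<lambda>(v, y'). of_bool (y' = y))\<bar> \<le> \<mu> \<kappa>)" for y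
  proof -
    obtain \<mu> where "negligible \<mu>" "\<And>\<kappa> x. length (fst x) + length (snd x) \<le> 0 \<Longrightarrow>
       \<bar>E (\<pi> \<kappa> x0 x1) (\<lambda>(v, y'). of_bool (y' = y) * acc ?A \<kappa> (fst x @ enc_bits (pick i v) @ snd x))
      - E (?I \<kappa>) (\<lambda>(v, y'). of_bool (y' = y) * acc ?A \<kappa> (fst x @ enc_bits (pick i v) @ snd x))\<bar> \<le> \<mu> \<kappa>"
      using single_output_indist[OF sim sh A polyb_const[of 0] inj, of y] by blast
    from this(1) this(2)[of "([], [])"] show ?thesis by (intro exI[of _ \<mu>]) (simp add: acc1)
  qed
  then have "\<exists>\<mu>. negligible \<mu> \<and> (\<forall>\<kappa>. 0 \<le> \<mu> \<kappa>) \<and> (\<forall>y\<in>?Y. \<forall>\<kappa>.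
      \<bar>E (\<pi> \<kappa> x0 x1) (\<lambda>(v, y'). of_bool (y' = y)) - E (?I \<kappa>) (\<lambda>(v, y'). of_bool (y' = y))\<bar> \<le> \<mu> \<kappa>)"
    by (intro negligible_finite_uniform[OF fin]) auto
  then obtain \<mu> where \<mu>: "negligible \<mu>" "\<And>y \<kappa>. y \<in> ?Y \<Longrightarrow>
      \<bar>E (\<pi> \<kappa> x0 x1) (\<lambda>(v, y'). of_bool (y' = y)) - E (?I \<kappa>) (\<lambda>(v, y'). of_bool (y' = y))\<bar> \<le> \<mu> \<kappa>"
    by blast
  have sum: "E p (\<lambda>(v, y'). of_bool (y' \<in> ?Y)) = (\<Sum>y\<in>?Y. E p (\<lambda>(v, y'). of_bool (y' = y)))"
    for p :: "('v \<times> _) pmf"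
  proof -
    have "(\<lambda>(v::'v, y'). of_bool (y' \<in> ?Y)) = (\<lambda>x. \<Sum>y\<in>?Y. (case x of (v, y') \<Rightarrow> of_bool (y' = y)) :: real)"
      using fin by (auto simp: fun_eq_iff of_bool_def sum.delta)
    then show ?thesis
      by (simp only:) (intro Bochner_Integration.integral_sum integrable_bounded_pmf[of _ 1], auto)
  qed
  have "measure_pmf.prob (\<pi> \<kappa> x0 x1) {(v, y). y \<notin> ?Y} \<le> real (card ?Y) * \<mu> \<kappa>" for \<kappa>
  proof -
    have "1 = E (?I \<kappa>) (\<lambda>_. 1)" by simp
    also have "\<dots> = E (?I \<kappa>) (\<lambda>(v, y'). of_bool (y' \<in> ?Y))"
      by (rule E_cong) (use set_ideal_2pc in fastforce)
    finally have 1: "(\<Sum>y\<in>?Y. E (?I \<kappa>) (\<lambda>(v, y'). of_bool (y' = y))) = 1" by (simp add: sum)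
    have "E (\<pi> \<kappa> x0 x1) (\<lambda>(v, y'). of_bool (y' \<in> ?Y)) = measure_pmf.prob (\<pi> \<kappa> x0 x1) {(v, y). y \<in> ?Y}"
      using E_of_bool[of "\<pi> \<kappa> x0 x1" "\<lambda>(v, y'). y' \<in> ?Y"] by (simp add: case_prod_unfold)
    also have "\<dots> = 1 - measure_pmf.prob (\<pi> \<kappa> x0 x1) {(v, y). y \<notin> ?Y}"
      by (subst measure_pmf.prob_compl[symmetric]) (auto intro!: arg_cong[where f = "measure_pmf.prob _"])
    finally have "measure_pmf.prob (\<pi> \<kappa> x0 x1) {(v, y). y \<notin> ?Y} =
       (\<Sum>y\<in>?Y. E (?I \<kappa>) (\<lambda>(v, y'). of_bool (y' = y)) - E (\<pi> \<kappa> x0 x1) (\<lambda>(v, y'). of_bool (y' = y)))"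
      by (simp add: sum_subtractf 1 flip: sum)
    also have "\<dots> \<le> (\<Sum>y\<in>?Y. \<mu> \<kappa>)"
      using \<mu>(2) by (intro sum_mono) (smt (verit))
    finally show ?thesis by simp
  qed
  moreover have "negligible (\<lambda>\<kappa>. \<Sum>y\<in>?Y. \<mu> \<kappa>)" using fin \<mu>(1) by (intro negligible_sum)
  ultimately show ?thesis by (intro exI[of _ "\<lambda>\<kappa>. real (card ?Y) * \<mu> \<kappa>"]) simp
qed


lemma E_split_outputs:
  assumes "finite Y" "unit_fun h"
  shows "E p h = (\<Sum>y\<in>Y. E p (\<lambda>(v, y'). of_bool (y' = y) * h (v, y'))) + E p (\<lambda>(v, y'). of_bool (y' \<notin> Y) * h (v, y'))"
proof -
  have i: "integrable (measure_pmf p) (\<lambda>(v, y'). of_bool (Q y') * h (v, y'))" for Q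
    using assms(2) by (intro unit_fun_integrable) (auto simp: unit_fun_def)
  have eq: "h = (\<lambda>x. (\<Sum>y\<in>Y. (case x of (v, y') \<Rightarrow> of_bool (y' = y) * h (v, y'))) + (case x of (v, y') \<Rightarrow> of_bool (y' \<notin> Y) * h (v, y')))"
    using assms(1) by (auto simp: fun_eq_iff of_bool_def sum.delta sum_distrib_right[symmetric])
  show ?thesis
    by (subst eq, subst Bochner_Integration.integral_add)
       (use i in \<open>auto intro!: Bochner_Integration.integrable_sum Bochner_Integration.integral_sum\<close>)
qed

text \<open>A test on view and output of the computation is given by an arbitrary function on unexpected
  outputs, and on each expected output by a random context in which the adversary sees the view.\<close>

lemma call_indist:
  assumes sim: "simulates i shape enc_in enc_out f \<pi> Sim" and sh: "shape x0 = shape x1"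
    and A: "adversary A" and l: "polyb L" and inj: "inj_enc enc_out" and fin: "finite (set_pmf (f x0 x1))"
  shows "\<exists>\<mu>. negligible \<mu> \<and> (\<forall>\<kappa> h J. unit_fun h \<longrightarrow>
     (\<forall>y\<in>set_pmf (f x0 x1). (\<forall>x \<in> set_pmf (J y). length (fst x) + length (snd x) \<le> L \<kappa>) \<and>
        (\<forall>v. h (v, y) = E (J y) (\<lambda>x. acc A \<kappa> (fst x @ enc_bits (pick i v) @ snd x)))) \<longrightarrow>
     \<bar>E (\<pi> \<kappa> x0 x1) h - E (ideal_2pc i enc_in enc_out f Sim \<kappa> x0 x1) h\<bar> \<le> \<mu> \<kappa>)"
proof -
  let ?Y = "set_pmf (f x0 x1)"
  let ?I = "\<lambda>\<kappa>. ideal_2pc i enc_in enc_out f Sim \<kappa> x0 x1"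
  let ?g = "\<lambda>\<kappa> y x (v, y'). of_bool (y' = y) * acc A \<kappa> (fst x @ enc_bits (pick i v) @ snd x)"
  have "\<exists>\<mu>. negligible \<mu> \<and> (\<forall>\<kappa>. 0 \<le> \<mu> \<kappa>) \<and> (\<forall>y\<in>?Y. \<forall>\<kappa>. \<forall>x. length (fst x) + length (snd x) \<le> L \<kappa> \<longrightarrow>
     \<bar>E (\<pi> \<kappa> x0 x1) (?g \<kappa> y x) - E (?I \<kappa>) (?g \<kappa> y x)\<bar> \<le> \<mu> \<kappa>)"
    by (rule negligible_finite_uniform[OF fin single_output_indist[OF sim sh A l inj]]) force
  then obtain \<mu>1 where m1: "negligible \<mu>1" "\<And>\<kappa>. 0 \<le> \<mu>1 \<kappa>" "\<And>y \<kappa> x. y \<in> ?Y \<Longrightarrow> length (fst x) + length (snd x) \<le> L \<kappa> \<Longrightarrow>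
     \<bar>E (\<pi> \<kappa> x0 x1) (?g \<kappa> y x) - E (?I \<kappa>) (?g \<kappa> y x)\<bar> \<le> \<mu>1 \<kappa>" by blast
  obtain \<mu>2 where m2: "negligible \<mu>2" "\<And>\<kappa>. measure_pmf.prob (\<pi> \<kappa> x0 x1) {(v, y). y \<notin> ?Y} \<le> \<mu>2 \<kappa>"
    using bad_output_negligible[OF sim sh inj fin] by blast
  have "negligible (\<lambda>\<kappa>. (\<Sum>y\<in>?Y. \<mu>1 \<kappa>) + \<mu>2 \<kappa>)"
    using fin m1(1) m2(1) by (intro negligible_add negligible_sum)
  moreover have "\<bar>E (\<pi> \<kappa> x0 x1) h - E (?I \<kappa>) h\<bar> \<le> (\<Sum>y\<in>?Y. \<mu>1 \<kappa>) + \<mu>2 \<kappa>"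
    if h: "unit_fun h" and J: "\<And>y x. y \<in> ?Y \<Longrightarrow> x \<in> set_pmf (J y) \<Longrightarrow> length (fst x) + length (snd x) \<le> L \<kappa>"
      "\<And>y v. y \<in> ?Y \<Longrightarrow> h (v, y) = E (J y) (\<lambda>x. acc A \<kappa> (fst x @ enc_bits (pick i v) @ snd x))"
    for \<kappa> h J
  proof -
    let ?h = "\<lambda>y (v, y'). of_bool (y' = y) * h (v, y')"
    let ?b = "\<lambda>(v, y'). of_bool (y' \<notin> ?Y) * h (v, y')"
    have ug: "unit_fun (\<lambda>x. ?g \<kappa> y x z)" "unit_fun (?g \<kappa> y x)" for y x z
      using unit_acc[of A \<kappa> "\<lambda>x. x"] by (auto simp: unit_fun_def split: prod.splits)
    \<comment> \<open>Drawing the context before the computation reduces a random context to fixed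
      ones, for which \<open>\<mu>1\<close> is a common bound.\<close>
    have hy: "E p (?h y) = E (J y) (\<lambda>x. E p (?g \<kappa> y x))" if "y \<in> ?Y" for y p
    proof -
      have "?h y z = E (J y) (\<lambda>x. ?g \<kappa> y x z)" for z
        using J(2)[OF that] by (cases z) (auto simp: of_bool_def)
      then have "E p (?h y) = E p (\<lambda>z. E (J y) (\<lambda>x. ?g \<kappa> y x z))" by (rule E_cong)
      also have "\<dots> = E (J y) (\<lambda>x. E p (\<lambda>z. ?g \<kappa> y x z))" by (rule E_swap) (rule ug)
      finally show ?thesis .
    qed
    have d: "\<bar>E (\<pi> \<kappa> x0 x1) (?h y) - E (?I \<kappa>) (?h y)\<bar> \<le> \<mu>1 \<kappa>" if "y \<in> ?Y" for y
      unfolding hy[OF that]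
    proof (rule E_diff_le)
      show "unit_fun (\<lambda>x. E (\<pi> \<kappa> x0 x1) (?g \<kappa> y x))" "unit_fun (\<lambda>x. E (?I \<kappa>) (?g \<kappa> y x))"
        by (rule unit_fun_E, rule ug)+
    qed (rule m1(3)[OF that J(1)[OF that]])
    \<comment> \<open>Ideal outputs never leave \<open>?Y\<close>, so the arbitrary part of the test
      contributes on the real side only.\<close>
    have "E (?I \<kappa>) ?b = E (?I \<kappa>) (\<lambda>_. 0)"
      by (rule E_cong) (use set_ideal_2pc in fastforce)
    then have I0: "E (?I \<kappa>) ?b = 0" by simp
    have ub: "unit_fun ?b" using h by (auto simp: unit_fun_def)
    have "E (\<pi> \<kappa> x0 x1) ?b \<le> E (\<pi> \<kappa> x0 x1) (\<lambda>z. of_bool (snd z \<notin> ?Y))"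
      using h by (intro integral_mono unit_fun_integrable ub) (auto simp: unit_fun_def)
    also have "\<dots> \<le> \<mu>2 \<kappa>" using m2(2)[of \<kappa>] by (simp add: E_of_bool case_prod_unfold)
    finally have b: "\<bar>E (\<pi> \<kappa> x0 x1) ?b\<bar> \<le> \<mu>2 \<kappa>" using E_unit[OF ub, of "\<pi> \<kappa> x0 x1"] by simp
    have "E (\<pi> \<kappa> x0 x1) h - E (?I \<kappa>) h =
        (\<Sum>y\<in>?Y. E (\<pi> \<kappa> x0 x1) (?h y) - E (?I \<kappa>) (?h y)) + E (\<pi> \<kappa> x0 x1) ?b"
      unfolding E_split_outputs[OF fin h, of "\<pi> \<kappa> x0 x1"] E_split_outputs[OF fin h, of "?I \<kappa>"] I0
      by (simp add: sum_subtractf)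
    also have "\<bar>\<dots>\<bar> \<le> (\<Sum>y\<in>?Y. \<bar>E (\<pi> \<kappa> x0 x1) (?h y) - E (?I \<kappa>) (?h y)\<bar>) + \<bar>E (\<pi> \<kappa> x0 x1) ?b\<bar>"
      by (rule order_trans[OF abs_triangle_ineq]) (intro add_mono sum_abs order_refl)
    also have "\<dots> \<le> (\<Sum>y\<in>?Y. \<mu>1 \<kappa>) + \<mu>2 \<kappa>" by (intro add_mono sum_mono d b)
    finally show ?thesis .
  qed
  ultimately show ?thesis by (intro exI[of _ "\<lambda>\<kappa>. (\<Sum>y\<in>?Y. \<mu>1 \<kappa>) + \<mu>2 \<kappa>"]) blast
qed


section \<open>The hybrid argument\<close>

type_synonym views = "party \<Rightarrow> bool list"
type_synonym phase = "nat \<Rightarrow> exec_state \<Rightarrow> exec_state pmf"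

abbreviation vapp :: "views \<Rightarrow> views \<Rightarrow> views" where
  "vapp v w \<equiv> (\<lambda>p. v p @ w p)"

text \<open>Phases write views but never read them. Hence what a phase appends can be drawn from the
  states alone, and the adversary's string can be cut open around a transcript.\<close>

definition append_only :: "phase \<Rightarrow> bool" where
  "append_only K \<longleftrightarrow> (\<forall>\<kappa> \<sigma> v. K \<kappa> (\<sigma>, v) = map_pmf (\<lambda>(\<sigma>', w). (\<sigma>', vapp v w)) (K \<kappa> (\<sigma>, \<lambda>_. [])))"

definition run_phases :: "phase list \<Rightarrow> phase" where
  "run_phases Ks \<kappa> e = foldr (\<lambda>K k e. bind_pmf (K \<kappa> e) k) Ks return_pmf e"

lemma run_phases_simps [simp]:
  "run_phases [] \<kappa> e = return_pmf e"
  "run_phases (K # Ks) \<kappa> e = bind_pmf (K \<kappa> e) (run_phases Ks \<kappa>)"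
  by (simp_all add: run_phases_def cong: bind_pmf_cong)

lemma append_onlyD: "append_only K \<Longrightarrow> K \<kappa> (\<sigma>, v) = map_pmf (\<lambda>(\<sigma>', w). (\<sigma>', vapp v w)) (K \<kappa> (\<sigma>, \<lambda>_. []))"
  unfolding append_only_def by blast

lemma append_only_run_phases:
  "(\<And>K. K \<in> set Ks \<Longrightarrow> append_only K) \<Longrightarrow> append_only (run_phases Ks)"
proof (induction Ks)
  case Nil
  then show ?case by (simp add: append_only_def)
next
  case (Cons K Ks)
  have K: "append_only K" and Ks: "append_only (run_phases Ks)" using Cons by auto
  show ?case unfolding append_only_def
  proof (intro allI)
    fix \<kappa> \<sigma> and v :: views
    have "run_phases Ks \<kappa> (\<sigma>', vapp v w) = map_pmf (\<lambda>(\<sigma>', w). (\<sigma>', vapp v w)) (run_phases Ks \<kappa> (\<sigma>', w))" for \<sigma>' w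
      unfolding append_onlyD[OF Ks, of \<kappa> \<sigma>' "vapp v w"] append_onlyD[OF Ks, of \<kappa> \<sigma>' w]
      by (simp add: map_pmf_comp case_prod_unfold)
    then show "run_phases (K # Ks) \<kappa> (\<sigma>, v) = map_pmf (\<lambda>(\<sigma>', w). (\<sigma>', vapp v w)) (run_phases (K # Ks) \<kappa> (\<sigma>, \<lambda>_. []))"
      unfolding run_phases_simps append_onlyD[OF K, of \<kappa> \<sigma> v]
      by (simp add: bind_map_pmf map_bind_pmf case_prod_unfold)
  qed
qed

type_synonym states = "sstate \<times> sstate"

text \<open>The equal public shapes demanded by \<open>secure_2pc\<close> have to hold all along the
  run. The budgets belong to them because they decide which batches are used.\<close>

fun same_shape :: "states \<Rightarrow> bool" where
  "same_shape (s0, s1) \<longleftrightarrow>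
     map (\<lambda>(r, B). (r, map length B)) (store s0) = map (\<lambda>(r, B). (r, map length B)) (store s1) \<and>
     map length (cache s0) = map length (cache s1)"

context
  fixes A :: "com \<times> (nat \<Rightarrow> bool list)" and n :: nat and C :: "party set"
begin

definition owners_view :: "views \<Rightarrow> bool list" where
  "owners_view v = concat (map v (filter (\<lambda>p. p \<in> C) (map Owner [0..<n])))"

lemma adversary_view_eq:
  assumes "Server i \<in> C" "\<And>j. j \<noteq> i \<Longrightarrow> Server j \<notin> C"
  shows "adversary_view n C v = owners_view v @ v (Server i)"
  using assms by (cases i) (auto simp: adversary_view_def owners_view_def)

definition vlen :: "views \<Rightarrow> nat" where
  "vlen v = length (adversary_view n C v)"

lemma length_concat_map_append:
  "length (concat (map (\<lambda>p. f p @ g p) ps)) = length (concat (map f ps)) + length (concat (map g ps))"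
  by (induction ps) auto

lemma vlen_vapp: "vlen (vapp v w) = vlen v + vlen w"
  by (simp add: vlen_def adversary_view_def length_concat_map_append)

lemma vlen_split:
  assumes "Server i \<in> C" "\<And>j. j \<noteq> i \<Longrightarrow> Server j \<notin> C"
  shows "vlen v = length (owners_view v) + length (v (Server i))"
  by (simp add: vlen_def adversary_view_eq[OF assms])

definition accept :: "nat \<Rightarrow> exec_state \<Rightarrow> real" where
  "accept \<kappa> e = acc A \<kappa> (adversary_view n C (snd e))"

text \<open>Tests that arise from running the remaining, already idealized, phases.\<close>

definition future_test :: "nat \<Rightarrow> states set \<Rightarrow> (exec_state \<Rightarrow> real) \<Rightarrow> nat \<Rightarrow> bool" where
  "future_test \<kappa> G W b \<longleftrightarrow> unit_fun W \<and> (\<forall>\<sigma>\<in>G. \<exists>J. (\<forall>w\<in>set_pmf J. vlen w \<le> b) \<and>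
     (\<forall>v. W (\<sigma>, v) = E J (\<lambda>w. acc A \<kappa> (adversary_view n C (vapp v w)))))"

text \<open>The contract that the induction over phases passes on, with \<open>G'\<close> becoming
  the \<open>G\<close> of the next phase. The real phase may leave \<open>G'\<close> or the length
  bound with negligible probability. The ideal one may not, since its views end up in
  advice.\<close>

definition good_phase :: "phase \<Rightarrow> phase \<Rightarrow> bool" where
  "good_phase R I \<longleftrightarrow> append_only I \<and> (\<forall>G. finite G \<longrightarrow> Ball G same_shape \<longrightarrow>
     (\<exists>G' L \<mu>. finite G' \<and> Ball G' same_shape \<and> polyb L \<and> negligible \<mu> \<and>
        (\<forall>\<kappa> \<sigma>. \<sigma> \<in> G \<longrightarrow> (\<forall>v. (\<forall>e\<in>set_pmf (I \<kappa> (\<sigma>, v)). fst e \<in> G' \<and> vlen (snd e) \<le> vlen v + L \<kappa>) \<and>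
            measure_pmf.prob (R \<kappa> (\<sigma>, v)) {e. \<not> (fst e \<in> G' \<and> vlen (snd e) \<le> vlen v + L \<kappa>)} \<le> \<mu> \<kappa>)) \<and>
        (\<forall>L'. polyb L' \<longrightarrow> (\<exists>\<mu>'. negligible \<mu>' \<and> (\<forall>\<kappa> \<sigma> v W. \<sigma> \<in> G \<longrightarrow> vlen v \<le> L' \<kappa> \<longrightarrow>
            future_test \<kappa> G' W (L' \<kappa>) \<longrightarrow> \<bar>E (R \<kappa> (\<sigma>, v)) W - E (I \<kappa> (\<sigma>, v)) W\<bar> \<le> \<mu>' \<kappa>)))))"

lemma good_phaseE:
  assumes "good_phase R I" "finite G" "Ball G same_shape"
  obtains G' L \<mu> where "finite G'" "Ball G' same_shape" "polyb L" "negligible \<mu>"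
    "\<And>\<kappa> \<sigma> v e. \<sigma> \<in> G \<Longrightarrow> e \<in> set_pmf (I \<kappa> (\<sigma>, v)) \<Longrightarrow> fst e \<in> G' \<and> vlen (snd e) \<le> vlen v + L \<kappa>"
    "\<And>\<kappa> \<sigma> v. \<sigma> \<in> G \<Longrightarrow>
       measure_pmf.prob (R \<kappa> (\<sigma>, v)) {e. \<not> (fst e \<in> G' \<and> vlen (snd e) \<le> vlen v + L \<kappa>)} \<le> \<mu> \<kappa>"
    "\<And>L'. polyb L' \<Longrightarrow> \<exists>\<mu>'. negligible \<mu>' \<and> (\<forall>\<kappa> \<sigma> v W. \<sigma> \<in> G \<longrightarrow> vlen v \<le> L' \<kappa> \<longrightarrow>
            future_test \<kappa> G' W (L' \<kappa>) \<longrightarrow> \<bar>E (R \<kappa> (\<sigma>, v)) W - E (I \<kappa> (\<sigma>, v)) W\<bar> \<le> \<mu>' \<kappa>)"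
proof -
  obtain G' L \<mu> where 1: "finite G'" "Ball G' same_shape" "polyb L" "negligible \<mu>"
    and 2: "\<forall>\<kappa> \<sigma>. \<sigma> \<in> G \<longrightarrow> (\<forall>v. (\<forall>e\<in>set_pmf (I \<kappa> (\<sigma>, v)). fst e \<in> G' \<and> vlen (snd e) \<le> vlen v + L \<kappa>) \<and>
            measure_pmf.prob (R \<kappa> (\<sigma>, v)) {e. \<not> (fst e \<in> G' \<and> vlen (snd e) \<le> vlen v + L \<kappa>)} \<le> \<mu> \<kappa>)"
    and 3: "\<forall>L'. polyb L' \<longrightarrow> (\<exists>\<mu>'. negligible \<mu>' \<and> (\<forall>\<kappa> \<sigma> v W. \<sigma> \<in> G \<longrightarrow> vlen v \<le> L' \<kappa> \<longrightarrow>
            future_test \<kappa> G' W (L' \<kappa>) \<longrightarrow> \<bar>E (R \<kappa> (\<sigma>, v)) W - E (I \<kappa> (\<sigma>, v)) W\<bar> \<le> \<mu>' \<kappa>))"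
    using assms(1)[unfolded good_phase_def, THEN conjunct2, THEN spec, THEN mp, OF assms(2), THEN mp, OF assms(3)]
    by (elim exE conjE) (rule that)
  show ?thesis
  proof (rule that[OF 1])
    fix \<kappa> \<sigma> v assume s: "\<sigma> \<in> G"
    note 4 = 2[THEN spec, THEN spec, THEN mp, OF s, THEN spec]
    show "fst e \<in> G' \<and> vlen (snd e) \<le> vlen v + L \<kappa>" if "e \<in> set_pmf (I \<kappa> (\<sigma>, v))" for e
      using 4[THEN conjunct1] that by (rule bspec)
    show "measure_pmf.prob (R \<kappa> (\<sigma>, v)) {e. \<not> (fst e \<in> G' \<and> vlen (snd e) \<le> vlen v + L \<kappa>)} \<le> \<mu> \<kappa>"
      using 4[THEN conjunct2] .
  qed (rule 3[THEN spec, THEN mp])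
qed

lemma good_phase_append_only: "good_phase R I \<Longrightarrow> append_only I"
  by (simp add: good_phase_def)

lemma ideal_view_length:
  assumes "\<And>P. P \<in> set Ps \<Longrightarrow> good_phase (fst P) (snd P)" "finite G" "Ball G same_shape"
  shows "\<exists>L. polyb L \<and> (\<forall>\<kappa> \<sigma> v. \<sigma> \<in> G \<longrightarrow>
    (\<forall>e \<in> set_pmf (run_phases (map snd Ps) \<kappa> (\<sigma>, v)). vlen (snd e) \<le> vlen v + L \<kappa>))"
  using assms
proof (induction Ps arbitrary: G)
  case Nil
  show ?case by (intro exI[of _ "\<lambda>_. 0"]) auto
next
  case (Cons P Ps)
  have "good_phase (fst P) (snd P)" using Cons.prems(1) by simp
  then obtain G' L \<mu> where G': "finite G'" "Ball G' same_shape" "polyb L"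
    "\<And>\<kappa> \<sigma> v e. \<sigma> \<in> G \<Longrightarrow> e \<in> set_pmf (snd P \<kappa> (\<sigma>, v)) \<Longrightarrow> fst e \<in> G' \<and> vlen (snd e) \<le> vlen v + L \<kappa>"
    using Cons.prems(2,3) by (rule good_phaseE) (rule that)
  have "\<exists>L. polyb L \<and> (\<forall>\<kappa> \<sigma> v. \<sigma> \<in> G' \<longrightarrow>
    (\<forall>e \<in> set_pmf (run_phases (map snd Ps) \<kappa> (\<sigma>, v)). vlen (snd e) \<le> vlen v + L \<kappa>))"
    using Cons.prems(1) G'(1,2) by (intro Cons.IH) auto
  then obtain L2 where L2: "polyb L2" "\<And>\<kappa> \<sigma> v e. \<sigma> \<in> G' \<Longrightarrow>
    e \<in> set_pmf (run_phases (map snd Ps) \<kappa> (\<sigma>, v)) \<Longrightarrow> vlen (snd e) \<le> vlen v + L2 \<kappa>" by blast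
  have "polyb (\<lambda>\<kappa>. L \<kappa> + L2 \<kappa>)" using G'(3) L2(1) by (rule polyb_add)
  moreover have "vlen (snd e) \<le> vlen v + (L \<kappa> + L2 \<kappa>)"
    if s: "\<sigma> \<in> G" and e: "e \<in> set_pmf (run_phases (map snd (P # Ps)) \<kappa> (\<sigma>, v))" for \<kappa> \<sigma> v e
  proof -
    obtain \<sigma>' v' where 1: "(\<sigma>', v') \<in> set_pmf (snd P \<kappa> (\<sigma>, v))" "e \<in> set_pmf (run_phases (map snd Ps) \<kappa> (\<sigma>', v'))"
      using e by auto
    from G'(4)[OF s 1(1)] L2(2)[OF _ 1(2)] show ?thesis by simp
  qed
  ultimately show ?case by (intro exI[of _ "\<lambda>\<kappa>. L \<kappa> + L2 \<kappa>"]) blast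
qed

lemma unit_accept: "unit_fun (accept \<kappa>)"
  unfolding accept_def[abs_def] by (rule unit_acc)

text \<open>Triangle inequality with the middle term "first phase real, all others ideal": the
  induction hypothesis pays for the later phases, the contract of the first phase for the
  rest.\<close>

theorem hybrid:
  assumes "\<And>P. P \<in> set Ps \<Longrightarrow> good_phase (fst P) (snd P)" "finite G" "Ball G same_shape" "polyb L"
  shows "\<exists>\<mu>. negligible \<mu> \<and> (\<forall>\<kappa> \<sigma> v. \<sigma> \<in> G \<longrightarrow> vlen v \<le> L \<kappa> \<longrightarrow>
    \<bar>E (run_phases (map fst Ps) \<kappa> (\<sigma>, v)) (accept \<kappa>) - E (run_phases (map snd Ps) \<kappa> (\<sigma>, v)) (accept \<kappa>)\<bar> \<le> \<mu> \<kappa>)"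
  using assms
proof (induction Ps arbitrary: G L)
  case Nil
  show ?case by (intro exI[of _ "\<lambda>_. 0"]) auto
next
  case (Cons P Ps)
  let ?R = "run_phases (map fst Ps)" and ?I = "run_phases (map snd Ps)"
  have gp: "good_phase (fst P) (snd P)" using Cons.prems(1) by simp
  obtain G' K \<mu>1 where G': "finite G'" "Ball G' same_shape" "polyb K" and m1: "negligible \<mu>1"
    "\<And>\<kappa> \<sigma> v. \<sigma> \<in> G \<Longrightarrow>
       measure_pmf.prob (fst P \<kappa> (\<sigma>, v)) {e. \<not> (fst e \<in> G' \<and> vlen (snd e) \<le> vlen v + K \<kappa>)} \<le> \<mu>1 \<kappa>"
    and ind: "\<And>L'. polyb L' \<Longrightarrow> \<exists>\<mu>'. negligible \<mu>' \<and> (\<forall>\<kappa> \<sigma> v W. \<sigma> \<in> G \<longrightarrow> vlen v \<le> L' \<kappa> \<longrightarrow>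
            future_test \<kappa> G' W (L' \<kappa>) \<longrightarrow> \<bar>E (fst P \<kappa> (\<sigma>, v)) W - E (snd P \<kappa> (\<sigma>, v)) W\<bar> \<le> \<mu>' \<kappa>)"
    using gp Cons.prems(2,3) by (rule good_phaseE) (rule that)
  have gps: "\<And>P. P \<in> set Ps \<Longrightarrow> good_phase (fst P) (snd P)" using Cons.prems(1) by simp
  have "polyb (\<lambda>\<kappa>. L \<kappa> + K \<kappa>)" using Cons.prems(4) G'(3) by (rule polyb_add)
  then have "\<exists>\<mu>. negligible \<mu> \<and> (\<forall>\<kappa> \<sigma> v. \<sigma> \<in> G' \<longrightarrow> vlen v \<le> L \<kappa> + K \<kappa> \<longrightarrow>
    \<bar>E (?R \<kappa> (\<sigma>, v)) (accept \<kappa>) - E (?I \<kappa> (\<sigma>, v)) (accept \<kappa>)\<bar> \<le> \<mu> \<kappa>)"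
    by (intro Cons.IH gps G'(1,2))
  then obtain \<mu>2 where m2: "negligible \<mu>2" "\<And>\<kappa> \<sigma> v. \<sigma> \<in> G' \<Longrightarrow> vlen v \<le> L \<kappa> + K \<kappa> \<Longrightarrow>
    \<bar>E (?R \<kappa> (\<sigma>, v)) (accept \<kappa>) - E (?I \<kappa> (\<sigma>, v)) (accept \<kappa>)\<bar> \<le> \<mu>2 \<kappa>"
    by blast
  have "\<exists>L. polyb L \<and> (\<forall>\<kappa> \<sigma> v. \<sigma> \<in> G' \<longrightarrow> (\<forall>e \<in> set_pmf (?I \<kappa> (\<sigma>, v)). vlen (snd e) \<le> vlen v + L \<kappa>))"
    by (intro ideal_view_length gps G'(1,2))
  then obtain L2 where L2: "polyb L2" "\<And>\<kappa> \<sigma> v e. \<sigma> \<in> G' \<Longrightarrow>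
    e \<in> set_pmf (?I \<kappa> (\<sigma>, v)) \<Longrightarrow> vlen (snd e) \<le> vlen v + L2 \<kappa>"
    by blast
  \<comment> \<open>One bound for both sides of the transcript: the view so far and what the ideal
    phases append to it.\<close>
  have "polyb (\<lambda>\<kappa>. L \<kappa> + L2 \<kappa>)" using Cons.prems(4) L2(1) by (rule polyb_add)
  from ind[OF this] obtain \<mu>3 where m3: "negligible \<mu>3" "\<And>\<kappa> \<sigma> v W. \<sigma> \<in> G \<Longrightarrow> vlen v \<le> L \<kappa> + L2 \<kappa> \<Longrightarrow>
            future_test \<kappa> G' W (L \<kappa> + L2 \<kappa>) \<Longrightarrow> \<bar>E (fst P \<kappa> (\<sigma>, v)) W - E (snd P \<kappa> (\<sigma>, v)) W\<bar> \<le> \<mu>3 \<kappa>"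
    by blast
  have ao: "append_only ?I"
  proof (rule append_only_run_phases)
    fix K assume "K \<in> set (map snd Ps)"
    then obtain P where "P \<in> set Ps" "K = snd P" by auto
    then show "append_only K" using good_phase_append_only[OF gps] by simp
  qed
  have "\<bar>E (run_phases (map fst (P # Ps)) \<kappa> (\<sigma>, v)) (accept \<kappa>) - E (run_phases (map snd (P # Ps)) \<kappa> (\<sigma>, v)) (accept \<kappa>)\<bar>
      \<le> (\<bar>\<mu>2 \<kappa>\<bar> + \<mu>1 \<kappa>) + \<mu>3 \<kappa>" if s: "\<sigma> \<in> G" and v: "vlen v \<le> L \<kappa>" for \<kappa> \<sigma> v
  proof -
    let ?f = "\<lambda>e. E (?R \<kappa> e) (accept \<kappa>)" and ?g = "\<lambda>e. E (?I \<kappa> e) (accept \<kappa>)"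
    have u: "unit_fun ?f" "unit_fun ?g" by (intro unit_fun_E unit_accept)+
    \<comment> \<open>Under the real first phase, the induction hypothesis applies only to outcomes
      in \<open>G'\<close> with short views; the others are charged to the bad event.\<close>
    have "\<bar>E (fst P \<kappa> (\<sigma>, v)) ?f - E (fst P \<kappa> (\<sigma>, v)) ?g\<bar> \<le> \<bar>\<mu>2 \<kappa>\<bar> +
      measure_pmf.prob (fst P \<kappa> (\<sigma>, v)) {e. \<not> (fst e \<in> G' \<and> vlen (snd e) \<le> vlen v + K \<kappa>)}"
    proof (rule E_diff_le_bad[OF u])
      fix e assume "\<not> \<not> (fst e \<in> G' \<and> vlen (snd e) \<le> vlen v + K \<kappa>)"
      then have "fst e \<in> G'" "vlen (snd e) \<le> L \<kappa> + K \<kappa>" using v by auto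
      from m2(2)[OF this] show "\<bar>?f e - ?g e\<bar> \<le> \<bar>\<mu>2 \<kappa>\<bar>" by simp
    qed simp
    also have "\<dots> \<le> \<bar>\<mu>2 \<kappa>\<bar> + \<mu>1 \<kappa>" using m1(2)[OF s] by simp
    finally have 1: "\<bar>E (fst P \<kappa> (\<sigma>, v)) ?f - E (fst P \<kappa> (\<sigma>, v)) ?g\<bar> \<le> \<bar>\<mu>2 \<kappa>\<bar> + \<mu>1 \<kappa>" .
    \<comment> \<open>The ideal tail is append-only, so its contribution from each state in
      \<open>G'\<close> can be drawn on empty views and appended to any view.\<close>
    have "future_test \<kappa> G' ?g (L \<kappa> + L2 \<kappa>)"
      unfolding future_test_def
    proof (intro conjI u ballI)
      fix \<sigma>' assume s': "\<sigma>' \<in> G'"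
      let ?J = "map_pmf snd (?I \<kappa> (\<sigma>', \<lambda>_. []))"
      have "vlen w \<le> L \<kappa> + L2 \<kappa>" if w: "w \<in> set_pmf ?J" for w
      proof -
        obtain e where e: "e \<in> set_pmf (?I \<kappa> (\<sigma>', \<lambda>_. []))" "w = snd e" using w by auto
        have "vlen (\<lambda>_. []) = 0" by (simp add: vlen_def adversary_view_def)
        with L2(2)[OF s' e(1)] show ?thesis by (simp add: e(2))
      qed
      moreover have "?g (\<sigma>', v') = E ?J (\<lambda>w. acc A \<kappa> (adversary_view n C (vapp v' w)))" for v'
        by (subst append_onlyD[OF ao]) (simp add: accept_def case_prod_unfold)
      ultimately show "\<exists>J. (\<forall>w\<in>set_pmf J. vlen w \<le> L \<kappa> + L2 \<kappa>) \<and>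
         (\<forall>v. ?g (\<sigma>', v) = E J (\<lambda>w. acc A \<kappa> (adversary_view n C (vapp v w))))"
        by (intro exI[of _ ?J]) blast
    qed
    then have 2: "\<bar>E (fst P \<kappa> (\<sigma>, v)) ?g - E (snd P \<kappa> (\<sigma>, v)) ?g\<bar> \<le> \<mu>3 \<kappa>"
      using m3(2)[OF s] v by simp
    show ?thesis using 1 2 by (simp add: E_bind[OF unit_accept])
  qed
  moreover have "negligible (\<lambda>\<kappa>. (\<bar>\<mu>2 \<kappa>\<bar> + \<mu>1 \<kappa>) + \<mu>3 \<kappa>)"
    using m1(1) m2(1) m3(1) by (intro negligible_add negligible_abs)
  ultimately show ?case by blast
qed

end


text \<open>The common form of Transform, Shrink and flush, so that one reduction serves all three.
  \<open>Z\<close> draws the servers' random contributions; \<open>pre\<close> and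
  \<open>post\<close> are what a server sees around its transcript.\<close>

definition call_phase :: "('i, 'o) two_pc \<Rightarrow> (zm \<times> zm) pmf \<Rightarrow> (states \<Rightarrow> zm \<times> zm \<Rightarrow> 'i \<times> 'i) \<Rightarrow>
    (states \<Rightarrow> 'o \<times> 'o \<Rightarrow> states) \<Rightarrow> (zm \<times> zm \<Rightarrow> server \<Rightarrow> bool list) \<Rightarrow> ('o \<Rightarrow> bool list) \<Rightarrow> phase" where
  "call_phase \<pi> Z inp upd pre post \<kappa> = (\<lambda>(\<sigma>, v). do {
     z \<leftarrow> Z;
     (tr, y) \<leftarrow> \<pi> \<kappa> (fst (inp \<sigma> z)) (snd (inp \<sigma> z));
     return_pmf (upd \<sigma> y, observe (\<lambda>j. pre z j @ enc_bits (pick j tr) @ post (pick j y)) v) })"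

lemma observe_vapp: "observe g v = vapp v (observe g (\<lambda>_. []))"
  by (auto simp: observe_def fun_eq_iff split: party.splits)

lemma append_only_call_phase: "append_only (call_phase \<pi> Z inp upd pre post)"
  unfolding append_only_def call_phase_def
  by (subst observe_vapp) (simp add: map_bind_pmf case_prod_unfold)

lemma prob_as_E: "measure_pmf.prob p {x. P x} = E p (\<lambda>x. of_bool (P x))"
  by (rule E_of_bool[symmetric])

lemma unit_of_bool: "unit_fun (\<lambda>x. of_bool (P x))"
  by (simp add: unit_fun_def)

context
  fixes A :: "com \<times> (nat \<Rightarrow> bool list)" and n :: nat and C :: "party set" and i :: server
  assumes A: "adversary A" and C: "Server i \<in> C" "\<And>j. j \<noteq> i \<Longrightarrow> Server j \<notin> C"
begin

lemmas vlen_split' = vlen_split[OF C] and adversary_view_eq' = adversary_view_eq[OF C]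

lemma vlen_observe: "vlen n C (observe g v) = vlen n C v + length (g i)"
proof -
  have "owners_view n C (observe g v) = owners_view n C v"
    unfolding owners_view_def by (rule arg_cong[where f = concat]) (auto simp: observe_def)
  then show ?thesis by (simp add: vlen_split' observe_def)
qed

lemma E_call_phase:
  assumes "unit_fun W"
  shows "E (call_phase \<pi> Z inp upd pre post \<kappa> (\<sigma>, v)) W =
    E Z (\<lambda>z. E (\<pi> \<kappa> (fst (inp \<sigma> z)) (snd (inp \<sigma> z)))
      (\<lambda>(tr, y). W (upd \<sigma> y, observe (\<lambda>j. pre z j @ enc_bits (pick j tr) @ post (pick j y)) v)))"
  by (simp add: call_phase_def E_bind[OF assms] case_prod_unfold)

text \<open>The next state is a function of the old one and of the output, not of the transcript. On
  each expected output a future test is therefore a random context around the transcript, as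
  \<open>call_indist\<close> demands.\<close>

lemma good_call_phase:
  fixes f :: "'i \<Rightarrow> 'i \<Rightarrow> ('o \<times> 'o) pmf" and \<pi> :: "('i, 'o) two_pc"
  assumes sec: "secure_2pc shape enc_in enc_out f \<pi>"
    and sim: "simulates i shape enc_in enc_out f \<pi> Sim"
    and inj: "inj_enc enc_out" and finZ: "finite (set_pmf Z)"
    and fin: "\<And>x0 x1. finite (set_pmf (f x0 x1))"
    and sh: "\<And>\<sigma> z. same_shape \<sigma> \<Longrightarrow> shape (fst (inp \<sigma> z)) = shape (snd (inp \<sigma> z))"
    and upd: "\<And>\<sigma> z y. same_shape \<sigma> \<Longrightarrow> y \<in> set_pmf (f (fst (inp \<sigma> z)) (snd (inp \<sigma> z))) \<Longrightarrow> same_shape (upd \<sigma> y)"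
  shows "good_phase A n C (call_phase \<pi> Z inp upd pre post)
           (call_phase (ideal_2pc i enc_in enc_out f Sim) Z inp upd pre post)"
  unfolding good_phase_def
proof (intro conjI allI impI append_only_call_phase)
  fix G assume G: "finite G" "Ball G same_shape"
  let ?x0 = "\<lambda>s. fst (inp (fst s) (snd s))" and ?x1 = "\<lambda>s. snd (inp (fst s) (snd s))"
  let ?R = "call_phase \<pi> Z inp upd pre post" and ?id = "ideal_2pc i enc_in enc_out f Sim"
  let ?I = "call_phase ?id Z inp upd pre post"
  let ?ob = "\<lambda>z tr y. observe (\<lambda>j. pre z j @ enc_bits (pick j tr) @ post (pick j y))"
  \<comment> \<open>Pairs of a state and random contributions fix the inputs, and \<open>S3\<close>
    adds the expected outputs. Both sets are finite and do not depend on
    \<open>\<kappa>\<close>.\<close>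
  define S where "S = G \<times> set_pmf Z"
  define Y where "Y s = set_pmf (f (?x0 s) (?x1 s))" for s
  define G' where "G' = (\<Union>s\<in>S. upd (fst s) ` Y s)"
  define S3 where "S3 = Sigma S Y"
  have finS: "finite S" using G finZ by (simp add: S_def)
  have finY: "finite (Y s)" for s unfolding Y_def by (rule fin)
  have finS3: "finite S3" unfolding S3_def using finS finY by auto
  have shS: "shape (?x0 s) = shape (?x1 s)" if "s \<in> S" for s
    using that G sh by (auto simp: S_def)
  \<comment> \<open>Sums serve as crude maxima of the lengths of inputs and outputs; they are
    constants in \<open>\<kappa>\<close>.\<close>
  define a where "a = (\<Sum>s\<in>S. length (enc_in (?x0 s)) + length (enc_in (?x1 s)))"
  define b where "b = (\<Sum>s\<in>S3. length (pre (snd (fst s)) i) + length (post (pick i (snd s)))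
      + length (enc_in (pick i (?x0 (fst s), ?x1 (fst s)))) + length (enc_out (pick i (snd s))))"
  have a: "length (enc_in (?x0 s)) + length (enc_in (?x1 s)) \<le> a" if "s \<in> S" for s
    unfolding a_def using that finS by (intro member_le_sum) auto
  have b: "length (pre (snd s) i) + length (post (pick i y)) + length (enc_in (pick i (?x0 s, ?x1 s)))
      + length (enc_out (pick i y)) \<le> b" if "s \<in> S" "y \<in> Y s" for s y
  proof -
    have "(s, y) \<in> S3" using that by (simp add: S3_def)
    from member_le_sum[OF this _ finS3, of "\<lambda>s. length (pre (snd (fst s)) i) + length (post (pick i (snd s)))
      + length (enc_in (pick i (?x0 (fst s), ?x1 (fst s)))) + length (enc_out (pick i (snd s)))"]
    show ?thesis unfolding b_def by simp
  qed
  obtain k where k: "\<And>\<kappa> x0 x1 v0 v1 y. shape x0 = shape x1 \<Longrightarrow> ((v0, v1), y) \<in> set_pmf (\<pi> \<kappa> x0 x1) \<Longrightarrow>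
        length v0 + length v1 \<le> (\<kappa> + length (enc_in x0) + length (enc_in x1)) ^ k + k"
    using sec[unfolded secure_2pc_def, THEN conjunct1] by blast
  have "ppt Sim" using sim by (simp add: simulates_def)
  then obtain T where T: "polyb T" "mono T" "\<And>x y. y \<in> set_pmf (exec Sim x) \<Longrightarrow> length y \<le> T (length x)"
    using exec_length by blast
  \<comment> \<open>The first term is for a real transcript, the second for a simulated one, both
    doubled by \<open>enc_bits\<close>; 1 is the delimiter, and \<open>b\<close> covers what
    surrounds the transcript.\<close>
  define L where "L \<kappa> = 2 * ((\<kappa> + a) ^ k + k) + 2 * T (\<kappa> + 1 + b) + 1 + b" for \<kappa>
  have "polyb (\<lambda>\<kappa>. T (\<kappa> + 1 + b))" by (rule polyb_comp[OF T(1)]) (intro polyb_add, auto)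
  then have L: "polyb L" unfolding L_def by (intro polyb_add polyb_mult polyb_power) auto
  have finG': "finite G'" using finS finY by (simp add: G'_def)
  have G'sh: "Ball G' same_shape" using G upd by (auto simp: G'_def S_def Y_def)
  have "\<exists>\<mu>. negligible \<mu> \<and> (\<forall>\<kappa>. 0 \<le> \<mu> \<kappa>) \<and> (\<forall>s\<in>S. \<forall>\<kappa>.
      measure_pmf.prob (\<pi> \<kappa> (?x0 s) (?x1 s)) {(v, y). y \<notin> Y s} \<le> \<mu> \<kappa>)"
    unfolding Y_def
    by (rule negligible_finite_uniform[OF finS bad_output_negligible[OF sim shS inj fin]]) auto
  then obtain \<mu> where \<mu>: "negligible \<mu>" "\<And>\<kappa>. 0 \<le> \<mu> \<kappa>"
    "\<And>s \<kappa>. s \<in> S \<Longrightarrow> measure_pmf.prob (\<pi> \<kappa> (?x0 s) (?x1 s)) {(v, y). y \<notin> Y s} \<le> \<mu> \<kappa>" by blast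
  have len: "vlen n C (?ob z tr y v) = vlen n C v + (length (pre z i) + (2 * length (pick i tr) + 1) + length (post (pick i y)))"
    for z tr y v by (simp add: vlen_observe)
  have ideal: "fst e \<in> G' \<and> vlen n C (snd e) \<le> vlen n C v + L \<kappa>"
    if \<sigma>: "\<sigma> \<in> G" and e: "e \<in> set_pmf (?I \<kappa> (\<sigma>, v))" for \<kappa> \<sigma> v e
  proof -
    obtain z u y where z: "z \<in> set_pmf Z" and
      uy: "(u, y) \<in> set_pmf (?id \<kappa> (fst (inp \<sigma> z)) (snd (inp \<sigma> z)))" and eq: "e = (upd \<sigma> y, ?ob z u y v)"
      using e by (auto simp: call_phase_def simp del: set_pmf_eq)
    let ?s = "(\<sigma>, z)"
    have s: "?s \<in> S" using \<sigma> z by (simp add: S_def)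
    obtain w where u: "u = (w, w)" "y \<in> Y ?s"
      "w \<in> set_pmf (exec Sim (enc_nat \<kappa> @ enc_in (pick i (?x0 ?s, ?x1 ?s)) @ enc_out (pick i y)))"
    proof (rule that)
      have "((fst u, snd u), y) \<in> set_pmf (?id \<kappa> (?x0 ?s) (?x1 ?s))" using uy by simp
      note * = set_ideal_2pc[OF this]
      show "u = (snd u, snd u)" using * by (simp add: prod_eq_iff)
      show "y \<in> Y ?s" using * by (simp add: Y_def)
      show "snd u \<in> set_pmf (exec Sim (enc_nat \<kappa> @ enc_in (pick i (?x0 ?s, ?x1 ?s)) @ enc_out (pick i y)))"
        using * by blast
    qed
    have "length w \<le> T (length (enc_nat \<kappa> @ enc_in (pick i (?x0 ?s, ?x1 ?s)) @ enc_out (pick i y)))"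
      by (rule T(3)[OF u(3)])
    also have "\<dots> \<le> T (\<kappa> + 1 + b)"
      using b[OF s u(2)] by (intro monoD[OF T(2)]) (simp add: enc_nat_def)
    finally have "length w \<le> T (\<kappa> + 1 + b)" .
    moreover have "upd \<sigma> y \<in> G'" unfolding G'_def using s u(2) by force
    moreover have "vlen n C (?ob z (w, w) y v) = vlen n C v + (length (pre z i) + (2 * length w + 1) + length (post (pick i y)))"
      using len[of z "(w, w)" y v] by simp
    ultimately show ?thesis using b[OF s u(2)] by (simp add: eq u(1) L_def del: pick_same)
  qed
  have real: "measure_pmf.prob (?R \<kappa> (\<sigma>, v)) {e. \<not> (fst e \<in> G' \<and> vlen n C (snd e) \<le> vlen n C v + L \<kappa>)} \<le> \<mu> \<kappa>"
    if \<sigma>: "\<sigma> \<in> G" for \<kappa> \<sigma> v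
  proof -
    let ?bad = "\<lambda>e. \<not> (fst e \<in> G' \<and> vlen n C (snd e) \<le> vlen n C v + L \<kappa>)"
    have 1: "\<bar>E (\<pi> \<kappa> (fst (inp \<sigma> z)) (snd (inp \<sigma> z))) (\<lambda>(tr, y). of_bool (?bad (upd \<sigma> y, ?ob z tr y v)))\<bar> \<le> \<mu> \<kappa>"
      if z: "z \<in> set_pmf Z" for z
    proof -
      let ?s = "(\<sigma>, z)"
      have s: "?s \<in> S" using \<sigma> z by (simp add: S_def)
      have "\<not> ?bad (upd \<sigma> y, ?ob z tr y v)"
        if tr: "(tr, y) \<in> set_pmf (\<pi> \<kappa> (?x0 ?s) (?x1 ?s))" and y: "y \<in> Y ?s" for tr y
      proof -
        obtain v0 v1 where v: "tr = (v0, v1)" by force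
        have "length v0 + length v1 \<le> (\<kappa> + length (enc_in (?x0 ?s)) + length (enc_in (?x1 ?s))) ^ k + k"
          using tr unfolding v by (rule k[OF shS[OF s]])
        also have "\<dots> \<le> (\<kappa> + a) ^ k + k"
          using a[OF s] by (intro add_right_mono power_mono) auto
        finally have "length (pick i tr) \<le> (\<kappa> + a) ^ k + k" by (cases i) (simp_all add: v)
        moreover have "upd \<sigma> y \<in> G'" unfolding G'_def using s y by force
        ultimately show ?thesis using b[OF s y] by (simp add: len L_def)
      qed
      \<comment> \<open>On expected outputs the length bound of \<open>secure_2pc\<close> holds and
        the next state lies in \<open>G'\<close>; so the bad event requires an unexpected
        output.\<close>
      then have "E (\<pi> \<kappa> (?x0 ?s) (?x1 ?s)) (\<lambda>(tr, y). of_bool (?bad (upd \<sigma> y, ?ob z tr y v)))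
          = E (\<pi> \<kappa> (?x0 ?s) (?x1 ?s)) (\<lambda>(tr, y). of_bool (?bad (upd \<sigma> y, ?ob z tr y v)) * of_bool (y \<notin> Y ?s))"
        by (intro E_cong) auto
      also have "\<dots> \<le> E (\<pi> \<kappa> (?x0 ?s) (?x1 ?s)) (\<lambda>x. of_bool (snd x \<notin> Y ?s))"
        by (intro integral_mono unit_fun_integrable) (auto simp: unit_fun_def)
      also have "\<dots> \<le> \<mu> \<kappa>" using \<mu>(3)[OF s, of \<kappa>] by (simp add: E_of_bool case_prod_unfold)
      moreover have "0 \<le> E (\<pi> \<kappa> (?x0 ?s) (?x1 ?s)) (\<lambda>(tr, y). of_bool (?bad (upd \<sigma> y, ?ob z tr y v)))"
        by (intro integral_nonneg_AE) auto
      ultimately show ?thesis by simp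
    qed
    have "\<bar>E Z (\<lambda>z. E (\<pi> \<kappa> (fst (inp \<sigma> z)) (snd (inp \<sigma> z))) (\<lambda>(tr, y). of_bool (?bad (upd \<sigma> y, ?ob z tr y v))))\<bar> \<le> \<mu> \<kappa>"
      by (rule abs_E_le) (rule 1)
    then show ?thesis
      unfolding prob_as_E E_call_phase[OF unit_of_bool] by simp
  qed
  have indist: "\<exists>\<mu>'. negligible \<mu>' \<and> (\<forall>\<kappa> \<sigma> v W. \<sigma> \<in> G \<longrightarrow> vlen n C v \<le> L' \<kappa> \<longrightarrow>
      future_test A n C \<kappa> G' W (L' \<kappa>) \<longrightarrow> \<bar>E (?R \<kappa> (\<sigma>, v)) W - E (?I \<kappa> (\<sigma>, v)) W\<bar> \<le> \<mu>' \<kappa>)"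
    if L': "polyb L'" for L'
  proof -
    \<comment> \<open>\<open>L'\<close> once for the view so far and once for the later views, and
      \<open>b\<close> for \<open>pre\<close> and \<open>post\<close>.\<close>
    define M where "M \<kappa> = 2 * L' \<kappa> + b" for \<kappa>
    have M: "polyb M" unfolding M_def using L' by (intro polyb_add polyb_mult) auto
    have "\<exists>\<mu>'. negligible \<mu>' \<and> (\<forall>\<kappa>. 0 \<le> \<mu>' \<kappa>) \<and> (\<forall>s\<in>S. \<forall>\<kappa>. \<forall>h J. unit_fun h \<longrightarrow>
     (\<forall>y\<in>set_pmf (f (?x0 s) (?x1 s)). (\<forall>x \<in> set_pmf (J y). length (fst x) + length (snd x) \<le> M \<kappa>) \<and>
        (\<forall>v. h (v, y) = E (J y) (\<lambda>x. acc A \<kappa> (fst x @ enc_bits (pick i v) @ snd x)))) \<longrightarrow>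
     \<bar>E (\<pi> \<kappa> (?x0 s) (?x1 s)) h - E (?id \<kappa> (?x0 s) (?x1 s)) h\<bar> \<le> \<mu>' \<kappa>)"
    proof (rule negligible_finite_uniform[OF finS call_indist[OF sim shS A M inj fin]])
      fix s \<kappa> and c d :: real
      assume 1: "\<forall>h J. unit_fun h \<longrightarrow>
     (\<forall>y\<in>set_pmf (f (?x0 s) (?x1 s)). (\<forall>x \<in> set_pmf (J y). length (fst x) + length (snd x) \<le> M \<kappa>) \<and>
        (\<forall>v. h (v, y) = E (J y) (\<lambda>x. acc A \<kappa> (fst x @ enc_bits (pick i v) @ snd x)))) \<longrightarrow>
     \<bar>E (\<pi> \<kappa> (?x0 s) (?x1 s)) h - E (?id \<kappa> (?x0 s) (?x1 s)) h\<bar> \<le> c" and 2: "c \<le> d"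
      show "\<forall>h J. unit_fun h \<longrightarrow>
     (\<forall>y\<in>set_pmf (f (?x0 s) (?x1 s)). (\<forall>x \<in> set_pmf (J y). length (fst x) + length (snd x) \<le> M \<kappa>) \<and>
        (\<forall>v. h (v, y) = E (J y) (\<lambda>x. acc A \<kappa> (fst x @ enc_bits (pick i v) @ snd x)))) \<longrightarrow>
     \<bar>E (\<pi> \<kappa> (?x0 s) (?x1 s)) h - E (?id \<kappa> (?x0 s) (?x1 s)) h\<bar> \<le> d"
        by (intro allI impI) (rule order_trans[OF 1[THEN spec, THEN spec, THEN mp, THEN mp] 2])
    qed
    then obtain \<mu>' where m1: "negligible \<mu>'" and m0: "\<forall>s\<in>S. \<forall>\<kappa>. \<forall>h J. unit_fun h \<longrightarrow>
     (\<forall>y\<in>set_pmf (f (?x0 s) (?x1 s)). (\<forall>x \<in> set_pmf (J y). length (fst x) + length (snd x) \<le> M \<kappa>) \<and>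
        (\<forall>v. h (v, y) = E (J y) (\<lambda>x. acc A \<kappa> (fst x @ enc_bits (pick i v) @ snd x)))) \<longrightarrow>
     \<bar>E (\<pi> \<kappa> (?x0 s) (?x1 s)) h - E (?id \<kappa> (?x0 s) (?x1 s)) h\<bar> \<le> \<mu>' \<kappa>"
      by (elim exE conjE) (rule that)
    have m2: "\<bar>E (\<pi> \<kappa> (?x0 s) (?x1 s)) h - E (?id \<kappa> (?x0 s) (?x1 s)) h\<bar> \<le> \<mu>' \<kappa>"
      if "s \<in> S" "unit_fun h"
      and "\<And>y x. y \<in> Y s \<Longrightarrow> x \<in> set_pmf (J y) \<Longrightarrow> length (fst x) + length (snd x) \<le> M \<kappa>"
      and "\<And>y v. y \<in> Y s \<Longrightarrow> h (v, y) = E (J y) (\<lambda>x. acc A \<kappa> (fst x @ enc_bits (pick i v) @ snd x))"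
      for s \<kappa> h J
    proof (rule m0[THEN bspec, OF that(1), THEN spec[of _ \<kappa>], THEN spec[of _ h], THEN spec[of _ J], THEN mp, OF that(2), THEN mp],
        rule ballI)
      fix y assume "y \<in> set_pmf (f (?x0 s) (?x1 s))"
      then have y: "y \<in> Y s" by (simp add: Y_def)
      show "(\<forall>x \<in> set_pmf (J y). length (fst x) + length (snd x) \<le> M \<kappa>) \<and>
        (\<forall>v. h (v, y) = E (J y) (\<lambda>x. acc A \<kappa> (fst x @ enc_bits (pick i v) @ snd x)))"
        using that(3)[OF y] that(4)[OF y] by blast
    qed
    have "\<bar>E (?R \<kappa> (\<sigma>, v)) W - E (?I \<kappa> (\<sigma>, v)) W\<bar> \<le> \<mu>' \<kappa>"
      if \<sigma>: "\<sigma> \<in> G" and v: "vlen n C v \<le> L' \<kappa>" and W: "future_test A n C \<kappa> G' W (L' \<kappa>)" for \<kappa> \<sigma> v W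
    proof -
      have uW: "unit_fun W" using W by (simp add: future_test_def)
      have "\<forall>\<sigma>\<in>G'. \<exists>J. (\<forall>w\<in>set_pmf J. vlen n C w \<le> L' \<kappa>) \<and>
         (\<forall>v. W (\<sigma>, v) = E J (\<lambda>w. acc A \<kappa> (adversary_view n C (vapp v w))))"
        using W by (simp add: future_test_def)
      from bchoice[OF this] obtain J where J0: "\<forall>\<sigma>\<in>G'. (\<forall>w\<in>set_pmf (J \<sigma>). vlen n C w \<le> L' \<kappa>) \<and>
         (\<forall>v. W (\<sigma>, v) = E (J \<sigma>) (\<lambda>w. acc A \<kappa> (adversary_view n C (vapp v w))))" by blast
      have J: "\<And>\<sigma> w. \<sigma> \<in> G' \<Longrightarrow> w \<in> set_pmf (J \<sigma>) \<Longrightarrow> vlen n C w \<le> L' \<kappa>"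
        "\<And>\<sigma> v. \<sigma> \<in> G' \<Longrightarrow> W (\<sigma>, v) = E (J \<sigma>) (\<lambda>w. acc A \<kappa> (adversary_view n C (vapp v w)))"
        using J0 by blast+
      let ?h = "\<lambda>z (tr, y). W (upd \<sigma> y, ?ob z tr y v)"
      have uh: "unit_fun (?h z)" for z using uW unfolding unit_fun_def case_prod_unfold by blast
      have "\<bar>E (\<pi> \<kappa> (fst (inp \<sigma> z)) (snd (inp \<sigma> z))) (?h z) - E (?id \<kappa> (fst (inp \<sigma> z)) (snd (inp \<sigma> z))) (?h z)\<bar> \<le> \<mu>' \<kappa>"
        if z: "z \<in> set_pmf Z" for z
      proof -
        let ?s = "(\<sigma>, z)"
        have s: "?s \<in> S" using \<sigma> z by (simp add: S_def)
        \<comment> \<open>Owners precede servers in the adversary's view, so what the future appends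
          for the owners goes left of the transcript and what it appends for server \<open>i\<close>
          goes right of it.\<close>
        let ?K = "\<lambda>y. map_pmf (\<lambda>w. (owners_view n C (vapp v w) @ v (Server i) @ pre z i, post (pick i y) @ w (Server i))) (J (upd \<sigma> y))"
        have "\<bar>E (\<pi> \<kappa> (?x0 ?s) (?x1 ?s)) (?h z) - E (?id \<kappa> (?x0 ?s) (?x1 ?s)) (?h z)\<bar> \<le> \<mu>' \<kappa>"
        proof (rule m2[OF s uh, where J = ?K])
          fix y assume y: "y \<in> Y ?s"
          have uG: "upd \<sigma> y \<in> G'" unfolding G'_def using s y by force
          show "length (fst x) + length (snd x) \<le> M \<kappa>" if x: "x \<in> set_pmf (?K y)" for x
          proof -
            obtain w where w: "w \<in> set_pmf (J (upd \<sigma> y))"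
              "x = (owners_view n C (vapp v w) @ v (Server i) @ pre z i, post (pick i y) @ w (Server i))"
              using x by auto
            have "length (owners_view n C (vapp v w)) + length (v (Server i)) + length (w (Server i)) = vlen n C v + vlen n C w"
              using vlen_vapp[of n C v w] vlen_split'[of n "vapp v w"] by simp
            then show ?thesis using J(1)[OF uG w(1)] v b[OF s y] by (simp add: w(2) M_def)
          qed
          have "adversary_view n C (vapp (?ob z tr y v) w) = (owners_view n C (vapp v w) @ v (Server i) @ pre z i) @
              enc_bits (pick i tr) @ (post (pick i y) @ w (Server i))" for tr w
          proof -
            have "owners_view n C (vapp (?ob z tr y v) w) = owners_view n C (vapp v w)"
              unfolding owners_view_def by (rule arg_cong[where f = concat]) (auto simp: observe_def)
            then show ?thesis by (simp add: adversary_view_eq' observe_def)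
          qed
          then show "?h z (tr, y) = E (?K y) (\<lambda>x. acc A \<kappa> (fst x @ enc_bits (pick i tr) @ snd x))" for tr
            by (simp add: J(2)[OF uG])
        qed
        then show ?thesis by simp
      qed
      then show ?thesis
        unfolding E_call_phase[OF uW] by (intro E_diff_le unit_fun_E uh)
    qed
    then show ?thesis using m1 by blast
  qed
  show "\<exists>G' L \<mu>. finite G' \<and> Ball G' same_shape \<and> polyb L \<and> negligible \<mu> \<and>
        (\<forall>\<kappa> \<sigma>. \<sigma> \<in> G \<longrightarrow> (\<forall>v. (\<forall>e\<in>set_pmf (?I \<kappa> (\<sigma>, v)). fst e \<in> G' \<and> vlen n C (snd e) \<le> vlen n C v + L \<kappa>) \<and>
            measure_pmf.prob (?R \<kappa> (\<sigma>, v)) {e. \<not> (fst e \<in> G' \<and> vlen n C (snd e) \<le> vlen n C v + L \<kappa>)} \<le> \<mu> \<kappa>)) \<and>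
        (\<forall>L'. polyb L' \<longrightarrow> (\<exists>\<mu>'. negligible \<mu>' \<and> (\<forall>\<kappa> \<sigma> v W. \<sigma> \<in> G \<longrightarrow> vlen n C v \<le> L' \<kappa> \<longrightarrow>
            future_test A n C \<kappa> G' W (L' \<kappa>) \<longrightarrow> \<bar>E (?R \<kappa> (\<sigma>, v)) W - E (?I \<kappa> (\<sigma>, v)) W\<bar> \<le> \<mu>' \<kappa>)))"
  proof (intro exI conjI)
    show "finite G'" "Ball G' same_shape" "polyb L" "negligible \<mu>" by fact+
    show "\<forall>\<kappa> \<sigma>. \<sigma> \<in> G \<longrightarrow> (\<forall>v. (\<forall>e\<in>set_pmf (?I \<kappa> (\<sigma>, v)). fst e \<in> G' \<and> vlen n C (snd e) \<le> vlen n C v + L \<kappa>) \<and>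
            measure_pmf.prob (?R \<kappa> (\<sigma>, v)) {e. \<not> (fst e \<in> G' \<and> vlen n C (snd e) \<le> vlen n C v + L \<kappa>)} \<le> \<mu> \<kappa>)"
      by (intro allI impI conjI ballI ideal real)
    show "\<forall>L'. polyb L' \<longrightarrow> (\<exists>\<mu>'. negligible \<mu>' \<and> (\<forall>\<kappa> \<sigma> v W. \<sigma> \<in> G \<longrightarrow> vlen n C v \<le> L' \<kappa> \<longrightarrow>
            future_test A n C \<kappa> G' W (L' \<kappa>) \<longrightarrow> \<bar>E (?R \<kappa> (\<sigma>, v)) W - E (?I \<kappa> (\<sigma>, v)) W\<bar> \<le> \<mu>' \<kappa>))"
      by (intro allI impI indist)
  qed
qed

text \<open>For the upload, which is the same in both worlds. As it ignores \<open>\<kappa>\<close>,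
  the growth of the views is bounded by a constant.\<close>

lemma good_same_phase:
  assumes ao: "append_only K" and \<kappa>: "\<And>\<kappa>. K \<kappa> = K 0"
    and fin: "\<And>\<sigma>. finite (set_pmf (K 0 (\<sigma>, \<lambda>_. [])))"
    and sh: "\<And>\<sigma> e. same_shape \<sigma> \<Longrightarrow> e \<in> set_pmf (K 0 (\<sigma>, \<lambda>_. [])) \<Longrightarrow> same_shape (fst e)"
  shows "good_phase A n C K K"
  unfolding good_phase_def
proof (intro conjI allI impI ao)
  fix G assume G: "finite G" "Ball G same_shape"
  define U where "U = (\<Union>\<sigma>\<in>G. set_pmf (K 0 (\<sigma>, \<lambda>_. [])))"
  have finU: "finite U" using G fin by (simp add: U_def)
  define L where "L = (\<Sum>e\<in>U. vlen n C (snd e))"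
  have ideal: "fst e \<in> fst ` U \<and> vlen n C (snd e) \<le> vlen n C v + L"
    if \<sigma>: "\<sigma> \<in> G" and e: "e \<in> set_pmf (K \<kappa> (\<sigma>, v))" for \<kappa> \<sigma> v e
  proof -
    obtain \<sigma>' w where w: "(\<sigma>', w) \<in> set_pmf (K 0 (\<sigma>, \<lambda>_. []))" "e = (\<sigma>', vapp v w)"
    proof -
      have "e \<in> set_pmf (K 0 (\<sigma>, v))" using e by (simp only: \<kappa>[of \<kappa>])
      then have "e \<in> set_pmf (map_pmf (\<lambda>(\<sigma>', w). (\<sigma>', vapp v w)) (K 0 (\<sigma>, \<lambda>_. [])))"
        by (subst (asm) append_onlyD[OF ao])
      then show ?thesis using that by auto
    qed
    then have U: "(\<sigma>', w) \<in> U" using \<sigma> by (auto simp: U_def)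
    have "vlen n C w \<le> L" using member_le_sum[OF U _ finU, of "\<lambda>e. vlen n C (snd e)"] by (simp add: L_def)
    then show ?thesis using U w(2) by (force simp: vlen_vapp)
  qed
  show "\<exists>G' L \<mu>. finite G' \<and> Ball G' same_shape \<and> polyb L \<and> negligible \<mu> \<and>
        (\<forall>\<kappa> \<sigma>. \<sigma> \<in> G \<longrightarrow> (\<forall>v. (\<forall>e\<in>set_pmf (K \<kappa> (\<sigma>, v)). fst e \<in> G' \<and> vlen n C (snd e) \<le> vlen n C v + L \<kappa>) \<and>
            measure_pmf.prob (K \<kappa> (\<sigma>, v)) {e. \<not> (fst e \<in> G' \<and> vlen n C (snd e) \<le> vlen n C v + L \<kappa>)} \<le> \<mu> \<kappa>)) \<and>
        (\<forall>L'. polyb L' \<longrightarrow> (\<exists>\<mu>'. negligible \<mu>' \<and> (\<forall>\<kappa> \<sigma> v W. \<sigma> \<in> G \<longrightarrow> vlen n C v \<le> L' \<kappa> \<longrightarrow>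
            future_test A n C \<kappa> G' W (L' \<kappa>) \<longrightarrow> \<bar>E (K \<kappa> (\<sigma>, v)) W - E (K \<kappa> (\<sigma>, v)) W\<bar> \<le> \<mu>' \<kappa>)))"
  proof (intro exI conjI)
    show "finite (fst ` U)" using finU by simp
    show "Ball (fst ` U) same_shape"
    proof
      fix x assume "x \<in> fst ` U"
      then obtain e \<sigma> where "\<sigma> \<in> G" "e \<in> set_pmf (K 0 (\<sigma>, \<lambda>_. []))" "x = fst e"
        unfolding U_def by blast
      then show "same_shape x" using sh[of \<sigma> e] G(2) by blast
    qed
    show "polyb (\<lambda>_. L)" "negligible (\<lambda>_. 0)" by auto
    have "measure_pmf.prob (K \<kappa> (\<sigma>, v)) {e. \<not> (fst e \<in> fst ` U \<and> vlen n C (snd e) \<le> vlen n C v + L)} \<le> 0"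
      if "\<sigma> \<in> G" for \<kappa> \<sigma> v
    proof -
      have "E (K \<kappa> (\<sigma>, v)) (\<lambda>e. of_bool (\<not> (fst e \<in> fst ` U \<and> vlen n C (snd e) \<le> vlen n C v + L))) = E (K \<kappa> (\<sigma>, v)) (\<lambda>_. 0)"
        by (rule E_cong) (use ideal[OF that] in auto)
      then show ?thesis unfolding prob_as_E by simp
    qed
    then show "\<forall>\<kappa> \<sigma>. \<sigma> \<in> G \<longrightarrow> (\<forall>v. (\<forall>e\<in>set_pmf (K \<kappa> (\<sigma>, v)). fst e \<in> fst ` U \<and> vlen n C (snd e) \<le> vlen n C v + L) \<and>
            measure_pmf.prob (K \<kappa> (\<sigma>, v)) {e. \<not> (fst e \<in> fst ` U \<and> vlen n C (snd e) \<le> vlen n C v + L)} \<le> 0)"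
      by (intro allI impI conjI ballI ideal)
    show "\<forall>L'. polyb L' \<longrightarrow> (\<exists>\<mu>'. negligible \<mu>' \<and> (\<forall>\<kappa> \<sigma> v W. \<sigma> \<in> G \<longrightarrow> vlen n C v \<le> L' \<kappa> \<longrightarrow>
            future_test A n C \<kappa> (fst ` U) W (L' \<kappa>) \<longrightarrow> \<bar>E (K \<kappa> (\<sigma>, v)) W - E (K \<kappa> (\<sigma>, v)) W\<bar> \<le> \<mu>' \<kappa>))"
      by (intro allI impI exI[of _ "\<lambda>_. 0"]) simp
  qed
qed

end


section \<open>Encodings and supports\<close>

lemma enc_list_simps [simp]: "enc_list e [] = [False]" "enc_list e (x # xs) = True # e x @ enc_list e xs"
  by (simp_all add: enc_list_def)

text \<open>A leading \<open>True\<close> announces an element and \<open>False\<close> ends the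
  list, so self-delimiting elements give a self-delimiting list.\<close>

lemma inj_enc_list: "inj_enc e \<Longrightarrow> inj_enc (enc_list e)"
  unfolding inj_enc_def
proof (intro allI)
  fix xs ys :: "'a list" and r s :: "bool list"
  assume e: "\<forall>x y r s. e x @ r = e y @ s \<longrightarrow> x = y \<and> r = s"
  show "enc_list e xs @ r = enc_list e ys @ s \<longrightarrow> xs = ys \<and> r = s"
  proof (induction xs arbitrary: ys)
    case Nil
    show ?case by (cases ys) auto
  next
    case (Cons x xs)
    show ?case
    proof (cases ys)
      case (Cons y ys')
      then show ?thesis using e[rule_format, of x "enc_list e xs @ r" y "enc_list e ys' @ s"] Cons.IH[of ys']
        by auto
    qed simp
  qed
qed

lemma inj_enc_zm: "inj_enc enc_zm"
  unfolding inj_enc_def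
proof (intro allI impI)
  fix x y :: zm and r s :: "bool list"
  assume "enc_zm x @ r = enc_zm y @ s"
  then have *: "map (bit x) [0..<32] = map (bit y) [0..<32]" "r = s" by (simp_all add: enc_zm_def)
  have "x = y"
  proof (rule bit_word_eqI)
    fix n :: nat assume "n < LENGTH(32)"
    then show "bit x n = bit y n" using *(1) by simp
  qed
  then show "x = y \<and> r = s" using * by simp
qed

lemma inj_enc_nat: "inj_enc enc_nat"
  unfolding inj_enc_def
proof (intro allI impI)
  fix x y :: nat and r s :: "bool list"
  assume a: "enc_nat x @ r = enc_nat y @ s"
  then have "takeWhile id (enc_nat x @ r) = takeWhile id (enc_nat y @ s)" by simp
  then have "length (replicate x True) = length (replicate y True)" unfolding takeWhile_enc_nat by simp
  then show "x = y \<and> r = s" using a by simp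
qed

lemma inj_enc_tuples: "inj_enc enc_tuples"
  unfolding enc_tuples_def[abs_def] by (intro inj_enc_list inj_enc_zm)

lemma inj_enc_transform_out: "inj_enc enc_transform_out"
  unfolding inj_enc_def
  by (auto simp: inj_encD[OF inj_enc_tuples] inj_encD[OF inj_enc_zm])

lemma inj_enc_shrink_out: "inj_enc enc_shrink_out"
  unfolding inj_enc_def
  by (auto simp: inj_encD[OF inj_enc_tuples] inj_encD[OF inj_enc_zm] inj_encD[OF inj_enc_nat])

section \<open>Supports of sharings and volumes\<close>

abbreviation unif :: "nat list \<Rightarrow> tuple list pmf" where
  "unif L \<equiv> pmf_of_set {R. map length R = L}"

lemma finite_shape: "finite {R :: tuple list. map length R = L}"
proof (induction L)
  case (Cons l L)
  have "{R :: tuple list. map length R = l # L} \<subseteq> (\<lambda>(a, b). a # b) ` ({x. length x = l} \<times> {R. map length R = L})"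
    by (auto simp: map_eq_Cons_conv)
  moreover have "finite {x :: zm list. length x = l}"
    using finite_lists_length_eq[of "UNIV :: zm set" l] by simp
  ultimately show ?case using Cons by (meson finite_SigmaI finite_imageI finite_subset)
qed simp

lemma shape_nonempty: "{R :: tuple list. map length R = L} \<noteq> {}"
proof -
  have "map (\<lambda>l. replicate l 0) L \<in> {R :: tuple list. map length R = L}" by (simp add: o_def)
  then show ?thesis by blast
qed

lemma set_unif [simp]: "set_pmf (unif L) = {R. map length R = L}"
  by (rule set_pmf_of_set[OF shape_nonempty finite_shape])

lemma map2_xor_length: "map length X = map length R \<Longrightarrow> map length (xor_tuples X R) = map length X"
proof (induction X arbitrary: R)
  case (Cons x X)
  then obtain r R' where "R = r # R'" "length x = length r" "map length X = map length R'"
    by (auto simp: Cons_eq_map_conv)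
  with Cons.IH[of R'] show ?case by (simp add: xor_tuples_def)
qed (simp add: xor_tuples_def)

lemma finite_share: "finite (set_pmf (share X))"
  by (simp add: share_def finite_shape)

lemma share_shape: "p \<in> set_pmf (share X) \<Longrightarrow> map length (fst p) = map length X \<and> map length (snd p) = map length X"
  by (auto simp: share_def map2_xor_length)

lemma finite_share_each: "finite (set_pmf (share_each Xs))"
  by (induction Xs) (auto simp: finite_share)

lemma share_each_shape: "ps \<in> set_pmf (share_each Xs) \<Longrightarrow>
   map (map length \<circ> fst) ps = map (map length) Xs \<and> map (map length \<circ> snd) ps = map (map length) Xs"
proof (induction Xs arbitrary: ps)
  case (Cons X Xs)
  from Cons.prems obtain p ps' where p: "p \<in> set_pmf (share X)" "ps' \<in> set_pmf (share_each Xs)" "ps = p # ps'"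
    by auto
  from Cons.IH[OF p(2)] share_shape[OF p(1)] show ?case by (simp add: p(3))
qed simp

text \<open>Clipping at the cache length confines the noisy volume to finitely many values. This
  gives Shrink the finite set of outputs that \<open>call_indist\<close> relies on.\<close>

lemma set_volume:
  assumes "\<beta> > 0" shows "set_pmf (volume \<beta> c len) \<subseteq> {..len}"
proof
  fix x assume x: "x \<in> set_pmf (volume \<beta> c len)"
  show "x \<in> {..len}"
  proof (rule ccontr)
    assume n: "x \<notin> {..len}"
    have "(\<lambda>y. min len (nat \<lfloor>real c + y\<rfloor>)) \<in> measurable (laplace \<beta>) (count_space UNIV)"
      by (simp add: laplace_def)
    then have "pmf (volume \<beta> c len) x = measure (laplace \<beta>) ((\<lambda>y. min len (nat \<lfloor>real c + y\<rfloor>)) -` {x} \<inter> space (laplace \<beta>))"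
      unfolding pmf.rep_eq measure_pmf_volume[OF assms] by (intro measure_distr) auto
    also have "(\<lambda>y. min len (nat \<lfloor>real c + y\<rfloor>)) -` {x} = {}" using n by auto
    finally show False using x by (simp add: set_pmf_iff)
  qed
qed

lemma finite_volume: "\<beta> > 0 \<Longrightarrow> finite (set_pmf (volume \<beta> c len))"
  using finite_subset[OF set_volume] by blast


section \<open>The phases of the protocol\<close>

definition zm2 :: "(zm \<times> zm) pmf" where
  "zm2 = pair_pmf (pmf_of_set UNIV) (pmf_of_set UNIV)"

definition upload_phase :: "params \<Rightarrow> gdb \<Rightarrow> nat \<Rightarrow> phase" where
  "upload_phase pp D t \<kappa> = upload pp D t"

definition transform_phase :: "params \<Rightarrow> (transform_in, transform_out) two_pc \<Rightarrow> phase" where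
  "transform_phase pp \<pi> = call_phase \<pi> zm2
     (\<lambda>(s0, s1) (z0, z1). ((map snd (usable pp s0), counter s0, z0), (map snd (usable pp s1), counter s1, z1)))
     (\<lambda>(s0, s1) (y0, y1). (after_transform pp y0 s0, after_transform pp y1 s1))
     (\<lambda>z j. enc_zm (pick j z)) enc_transform_out"

definition shrink_phase :: "(shrink_in, shrink_out) two_pc \<Rightarrow> phase" where
  "shrink_phase \<pi> = call_phase \<pi> zm2
     (\<lambda>(s0, s1) (z0, z1). ((cache s0, counter s0, z0), (cache s1, counter s1, z1)))
     (\<lambda>(s0, s1) (y0, y1). (after_shrink y0 s0, after_shrink y1 s1))
     (\<lambda>z j. enc_zm (pick j z)) enc_shrink_out"

text \<open>A flush re-shares no counter, so a constant pair takes the place of the random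
  contributions.\<close>

definition flush_phase :: "(tuple list, tuple list) two_pc \<Rightarrow> phase" where
  "flush_phase \<pi> = call_phase \<pi> (return_pmf (0, 0))
     (\<lambda>(s0, s1) z. (cache s0, cache s1))
     (\<lambda>(s0, s1) (y0, y1). (after_flush y0 s0, after_flush y1 s1))
     (\<lambda>z j. []) enc_tuples"

lemma transform_phase: "transform pp \<pi> \<kappa> = transform_phase pp \<pi> \<kappa>"
  by (rule ext) (simp add: transform_def transform_phase_def call_phase_def zm2_def pair_pmf_def
      bind_assoc_pmf bind_return_pmf case_prod_unfold)

lemma shrink_phase: "shrink_timer \<pi> \<kappa> = shrink_phase \<pi> \<kappa>"
  by (rule ext) (simp add: shrink_timer_def shrink_phase_def call_phase_def zm2_def pair_pmf_def
      bind_assoc_pmf bind_return_pmf case_prod_unfold)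

lemma flush_phase: "flush_cache \<pi> \<kappa> = flush_phase \<pi> \<kappa>"
  by (rule ext) (simp add: flush_cache_def flush_phase_def call_phase_def
      bind_assoc_pmf bind_return_pmf case_prod_unfold)

definition step_phases :: "params \<Rightarrow> (transform_in, transform_out) two_pc \<Rightarrow> (shrink_in, shrink_out) two_pc \<Rightarrow>
   (tuple list, tuple list) two_pc \<Rightarrow> gdb \<Rightarrow> nat \<Rightarrow> phase list" where
  "step_phases pp \<pi>T \<pi>S \<pi>F D t = [upload_phase pp D t, transform_phase pp \<pi>T] @
     (if interval pp dvd t then [shrink_phase \<pi>S] else []) @
     (if flush_interval pp dvd t then [flush_phase \<pi>F] else [])"

lemma run_phases_append: "run_phases (Ks @ Ls) \<kappa> e = bind_pmf (run_phases Ks \<kappa> e) (run_phases Ls \<kappa>)"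
proof (induction Ks arbitrary: e)
  case (Cons K Ks)
  show ?case by (simp add: Cons.IH[abs_def] bind_assoc_pmf)
qed (simp add: bind_return_pmf)

lemma time_step_phases: "time_step pp \<pi>T \<pi>S \<pi>F \<kappa> D t e = run_phases (step_phases pp \<pi>T \<pi>S \<pi>F D t) \<kappa> e"
  by (auto simp: time_step_def step_phases_def upload_phase_def transform_phase shrink_phase flush_phase
      run_phases_def bind_return_pmf bind_return_pmf')

lemma run_eq_phases:
  "run pp \<pi>T \<pi>S \<pi>F \<kappa> N D =
     bind_pmf start (run_phases (concat (map (step_phases pp \<pi>T \<pi>S \<pi>F D) [1..<Suc N])) \<kappa>)"
proof (induction N)
  case (Suc N)
  have "run_phases (concat (map (step_phases pp \<pi>T \<pi>S \<pi>F D) [1..<Suc (Suc N)])) \<kappa> e =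
     bind_pmf (run_phases (concat (map (step_phases pp \<pi>T \<pi>S \<pi>F D) [1..<Suc N])) \<kappa> e) (time_step pp \<pi>T \<pi>S \<pi>F \<kappa> D (Suc N))" for e
    by (simp add: run_phases_append time_step_phases[abs_def])
  then show ?case by (simp add: Suc.IH bind_assoc_pmf)
qed (simp add: bind_return_pmf')

lemma upload_eq:
  "upload pp D t (\<sigma>, v) = map_pmf (\<lambda>ps. let B = (concat (map fst ps), concat (map snd ps)) in
       ((receive pp (fst B) (fst \<sigma>), receive pp (snd B) (snd \<sigma>)),
        vapp v (\<lambda>p. (case p of
             Owner j \<Rightarrow> enc_tuples (owner_batch pp D t j) @
                        enc_tuples (fst (ps ! j)) @ enc_tuples (snd (ps ! j))
           | Server i \<Rightarrow> enc_tuples (pick i B)))))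
     (share_each (map (owner_batch pp D t) [0..<num_owners pp]))"
  by (simp add: upload_def map_pmf_def case_prod_unfold Let_def)

lemma append_only_upload: "append_only (upload_phase pp D t)"
  unfolding append_only_def upload_phase_def upload_eq
  by (simp add: map_pmf_comp Let_def)

section \<open>Equal public shapes are preserved\<close>

lemma usable_shape:
  "map (\<lambda>(r, B). (r, map length B)) (usable pp s) =
     filter (\<lambda>(r, B). trunc pp \<le> r) (map (\<lambda>(r, B). (r, map length B)) (store s))"
  by (simp add: usable_def filter_map o_def case_prod_unfold)

lemma same_shape_transform:
  assumes sh: "same_shape (s0, s1)"
    and y: "y \<in> set_pmf (transform_fun pp q (map snd (usable pp s0), c0, z0) (map snd (usable pp s1), c1, z1))"
  shows "same_shape (after_transform pp (fst y) s0, after_transform pp (snd y) s1)"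
proof -
  have u: "map (\<lambda>(r, B). (r, map length B)) (usable pp s0) = map (\<lambda>(r, B). (r, map length B)) (usable pp s1)"
    using sh unfolding usable_shape by simp
  have "map length (fst (fst y)) = map length (fst (snd y))"
    using y by (auto simp: case_prod_unfold Let_def dest!: share_shape)
  moreover have "map (\<lambda>(r, B). (r, map length B)) (map (\<lambda>(r, B). (r - trunc pp, B)) (usable pp s0)) =
     map (\<lambda>(r, B). (r, map length B)) (map (\<lambda>(r, B). (r - trunc pp, B)) (usable pp s1))"
    using arg_cong[OF u, of "map (\<lambda>(r, l). (r - trunc pp, l))"] by (simp add: o_def case_prod_unfold)
  ultimately show ?thesis using sh by (simp add: after_transform_def)
qed

lemma same_shape_shrink:
  assumes sh: "same_shape (s0, s1)"
    and y: "y \<in> set_pmf (shrink_fun pp (cache s0, c0, z0) (cache s1, c1, z1))"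
  shows "same_shape (after_shrink (fst y) s0, after_shrink (snd y) s1)"
proof -
  obtain n V0 Y0 r0 n' V1 Y1 r1 where yy: "y = ((n, V0, Y0, r0), (n', V1, Y1, r1))" by (metis prod.exhaust)
  have "map length Y0 = map length Y1"
    using y by (auto simp: yy case_prod_unfold Let_def dest!: share_shape)
  then show ?thesis using sh by (simp add: yy)
qed

section \<open>The protocol against its idealization for one corrupted server\<close>

context
  fixes pp :: params and q :: query
    and \<pi>T :: "(transform_in, transform_out) two_pc"
    and \<pi>S :: "(shrink_in, shrink_out) two_pc"
    and \<pi>F :: "(tuple list, tuple list) two_pc"
    and i :: server and SimT SimS SimF :: com
    and A :: "com \<times> (nat \<Rightarrow> bool list)" and C :: "party set"
  assumes pos: "eps pp > 0" "budget pp > 0"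
    and secT: "secure_2pc transform_shape enc_transform_in enc_transform_out (transform_fun pp q) \<pi>T"
    and secS: "secure_2pc shrink_shape enc_shrink_in enc_shrink_out (shrink_fun pp) \<pi>S"
    and secF: "secure_2pc (map length) enc_tuples enc_tuples (flush_fun pp) \<pi>F"
    and simT: "simulates i transform_shape enc_transform_in enc_transform_out (transform_fun pp q) \<pi>T SimT"
    and simS: "simulates i shrink_shape enc_shrink_in enc_shrink_out (shrink_fun pp) \<pi>S SimS"
    and simF: "simulates i (map length) enc_tuples enc_tuples (flush_fun pp) \<pi>F SimF"
    and A: "adversary A" and C: "Server i \<in> C" "\<And>j. j \<noteq> i \<Longrightarrow> Server j \<notin> C"
begin

abbreviation "idT \<equiv> ideal_2pc i enc_transform_in enc_transform_out (transform_fun pp q) SimT"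
abbreviation "idS \<equiv> ideal_2pc i enc_shrink_in enc_shrink_out (shrink_fun pp) SimS"
abbreviation "idF \<equiv> ideal_2pc i enc_tuples enc_tuples (flush_fun pp) SimF"

lemma good_upload: "good_phase A (num_owners pp) C (upload_phase pp D t) (upload_phase pp D t)"
proof (rule good_same_phase[OF A C append_only_upload])
  show "upload_phase pp D t \<kappa> = upload_phase pp D t 0" for \<kappa> by (simp add: upload_phase_def)
  show "finite (set_pmf (upload_phase pp D t 0 (\<sigma>, \<lambda>_. [])))" for \<sigma>
    unfolding upload_phase_def upload_eq set_map_pmf by (intro finite_imageI finite_share_each)
  fix \<sigma> e assume sh: "same_shape \<sigma>" and "e \<in> set_pmf (upload_phase pp D t 0 (\<sigma>, \<lambda>_. []))"
  then obtain ps where ps: "ps \<in> set_pmf (share_each (map (owner_batch pp D t) [0..<num_owners pp]))"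
    "fst e = (receive pp (concat (map fst ps)) (fst \<sigma>), receive pp (concat (map snd ps)) (snd \<sigma>))"
    by (auto simp: upload_phase_def upload_eq Let_def)
  have "map length (concat (map fst ps)) = map length (concat (map snd ps))"
    using share_each_shape[OF ps(1)] by (simp add: map_concat)
  then show "same_shape (fst e)" using sh by (cases \<sigma>) (simp add: ps(2) receive_def)
qed

lemma good_transform: "good_phase A (num_owners pp) C (transform_phase pp \<pi>T) (transform_phase pp idT)"
  unfolding transform_phase_def
proof (rule good_call_phase[OF A C secT simT inj_enc_transform_out])
  show "finite (set_pmf zm2)" by simp
  show "finite (set_pmf (transform_fun pp q x0 x1))" for x0 x1
    by (cases x0; cases x1) (auto simp: Let_def finite_share)
  fix \<sigma> :: states assume sh: "same_shape \<sigma>"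
  obtain s0 s1 where \<sigma>: "\<sigma> = (s0, s1)" by force
  have u: "map (\<lambda>(r, B). (r, map length B)) (usable pp s0) = map (\<lambda>(r, B). (r, map length B)) (usable pp s1)"
    using sh unfolding usable_shape by (simp add: \<sigma>)
  fix z :: "zm \<times> zm"
  let ?inp = "(\<lambda>(s0, s1) (z0, z1). ((map snd (usable pp s0), counter s0, z0), (map snd (usable pp s1), counter s1, z1))) \<sigma> z"
  have "map (snd \<circ> (\<lambda>(r, B). (r, map length B))) (usable pp s0) = map (snd \<circ> (\<lambda>(r, B). (r, map length B))) (usable pp s1)"
    using u unfolding map_map[symmetric] by simp
  then show "transform_shape (fst ?inp) = transform_shape (snd ?inp)"
    by (simp add: \<sigma> case_prod_unfold o_def)
  fix y assume "y \<in> set_pmf (transform_fun pp q (fst ?inp) (snd ?inp))"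
  then show "same_shape ((\<lambda>(s0, s1) (y0, y1). (after_transform pp y0 s0, after_transform pp y1 s1)) \<sigma> y)"
    using same_shape_transform[of s0 s1 y pp q _ "fst z" _ "snd z"] sh by (simp add: \<sigma> case_prod_unfold)
qed

lemma good_shrink: "good_phase A (num_owners pp) C (shrink_phase \<pi>S) (shrink_phase idS)"
  unfolding shrink_phase_def
proof (rule good_call_phase[OF A C secS simS inj_enc_shrink_out])
  have "real (budget pp) / eps pp > 0" using pos by simp
  then show "finite (set_pmf (shrink_fun pp x0 x1))" for x0 x1
    by (cases x0; cases x1) (auto simp: Let_def finite_share finite_volume)
  show "finite (set_pmf zm2)" by simp
  fix \<sigma> :: states assume sh: "same_shape \<sigma>"
  obtain s0 s1 where \<sigma>: "\<sigma> = (s0, s1)" by force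
  fix z :: "zm \<times> zm"
  let ?inp = "(\<lambda>(s0, s1) (z0, z1). ((cache s0, counter s0, z0), (cache s1, counter s1, z1))) \<sigma> z"
  show "shrink_shape (fst ?inp) = shrink_shape (snd ?inp)"
    using sh by (simp add: \<sigma> case_prod_unfold)
  fix y assume "y \<in> set_pmf (shrink_fun pp (fst ?inp) (snd ?inp))"
  then show "same_shape ((\<lambda>(s0, s1) (y0, y1). (after_shrink y0 s0, after_shrink y1 s1)) \<sigma> y)"
    using same_shape_shrink[of s0 s1 y pp _ "fst z" _ "snd z"] sh by (simp add: \<sigma> case_prod_unfold)
qed

lemma good_flush: "good_phase A (num_owners pp) C (flush_phase \<pi>F) (flush_phase idF)"
  unfolding flush_phase_def
proof (rule good_call_phase[OF A C secF simF inj_enc_tuples])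
  show "finite (set_pmf (flush_fun pp x0 x1))" for x0 x1 by (simp add: flush_fun_def finite_share)
  show "finite (set_pmf (return_pmf (0, 0)))" by simp
qed (auto simp: after_flush_def)

lemma incshrink_hybrid:
  "\<exists>\<mu>. negligible \<mu> \<and> (\<forall>\<kappa>.
    \<bar>prob_one A \<kappa> (map_pmf (adversary_view (num_owners pp) C) (incshrink_timer pp \<pi>T \<pi>S \<pi>F \<kappa> N D)) -
     prob_one A \<kappa> (map_pmf (adversary_view (num_owners pp) C) (incshrink_timer pp idT idS idF \<kappa> N D))\<bar> \<le> \<mu> \<kappa>)"
proof -
  let ?n = "num_owners pp"
  \<comment> \<open>Which phases a step contains depends on the time alone, so the real and the
    ideal list have equal length and can be paired.\<close>
  define Ps where "Ps = concat (map (\<lambda>t. zip (step_phases pp \<pi>T \<pi>S \<pi>F D t) (step_phases pp idT idS idF D t)) [1..<Suc N])"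
  have len: "length (step_phases pp \<pi>T \<pi>S \<pi>F D t) = length (step_phases pp idT idS idF D t)" for t
    by (simp add: step_phases_def)
  have fst: "map fst Ps = concat (map (step_phases pp \<pi>T \<pi>S \<pi>F D) [1..<Suc N])"
    unfolding Ps_def map_concat map_map o_def by (simp only: map_fst_zip[OF len])
  have snd: "map snd Ps = concat (map (step_phases pp idT idS idF D) [1..<Suc N])"
    unfolding Ps_def map_concat map_map o_def by (simp only: map_snd_zip[OF len])
  have good: "good_phase A ?n C (fst P) (snd P)" if P: "P \<in> set Ps" for P
    using P good_upload good_transform good_shrink good_flush
    by (auto simp: Ps_def step_phases_def split: if_splits)
  let ?G = "fst ` set_pmf start"
  have "finite (set_pmf start)" by (auto simp: start_def share_zm_def)
  then have G: "finite ?G" "finite (set_pmf start)" by auto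
  have "Ball ?G same_shape" by (auto simp: start_def)
  define l where "l = (\<Sum>e\<in>set_pmf start. vlen ?n C (snd e))"
  from hybrid[OF good G(1) \<open>Ball ?G same_shape\<close> polyb_const[of l]]
  obtain \<mu> where \<mu>: "negligible \<mu>" "\<And>\<kappa> \<sigma> v. \<sigma> \<in> ?G \<Longrightarrow> vlen ?n C v \<le> l \<Longrightarrow>
    \<bar>E (run_phases (map fst Ps) \<kappa> (\<sigma>, v)) (accept A ?n C \<kappa>) - E (run_phases (map snd Ps) \<kappa> (\<sigma>, v)) (accept A ?n C \<kappa>)\<bar> \<le> \<mu> \<kappa>"
    by blast
  have p1: "prob_one A \<kappa> (map_pmf (adversary_view ?n C) (incshrink_timer pp \<rho>T \<rho>S \<rho>F \<kappa> N D)) =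
     E start (\<lambda>e. E (run_phases (concat (map (step_phases pp \<rho>T \<rho>S \<rho>F D) [1..<Suc N])) \<kappa> e) (accept A ?n C \<kappa>))"
    for \<rho>T \<rho>S \<rho>F \<kappa>
    unfolding prob_one_E incshrink_timer_def E_map run_eq_phases
    by (subst E_bind) (simp_all add: accept_def[abs_def] unit_acc)
  have "\<bar>prob_one A \<kappa> (map_pmf (adversary_view ?n C) (incshrink_timer pp \<pi>T \<pi>S \<pi>F \<kappa> N D)) -
     prob_one A \<kappa> (map_pmf (adversary_view ?n C) (incshrink_timer pp idT idS idF \<kappa> N D))\<bar> \<le> \<mu> \<kappa>" for \<kappa>
    unfolding p1 fst[symmetric] snd[symmetric]
  proof (rule E_diff_le)
    fix e assume e: "e \<in> set_pmf start"
    have "vlen ?n C (snd e) \<le> l" using member_le_sum[OF e _ G(2), of "\<lambda>e. vlen ?n C (snd e)"] by (simp add: l_def)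
    with \<mu>(2)[of "fst e" "snd e" \<kappa>] e
    show "\<bar>E (run_phases (map fst Ps) \<kappa> e) (accept A ?n C \<kappa>) - E (run_phases (map snd Ps) \<kappa> e) (accept A ?n C \<kappa>)\<bar> \<le> \<mu> \<kappa>"
      by simp
  qed (intro unit_fun_E unit_accept)+
  with \<mu>(1) show ?thesis by blast
qed

end


section \<open>One share is uniformly distributed\<close>

lemma xor_xor_cancel [simp]: "xor (xor a b) b = (a :: zm)" "xor b (xor a b) = a" "xor b (xor b a) = a" "xor (xor b a) b = a"
  by (simp_all add: xor.assoc xor.commute xor.left_commute)

lemma map2_xor_cancel:
  "length x = length r \<Longrightarrow> map2 xor (map2 xor x r) r = (x :: zm list)"
  by (induction x r rule: list_induct2) auto

lemma map2_xor_commute: "length x = length r \<Longrightarrow> map2 xor x r = map2 xor r (x :: zm list)"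
  by (induction x r rule: list_induct2) (auto simp: xor.commute)

lemma xor_tuples_Cons [simp]: "xor_tuples (x # X) (r # R) = map2 xor x r # xor_tuples X R"
  and xor_tuples_Nil [simp]: "xor_tuples [] R = []" "xor_tuples X [] = []"
  by (simp_all add: xor_tuples_def)

lemma shape_induct [consumes 1, case_names Nil Cons]:
  assumes "map length (X :: 'a list list) = map length (R :: 'b list list)" "P [] []"
    "\<And>x X r R. length x = length r \<Longrightarrow> map length X = map length R \<Longrightarrow> P X R \<Longrightarrow> P (x # X) (r # R)"
  shows "P X R"
proof -
  have "length X = length R" using arg_cong[OF assms(1), of length] by simp
  from this assms(1) show ?thesis by (induction X R rule: list_induct2) (auto intro: assms(2,3))
qed

lemma xor_tuples_cancel: "map length X = map length R \<Longrightarrow> xor_tuples (xor_tuples X R) R = X"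
  by (induction X R rule: shape_induct) (auto simp: map2_xor_cancel)

lemma xor_tuples_commute: "map length X = map length R \<Longrightarrow> xor_tuples X R = xor_tuples R X"
  by (induction X R rule: shape_induct) (auto simp: map2_xor_commute)

lemma xor_tuples_append:
  "map length X = map length R \<Longrightarrow> xor_tuples (X @ X') (R @ R') = xor_tuples X R @ xor_tuples X' R'"
  by (induction X R rule: shape_induct) auto

text \<open>The sharing of \<open>X\<close> in which server \<open>i\<close> holds the mask
  \<open>R\<close>: secret sharing from the point of view of the corrupted server.\<close>

fun mk :: "server \<Rightarrow> tuple list \<Rightarrow> tuple list \<Rightarrow> tuple list \<times> tuple list" where
  "mk S0 X R = (R, xor_tuples X R)"
| "mk S1 X R = (xor_tuples X R, R)"

lemma pick_mk [simp]: "pick i (mk i X R) = R"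
  by (cases i) auto

lemma xor_mk: "map length X = map length R \<Longrightarrow> xor_tuples (fst (mk i X R)) (snd (mk i X R)) = X"
  using xor_tuples_cancel[of X R] xor_tuples_commute[of "xor_tuples X R" R]
  by (cases i) (auto simp: map2_xor_length)

lemma unif_xor: "map length X = L \<Longrightarrow> map_pmf (xor_tuples X) (unif L) = unif L"
proof (rule map_pmf_of_set_bij_betw[OF _ shape_nonempty finite_shape])
  assume X: "map length X = L"
  show "bij_betw (xor_tuples X) {R. map length R = L} {R. map length R = L}"
  proof (rule bij_betw_byWitness[where f' = "xor_tuples X"])
    have *: "xor_tuples X (xor_tuples X R) = R" if "map length R = L" for R
    proof -
      have "xor_tuples X (xor_tuples X R) = xor_tuples (xor_tuples R X) X"
        using that X by (metis map2_xor_length xor_tuples_commute)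
      then show ?thesis using that X by (simp add: xor_tuples_cancel)
    qed
    then show "\<forall>R\<in>{R. map length R = L}. xor_tuples X (xor_tuples X R) = R"
      "\<forall>R\<in>{R. map length R = L}. xor_tuples X (xor_tuples X R) = R" by auto
  qed (use X map2_xor_length in auto)
qed

text \<open>\<open>share\<close> gives the mask to \<open>S0\<close>. Translation by
  \<open>X\<close> permutes the masks of a shape, so the mask may equally well be taken to be the
  share of \<open>S1\<close>.\<close>

lemma share_mk: "share X = map_pmf (mk i X) (unif (map length X))"
proof (cases i)
  case S0
  have "mk S0 X = (\<lambda>R. (R, xor_tuples X R))" by (rule ext) simp
  then show ?thesis using S0 by (simp add: share_def)
next
  case S1
  have "share X = map_pmf (\<lambda>R. (R, xor_tuples X R)) (map_pmf (xor_tuples X) (unif (map length X)))"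
    by (simp add: unif_xor share_def)
  also have "\<dots> = map_pmf (mk i X) (unif (map length X))"
    unfolding map_pmf_comp
  proof (rule map_pmf_cong[OF refl])
    fix R assume "R \<in> set_pmf (unif (map length X))"
    then have R: "map length R = map length X" by simp
    have "xor_tuples X (xor_tuples X R) = xor_tuples (xor_tuples R X) X"
      using R by (metis map2_xor_length xor_tuples_commute)
    then show "(xor_tuples X R, xor_tuples X (xor_tuples X R)) = mk i X R"
      using R S1 by (simp add: xor_tuples_cancel)
  qed
  finally show ?thesis .
qed

lemma map_pick_share: "map_pmf (pick i) (share X) = unif (map length X)"
  by (simp add: share_mk[of X i] map_pmf_comp)

fun unif_each :: "nat list list \<Rightarrow> tuple list list pmf" where
  "unif_each [] = return_pmf []"
| "unif_each (L # Ls) = do { R \<leftarrow> unif L; Rs \<leftarrow> unif_each Ls; return_pmf (R # Rs) }"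

lemma set_unif_each: "Rs \<in> set_pmf (unif_each Ls) \<Longrightarrow> map (map length) Rs = Ls"
  by (induction Ls arbitrary: Rs) auto

lemma share_each_mk: "share_each Xs = map_pmf (map2 (mk i) Xs) (unif_each (map (map length) Xs))"
proof (induction Xs)
  case (Cons X Xs)
  show ?case
    by (simp add: Cons.IH share_mk[of X i] bind_map_pmf map_bind_pmf)
qed simp

abbreviation U :: "zm pmf" where "U \<equiv> pmf_of_set UNIV"

lemma U_xor: "map_pmf (\<lambda>z. xor a z) U = U" "map_pmf (\<lambda>z. xor z a) U = U"
proof -
  have "bij_betw (\<lambda>z. xor a z) (UNIV :: zm set) UNIV" "bij_betw (\<lambda>z. xor z a) (UNIV :: zm set) UNIV"
    by (rule bij_betw_byWitness[where f' = "\<lambda>z. xor a z"]; simp)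
       (rule bij_betw_byWitness[where f' = "\<lambda>z. xor z a"]; simp)
  then show "map_pmf (\<lambda>z. xor a z) U = U" "map_pmf (\<lambda>z. xor z a) U = U"
    by (auto intro!: map_pmf_of_set_bij_betw)
qed


section \<open>Rows and caches\<close>

lemma shape_replicate_iff: "map length (X :: tuple list) = replicate m w \<longleftrightarrow> length X = m \<and> (\<forall>x\<in>set X. length x = w)"
proof (induction X arbitrary: m)
  case (Cons x X)
  show ?case by (cases m) (auto simp: Cons.IH)
qed auto

lemma mset_SOME [simp]: "mset (SOME xs. mset xs = M) = M"
  by (rule someI_ex[OF ex_mset])

lemma set_SOME_mset [simp]: "set (SOME xs. mset xs = M) = set_mset M"
  using mset_SOME set_mset_mset by metis

lemma length_SOME_mset [simp]: "length (SOME xs. mset xs = M) = size M"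
  using mset_SOME size_mset by metis

lemma length_padded [simp]: "length (padded n w M) = n"
  by (simp add: padded_def)

lemma padded_shape:
  assumes "\<And>x. x \<in># M \<Longrightarrow> length x = w"
  shows "map length (padded n w M) = replicate n (Suc w)"
  unfolding shape_replicate_iff
proof
  show "\<forall>x\<in>set (padded n w M). length x = Suc w"
    using assms by (auto simp: padded_def real_tuple_def dummy_tuple_def dest!: in_set_takeD)
qed simp

lemma is_real_real [simp]: "is_real (real_tuple x)" and tl_real [simp]: "tl (real_tuple x) = x"
  and is_real_dummy [simp]: "\<not> is_real (dummy_tuple w)"
  by (simp_all add: is_real_def real_tuple_def dummy_tuple_def)

lemma filter_real_padded: "filter is_real (padded n w M) = map real_tuple (take n (SOME xs. mset xs = M))"
proof -
  have "filter is_real (map real_tuple xs) = map real_tuple xs" for xs :: "tuple list"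
    by (induction xs) auto
  then show ?thesis by (simp add: padded_def take_map)
qed

lemma count_padded: "length (filter is_real (padded n w M)) = min n (size M)"
  by (simp add: filter_real_padded)

lemma reals_of_padded: "size M \<le> n \<Longrightarrow> reals_of (padded n w M) = M"
  by (simp add: reals_of_def filter_real_padded o_def)

lemma reals_of_append: "reals_of (X @ Y) = reals_of X + reals_of Y"
  by (simp add: reals_of_def)

lemma reals_of_concat: "reals_of (concat Xs) = (\<Sum>X\<leftarrow>Xs. reals_of X)"
  by (induction Xs) (auto simp: reals_of_append reals_of_def)

lemma sort_cache_shape:
  assumes "map length X = replicate (length X) w"
  shows "map length (sort_cache X) = replicate (length X) w" "length (sort_cache X) = length X"
  using assms unfolding shape_replicate_iff
  by (auto simp: sort_cache_def sum_length_filter_compl)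

text \<open>In a valid database no owner has more records than slots, so padding loses nothing, and
  the owners partition the updates of a step.\<close>

lemma valid_batches:
  assumes "D \<in> valid_dbs pp" "t \<ge> 1"
  shows "reals_of (concat (map (owner_batch pp D t) [0..<num_owners pp])) = image_mset snd (D t)"
    and "j < num_owners pp \<Longrightarrow> map length (owner_batch pp D t j) = replicate (caps pp ! j) (Suc (rec_width pp))"
proof -
  have v: "\<And>u. u \<in># D t \<Longrightarrow> fst u < num_owners pp \<and> length (snd u) = rec_width pp"
    "\<And>j. j < num_owners pp \<Longrightarrow> size {#u \<in># D t. fst u = j#} \<le> caps pp ! j"
    using assms unfolding valid_dbs_def by blast+
  have "(\<Sum>j\<leftarrow>[0..<m]. image_mset snd {#u \<in># D t. fst u = j#}) = image_mset snd {#u \<in># D t. fst u < m#}" for m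
  proof (induction m)
    case (Suc m)
    have "{#u \<in># D t. fst u < Suc m#} = {#u \<in># D t. fst u < m#} + {#u \<in># D t. fst u = m#}"
      by (rule multiset_eqI) auto
    then show ?case using Suc by simp
  qed simp
  moreover have "{#u \<in># D t. fst u < num_owners pp#} = D t"
    using v(1) by (intro filter_mset_eq_conv[THEN iffD2]) auto
  moreover have "map (\<lambda>j. reals_of (owner_batch pp D t j)) [0..<num_owners pp] = map (\<lambda>j. image_mset snd {#u \<in># D t. fst u = j#}) [0..<num_owners pp]"
    using v(2) by (intro map_cong) (auto simp: owner_batch_def intro!: reals_of_padded)
  ultimately show "reals_of (concat (map (owner_batch pp D t) [0..<num_owners pp])) = image_mset snd (D t)"
    by (simp only: reals_of_concat map_map o_def)
  show "map length (owner_batch pp D t j) = replicate (caps pp ! j) (Suc (rec_width pp))" if "j < num_owners pp"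
    unfolding owner_batch_def using v(1) by (intro padded_shape) auto
qed


section \<open>The simulated execution\<close>

text \<open>What the corrupted server sees is recorded symbolically: transcripts of the two-party
  computations depend on the security parameter and are only filled in by the simulator. The batch
  masks are recorded together with their time step.\<close>

datatype tok = Lit "bool list" | Call nat "bool list"

type_synonym masks = "(nat \<times> tuple list list) list"
type_synonym sim_state = "sstate \<times> masks \<times> tok list"

text \<open>The materialized view is only ever appended to and affects nothing that is observed
  later, so it is forgotten.\<close>

definition core :: "sstate \<Rightarrow> sstate" where "core \<sigma> = \<sigma>\<lparr>mview := []\<rparr>"

fun expand :: "nat \<Rightarrow> (nat \<Rightarrow> com) \<Rightarrow> tok list \<Rightarrow> bool list pmf" where
  "expand \<kappa> sims [] = return_pmf []"
| "expand \<kappa> sims (Lit b # ks) = map_pmf (\<lambda>w. b @ w) (expand \<kappa> sims ks)"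
| "expand \<kappa> sims (Call k x # ks) =
     do { v \<leftarrow> exec (sims k) (enc_nat \<kappa> @ x); w \<leftarrow> expand \<kappa> sims ks; return_pmf (enc_bits v @ w) }"

lemma expand_append:
  "expand \<kappa> sims (ks @ ls) = do { v \<leftarrow> expand \<kappa> sims ks; w \<leftarrow> expand \<kappa> sims ls; return_pmf (v @ w) }"
proof (induction ks)
  case (Cons k ks)
  then show ?case
    by (cases k) (simp_all add: map_pmf_def bind_assoc_pmf bind_return_pmf)
qed (simp add: bind_return_pmf bind_return_pmf')

definition batch_shapes :: "params \<Rightarrow> nat list list" where
  "batch_shapes pp = map (\<lambda>j. replicate (caps pp ! j) (Suc (rec_width pp))) [0..<num_owners pp]"

abbreviation row_shape :: "params \<Rightarrow> nat \<Rightarrow> nat list" where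
  "row_shape pp m \<equiv> replicate m (Suc (row_width pp))"

text \<open>The masks are kept because an owner sees both shares of its batches, and these have to
  agree with what the server received.\<close>

definition sim_upload :: "params \<Rightarrow> nat \<Rightarrow> sim_state \<Rightarrow> sim_state pmf" where
  "sim_upload pp t = (\<lambda>(\<sigma>, M, ks). map_pmf (\<lambda>Rs. (receive pp (concat Rs) \<sigma>, M @ [(t, Rs)],
      ks @ [Lit (enc_tuples (concat Rs))])) (unif_each (batch_shapes pp)))"

definition sim_call :: "nat \<Rightarrow> (sstate \<Rightarrow> (zm \<times> 'o) pmf) \<Rightarrow> (sstate \<Rightarrow> zm \<Rightarrow> 'o \<Rightarrow> bool list) \<Rightarrow>
    ('o \<Rightarrow> sstate \<Rightarrow> sstate) \<Rightarrow> (zm \<Rightarrow> bool list) \<Rightarrow> ('o \<Rightarrow> bool list) \<Rightarrow> sim_state \<Rightarrow> sim_state pmf" where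
  "sim_call k d arg upd pre post = (\<lambda>(\<sigma>, M, ks). map_pmf (\<lambda>(z, y).
      (core (upd y \<sigma>), M, ks @ [Lit (pre z), Call k (arg \<sigma> z y), Lit (post y)])) (d \<sigma>))"

definition sim_transform :: "params \<Rightarrow> sim_state \<Rightarrow> sim_state pmf" where
  "sim_transform pp = sim_call 0
     (\<lambda>_. do { z \<leftarrow> U; X \<leftarrow> unif (row_shape pp (out_size pp)); r \<leftarrow> U; return_pmf (z, (X, r)) })
     (\<lambda>\<sigma> z y. enc_transform_in (map snd (usable pp \<sigma>), counter \<sigma>, z) @ enc_transform_out y)
     (after_transform pp) enc_zm enc_transform_out"

text \<open>The count \<open>c\<close> is the only data-dependent quantity in the simulated
  execution. The volume is drawn first, so that the rest is post-processing of it.\<close>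

definition sim_shrink :: "params \<Rightarrow> nat \<Rightarrow> sim_state \<Rightarrow> sim_state pmf" where
  "sim_shrink pp c = sim_call 1
     (\<lambda>\<sigma>. do { n \<leftarrow> volume (real (budget pp) / eps pp) c (length (cache \<sigma>));
        z \<leftarrow> U; V \<leftarrow> unif (row_shape pp (min n (length (cache \<sigma>)))); Y \<leftarrow> unif (row_shape pp (length (cache \<sigma>) - n));
        r \<leftarrow> U; return_pmf (z, (n, V, Y, r)) })
     (\<lambda>\<sigma> z y. enc_shrink_in (cache \<sigma>, counter \<sigma>, z) @ enc_shrink_out y)
     after_shrink enc_zm enc_shrink_out"

definition sim_flush :: "params \<Rightarrow> sim_state \<Rightarrow> sim_state pmf" where
  "sim_flush pp = sim_call 2
     (\<lambda>\<sigma>. map_pmf (\<lambda>V. (0, V)) (unif (row_shape pp (min (flush_size pp) (length (cache \<sigma>))))))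
     (\<lambda>\<sigma> z y. enc_tuples (cache \<sigma>) @ enc_tuples y) after_flush (\<lambda>_. []) enc_tuples"

definition sim_start :: "sim_state pmf" where
  "sim_start = map_pmf (\<lambda>c. (\<lparr>store = [], cache = [], counter = c, mview = []\<rparr>, [], [Lit (enc_zm c)])) U"

definition sim_step :: "params \<Rightarrow> (nat \<Rightarrow> nat) \<Rightarrow> nat \<Rightarrow> sim_state \<Rightarrow> sim_state pmf" where
  "sim_step pp cs t s = do {
     s \<leftarrow> sim_upload pp t s;
     s \<leftarrow> sim_transform pp s;
     s \<leftarrow> (if interval pp dvd t then sim_shrink pp (cs t) s else return_pmf s);
     (if flush_interval pp dvd t then sim_flush pp s else return_pmf s) }"

fun sim_run :: "params \<Rightarrow> (nat \<Rightarrow> nat) \<Rightarrow> nat \<Rightarrow> sim_state pmf" where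
  "sim_run pp cs 0 = sim_start"
| "sim_run pp cs (Suc t) = bind_pmf (sim_run pp cs t) (sim_step pp cs (Suc t))"


subsection \<open>The data-dependent quantities\<close>

text \<open>The servers' stores without sharing and padding. They are defined for every growing
  database, valid or not, since privacy quantifies over all of them.\<close>

type_synonym plain_store = "(nat \<times> tuple multiset) list"

definition plain_usable :: "params \<Rightarrow> plain_store \<Rightarrow> plain_store" where
  "plain_usable pp P = filter (\<lambda>(r, m). trunc pp \<le> r) P"

definition plain_spend :: "params \<Rightarrow> plain_store \<Rightarrow> plain_store" where
  "plain_spend pp P = map (\<lambda>(r, m). (r - trunc pp, m)) (plain_usable pp P)"

text \<open>The minimum is there because padding to the public size cuts off surplus rows.\<close>

definition row_count :: "params \<Rightarrow> query \<Rightarrow> plain_store \<Rightarrow> nat" where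
  "row_count pp q P = min (out_size pp) (size (q (map snd (plain_usable pp P))))"

definition plain_receive :: "params \<Rightarrow> gdb \<Rightarrow> nat \<Rightarrow> plain_store \<Rightarrow> plain_store" where
  "plain_receive pp D t P = P @ [(budget pp, image_mset snd (D t))]"

fun plain_run :: "params \<Rightarrow> gdb \<Rightarrow> nat \<Rightarrow> plain_store" where
  "plain_run pp D 0 = []"
| "plain_run pp D (Suc t) = plain_spend pp (plain_receive pp D (Suc t) (plain_run pp D t))"

text \<open>Indexed from 0: these are the rows of step \<open>Suc t\<close>.\<close>

definition new_rows :: "params \<Rightarrow> query \<Rightarrow> gdb \<Rightarrow> nat \<Rightarrow> nat" where
  "new_rows pp q D t = row_count pp q (plain_receive pp D (Suc t) (plain_run pp D t))"

text \<open>The counter as a Shrink at step \<open>t\<close> would find it;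
  \<open>count_after\<close> takes a reset at that step into account.\<close>

fun count_before :: "params \<Rightarrow> query \<Rightarrow> gdb \<Rightarrow> nat \<Rightarrow> nat" where
  "count_before pp q D 0 = 0"
| "count_before pp q D (Suc t) = (if interval pp dvd t then 0 else count_before pp q D t) + new_rows pp q D t"

abbreviation count_after :: "params \<Rightarrow> query \<Rightarrow> gdb \<Rightarrow> nat \<Rightarrow> nat" where
  "count_after pp q D t \<equiv> (if interval pp dvd t then 0 else count_before pp q D t)"

text \<open>At step \<open>Suc t\<close> the counter has collected
  \<open>t mod interval pp + 1\<close> steps since the last reset. Together with the bound on
  \<open>interval pp * out_size pp\<close> this excludes wrap-around of the 32-bit counter.\<close>

lemma count_before_le:
  assumes "interval pp > 0"
  shows "count_before pp q D (Suc t) \<le> (t mod interval pp + 1) * out_size pp"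
proof (induction t)
  case 0
  show ?case by (simp add: new_rows_def row_count_def)
next
  case (Suc t)
  have n: "new_rows pp q D (Suc t) \<le> out_size pp" by (simp add: new_rows_def row_count_def)
  show ?case
  proof (cases "interval pp dvd Suc t")
    case True
    then show ?thesis using n by simp
  next
    case False
    then have "Suc t mod interval pp = Suc (t mod interval pp)"
      by (auto simp: mod_Suc dvd_eq_mod_eq_0 split: if_splits)
    then show ?thesis using n Suc.IH False by simp
  qed
qed

lemma count_before_bound:
  assumes "interval pp > 0"
  shows "count_before pp q D t \<le> interval pp * out_size pp"
proof (cases t)
  case (Suc s)
  have "(s mod interval pp + 1) * out_size pp \<le> interval pp * out_size pp"
    using assms by (intro mult_le_mono1) (simp add: Suc_leI)
  with count_before_le[OF assms, of q D s] show ?thesis by (simp add: Suc)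
qed simp


subsection \<open>The ideal execution seen by one server\<close>

fun plain_of :: "states \<Rightarrow> plain_store" where
  "plain_of (s0, s1) = map2 (\<lambda>(r, B) (r', B'). (r, reals_of (xor_tuples B B'))) (store s0) (store s1)"

text \<open>The shared counter determines \<open>c\<close> only modulo \<open>2 ^ 32\<close>; the
  number itself is recovered where Shrink uses it, from a bound on \<open>c\<close>.\<close>

definition inv :: "params \<Rightarrow> plain_store \<Rightarrow> nat \<Rightarrow> states \<Rightarrow> bool" where
  "inv pp P c \<sigma> \<longleftrightarrow> same_shape \<sigma> \<and> map length (cache (fst \<sigma>)) = row_shape pp (length (cache (fst \<sigma>))) \<and>
     plain_of \<sigma> = P \<and> xor (counter (fst \<sigma>)) (counter (snd \<sigma>)) = of_nat c"

fun batch_view :: "server \<Rightarrow> params \<Rightarrow> gdb \<Rightarrow> nat \<Rightarrow> nat \<times> tuple list list \<Rightarrow> bool list" where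
  "batch_view i pp D j (t, Rs) = (let X = owner_batch pp D t j; p = mk i X (Rs ! j)
     in enc_tuples X @ enc_tuples (fst p) @ enc_tuples (snd p))"

definition owner_views :: "server \<Rightarrow> params \<Rightarrow> gdb \<Rightarrow> masks \<Rightarrow> bool list list" where
  "owner_views i pp D M = map (\<lambda>j. concat (map (batch_view i pp D j) M)) [0..<num_owners pp]"

text \<open>The views of all owners are kept, corrupted or not, so that one statement serves every
  corruption pattern with server \<open>i\<close>.\<close>

definition proj :: "server \<Rightarrow> nat \<Rightarrow> exec_state \<Rightarrow> sstate \<times> bool list list \<times> bool list" where
  "proj i n e = (core (pick i (fst e)), map (\<lambda>j. snd e (Owner j)) [0..<n], snd e (Server i))"

definition fill :: "server \<Rightarrow> params \<Rightarrow> gdb \<Rightarrow> nat \<Rightarrow> (nat \<Rightarrow> com) \<Rightarrow> sim_state \<Rightarrow>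
    (sstate \<times> bool list list \<times> bool list) pmf" where
  "fill i pp D \<kappa> sims = (\<lambda>(\<sigma>, M, ks). map_pmf (\<lambda>w. (\<sigma>, owner_views i pp D M, w)) (expand \<kappa> sims ks))"

context
  fixes i :: server and pp :: params and D :: gdb and \<kappa> :: nat and sims :: "nat \<Rightarrow> com"
begin

abbreviation "nn \<equiv> num_owners pp"

text \<open>The distributions agree exactly, without an error term: the transcripts of the ideal
  execution come from the simulators by construction.\<close>

definition related :: "plain_store \<Rightarrow> nat \<Rightarrow> exec_state pmf \<Rightarrow> sim_state pmf \<Rightarrow> bool" where
  "related P c Q S \<longleftrightarrow> (\<forall>e\<in>set_pmf Q. inv pp P c (fst e)) \<and>
     map_pmf (proj i nn) Q = bind_pmf S (fill i pp D \<kappa> sims)"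

text \<open>\<open>K'\<close> is the phase as a random function of what server \<open>i\<close> and
  the owners know. That it exists under \<open>inv\<close> is secrecy: beyond \<open>P\<close> and
  \<open>c\<close>, the state of the other server has no influence on what is seen next.\<close>

lemma related_step:
  assumes rel: "related P c Q S"
    and inv: "\<And>e e'. inv pp P c (fst e) \<Longrightarrow> e' \<in> set_pmf (K e) \<Longrightarrow> inv pp P' c' (fst e')"
    and proj: "\<And>e. inv pp P c (fst e) \<Longrightarrow> map_pmf (proj i nn) (K e) = K' (proj i nn e)"
    and sim: "\<And>s. bind_pmf (fill i pp D \<kappa> sims s) K' = bind_pmf (simK s) (fill i pp D \<kappa> sims)"
  shows "related P' c' (bind_pmf Q K) (bind_pmf S simK)"
  unfolding related_def
proof
  show "\<forall>e\<in>set_pmf (bind_pmf Q K). inv pp P' c' (fst e)"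
    using rel inv unfolding related_def by fastforce
  have "map_pmf (proj i nn) (bind_pmf Q K) = bind_pmf Q (\<lambda>e. K' (proj i nn e))"
    unfolding map_bind_pmf using rel by (intro bind_pmf_cong refl proj) (simp add: related_def)
  also have "\<dots> = bind_pmf (map_pmf (proj i nn) Q) K'" by (simp add: bind_map_pmf)
  also have "\<dots> = bind_pmf (bind_pmf S simK) (fill i pp D \<kappa> sims)"
    using rel by (simp add: related_def bind_assoc_pmf sim)
  finally show "map_pmf (proj i nn) (bind_pmf Q K) = bind_pmf (bind_pmf S simK) (fill i pp D \<kappa> sims)" .
qed

lemma related_call:
  fixes f :: "'i \<Rightarrow> 'i \<Rightarrow> ('o \<times> 'o) pmf"
  assumes rel: "related P c Q S"
    and inv: "\<And>\<sigma> z y. inv pp P c \<sigma> \<Longrightarrow> y \<in> set_pmf (f (fst (inp \<sigma> z)) (snd (inp \<sigma> z))) \<Longrightarrow> inv pp P' c' (upd \<sigma> y)"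
    and arg: "\<And>\<sigma> z y. enc_in (pick i (inp \<sigma> z)) @ enc_out y = arg (core (pick i \<sigma>)) (pick i z) y"
    and upd: "\<And>\<sigma> y. core (pick i (upd \<sigma> y)) = core (updi (pick i y) (core (pick i \<sigma>)))"
    and dist: "\<And>\<sigma>. inv pp P c \<sigma> \<Longrightarrow> bind_pmf Z (\<lambda>z. map_pmf (\<lambda>y. (pick i z, pick i y)) (f (fst (inp \<sigma> z)) (snd (inp \<sigma> z)))) =
        d (core (pick i \<sigma>))"
    and pre: "\<And>z. pre z i = pre' (pick i z)"
  shows "related P' c' (bind_pmf Q (call_phase (ideal_2pc i enc_in enc_out f (sims k)) Z inp upd pre enc_out \<kappa>))
     (bind_pmf S (sim_call k d arg updi pre' enc_out))"
proof (rule related_step[OF rel])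
  let ?K = "call_phase (ideal_2pc i enc_in enc_out f (sims k)) Z inp upd pre enc_out \<kappa>"
  let ?K' = "\<lambda>(\<sigma>, o', w). do { (z, y) \<leftarrow> d \<sigma>; v \<leftarrow> exec (sims k) (enc_nat \<kappa> @ arg \<sigma> z y);
      return_pmf (core (updi y \<sigma>), o', w @ pre' z @ enc_bits v @ enc_out y) }"
  show "inv pp P' c' (fst e')" if "inv pp P c (fst e)" "e' \<in> set_pmf (?K e)" for e e'
    using that by (cases e) (auto simp: call_phase_def ideal_2pc_def intro: inv)
  show "map_pmf (proj i nn) (?K e) = ?K' (proj i nn e)" if e: "inv pp P c (fst e)" for e
  proof -
    obtain \<sigma> v where ev: "e = (\<sigma>, v)" by (cases e) blast
    have "map_pmf (proj i nn) (?K e) = do { z \<leftarrow> Z; y \<leftarrow> f (fst (inp \<sigma> z)) (snd (inp \<sigma> z));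
        u \<leftarrow> exec (sims k) (enc_nat \<kappa> @ arg (core (pick i \<sigma>)) (pick i z) (pick i y));
        return_pmf (core (updi (pick i y) (core (pick i \<sigma>))), map (\<lambda>j. v (Owner j)) [0..<nn],
           v (Server i) @ pre' (pick i z) @ enc_bits u @ enc_out (pick i y)) }"
      by (simp add: ev call_phase_def ideal_2pc_def map_bind_pmf bind_assoc_pmf bind_return_pmf proj_def upd arg pre observe_def)
    also have "\<dots> = ?K' (proj i nn e)"
      using dist[of \<sigma>] e by (simp add: ev proj_def dist[symmetric] bind_assoc_pmf bind_map_pmf)
    finally show ?thesis .
  qed
  show "bind_pmf (fill i pp D \<kappa> sims s) ?K' = bind_pmf (sim_call k d arg updi pre' enc_out s) (fill i pp D \<kappa> sims)" for s
  proof -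
    obtain \<sigma> M ks where s: "s = (\<sigma>, M, ks)" by (metis prod.exhaust)
    let ?ov = "owner_views i pp D M"
    have "bind_pmf (fill i pp D \<kappa> sims s) ?K' = do { w \<leftarrow> expand \<kappa> sims ks; zy \<leftarrow> d \<sigma>;
        v \<leftarrow> exec (sims k) (enc_nat \<kappa> @ arg \<sigma> (fst zy) (snd zy));
        return_pmf (core (updi (snd zy) \<sigma>), ?ov, w @ pre' (fst zy) @ enc_bits v @ enc_out (snd zy)) }"
      by (simp add: s fill_def bind_map_pmf case_prod_unfold)
    also have "\<dots> = do { zy \<leftarrow> d \<sigma>; w \<leftarrow> expand \<kappa> sims ks;
        v \<leftarrow> exec (sims k) (enc_nat \<kappa> @ arg \<sigma> (fst zy) (snd zy));
        return_pmf (core (updi (snd zy) \<sigma>), ?ov, w @ pre' (fst zy) @ enc_bits v @ enc_out (snd zy)) }"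
      by (rule bind_commute_pmf)
    also have "\<dots> = bind_pmf (sim_call k d arg updi pre' enc_out s) (fill i pp D \<kappa> sims)"
      by (simp add: s sim_call_def fill_def bind_map_pmf case_prod_unfold expand_append map_bind_pmf
          bind_assoc_pmf bind_return_pmf map_pmf_def)
    finally show ?thesis .
  qed
qed

end


lemma pick_pair: "pick i (concat (map fst ps), concat (map snd ps)) = concat (map (pick i) ps)"
  by (cases i) (auto intro!: arg_cong[where f = concat])

lemma xor_concat_mk:
  assumes "map (map length) Xs = map (map length) Rs"
  shows "xor_tuples (concat (map fst (map2 (mk i) Xs Rs))) (concat (map snd (map2 (mk i) Xs Rs))) = concat Xs"
proof -
  have "length Xs = length Rs" using arg_cong[OF assms, of length] by simp
  from this assms show ?thesis
  proof (induction Xs Rs rule: list_induct2)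
    case (Cons X Xs R Rs)
    then have e: "map length X = map length R" by simp
    then have "map length (fst (mk i X R)) = map length (snd (mk i X R))"
      by (cases i) (simp_all add: map2_xor_length)
    with Cons e show ?case by (simp add: xor_tuples_append xor_mk)
  qed simp
qed

text \<open>The other server's contribution is a one-time pad: for any own contribution and any
  \<open>a\<close>, the re-shared word is uniform.\<close>

lemma zm2_pick: "bind_pmf zm2 (\<lambda>z. g (pick i z) (xor a (xor (fst z) (snd z)))) = do { z \<leftarrow> U; r \<leftarrow> U; g z r }"
proof -
  have *: "bind_pmf U (\<lambda>z. h (xor a (xor z b))) = bind_pmf U h" "bind_pmf U (\<lambda>z. h (xor a (xor b z))) = bind_pmf U h"
    for h :: "zm \<Rightarrow> 'b pmf" and b
  proof -
    have "bind_pmf U (\<lambda>z. h (xor a (xor z b))) = bind_pmf (map_pmf (xor a) (map_pmf (\<lambda>z. xor z b) U)) h"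
      by (simp add: bind_map_pmf)
    then show "bind_pmf U (\<lambda>z. h (xor a (xor z b))) = bind_pmf U h" by (simp add: U_xor)
    have "bind_pmf U (\<lambda>z. h (xor a (xor b z))) = bind_pmf (map_pmf (xor a) (map_pmf (\<lambda>z. xor b z) U)) h"
      by (simp add: bind_map_pmf)
    then show "bind_pmf U (\<lambda>z. h (xor a (xor b z))) = bind_pmf U h" by (simp add: U_xor)
  qed
  show ?thesis
  proof (cases i)
    case S0
    then show ?thesis by (simp add: zm2_def pair_pmf_def bind_assoc_pmf bind_return_pmf *)
  next
    case S1
    have "bind_pmf zm2 (\<lambda>z. g (pick i z) (xor a (xor (fst z) (snd z)))) =
        bind_pmf U (\<lambda>z0. bind_pmf U (\<lambda>z1. g z1 (xor a (xor z0 z1))))"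
      by (simp add: S1 zm2_def pair_pmf_def bind_assoc_pmf bind_return_pmf)
    also have "\<dots> = bind_pmf U (\<lambda>z1. bind_pmf U (\<lambda>z0. g z1 (xor a (xor z0 z1))))"
      by (rule bind_commute_pmf)
    finally show ?thesis by (simp add: *)
  qed
qed

lemma core_simps [simp]:
  "store (core \<sigma>) = store \<sigma>" "cache (core \<sigma>) = cache \<sigma>" "counter (core \<sigma>) = counter \<sigma>" "core (core \<sigma>) = core \<sigma>"
  "usable pp (core \<sigma>) = usable pp \<sigma>"
  "core (receive pp B \<sigma>) = receive pp B (core \<sigma>)" "core (after_transform pp y (core \<sigma>)) = core (after_transform pp y \<sigma>)"
  "core (after_flush V (core \<sigma>)) = core (after_flush V \<sigma>)"
  by (simp_all add: core_def usable_def receive_def after_transform_def after_flush_def)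

lemma core_after_shrink [simp]: "core (after_shrink y (core \<sigma>)) = core (after_shrink y \<sigma>)"
  by (cases y) (simp add: core_def)

lemma plain_usable_map2:
  fixes f :: "nat \<times> tuple list \<Rightarrow> nat \<times> tuple list \<Rightarrow> nat \<times> tuple multiset"
  assumes "map (\<lambda>(r, B). (r, map length B)) l0 = map (\<lambda>(r, B). (r, map length B)) l1"
    and f: "f = (\<lambda>(r, B) (r', B'). (r, reals_of (xor_tuples B B')))"
  shows "plain_usable pp (map2 f l0 l1) = map2 f (filter (\<lambda>(r, B). trunc pp \<le> r) l0) (filter (\<lambda>(r, B). trunc pp \<le> r) l1)"
proof -
  have "length l0 = length l1" using arg_cong[OF assms(1), of length] by simp
  from this assms(1) show ?thesis
    by (induction l0 l1 rule: list_induct2) (auto simp: plain_usable_def f)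
qed

lemma map_reals_map2:
  "map reals_of (map2 xor_tuples (map snd l0) (map snd l1)) =
   map snd (map2 (\<lambda>(r, B) (r', B'). (r, reals_of (xor_tuples B B'))) l0 l1)"
  by (simp add: zip_map1 zip_map2 o_def case_prod_unfold)

lemma same_shape_length:
  assumes "same_shape (s0, s1)" shows "length (store s0) = length (store s1)"
proof -
  have "map (\<lambda>(r, B). (r, map length B)) (store s0) = map (\<lambda>(r, B). (r, map length B)) (store s1)"
    using assms by simp
  from arg_cong[OF this, of length] show ?thesis by simp
qed

lemma shape_length: "map length X = replicate m w \<Longrightarrow> length X = m"
  by (metis length_map length_replicate)

lemma share_each_concat_shape:
  "ps \<in> set_pmf (share_each Xs) \<Longrightarrow> map length (concat (map fst ps)) = map length (concat (map snd ps))"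
  using share_each_shape[of ps Xs] by (simp add: map_concat)

lemma bind_share_pick:
  "bind_pmf (share X) (\<lambda>p. h (pick i p)) = bind_pmf (unif (map length X)) h"
  unfolding map_pick_share[of i X, symmetric] by (simp add: bind_map_pmf)

context
  fixes i :: server and pp :: params and D :: gdb and \<kappa> :: nat and sims :: "nat \<Rightarrow> com" and q :: query
  assumes valid: "D \<in> valid_dbs pp" and pos: "interval pp > 0"
    and bound: "interval pp * out_size pp < 2 ^ 32"
    and tq: "truncated_query (trunc pp) (row_width pp) q"
begin

abbreviation "rel \<equiv> related i pp D \<kappa> sims"

lemma rel_start: "rel [] 0 start sim_start"
  unfolding related_def
proof
  show "\<forall>e\<in>set_pmf start. inv pp [] 0 (fst e)"
    by (auto simp: start_def share_zm_def inv_def)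
  have "map_pmf (proj i (num_owners pp)) start = map_pmf (\<lambda>c. (\<lparr>store = [], cache = [], counter = c, mview = []\<rparr>,
      map (\<lambda>j. []) [0..<num_owners pp], enc_zm c)) U"
    by (cases i) (simp_all add: start_def share_zm_def proj_def core_def observe_def map_pmf_comp map_bind_pmf
        bind_map_pmf map_pmf_def[symmetric])
  also have "\<dots> = bind_pmf sim_start (fill i pp D \<kappa> sims)"
    by (simp add: sim_start_def fill_def bind_map_pmf owner_views_def map_pmf_def bind_assoc_pmf bind_return_pmf)
  finally show "map_pmf (proj i (num_owners pp)) start = bind_pmf sim_start (fill i pp D \<kappa> sims)" .
qed

lemma rel_upload:
  assumes rel: "rel P c Q S" and t: "t \<ge> 1"
  shows "rel (plain_receive pp D t P) c (bind_pmf Q (upload pp D t)) (bind_pmf S (sim_upload pp t))"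
proof (rule related_step[OF rel])
  let ?n = "num_owners pp"
  let ?Xs = "map (owner_batch pp D t) [0..<?n]"
  have sh: "map (map length) ?Xs = batch_shapes pp"
    using valid_batches(2)[OF valid t] by (simp add: batch_shapes_def)
  let ?K' = "\<lambda>(\<sigma>, o', w). map_pmf (\<lambda>Rs. (receive pp (concat Rs) \<sigma>,
      map (\<lambda>j. o' ! j @ batch_view i pp D j (t, Rs)) [0..<?n], w @ enc_tuples (concat Rs))) (unif_each (batch_shapes pp))"
  have sheq: "map (map length) ?Xs = map (map length) Rs" "length Rs = ?n" if "Rs \<in> set_pmf (unif_each (batch_shapes pp))" for Rs
  proof -
    show "map (map length) ?Xs = map (map length) Rs" unfolding sh set_unif_each[OF that] ..
    have "length (map (map length) Rs) = length (batch_shapes pp)" unfolding set_unif_each[OF that] ..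
    then show "length Rs = ?n" by (simp add: batch_shapes_def)
  qed
  show "inv pp (plain_receive pp D t P) c (fst e')"
    if e: "inv pp P c (fst e)" and e': "e' \<in> set_pmf (upload pp D t e)" for e e'
  proof -
    obtain s0 s1 v where ev: "e = ((s0, s1), v)" by (metis prod.exhaust)
    obtain Rs where Rs: "Rs \<in> set_pmf (unif_each (batch_shapes pp))"
      and e'2: "fst e' = (receive pp (concat (map fst (map2 (mk i) ?Xs Rs))) s0, receive pp (concat (map snd (map2 (mk i) ?Xs Rs))) s1)"
      using e' unfolding ev upload_eq share_each_mk[of _ i] sh by (auto simp: Let_def)
    let ?B0 = "concat (map fst (map2 (mk i) ?Xs Rs))" and ?B1 = "concat (map snd (map2 (mk i) ?Xs Rs))"
    have "map2 (mk i) ?Xs Rs \<in> set_pmf (share_each ?Xs)"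
      using Rs unfolding share_each_mk[of _ i] sh by auto
    then have "map length ?B0 = map length ?B1" by (rule share_each_concat_shape)
    moreover have "reals_of (xor_tuples ?B0 ?B1) = image_mset snd (D t)"
      unfolding xor_concat_mk[OF sheq(1)[OF Rs]] by (rule valid_batches(1)[OF valid t])
    ultimately show ?thesis using e same_shape_length[of s0 s1]
      by (auto simp add: ev e'2 inv_def receive_def plain_receive_def simp del: map_map)
  qed
  show "map_pmf (proj i ?n) (upload pp D t e) = ?K' (proj i ?n e)" for e
  proof -
    obtain \<sigma> v where ev: "e = (\<sigma>, v)" by (cases e) blast
    have p: "pick i (receive pp B0 (fst \<sigma>), receive pp B1 (snd \<sigma>)) = receive pp (pick i (B0, B1)) (pick i \<sigma>)" for B0 B1
      by (cases i) auto
    show ?thesis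
      unfolding ev upload_eq share_each_mk[of _ i] sh proj_def map_pmf_comp fst_conv snd_conv case_prod_conv
    proof (rule map_pmf_cong[OF refl], goal_cases)
      case (1 Rs)
      note Rs = 1
      \<comment> \<open>Server \<open>i\<close> receives exactly the masks, whatever the batches
        contain.\<close>
      have "map (pick i) (map2 (mk i) ?Xs Rs) = map2 (\<lambda>X R. R) ?Xs Rs" by auto
      also have "\<dots> = Rs" using sheq(2)[OF Rs] by (simp add: case_prod_unfold map_snd_zip)
      finally have "concat (map (pick i) (map2 (mk i) ?Xs Rs)) = concat Rs" by simp
      then show ?case
        using sheq(2)[OF Rs] by (simp add: Let_def p pick_pair del: map_map)
    qed
  qed
  show "bind_pmf (fill i pp D \<kappa> sims s) ?K' = bind_pmf (sim_upload pp t s) (fill i pp D \<kappa> sims)" for s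
  proof -
    obtain \<sigma> M ks where s: "s = (\<sigma>, M, ks)" by (metis prod.exhaust)
    have ov: "owner_views i pp D (M @ [(t, Rs)]) = map (\<lambda>j. owner_views i pp D M ! j @ batch_view i pp D j (t, Rs)) [0..<?n]" for Rs
      by (simp add: owner_views_def)
    have "bind_pmf (fill i pp D \<kappa> sims s) ?K' = do { w \<leftarrow> expand \<kappa> sims ks; Rs \<leftarrow> unif_each (batch_shapes pp);
       return_pmf (receive pp (concat Rs) \<sigma>, owner_views i pp D (M @ [(t, Rs)]), w @ enc_tuples (concat Rs)) }"
      unfolding ov by (simp add: s fill_def bind_map_pmf map_pmf_def bind_assoc_pmf bind_return_pmf)
    also have "\<dots> = do { Rs \<leftarrow> unif_each (batch_shapes pp); w \<leftarrow> expand \<kappa> sims ks;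
       return_pmf (receive pp (concat Rs) \<sigma>, owner_views i pp D (M @ [(t, Rs)]), w @ enc_tuples (concat Rs)) }"
      by (rule bind_commute_pmf)
    also have "\<dots> = bind_pmf (sim_upload pp t s) (fill i pp D \<kappa> sims)"
      by (simp add: s sim_upload_def fill_def bind_map_pmf expand_append map_bind_pmf bind_assoc_pmf bind_return_pmf map_pmf_def)
    finally show ?thesis .
  qed
qed

lemma rel_transform:
  assumes rel: "rel P c Q S"
  shows "rel (plain_spend pp P) (c + row_count pp q P)
    (bind_pmf Q (transform_phase pp (ideal_2pc i enc_transform_in enc_transform_out (transform_fun pp q) (sims 0)) \<kappa>))
    (bind_pmf S (sim_transform pp))"
  unfolding transform_phase_def sim_transform_def
proof (rule related_call[OF rel])
  let ?f = "\<lambda>(r, B) (r', B'). (r, reals_of (xor_tuples B B')) :: nat \<times> tuple multiset"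
  fix \<sigma> :: states
  obtain s0 s1 where \<sigma>: "\<sigma> = (s0, s1)" by force
  define rows where "rows = padded (out_size pp) (row_width pp) (q (map snd (plain_usable pp P)))"
  have rsh: "map length rows = row_shape pp (out_size pp)"
    unfolding rows_def using tq by (intro padded_shape) (auto simp: truncated_query_def)
  have rc: "length (filter is_real rows) = row_count pp q P"
    by (simp add: rows_def count_padded row_count_def)
  \<comment> \<open>Under the invariant the functionality depends on the shares only through
    \<open>P\<close> and \<open>c\<close>.\<close>
  have fn: "transform_fun pp q (map snd (usable pp s0), counter s0, z0) (map snd (usable pp s1), counter s1, z1) =
      map_pmf (\<lambda>p. ((fst p, xor z0 z1), (snd p, xor (of_nat (c + row_count pp q P)) (xor z0 z1)))) (share rows)"
    if inv: "inv pp P c \<sigma>" for z0 z1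
  proof -
    have P: "map2 ?f (store s0) (store s1) = P" using inv by (simp add: inv_def \<sigma>)
    have sh: "map (\<lambda>(r, B). (r, map length B)) (store s0) = map (\<lambda>(r, B). (r, map length B)) (store s1)"
      using inv by (simp add: inv_def \<sigma>)
    have "map reals_of (map2 xor_tuples (map snd (usable pp s0)) (map snd (usable pp s1))) = map snd (plain_usable pp P)"
      unfolding map_reals_map2 usable_def P[symmetric] plain_usable_map2[OF sh refl] ..
    moreover have "xor (counter s0) (counter s1) = of_nat c" using inv by (simp add: inv_def \<sigma>)
    ultimately show ?thesis
      by (simp add: Let_def rows_def[symmetric] rc map_pmf_def case_prod_unfold add.commute)
  qed
  let ?inp = "\<lambda>(s0, s1) (z0, z1). ((map snd (usable pp s0), counter s0, z0), (map snd (usable pp s1), counter s1, z1))"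
  show "inv pp (plain_spend pp P) (c + row_count pp q P)
      ((\<lambda>(s0, s1) (y0, y1). (after_transform pp y0 s0, after_transform pp y1 s1)) \<sigma> y)"
    if inv: "inv pp P c \<sigma>" and y: "y \<in> set_pmf (transform_fun pp q (fst (?inp \<sigma> z)) (snd (?inp \<sigma> z)))" for z y
  proof -
    have sh: "same_shape (s0, s1)" using inv by (simp add: inv_def \<sigma>)
    have y': "y \<in> set_pmf (transform_fun pp q (map snd (usable pp s0), counter s0, fst z) (map snd (usable pp s1), counter s1, snd z))"
      using y by (simp add: \<sigma> case_prod_unfold)
    note sh' = same_shape_transform[OF sh y']
    obtain p where p: "p \<in> set_pmf (share rows)"
      "y = ((fst p, xor (fst z) (snd z)), (snd p, xor (of_nat (c + row_count pp q P)) (xor (fst z) (snd z))))"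
      using y' unfolding fn[OF inv] by auto
    have l: "map length (fst p) = row_shape pp (out_size pp)" using share_shape[OF p(1)] rsh by simp
    have c0: "map length (cache s0) = row_shape pp (length (cache s0))"
      using inv unfolding inv_def \<sigma> fst_conv by blast
    have "map length (cache s0 @ fst p) = row_shape pp (length (cache s0 @ fst p))"
      by (simp only: map_append c0 l shape_length[OF l] length_append replicate_add)
    moreover have "plain_of (after_transform pp (fst y) s0, after_transform pp (snd y) s1) = plain_spend pp P"
    proof -
      have P: "map2 ?f (store s0) (store s1) = P" using inv by (simp add: inv_def \<sigma>)
      have "plain_usable pp P = map2 ?f (usable pp s0) (usable pp s1)"
        unfolding usable_def P[symmetric] by (rule plain_usable_map2[OF _ refl]) (use sh in simp)
      then show ?thesis
        by (simp add: plain_spend_def after_transform_def zip_map1 zip_map2 o_def case_prod_unfold)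
    qed
    ultimately show ?thesis using sh'
      by (simp add: inv_def \<sigma> after_transform_def p(2) case_prod_unfold del: map_append)
  qed
  show "bind_pmf zm2 (\<lambda>z. map_pmf (\<lambda>y. (pick i z, pick i y)) (transform_fun pp q (fst (?inp \<sigma> z)) (snd (?inp \<sigma> z)))) =
        do { z \<leftarrow> U; X \<leftarrow> unif (row_shape pp (out_size pp)); r \<leftarrow> U; return_pmf (z, (X, r)) }" if inv: "inv pp P c \<sigma>"
  proof -
    \<comment> \<open>\<open>S0\<close> obtains the fresh mask itself and \<open>S1\<close> the
      masked counter. In both cases a constant is xored with a uniform word, so
      \<open>zm2_pick\<close> applies.\<close>
    define a :: zm where "a = (if i = S0 then 0 else of_nat (c + row_count pp q P))"
    have pk: "pick i ((fst p, w), (snd p, xor (of_nat (c + row_count pp q P)) w)) = (pick i p, xor a w)" for p :: "tuple list \<times> tuple list" and w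
      by (cases i) (simp_all add: a_def)
    have "map_pmf (\<lambda>y. (pick i z, pick i y)) (transform_fun pp q (fst (?inp \<sigma> z)) (snd (?inp \<sigma> z))) =
      bind_pmf (unif (row_shape pp (out_size pp))) (\<lambda>X. return_pmf (pick i z, (X, xor a (xor (fst z) (snd z)))))" for z
      unfolding rsh[symmetric] bind_share_pick[where i = i, symmetric]
      by (simp add: \<sigma> case_prod_unfold fn[OF inv] map_pmf_comp pk del: transform_fun.simps of_nat_add) (simp add: map_pmf_def)
    then have "bind_pmf zm2 (\<lambda>z. map_pmf (\<lambda>y. (pick i z, pick i y)) (transform_fun pp q (fst (?inp \<sigma> z)) (snd (?inp \<sigma> z)))) =
      bind_pmf zm2 (\<lambda>z. (\<lambda>u r. bind_pmf (unif (row_shape pp (out_size pp))) (\<lambda>X. return_pmf (u, (X, r)))) (pick i z) (xor a (xor (fst z) (snd z))))"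
      by simp
    also have "\<dots> = do { z \<leftarrow> U; r \<leftarrow> U; X \<leftarrow> unif (row_shape pp (out_size pp)); return_pmf (z, (X, r)) }"
      by (rule zm2_pick)
    also have "\<dots> = do { z \<leftarrow> U; X \<leftarrow> unif (row_shape pp (out_size pp)); r \<leftarrow> U; return_pmf (z, (X, r)) }"
      by (intro bind_pmf_cong refl bind_commute_pmf)
    finally show ?thesis .
  qed
  show "enc_transform_in (pick i (?inp \<sigma> z)) @ enc_transform_out y =
     enc_transform_in (map snd (usable pp (core (pick i \<sigma>))), counter (core (pick i \<sigma>)), pick i z) @ enc_transform_out y" for z y
    by (cases i) (simp_all add: \<sigma> case_prod_unfold)
  show "core (pick i ((\<lambda>(s0, s1) (y0, y1). (after_transform pp y0 s0, after_transform pp y1 s1)) \<sigma> y)) =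
      core (after_transform pp (pick i y) (core (pick i \<sigma>)))" for y
    by (cases i) (simp_all add: \<sigma> case_prod_unfold)
qed simp

lemma rel_shrink:
  assumes rel: "rel P c Q S" and c: "c < 2 ^ 32"
  shows "rel P 0
    (bind_pmf Q (shrink_phase (ideal_2pc i enc_shrink_in enc_shrink_out (shrink_fun pp) (sims 1)) \<kappa>))
    (bind_pmf S (sim_shrink pp c))"
  unfolding shrink_phase_def sim_shrink_def
proof (rule related_call[OF rel])
  fix \<sigma> :: states
  obtain s0 s1 where \<sigma>: "\<sigma> = (s0, s1)" by force
  define X where "X = sort_cache (xor_tuples (cache s0) (cache s1))"
  let ?m = "length (cache s0)"
  let ?vol = "volume (real (budget pp) / eps pp) c ?m"
  have X: "map length X = row_shape pp ?m" "length X = ?m" "length (cache s1) = ?m" if "inv pp P c \<sigma>"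
  proof -
    have a: "map length (cache s0) = map length (cache s1)" "map length (cache s0) = row_shape pp ?m"
      using that by (auto simp: inv_def \<sigma>)
    have b: "map length (xor_tuples (cache s0) (cache s1)) = row_shape pp ?m"
      using map2_xor_length[OF a(1)] a(2) by simp
    then have "length (xor_tuples (cache s0) (cache s1)) = ?m" by (rule shape_length)
    with b show "map length X = row_shape pp ?m" "length X = ?m"
      unfolding X_def using sort_cache_shape[of "xor_tuples (cache s0) (cache s1)" "Suc (row_width pp)"] by simp_all
    show "length (cache s1) = ?m" using arg_cong[OF a(1), of length] by simp
  qed
  have fn: "shrink_fun pp (cache s0, counter s0, z0) (cache s1, counter s1, z1) =
      do { n \<leftarrow> ?vol; p \<leftarrow> share (take n X); p' \<leftarrow> share (drop n X);
           return_pmf ((n, fst p, fst p', xor z0 z1), (n, snd p, snd p', xor 0 (xor z0 z1))) }"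
    if inv: "inv pp P c \<sigma>" for z0 z1
  proof -
    have "xor (counter s0) (counter s1) = of_nat c" using inv by (simp add: inv_def \<sigma>)
    \<comment> \<open>No wrap-around, so the noise is centred at the true count.\<close>
    moreover have "unat (of_nat c :: zm) = c" using c by (simp add: unsigned_of_nat take_bit_nat_eq_self_iff)
    ultimately show ?thesis
      using X(2)[OF inv] by (simp add: Let_def X_def[symmetric] case_prod_unfold)
  qed
  let ?inp = "\<lambda>(s0, s1) (z0, z1). ((cache s0, counter s0, z0), (cache s1, counter s1, z1))"
  show "inv pp P 0 ((\<lambda>(s0, s1) (y0, y1). (after_shrink y0 s0, after_shrink y1 s1)) \<sigma> y)"
    if inv: "inv pp P c \<sigma>" and y: "y \<in> set_pmf (shrink_fun pp (fst (?inp \<sigma> z)) (snd (?inp \<sigma> z)))" for z y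
  proof -
    have sh: "same_shape (s0, s1)" using inv by (simp add: inv_def \<sigma>)
    have y': "y \<in> set_pmf (shrink_fun pp (cache s0, counter s0, fst z) (cache s1, counter s1, snd z))"
      using y by (simp add: \<sigma> case_prod_unfold)
    note sh' = same_shape_shrink[OF sh y']
    obtain n p p' where p: "p' \<in> set_pmf (share (drop n X))"
      "y = ((n, fst p, fst p', xor (fst z) (snd z)), (n, snd p, snd p', xor 0 (xor (fst z) (snd z))))"
      using y' unfolding fn[OF inv] by auto
    have l: "map length (fst p') = row_shape pp (?m - n)"
      using share_shape[OF p(1)] X(1)[OF inv] by (simp add: drop_map[symmetric])
    then have "map length (fst p') = row_shape pp (length (fst p'))" using shape_length[OF l] by simp
    then show ?thesis using sh' inv by (simp add: inv_def \<sigma> p(2))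
  qed
  show "bind_pmf zm2 (\<lambda>z. map_pmf (\<lambda>y. (pick i z, pick i y)) (shrink_fun pp (fst (?inp \<sigma> z)) (snd (?inp \<sigma> z)))) =
     do { n \<leftarrow> volume (real (budget pp) / eps pp) c (length (cache (core (pick i \<sigma>))));
        z \<leftarrow> U; V \<leftarrow> unif (row_shape pp (min n (length (cache (core (pick i \<sigma>)))))); Y \<leftarrow> unif (row_shape pp (length (cache (core (pick i \<sigma>))) - n));
        r \<leftarrow> U; return_pmf (z, (n, V, Y, r)) }" if inv: "inv pp P c \<sigma>"
  proof -
    have lc: "length (cache (core (pick i \<sigma>))) = ?m" using X(3)[OF inv] by (cases i) (simp_all add: \<sigma>)
    have tk: "map length (take n X) = row_shape pp (min n ?m)" and dr: "map length (drop n X) = row_shape pp (?m - n)" for n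
      using X(1)[OF inv] by (simp_all add: take_map[symmetric] drop_map[symmetric])
    have pk: "pick i ((n, fst p, fst p', w), (n, snd p, snd p', xor 0 w)) = (n, pick i p, pick i p', xor 0 w)"
      for n :: nat and p p' :: "tuple list \<times> tuple list" and w :: zm
      by (cases i) simp_all
    have "map_pmf (\<lambda>y. (pick i z, pick i y)) (shrink_fun pp (fst (?inp \<sigma> z)) (snd (?inp \<sigma> z))) =
      do { n \<leftarrow> ?vol; V \<leftarrow> unif (row_shape pp (min n ?m)); Y \<leftarrow> unif (row_shape pp (?m - n));
           return_pmf (pick i z, (n, V, Y, xor 0 (xor (fst z) (snd z)))) }" for z
      unfolding tk[symmetric] dr[symmetric] bind_share_pick[where i = i, symmetric]
      by (simp add: \<sigma> case_prod_unfold fn[OF inv] map_bind_pmf pk del: xor.left_neutral shrink_fun.simps)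
    then have "bind_pmf zm2 (\<lambda>z. map_pmf (\<lambda>y. (pick i z, pick i y)) (shrink_fun pp (fst (?inp \<sigma> z)) (snd (?inp \<sigma> z)))) =
      bind_pmf zm2 (\<lambda>z. (\<lambda>u r. do { n \<leftarrow> ?vol; V \<leftarrow> unif (row_shape pp (min n ?m)); Y \<leftarrow> unif (row_shape pp (?m - n));
           return_pmf (u, (n, V, Y, r)) }) (pick i z) (xor 0 (xor (fst z) (snd z))))"
      by simp
    also have "\<dots> = do { z \<leftarrow> U; r \<leftarrow> U; n \<leftarrow> ?vol; V \<leftarrow> unif (row_shape pp (min n ?m)); Y \<leftarrow> unif (row_shape pp (?m - n));
           return_pmf (z, (n, V, Y, r)) }"
      by (rule zm2_pick)
    \<comment> \<open>Independent draws are exchanged until the volume comes first, as in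
      \<open>sim_shrink\<close>.\<close>
    also have "\<dots> = do { z \<leftarrow> U; n \<leftarrow> ?vol; r \<leftarrow> U; V \<leftarrow> unif (row_shape pp (min n ?m)); Y \<leftarrow> unif (row_shape pp (?m - n));
           return_pmf (z, (n, V, Y, r)) }"
      by (intro bind_pmf_cong refl bind_commute_pmf)
    also have "\<dots> = do { z \<leftarrow> U; n \<leftarrow> ?vol; V \<leftarrow> unif (row_shape pp (min n ?m)); r \<leftarrow> U; Y \<leftarrow> unif (row_shape pp (?m - n));
           return_pmf (z, (n, V, Y, r)) }"
      by (intro bind_pmf_cong refl bind_commute_pmf)
    also have "\<dots> = do { z \<leftarrow> U; n \<leftarrow> ?vol; V \<leftarrow> unif (row_shape pp (min n ?m)); Y \<leftarrow> unif (row_shape pp (?m - n)); r \<leftarrow> U;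
           return_pmf (z, (n, V, Y, r)) }"
      by (intro bind_pmf_cong refl bind_commute_pmf)
    also have "\<dots> = do { n \<leftarrow> ?vol; z \<leftarrow> U; V \<leftarrow> unif (row_shape pp (min n ?m)); Y \<leftarrow> unif (row_shape pp (?m - n)); r \<leftarrow> U;
           return_pmf (z, (n, V, Y, r)) }"
      by (rule bind_commute_pmf)
    finally show ?thesis unfolding lc .
  qed
  show "enc_shrink_in (pick i (?inp \<sigma> z)) @ enc_shrink_out y =
     enc_shrink_in (cache (core (pick i \<sigma>)), counter (core (pick i \<sigma>)), pick i z) @ enc_shrink_out y" for z y
    by (cases i) (simp_all add: \<sigma> case_prod_unfold)
  show "core (pick i ((\<lambda>(s0, s1) (y0, y1). (after_shrink y0 s0, after_shrink y1 s1)) \<sigma> y)) =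
      core (after_shrink (pick i y) (core (pick i \<sigma>)))" for y
    by (cases i) (simp_all add: \<sigma> case_prod_unfold)
qed simp

text \<open>A flush leaves the counter alone, and its volume follows from
  \<open>flush_size pp\<close> and the cache length, which server \<open>i\<close> knows; hence
  \<open>c\<close> stays as it is.\<close>

lemma rel_flush:
  assumes rel: "rel P c Q S"
  shows "rel P c
    (bind_pmf Q (flush_phase (ideal_2pc i enc_tuples enc_tuples (flush_fun pp) (sims 2)) \<kappa>))
    (bind_pmf S (sim_flush pp))"
  unfolding flush_phase_def sim_flush_def
proof (rule related_call[OF rel])
  fix \<sigma> :: states
  obtain s0 s1 where \<sigma>: "\<sigma> = (s0, s1)" by force
  let ?m = "length (cache s0)"
  let ?inp = "\<lambda>(s0, s1) (z :: zm \<times> zm). (cache s0, cache s1)"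
  show "inv pp P c ((\<lambda>(s0, s1) (y0, y1). (after_flush y0 s0, after_flush y1 s1)) \<sigma> y)" if "inv pp P c \<sigma>" for y
    using that by (cases y) (simp add: inv_def \<sigma> after_flush_def)
  show "bind_pmf (return_pmf (0, 0)) (\<lambda>z. map_pmf (\<lambda>y. (pick i z, pick i y)) (flush_fun pp (fst (?inp \<sigma> z)) (snd (?inp \<sigma> z)))) =
      map_pmf (\<lambda>V. (0, V)) (unif (row_shape pp (min (flush_size pp) (length (cache (core (pick i \<sigma>)))))))"
    if inv: "inv pp P c \<sigma>"
  proof -
    have a: "map length (cache s0) = map length (cache s1)" "map length (cache s0) = row_shape pp ?m"
      using inv by (auto simp: inv_def \<sigma>)
    have b: "map length (xor_tuples (cache s0) (cache s1)) = row_shape pp ?m"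
      using map2_xor_length[OF a(1)] a(2) by simp
    then have "length (xor_tuples (cache s0) (cache s1)) = ?m" by (rule shape_length)
    with b have "map length (sort_cache (xor_tuples (cache s0) (cache s1))) = row_shape pp ?m"
      using sort_cache_shape[of "xor_tuples (cache s0) (cache s1)" "Suc (row_width pp)"] by simp
    then have tk: "map length (take (flush_size pp) (sort_cache (xor_tuples (cache s0) (cache s1)))) = row_shape pp (min (flush_size pp) ?m)"
      by (simp add: take_map[symmetric])
    have "length (cache (core (pick i \<sigma>))) = ?m" using arg_cong[OF a(1), of length] by (cases i) (simp_all add: \<sigma>)
    moreover have "pick i (0, 0) = (0 :: zm)" by (cases i) auto
    ultimately show ?thesis
      unfolding flush_fun_def by (simp add: \<sigma> bind_return_pmf tk[symmetric] map_pick_share[of i, symmetric] map_pmf_comp)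
  qed
  show "enc_tuples (pick i (?inp \<sigma> z)) @ enc_tuples y = enc_tuples (cache (core (pick i \<sigma>))) @ enc_tuples y" for z y
    by (cases i) (simp_all add: \<sigma> case_prod_unfold)
  show "core (pick i ((\<lambda>(s0, s1) (y0, y1). (after_flush y0 s0, after_flush y1 s1)) \<sigma> y)) =
      core (after_flush (pick i y) (core (pick i \<sigma>)))" for y
    by (cases i) (simp_all add: \<sigma> case_prod_unfold)
qed simp

theorem rel_run:
  "rel (plain_run pp D t) (count_after pp q D t)
     (run pp (ideal_2pc i enc_transform_in enc_transform_out (transform_fun pp q) (sims 0))
        (ideal_2pc i enc_shrink_in enc_shrink_out (shrink_fun pp) (sims 1))
        (ideal_2pc i enc_tuples enc_tuples (flush_fun pp) (sims 2)) \<kappa> t D)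
     (sim_run pp (count_before pp q D) t)"
proof (induction t)
  case 0
  show ?case using rel_start by simp
next
  case (Suc t)
  let ?P = "plain_receive pp D (Suc t) (plain_run pp D t)"
  let ?cb = "count_before pp q D (Suc t)"
  let ?R = "run pp (ideal_2pc i enc_transform_in enc_transform_out (transform_fun pp q) (sims 0))
        (ideal_2pc i enc_shrink_in enc_shrink_out (shrink_fun pp) (sims 1))
        (ideal_2pc i enc_tuples enc_tuples (flush_fun pp) (sims 2)) \<kappa> t D"
  let ?S = "sim_run pp (count_before pp q D) t"
  let ?Q2 = "bind_pmf (bind_pmf ?R (upload pp D (Suc t))) (transform_phase pp (ideal_2pc i enc_transform_in enc_transform_out (transform_fun pp q) (sims 0)) \<kappa>)"
  let ?S2 = "bind_pmf (bind_pmf ?S (sim_upload pp (Suc t))) (sim_transform pp)"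
  have 2: "rel (plain_run pp D (Suc t)) ?cb ?Q2 ?S2"
    using rel_transform[OF rel_upload[OF Suc, of "Suc t"]] by (simp add: new_rows_def add.commute)
  let ?Q3 = "bind_pmf ?Q2 (\<lambda>e. if interval pp dvd Suc t then shrink_phase (ideal_2pc i enc_shrink_in enc_shrink_out (shrink_fun pp) (sims 1)) \<kappa> e else return_pmf e)"
  let ?S3 = "bind_pmf ?S2 (\<lambda>s. if interval pp dvd Suc t then sim_shrink pp ?cb s else return_pmf s)"
  have "?cb < 2 ^ 32" using count_before_bound[OF pos, of q D "Suc t"] bound by linarith
  then have 3: "rel (plain_run pp D (Suc t)) (count_after pp q D (Suc t)) ?Q3 ?S3"
    using rel_shrink[OF 2] 2 by (simp add: bind_return_pmf' del: count_before.simps)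
  let ?Q4 = "bind_pmf ?Q3 (\<lambda>e. if flush_interval pp dvd Suc t then flush_phase (ideal_2pc i enc_tuples enc_tuples (flush_fun pp) (sims 2)) \<kappa> e else return_pmf e)"
  let ?S4 = "bind_pmf ?S3 (\<lambda>s. if flush_interval pp dvd Suc t then sim_flush pp s else return_pmf s)"
  have 4: "rel (plain_run pp D (Suc t)) (count_after pp q D (Suc t)) ?Q4 ?S4"
    using rel_flush[OF 3] 3 by (cases "flush_interval pp dvd Suc t") (simp_all add: bind_return_pmf' del: count_before.simps plain_run.simps)
  have "?Q4 = bind_pmf ?R (time_step pp (ideal_2pc i enc_transform_in enc_transform_out (transform_fun pp q) (sims 0))
        (ideal_2pc i enc_shrink_in enc_shrink_out (shrink_fun pp) (sims 1))
        (ideal_2pc i enc_tuples enc_tuples (flush_fun pp) (sims 2)) \<kappa> D (Suc t))"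
    by (simp add: time_step_def[abs_def] bind_assoc_pmf transform_phase shrink_phase flush_phase cong: if_cong)
  moreover have "?S4 = bind_pmf ?S (sim_step pp (count_before pp q D) (Suc t))"
    by (simp add: sim_step_def[abs_def] bind_assoc_pmf cong: if_cong)
  ultimately show ?case using 4 by simp
qed

end


section \<open>Differential privacy\<close>

text \<open>Privacy on single outcomes. For discrete distributions this gives the inequality for all
  events, and it composes along \<open>bind_pmf\<close>.\<close>

definition dp_le :: "real \<Rightarrow> 'a pmf \<Rightarrow> 'a pmf \<Rightarrow> bool" where
  "dp_le \<epsilon> p q \<longleftrightarrow> (\<forall>x. pmf p x \<le> exp \<epsilon> * pmf q x)"

lemma dp_le_refl: "0 \<le> \<epsilon> \<Longrightarrow> dp_le \<epsilon> p p"
  by (simp add: dp_le_def mult_le_cancel_right1)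

lemma dp_le_mono: "dp_le \<epsilon> p q \<Longrightarrow> \<epsilon> \<le> \<epsilon>' \<Longrightarrow> dp_le \<epsilon>' p q"
  unfolding dp_le_def by (meson exp_le_cancel_iff mult_right_mono order_trans pmf_nonneg)

lemma dp_le_ennreal: "dp_le \<epsilon> p q \<longleftrightarrow> (\<forall>x. ennreal (pmf p x) \<le> ennreal (exp \<epsilon>) * ennreal (pmf q x))"
  by (simp add: dp_le_def ennreal_mult[symmetric])

lemma nn_integral_measure_pmf_count: "nn_integral (measure_pmf p) g = (\<integral>\<^sup>+x. ennreal (pmf p x) * g x \<partial>count_space UNIV)"
  by (subst measure_pmf_eq_density) (simp add: nn_integral_density)

text \<open>Adaptive composition: inside the sum over intermediate results the two exponential
  factors multiply.\<close>

lemma dp_le_bind: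
  assumes "dp_le a p q" "\<And>x. dp_le b (f x) (g x)"
  shows "dp_le (a + b) (bind_pmf p f) (bind_pmf q g)"
  unfolding dp_le_ennreal
proof
  fix y
  have "ennreal (pmf (bind_pmf p f) y) = (\<integral>\<^sup>+x. ennreal (pmf p x) * ennreal (pmf (f x) y) \<partial>count_space UNIV)"
    by (simp add: ennreal_pmf_bind nn_integral_measure_pmf_count)
  also have "\<dots> \<le> (\<integral>\<^sup>+x. (ennreal (exp a) * ennreal (pmf q x)) * (ennreal (exp b) * ennreal (pmf (g x) y)) \<partial>count_space UNIV)"
    using assms unfolding dp_le_ennreal by (intro nn_integral_mono mult_mono) auto
  also have "\<dots> = (\<integral>\<^sup>+x. ennreal (exp (a + b)) * (ennreal (pmf q x) * ennreal (pmf (g x) y)) \<partial>count_space UNIV)"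
    by (simp add: exp_add ennreal_mult mult_ac)
  also have "\<dots> = ennreal (exp (a + b)) * ennreal (pmf (bind_pmf q g) y)"
    by (simp add: nn_integral_cmult ennreal_pmf_bind nn_integral_measure_pmf_count)
  finally show "ennreal (pmf (bind_pmf p f) y) \<le> ennreal (exp (a + b)) * ennreal (pmf (bind_pmf q g) y)" .
qed

lemma dp_le_bind_same: "0 \<le> b \<Longrightarrow> (\<And>x. dp_le b (f x) (g x)) \<Longrightarrow> dp_le b (bind_pmf p f) (bind_pmf p g)"
  using dp_le_bind[of 0 p p b f g] by (simp add: dp_le_refl)

lemma dp_le_postprocess: "0 \<le> a \<Longrightarrow> dp_le a p q \<Longrightarrow> dp_le a (bind_pmf p f) (bind_pmf q f)"
  using dp_le_bind[of a p q 0 f f] by (simp add: dp_le_refl)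

lemma dp_le_prob:
  assumes "dp_le \<epsilon> p q" shows "measure_pmf.prob p S \<le> exp \<epsilon> * measure_pmf.prob q S"
proof -
  have "emeasure (measure_pmf p) S = (\<integral>\<^sup>+x. ennreal (pmf p x) \<partial>count_space S)"
    by (simp add: nn_integral_pmf)
  also have "\<dots> \<le> (\<integral>\<^sup>+x. ennreal (exp \<epsilon>) * ennreal (pmf q x) \<partial>count_space S)"
    using assms unfolding dp_le_ennreal by (intro nn_integral_mono) auto
  also have "\<dots> = ennreal (exp \<epsilon>) * emeasure (measure_pmf q) S"
    by (simp add: nn_integral_cmult nn_integral_pmf)
  finally show ?thesis
    by (simp add: measure_pmf.emeasure_eq_measure ennreal_mult[symmetric])
qed

text \<open>Rounding and clipping are the same function of \<open>c + y\<close> on both sides.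
  Shifting \<open>y\<close> by \<open>c - c'\<close> therefore turns one event into the other and
  changes the density by at most the factor
  \<open>exp (\<bar>c - c'\<bar> / \<beta>)\<close>.\<close>

lemma dp_le_volume:
  assumes "\<beta> > 0"
  shows "dp_le (\<bar>real c - real c'\<bar> / \<beta>) (volume \<beta> c len) (volume \<beta> c' len)"
  unfolding dp_le_ennreal
proof
  fix x
  let ?A = "\<lambda>c::nat. {y. min len (nat \<lfloor>real c + y\<rfloor>) = x}"
  let ?f = "\<lambda>y. ennreal (exp (- \<bar>y\<bar> / \<beta>) / (2 * \<beta>))"
  let ?d = "real c - real c'"
  have pm: "ennreal (pmf (volume \<beta> c len) x) = (\<integral>\<^sup>+y. ?f y * indicator (?A c) y \<partial>lborel)" for c
  proof -
    have m: "(\<lambda>y. min len (nat \<lfloor>real c + y\<rfloor>)) \<in> measurable (laplace \<beta>) (count_space UNIV)"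
      by (simp add: laplace_def)
    have "ennreal (pmf (volume \<beta> c len) x) = emeasure (measure_pmf (volume \<beta> c len)) {x}"
      by (simp add: emeasure_pmf_single)
    also have "\<dots> = emeasure (laplace \<beta>) ((\<lambda>y. min len (nat \<lfloor>real c + y\<rfloor>)) -` {x} \<inter> space (laplace \<beta>))"
      unfolding measure_pmf_volume[OF assms] by (rule emeasure_distr[OF m]) simp
    also have "(\<lambda>y. min len (nat \<lfloor>real c + y\<rfloor>)) -` {x} \<inter> space (laplace \<beta>) = ?A c"
      by (auto simp: laplace_def)
    also have "emeasure (laplace \<beta>) (?A c) = (\<integral>\<^sup>+y. ?f y * indicator (?A c) y \<partial>lborel)"
      unfolding laplace_def by (intro emeasure_density) measurable
    finally show ?thesis .
  qed
  have "(\<integral>\<^sup>+y. ?f y * indicator (?A c) y \<partial>lborel) = (\<integral>\<^sup>+y. ?f (- ?d + y) * indicator (?A c) (- ?d + y) \<partial>lborel)"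
    using nn_integral_real_affine[of "\<lambda>y. ?f y * indicator (?A c) y" 1 "- ?d"] by simp
  also have "\<dots> \<le> (\<integral>\<^sup>+y. ennreal (exp (\<bar>?d\<bar> / \<beta>)) * (?f y * indicator (?A c') y) \<partial>lborel)"
  proof (rule nn_integral_mono)
    fix y
    have "- \<bar>- ?d + y\<bar> / \<beta> \<le> \<bar>?d\<bar> / \<beta> + - \<bar>y\<bar> / \<beta>"
    proof -
      have "\<bar>y\<bar> \<le> \<bar>- ?d + y\<bar> + \<bar>?d\<bar>" by linarith
      from divide_right_mono[OF this, of \<beta>] assms
      have "\<bar>y\<bar> / \<beta> \<le> \<bar>- ?d + y\<bar> / \<beta> + \<bar>?d\<bar> / \<beta>" by (simp only: add_divide_distrib less_imp_le)
      then show ?thesis unfolding minus_divide_left[symmetric] by linarith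
    qed
    then have "exp (- \<bar>- ?d + y\<bar> / \<beta>) \<le> exp (\<bar>?d\<bar> / \<beta>) * exp (- \<bar>y\<bar> / \<beta>)"
      by (simp flip: exp_add)
    then have "exp (- \<bar>- ?d + y\<bar> / \<beta>) / (2 * \<beta>) \<le> exp (\<bar>?d\<bar> / \<beta>) * (exp (- \<bar>y\<bar> / \<beta>) / (2 * \<beta>))"
      using assms by (simp add: divide_right_mono)
    then have "?f (- ?d + y) \<le> ennreal (exp (\<bar>?d\<bar> / \<beta>)) * ?f y"
      using assms by (simp add: ennreal_mult[symmetric])
    moreover have "indicator (?A c) (- ?d + y) = (indicator (?A c') y :: ennreal)"
    proof -
      have "real c + (- ?d + y) = real c' + y" by simp
      then show ?thesis by (simp only: indicator_def mem_Collect_eq)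
    qed
    ultimately show "?f (- ?d + y) * indicator (?A c) (- ?d + y) \<le> ennreal (exp (\<bar>?d\<bar> / \<beta>)) * (?f y * indicator (?A c') y)"
      by (simp add: mult.assoc[symmetric] mult_right_mono)
  qed
  also have "\<dots> = ennreal (exp (\<bar>?d\<bar> / \<beta>)) * (\<integral>\<^sup>+y. ?f y * indicator (?A c') y \<partial>lborel)"
    by (intro nn_integral_cmult) measurable
  finally show "ennreal (pmf (volume \<beta> c len) x) \<le> ennreal (exp (\<bar>?d\<bar> / \<beta>)) * ennreal (pmf (volume \<beta> c' len) x)"
    unfolding pm .
qed

lemma dp_sim_shrink:
  assumes "eps pp > 0" "budget pp > 0"
  shows "dp_le (\<bar>real c - real c'\<bar> * eps pp / real (budget pp)) (sim_shrink pp c s) (sim_shrink pp c' s)"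
proof -
  let ?d = "\<bar>real c - real c'\<bar> * eps pp / real (budget pp)"
  have d: "0 \<le> ?d" using assms by simp
  have "dp_le ?d (volume (real (budget pp) / eps pp) c len) (volume (real (budget pp) / eps pp) c' len)" for len
    using dp_le_volume[of "real (budget pp) / eps pp" c c' len] assms by simp
  then show ?thesis
    unfolding sim_shrink_def sim_call_def case_prod_unfold map_pmf_def
    by (intro dp_le_postprocess d)
qed

text \<open>A release costs in proportion to how far the two counts differ at that moment. Many
  releases thus stay cheap if the differences add up to little.\<close>

lemma dp_sim_run:
  assumes "eps pp > 0" "budget pp > 0"
  shows "dp_le ((\<Sum>t | t \<in> {1..N} \<and> interval pp dvd t. \<bar>real (cs t) - real (cs' t)\<bar>) * eps pp / real (budget pp))
    (sim_run pp cs N) (sim_run pp cs' N)"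
proof (induction N)
  case 0
  show ?case by (simp add: dp_le_refl)
next
  case (Suc N)
  let ?k = "eps pp / real (budget pp)"
  let ?s = "\<lambda>N. (\<Sum>t | t \<in> {1..N} \<and> interval pp dvd t. \<bar>real (cs t) - real (cs' t)\<bar>)"
  let ?d = "if interval pp dvd Suc N then \<bar>real (cs (Suc N)) - real (cs' (Suc N))\<bar> * eps pp / real (budget pp) else 0"
  have d: "0 \<le> ?d" using assms by simp
  have st: "dp_le ?d (sim_step pp cs (Suc N) s) (sim_step pp cs' (Suc N) s)" for s
    unfolding sim_step_def
    by (intro dp_le_bind_same dp_le_postprocess d)
       (auto intro: dp_le_refl dp_sim_shrink[OF assms])
  have "{t \<in> {1..Suc N}. interval pp dvd t} =
      (if interval pp dvd Suc N then insert (Suc N) {t \<in> {1..N}. interval pp dvd t} else {t \<in> {1..N}. interval pp dvd t})"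
    by (auto simp: le_Suc_eq)
  then have "?s (Suc N) * eps pp / real (budget pp) = ?s N * eps pp / real (budget pp) + ?d"
    by (simp add: add_divide_distrib distrib_right)
  then show ?case using dp_le_bind[OF Suc st] by simp
qed


subsection \<open>Sensitivity\<close>

lemma filter_instance_at:
  "filter_mset (\<lambda>x. fst x = i) (instance_at D t) = (if i \<in> {1..t} then image_mset (Pair i) (D i) else {#})"
proof (induction t)
  case (Suc t)
  have "instance_at D (Suc t) = instance_at D t + image_mset (Pair (Suc t)) (D (Suc t))"
    by (simp add: instance_at_def)
  moreover have "filter_mset (\<lambda>x. fst x = i) (image_mset (Pair (Suc t)) (D (Suc t))) =
      (if i = Suc t then image_mset (Pair i) (D i) else {#})"
    by (auto simp: filter_mset_image_mset o_def)
  ultimately show ?case using Suc by auto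
qed (simp add: instance_at_def)

lemma image_snd_Pair [simp]: "image_mset snd (image_mset (Pair i) A) = A"
  by (simp add: image_mset.compositionality o_def)

lemma image_Pair_inj: "image_mset (Pair i) A = image_mset (Pair i) B \<Longrightarrow> A = B"
  by (metis image_snd_Pair)

text \<open>\<open>neighboring\<close> allows a different record at each time. Instances carry time
  stamps, however, so the difference at \<open>Suc \<tau>\<close> persists in all later instances
  and uses up the single record by which they may differ.\<close>

lemma differ_once:
  assumes eq: "\<And>t. t \<le> \<tau> \<Longrightarrow> instance_at D t = instance_at D' t"
    and diff: "\<And>t. t > \<tau> \<Longrightarrow> \<exists>u. instance_at D t = add_mset u (instance_at D' t) \<or> instance_at D' t = add_mset u (instance_at D t)"
    and now: "instance_at D (Suc \<tau>) = add_mset u (instance_at D' (Suc \<tau>))"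
  shows "\<exists>x. D (Suc \<tau>) = add_mset x (D' (Suc \<tau>)) \<and> (\<forall>t \<ge> 1. t \<noteq> Suc \<tau> \<longrightarrow> D t = D' t)"
proof -
  let ?k = "Suc \<tau>"
  have before: "D t = D' t" if "t \<ge> 1" "t \<le> \<tau>" for t
  proof -
    have "image_mset (Pair t) (D t) = image_mset (Pair t) (D' t)"
      using arg_cong[OF eq[OF that(2)], of "filter_mset (\<lambda>x. fst x = t)"] that(1) by (simp add: filter_instance_at)
    then show ?thesis by (rule image_Pair_inj)
  qed
  have inst: "instance_at E ?k = instance_at E \<tau> + image_mset (Pair ?k) (E ?k)" for E :: gdb
    by (simp add: instance_at_def)
  have k: "image_mset (Pair ?k) (D ?k) = add_mset u (image_mset (Pair ?k) (D' ?k))"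
    using now eq[of \<tau>] by (simp add: inst)
  then have fu: "fst u = ?k" by (metis fst_conv image_iff set_image_mset union_single_eq_member)
  have kx: "D ?k = add_mset (snd u) (D' ?k)"
    using arg_cong[OF k, of "image_mset snd"] by (simp add: image_mset.compositionality o_def)
  have after: "D t = D' t" if t: "t > ?k" for t
  proof -
    obtain w where "instance_at D t = add_mset w (instance_at D' t) \<or> instance_at D' t = add_mset w (instance_at D t)"
      using diff[of t] t by auto
    then show ?thesis
    proof
      assume w: "instance_at D t = add_mset w (instance_at D' t)"
      \<comment> \<open>If \<open>w\<close> had another time stamp, the parts of the two instances
        belonging to step \<open>?k\<close> would coincide.\<close>
      have "fst w = ?k"
      proof (rule ccontr)
        assume "fst w \<noteq> ?k"
        then have "image_mset (Pair ?k) (D ?k) = image_mset (Pair ?k) (D' ?k)"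
          using arg_cong[OF w, of "filter_mset (\<lambda>x. fst x = ?k)"] t by (simp add: filter_instance_at)
        then show False using k by simp
      qed
      then have "image_mset (Pair t) (D t) = image_mset (Pair t) (D' t)"
        using arg_cong[OF w, of "filter_mset (\<lambda>x. fst x = t)"] t by (simp add: filter_instance_at)
      then show ?thesis by (rule image_Pair_inj)
    next
      assume w: "instance_at D' t = add_mset w (instance_at D t)"
      \<comment> \<open>Contradicts \<open>kx\<close>, by which \<open>D\<close> has one record more
        than \<open>D'\<close> at this step.\<close>
      have "size (D ?k) \<le> size (D' ?k)"
        using arg_cong[OF arg_cong[OF w, of "filter_mset (\<lambda>x. fst x = ?k)"], of size] t
        by (simp add: filter_instance_at split: if_splits)
      then show ?thesis using kx by simp
    qed
  qed
  show ?thesis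
  proof (intro exI conjI allI impI)
    show "D ?k = add_mset (snd u) (D' ?k)" by (rule kx)
    fix t assume "t \<ge> 1" "t \<noteq> ?k"
    then show "D t = D' t" using before[of t] after[of t] by (cases "t \<le> \<tau>") auto
  qed
qed

lemma neighboring_differ_once:
  assumes "neighboring D D'"
  obtains k x where "k \<ge> 1" "\<And>t. t \<ge> 1 \<Longrightarrow> t \<noteq> k \<Longrightarrow> D t = D' t"
    "D k = add_mset x (D' k) \<or> D' k = add_mset x (D k)"
proof -
  obtain \<tau> where \<tau>: "\<And>t. t \<le> \<tau> \<Longrightarrow> instance_at D t = instance_at D' t"
    "\<And>t. t > \<tau> \<Longrightarrow> \<exists>u. instance_at D t = add_mset u (instance_at D' t) \<or> instance_at D' t = add_mset u (instance_at D t)"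
    using assms unfolding neighboring_def by blast
  obtain u where "instance_at D (Suc \<tau>) = add_mset u (instance_at D' (Suc \<tau>)) \<or> instance_at D' (Suc \<tau>) = add_mset u (instance_at D (Suc \<tau>))"
    using \<tau>(2)[of "Suc \<tau>"] by auto
  then show ?thesis
  proof
    assume "instance_at D (Suc \<tau>) = add_mset u (instance_at D' (Suc \<tau>))"
    from differ_once[OF \<tau> this] obtain x where "D (Suc \<tau>) = add_mset x (D' (Suc \<tau>))"
      "\<forall>t \<ge> 1. t \<noteq> Suc \<tau> \<longrightarrow> D t = D' t" by blast
    then show ?thesis using that[of "Suc \<tau>" x] by simp
  next
    assume a: "instance_at D' (Suc \<tau>) = add_mset u (instance_at D (Suc \<tau>))"
    have "\<exists>u. instance_at D' t = add_mset u (instance_at D t) \<or> instance_at D t = add_mset u (instance_at D' t)" if "t > \<tau>" for t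
      using \<tau>(2)[OF that] by blast
    from differ_once[OF \<tau>(1)[symmetric] this a] obtain x where "D' (Suc \<tau>) = add_mset x (D (Suc \<tau>))"
      "\<forall>t \<ge> 1. t \<noteq> Suc \<tau> \<longrightarrow> D' t = D t" by blast
    then show ?thesis using that[of "Suc \<tau>" x] by simp
  qed
qed

lemma size_diff_mset:
  fixes P Q :: "'a multiset"
  shows "\<bar>real (size P) - real (size Q)\<bar> \<le> real (size (P - Q) + size (Q - P))"
proof -
  have "P + (Q - P) = Q + (P - Q)"
  proof (rule multiset_eqI)
    fix x
    have "a + (b - a) = b + (a - b)" for a b :: nat by arith
    then show "count (P + (Q - P)) x = count (Q + (P - Q)) x" by simp
  qed
  from arg_cong[OF this, of size] have "size P + size (Q - P) = size Q + size (P - Q)" by simp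
  then show ?thesis by linarith
qed

text \<open>The truncation bound limits the change of the query result, and cutting off at
  \<open>out_size pp\<close> is 1-Lipschitz.\<close>

lemma row_count_neighbor:
  assumes tq: "truncated_query (trunc pp) w q" and m: "m = add_mset x m' \<or> m' = add_mset x m"
    and P: "map snd (plain_usable pp P) = Ws @ m # Ws'" "map snd (plain_usable pp P') = Ws @ m' # Ws'"
  shows "\<bar>real (row_count pp q P) - real (row_count pp q P')\<bar> \<le> real (trunc pp)"
proof -
  let ?A = "q (Ws @ m # Ws')" and ?B = "q (Ws @ m' # Ws')"
  have "size (?A - ?B) + size (?B - ?A) \<le> trunc pp"
    using m tq unfolding truncated_query_def Let_def by (metis add.commute)
  then have "\<bar>real (size ?A) - real (size ?B)\<bar> \<le> real (trunc pp)"
    using size_diff_mset[of ?A ?B] by linarith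
  then show ?thesis unfolding row_count_def P by linarith
qed

text \<open>The stores differ in at most one batch, whose remaining budget pays for all future differences.\<close>

definition store_gap :: "real \<Rightarrow> plain_store \<Rightarrow> plain_store \<Rightarrow> bool" where
  "store_gap \<beta> P P' \<longleftrightarrow> (P = P' \<and> 0 \<le> \<beta>) \<or> (\<exists>L r m m' x R. P = L @ (r, m) # R \<and> P' = L @ (r, m') # R \<and>
     (m = add_mset x m' \<or> m' = add_mset x m) \<and> real r \<le> \<beta>)"

lemma store_gap_append: "store_gap \<beta> P P' \<Longrightarrow> store_gap \<beta> (P @ Q) (P' @ Q)"
  unfolding store_gap_def
proof (erule disjE, goal_cases)
  case 2
  then obtain L r m m' x R where "P = L @ (r, m) # R" "P' = L @ (r, m') # R" "m = add_mset x m' \<or> m' = add_mset x m" "real r \<le> \<beta>"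
    by blast
  then show "(P @ Q = P' @ Q \<and> 0 \<le> \<beta>) \<or> (\<exists>L r m m' x R. P @ Q = L @ (r, m) # R \<and> P' @ Q = L @ (r, m') # R \<and>
     (m = add_mset x m' \<or> m' = add_mset x m) \<and> real r \<le> \<beta>)"
    by (intro disjI2 exI[of _ L] exI[of _ r] exI[of _ m] exI[of _ m'] exI[of _ x] exI[of _ "R @ Q"]) auto
qed simp

lemma store_gap_spend:
  assumes tq: "truncated_query (trunc pp) w q" and g: "store_gap \<beta> P P'"
  shows "store_gap (\<beta> - \<bar>real (row_count pp q P) - real (row_count pp q P')\<bar>) (plain_spend pp P) (plain_spend pp P')"
proof (cases "plain_usable pp P = plain_usable pp P'")
  \<comment> \<open>A differing batch, if there is one, is exhausted, and \<open>plain_spend\<close>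
    drops it from both stores.\<close>
  case True
  moreover have "0 \<le> \<beta>" using g unfolding store_gap_def by (auto intro: order_trans[OF of_nat_0_le_iff])
  ultimately show ?thesis by (simp add: store_gap_def plain_spend_def row_count_def)
next
  case False
  then obtain L r m m' x R where *: "P = L @ (r, m) # R" "P' = L @ (r, m') # R"
     "m = add_mset x m' \<or> m' = add_mset x m" "real r \<le> \<beta>" and r: "trunc pp \<le> r"
    using g unfolding store_gap_def by (auto simp: plain_usable_def split: if_splits)
  have u: "plain_usable pp P = plain_usable pp L @ (r, m) # plain_usable pp R"
    "plain_usable pp P' = plain_usable pp L @ (r, m') # plain_usable pp R"
    using r by (simp_all add: * plain_usable_def)
  have "\<bar>real (row_count pp q P) - real (row_count pp q P')\<bar> \<le> real (trunc pp)"
    by (rule row_count_neighbor[OF tq *(3)]) (simp_all add: u)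
  moreover have "plain_spend pp P = plain_spend pp L @ (r - trunc pp, m) # plain_spend pp R"
    "plain_spend pp P' = plain_spend pp L @ (r - trunc pp, m') # plain_spend pp R"
    by (simp_all add: plain_spend_def u)
  ultimately show ?thesis using *(3,4) r unfolding store_gap_def
    by (intro disjI2 exI[of _ "plain_spend pp L"] exI[of _ "r - trunc pp"] exI[of _ m] exI[of _ m'] exI[of _ x] exI[of _ "plain_spend pp R"]) auto
qed

lemma new_rows_sensitivity:
  assumes tq: "truncated_query (trunc pp) w q" and k: "k \<ge> 1" "\<And>t. t \<ge> 1 \<Longrightarrow> t \<noteq> k \<Longrightarrow> D t = D' t"
    "D k = add_mset x (D' k) \<or> D' k = add_mset x (D k)"
  shows "(\<Sum>t<N. \<bar>real (new_rows pp q D t) - real (new_rows pp q D' t)\<bar>) \<le> real (budget pp)"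
proof -
  let ?a = "\<lambda>t. \<bar>real (new_rows pp q D t) - real (new_rows pp q D' t)\<bar>"
  have "store_gap (real (budget pp) - (\<Sum>t<N. ?a t)) (plain_run pp D N) (plain_run pp D' N) \<and>
      (N < k \<longrightarrow> plain_run pp D N = plain_run pp D' N \<and> (\<Sum>t<N. ?a t) = 0)" for N
  proof (induction N)
    case 0
    show ?case by (simp add: store_gap_def)
  next
    case (Suc N)
    let ?P = "plain_receive pp D (Suc N) (plain_run pp D N)" and ?P' = "plain_receive pp D' (Suc N) (plain_run pp D' N)"
    let ?\<beta> = "real (budget pp) - (\<Sum>t<N. ?a t)"
    have "store_gap ?\<beta> ?P ?P'"
    proof (cases "Suc N = k")
      case True
      \<comment> \<open>Nothing has been spent before step \<open>k\<close>, so the batch that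
        differs starts with the full budget.\<close>
      then have eq: "plain_run pp D N = plain_run pp D' N" "(\<Sum>t<N. ?a t) = 0" using Suc by auto
      show ?thesis unfolding store_gap_def plain_receive_def True eq using k(3)
        by (intro disjI2 exI[of _ "plain_run pp D' N"] exI[of _ "budget pp"] exI[of _ "image_mset snd (D k)"]
            exI[of _ "image_mset snd (D' k)"] exI[of _ "snd x"] exI[of _ "[]"]) auto
    next
      case False
      then have "D (Suc N) = D' (Suc N)" using k(2)[of "Suc N"] by simp
      then show ?thesis using Suc unfolding plain_receive_def by (auto intro: store_gap_append)
    qed
    from store_gap_spend[OF tq this]
    have "store_gap (?\<beta> - ?a N) (plain_run pp D (Suc N)) (plain_run pp D' (Suc N))" by (simp add: new_rows_def)
    moreover have "?P = ?P'" if "Suc N < k" using Suc k(2)[of "Suc N"] that by (simp add: plain_receive_def)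
    ultimately show ?case using Suc by (auto simp: new_rows_def algebra_simps)
  qed
  then have "store_gap (real (budget pp) - (\<Sum>t<N. ?a t)) (plain_run pp D N) (plain_run pp D' N)" by blast
  then have "0 \<le> real (budget pp) - (\<Sum>t<N. ?a t)"
    unfolding store_gap_def by (auto intro: order_trans[OF of_nat_0_le_iff])
  then show ?thesis by simp
qed

text \<open>A released count sums the new rows since the previous reset. These intervals are
  disjoint, so by the triangle inequality each step is charged at most once.\<close>

lemma count_before_sensitivity:
  "(\<Sum>t | t \<in> {1..N} \<and> interval pp dvd t. \<bar>real (count_before pp q D t) - real (count_before pp q D' t)\<bar>)
     \<le> (\<Sum>t<N. \<bar>real (new_rows pp q D t) - real (new_rows pp q D' t)\<bar>)"
proof -
  let ?a = "\<lambda>t. \<bar>real (new_rows pp q D t) - real (new_rows pp q D' t)\<bar>"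
  let ?c = "\<lambda>t. \<bar>real (count_before pp q D t) - real (count_before pp q D' t)\<bar>"
  let ?s = "\<lambda>N. \<Sum>t | t \<in> {1..N} \<and> interval pp dvd t. ?c t"
  \<comment> \<open>The extra term carries the difference accumulated in the counter since the last
    release; it makes the induction go through between releases.\<close>
  have "?s N + (if interval pp dvd N then 0 else ?c N) \<le> (\<Sum>t<N. ?a t)"
  proof (induction N)
    case (Suc N)
    have "{t \<in> {1..Suc N}. interval pp dvd t} =
        (if interval pp dvd Suc N then insert (Suc N) {t \<in> {1..N}. interval pp dvd t} else {t \<in> {1..N}. interval pp dvd t})"
      by (auto simp: le_Suc_eq)
    then have "?s (Suc N) + (if interval pp dvd Suc N then 0 else ?c (Suc N)) = ?s N + ?c (Suc N)" by simp
    moreover have "?c (Suc N) \<le> (if interval pp dvd N then 0 else ?c N) + ?a N" by auto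
    ultimately show ?case using Suc by simp
  qed simp
  moreover have "0 \<le> (if interval pp dvd N then 0 else ?c N)" by simp
  ultimately show ?thesis by linarith
qed

theorem sim_run_private:
  assumes pos: "eps pp > 0" "budget pp > 0" and tq: "truncated_query (trunc pp) w q" and nb: "neighboring D D'"
  shows "dp_le (eps pp) (sim_run pp (count_before pp q D) N) (sim_run pp (count_before pp q D') N)"
proof (rule dp_le_mono[OF dp_sim_run[OF pos]])
  obtain k x where k: "k \<ge> 1" "\<And>t. t \<ge> 1 \<Longrightarrow> t \<noteq> k \<Longrightarrow> D t = D' t"
    "D k = add_mset x (D' k) \<or> D' k = add_mset x (D k)"
    using neighboring_differ_once[OF nb] by blast
  let ?s = "\<Sum>t | t \<in> {1..N} \<and> interval pp dvd t. \<bar>real (count_before pp q D t) - real (count_before pp q D' t)\<bar>"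
  have "?s \<le> real (budget pp)"
    using count_before_sensitivity[where N = N and pp = pp and q = q and D = D and D' = D'] new_rows_sensitivity[where D = D and D' = D', OF tq k, of N] by linarith
  then have "?s * (eps pp / real (budget pp)) \<le> real (budget pp) * (eps pp / real (budget pp))"
    using pos by (intro mult_right_mono) auto
  then show "?s * eps pp / real (budget pp) \<le> eps pp" using pos by simp
qed


section \<open>The simulator\<close>

text \<open>The order matters: scripts address the pairs at 0, 2 and 6 by adding
  \<open>of_bool\<close>, and the simulator with number \<open>k\<close> as
  \<open>8 + k\<close>.\<close>

definition base_ops :: "(nat \<Rightarrow> com) \<Rightarrow> op list" where
  "base_ops sims = [LitOp False, LitOp True, XorOp False, XorOp True, BackOp, SkipOp, ArgOp False, ArgOp True,
     CallOp (sims 0), CallOp (sims 1), CallOp (sims 2)]"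

lemma base_ops_nth:
  "base_ops sims ! (of_bool b) = LitOp b" "base_ops sims ! (2 + of_bool b) = XorOp b"
  "base_ops sims ! 4 = BackOp" "base_ops sims ! 5 = SkipOp" "base_ops sims ! (6 + of_bool b) = ArgOp b"
  "k < 3 \<Longrightarrow> base_ops sims ! (8 + k) = CallOp (sims k)"
proof -
  show "base_ops sims ! (of_bool b) = LitOp b" "base_ops sims ! (2 + of_bool b) = XorOp b"
    "base_ops sims ! (6 + of_bool b) = ArgOp b"
    by (cases b; simp add: base_ops_def)+
  assume "k < 3"
  then have "k = 0 \<or> k = 1 \<or> k = 2" by auto
  then show "base_ops sims ! (8 + k) = CallOp (sims k)" by (auto simp: base_ops_def)
qed (simp_all add: base_ops_def)

lemma base_ops_Suc:
  "base_ops sims ! Suc (Suc 0) = XorOp False" "base_ops sims ! Suc (Suc (Suc 0)) = XorOp True"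
  by (simp_all add: base_ops_def)

definition bxor :: "bool \<Rightarrow> bool \<Rightarrow> bool" where "bxor a b \<longleftrightarrow> a \<noteq> b"

definition lit_script :: "bool list \<Rightarrow> nat list" where "lit_script x = map of_bool (rev x)"
definition xor_script :: "bool list \<Rightarrow> nat list" where "xor_script x = map (\<lambda>b. 2 + of_bool b) (rev x)"
definition arg_script :: "bool list \<Rightarrow> nat list" where "arg_script x = map (\<lambda>b. 6 + of_bool b) (rev x)"

context
  fixes \<kappa> :: nat and sims :: "nat \<Rightarrow> com"
begin

abbreviation "rn \<equiv> run_ops \<kappa> (base_ops sims)"

lemma rn_lit: "rn (lit_script x) (out, own, sav, arg) = return_pmf (x @ out, own, sav, arg)"
  by (induction x arbitrary: out) (simp_all add: lit_script_def run_ops_append bind_return_pmf base_ops_nth)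

lemma rn_arg: "rn (arg_script x) (out, own, sav, arg) = return_pmf (out, own, sav, x @ arg)"
  by (induction x arbitrary: arg) (simp_all add: arg_script_def run_ops_append bind_return_pmf base_ops_nth)

lemma rn_xor:
  "length x = length m \<Longrightarrow> rn (xor_script m) (out, rev x @ own, sav, arg) = return_pmf (map2 bxor x m @ out, own, x @ sav, arg)"
proof (induction x m arbitrary: own rule: list_induct2)
  case (Cons b x c m)
  show ?case using Cons.IH[of "b # own"]
    by (cases c) (simp_all add: xor_script_def run_ops_append bind_return_pmf base_ops_Suc bxor_def)
qed (simp add: xor_script_def)

lemma rn_back: "rn (replicate (length x) 4) (out, own, x @ sav, arg) = return_pmf (out, rev x @ own, sav, arg)"
  by (induction x arbitrary: own) (simp_all add: bind_return_pmf base_ops_nth)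

fun tok_script :: "tok \<Rightarrow> nat list" where
  "tok_script (Lit x) = lit_script x"
| "tok_script (Call k x) = arg_script x @ [8 + k]"

fun tok_ok :: "tok \<Rightarrow> bool" where
  "tok_ok (Lit x) \<longleftrightarrow> True"
| "tok_ok (Call k x) \<longleftrightarrow> k < 3"

text \<open>The output grows from its end, so the last token is treated first and the simulators are
  called in reverse order; their answers are independent, which makes the order immaterial.\<close>

lemma rn_toks:
  "list_all tok_ok ks \<Longrightarrow> rn (concat (map tok_script (rev ks))) (out, own, sav, []) =
     map_pmf (\<lambda>w. (w @ out, own, sav, [])) (expand \<kappa> sims ks)"
proof (induction ks)
  case (Cons k ks)
  have IH: "rn (concat (map tok_script (rev ks))) (out, own, sav, []) =
     map_pmf (\<lambda>w. (w @ out, own, sav, [])) (expand \<kappa> sims ks)" using Cons by simp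
  show ?case
  proof (cases k)
    case (Lit x)
    then show ?thesis
      by (simp add: run_ops_append IH bind_map_pmf rn_lit map_pmf_comp) (simp add: map_pmf_def)
  next
    case (Call j x)
    then have j: "j < 3" using Cons by simp
    have "rn (concat (map tok_script (rev (k # ks)))) (out, own, sav, []) =
       bind_pmf (expand \<kappa> sims ks) (\<lambda>w. bind_pmf (exec (sims j) (enc_nat \<kappa> @ x))
         (\<lambda>v. return_pmf (enc_bits v @ w @ out, own, sav, [])))"
      by (simp add: Call run_ops_append IH bind_map_pmf rn_arg bind_return_pmf bind_return_pmf' base_ops_nth j map_pmf_def bind_assoc_pmf)
    also have "\<dots> = bind_pmf (exec (sims j) (enc_nat \<kappa> @ x)) (\<lambda>v. bind_pmf (expand \<kappa> sims ks)
         (\<lambda>w. return_pmf (enc_bits v @ w @ out, own, sav, [])))"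
      by (rule bind_commute_pmf)
    finally show ?thesis by (simp add: Call map_bind_pmf)
  qed
qed simp

text \<open>A mask that leaves the delimiters of the encoding alone.\<close>

definition mask_row :: "tuple \<Rightarrow> bool list" where
  "mask_row r = concat (map (\<lambda>w. False # enc_zm w) r) @ [False]"

definition mask :: "tuple list \<Rightarrow> bool list" where
  "mask R = concat (map (\<lambda>r. False # mask_row r) R) @ [False]"

lemma length_enc_zm [simp]: "length (enc_zm w) = 32"
  by (simp add: enc_zm_def)

lemma enc_zm_xor: "map2 bxor (enc_zm x) (enc_zm r) = enc_zm (xor x r)"
  by (simp add: enc_zm_def zip_map1 zip_map2 zip_same_conv_map o_def bit_xor_iff bxor_def)

lemma mask_row_xor:
  "length x = length r \<Longrightarrow> length (enc_list enc_zm x) = length (mask_row r) \<and>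
     map2 bxor (enc_list enc_zm x) (mask_row r) = enc_list enc_zm (map2 xor x r)"
  by (induction x r rule: list_induct2) (simp_all add: mask_row_def enc_zm_xor bxor_def[of _ False] bxor_def[of False])

lemma mask_xor:
  "map length X = map length R \<Longrightarrow> length (enc_tuples X) = length (mask R) \<and>
     map2 bxor (enc_tuples X) (mask R) = enc_tuples (xor_tuples X R)"
  by (induction X R rule: shape_induct) (simp_all add: mask_def enc_tuples_def mask_row_xor bxor_def[of _ False])

text \<open>Back to front: second share, first share, the batch. The share that is not the mask
  arises by xoring the batch with the mask, the batch itself by xoring with zeros. Each use is
  followed by a restore through operation 4; the final skips drop the batch and the list marker in
  front of it.\<close>

fun batch_script :: "server \<Rightarrow> nat \<Rightarrow> nat \<times> tuple list list \<Rightarrow> nat list" where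
  "batch_script i j (t, Rs) =
     (if i = S0 then xor_script (mask (Rs ! j)) @ lit_script (enc_tuples (Rs ! j))
      else lit_script (enc_tuples (Rs ! j)) @ xor_script (mask (Rs ! j))) @
     replicate (length (mask (Rs ! j))) 4 @ xor_script (replicate (length (mask (Rs ! j))) False) @
     replicate (length (mask (Rs ! j))) 4 @ replicate (length (mask (Rs ! j))) 5 @ [5]"

lemma rn_skip: "rn (replicate (length x) 5) (out, x @ own, sav, arg) = return_pmf (out, own, sav, arg)"
  by (induction x) (simp_all add: bind_return_pmf base_ops_nth)

lemma map2_False: "map2 bxor x (replicate (length x) False) = x"
  by (induction x) (auto simp: bxor_def)

lemma rn_batch:
  assumes "map length (owner_batch pp D t j) = map length (Rs ! j)"
  shows "rn (batch_script i j (t, Rs)) (out, rev (enc_tuples (owner_batch pp D t j)) @ b # own, [], []) =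
    return_pmf (batch_view i pp D j (t, Rs) @ out, own, [], [])"
proof -
  let ?X = "owner_batch pp D t j" and ?R = "Rs ! j"
  let ?x = "enc_tuples ?X"
  have l: "length (mask ?R) = length ?x" and x: "map2 bxor ?x (mask ?R) = enc_tuples (xor_tuples ?X ?R)"
    using mask_xor[OF assms] by auto
  have xs: "rn (xor_script (mask ?R)) (o', rev ?x @ own', [], []) = return_pmf (enc_tuples (xor_tuples ?X ?R) @ o', own', ?x, [])" for o' own'
    using rn_xor[of ?x "mask ?R" o' own' "[]" "[]"] l x by simp
  have xf: "rn (xor_script (replicate (length ?x) False)) (o', rev ?x @ own', [], []) = return_pmf (?x @ o', own', ?x, [])" for o' own'
    using rn_xor[of ?x "replicate (length ?x) False" o' own' "[]" "[]"] by (simp add: map2_False)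
  have bk: "rn (replicate (length ?x) 4) (o', own', ?x, []) = return_pmf (o', rev ?x @ own', [], [])" for o' own'
    using rn_back[of ?x o' own' "[]" "[]"] by simp
  have sk: "rn (replicate (length ?x) 5) (o', rev ?x @ own', [], []) = return_pmf (o', own', [], [])" for o' own'
    using rn_skip[of "rev ?x" o' own' "[]" "[]"] by simp
  show ?thesis
    by (cases i) (simp_all add: l run_ops_append rn_lit xs xf bk sk bind_return_pmf base_ops_nth Let_def)
qed

end


section \<open>Scripts for all batches of all corrupted owners\<close>

definition good_masks :: "params \<Rightarrow> gdb \<Rightarrow> masks \<Rightarrow> bool" where
  "good_masks pp D M \<longleftrightarrow> (\<forall>(t, Rs) \<in> set M. \<forall>j < num_owners pp. map length (owner_batch pp D t j) = map length (Rs ! j))"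

text \<open>The leading skip removes the list terminator, the first bit met when the data of an
  owner are read from the end.\<close>

definition owner_script :: "server \<Rightarrow> masks \<Rightarrow> nat \<Rightarrow> nat list" where
  "owner_script i M j = 5 # concat (map (batch_script i j) (rev M))"

lemma rn_batches:
  assumes "good_masks pp D M" "j < num_owners pp"
  shows "run_ops \<kappa> (base_ops sims) (concat (map (batch_script i j) (rev M)))
      (out, rev (concat (map (\<lambda>x. True # enc_tuples (owner_batch pp D (fst x) j)) M)) @ own, [], []) =
    return_pmf (concat (map (batch_view i pp D j) M) @ out, own, [], [])"
  using assms(1)
proof (induction M arbitrary: own)
  case (Cons x M)
  obtain t Rs where x: "x = (t, Rs)" by force
  have g: "map length (owner_batch pp D t j) = map length (Rs ! j)" "good_masks pp D M"
    using Cons.prems assms(2) by (auto simp: good_masks_def x)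
  show ?case using Cons.IH[OF g(2)]
    by (simp add: x run_ops_append bind_return_pmf rn_batch[OF g(1)] del: batch_view.simps batch_script.simps)
qed simp

lemma rn_owner:
  assumes "good_masks pp D M" "j < num_owners pp" "map fst M = [1..<Suc N]"
  shows "run_ops \<kappa> (base_ops sims) (owner_script i M j) (out, rev (owner_data pp N D j) @ own, [], []) =
    return_pmf (concat (map (batch_view i pp D j) M) @ out, own, [], [])"
proof -
  have "owner_data pp N D j = concat (map (\<lambda>x. True # enc_tuples (owner_batch pp D (fst x) j)) M) @ [False]"
    unfolding owner_data_def assms(3)[symmetric] enc_list_def by (simp add: o_def)
  then show ?thesis
    using rn_batches[OF assms(1,2), of \<kappa> sims i out own]
    by (simp add: owner_script_def base_ops_nth bind_return_pmf)
qed

definition owners_script :: "server \<Rightarrow> masks \<Rightarrow> nat list \<Rightarrow> nat list" where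
  "owners_script i M J = concat (map (owner_script i M) (rev J))"

lemma rn_owners:
  assumes "good_masks pp D M" "\<forall>j \<in> set J. j < num_owners pp" "map fst M = [1..<Suc N]"
  shows "run_ops \<kappa> (base_ops sims) (owners_script i M J) (out, rev (concat (map (owner_data pp N D) J)) @ own, [], []) =
    return_pmf (concat (map (\<lambda>j. concat (map (batch_view i pp D j) M)) J) @ out, own, [], [])"
  using assms(2)
proof (induction J arbitrary: own)
  case (Cons j J)
  then show ?case
    using Cons.IH[of "rev (owner_data pp N D j) @ own"] rn_owner[OF assms(1) _ assms(3), of j]
    by (simp add: owners_script_def run_ops_append bind_return_pmf)
qed (simp add: owners_script_def)

text \<open>The part of the corruption pattern that matters: the corrupted server, if any, and the
  corrupted owners. The mechanism outputs one script per pattern; the operation numbers of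
  pattern \<open>k\<close> are shifted by \<open>11 * k\<close>.\<close>

type_synonym pattern = "server option \<times> nat list"

definition patterns :: "nat \<Rightarrow> pattern list" where
  "patterns n = List.product [None, Some S0, Some S1] (List.subseqs [0..<n])"

definition pattern_of :: "nat \<Rightarrow> party set \<Rightarrow> pattern" where
  "pattern_of n C = (if Server S0 \<in> C then Some S0 else if Server S1 \<in> C then Some S1 else None,
     filter (\<lambda>j. Owner j \<in> C) [0..<n])"

lemma filter_in_subseqs: "filter Q xs \<in> set (List.subseqs xs)"
  by (induction xs) (auto simp: Let_def)

lemma pattern_of_in: "pattern_of n C \<in> set (patterns n)"
  by (auto simp: pattern_of_def patterns_def filter_in_subseqs)

text \<open>With no server corrupted, reading the masks as the shares of \<open>S0\<close> is a mere
  convention.\<close>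

fun server_of :: "server option \<Rightarrow> server" where
  "server_of None = S0"
| "server_of (Some i) = i"

definition pattern_script :: "sim_state \<Rightarrow> pattern \<Rightarrow> nat list" where
  "pattern_script = (\<lambda>(\<sigma>, M, ks) (so, J).
     (if so = None then [] else concat (map tok_script (rev ks))) @ owners_script (server_of so) M J)"

definition all_scripts :: "nat \<Rightarrow> sim_state \<Rightarrow> nat list" where
  "all_scripts n s = concat (map (\<lambda>k. map (\<lambda>o'. 11 * k + o') (pattern_script s (patterns n ! k))) [0..<length (patterns n)])"

text \<open>In \<open>sim_cdp\<close> the mechanism is chosen before the corrupted set, so each
  simulator is handed the scripts of all patterns; operations of foreign patterns do
  nothing.\<close>

definition sim_ops :: "nat \<Rightarrow> nat \<Rightarrow> (nat \<Rightarrow> com) \<Rightarrow> op list" where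
  "sim_ops m idx sims = map (\<lambda>j. if j div 11 = idx then base_ops sims ! (j mod 11) else NopOp) [0..<11 * m]"

lemma length_base_ops [simp]: "length (base_ops sims) = 11"
  by (simp add: base_ops_def)

lemma run_sim_ops_other:
  "k \<noteq> idx \<Longrightarrow> k < m \<Longrightarrow> \<forall>o' \<in> set os. o' < 11 \<Longrightarrow>
   run_ops \<kappa> (sim_ops m idx sims) (map (\<lambda>o'. 11 * k + o') os) a = return_pmf a"
  by (induction os) (auto simp: sim_ops_def bind_return_pmf)

lemma run_sim_ops_same:
  assumes "idx < m" "\<forall>o' \<in> set os. o' < 11"
  shows "run_ops \<kappa> (sim_ops m idx sims) (map (\<lambda>o'. 11 * idx + o') os) a = run_ops \<kappa> (base_ops sims) os a"
  using assms(2)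
proof (induction os arbitrary: a)
  case (Cons o' os)
  have "run_ops \<kappa> (sim_ops m idx sims) (map (\<lambda>o'. 11 * idx + o') os) = run_ops \<kappa> (base_ops sims) os"
    by (rule ext) (use Cons in simp)
  moreover have "sim_ops m idx sims ! (11 * idx + o') = base_ops sims ! o'"
    using Cons.prems assms(1) by (simp add: sim_ops_def)
  ultimately show ?case by simp
qed simp

lemma run_all:
  assumes "idx < m" "\<And>k o'. k < m \<Longrightarrow> o' \<in> set (f k) \<Longrightarrow> o' < 11"
  shows "run_ops \<kappa> (sim_ops m idx sims) (concat (map (\<lambda>k. map (\<lambda>o'. 11 * k + o') (f k)) [0..<m])) a =
    run_ops \<kappa> (base_ops sims) (f idx) a"
proof -
  have "run_ops \<kappa> (sim_ops m idx sims) (concat (map (\<lambda>k. map (\<lambda>o'. 11 * k + o') (f k)) [0..<l])) a =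
    (if idx < l then run_ops \<kappa> (base_ops sims) (f idx) a else return_pmf a)" if "l \<le> m" for l
    using that
  proof (induction l)
    case (Suc l)
    have o: "\<forall>o' \<in> set (f l). o' < 11" using assms(2)[of l] Suc.prems by auto
    show ?case
    proof (cases "idx = l")
      case True
      then show ?thesis using Suc run_sim_ops_same[OF assms(1), of "f l"] o
        by (simp add: run_ops_append bind_return_pmf)
    next
      case False
      have "run_ops \<kappa> (sim_ops m idx sims) (map (\<lambda>o'. 11 * l + o') (f l)) = return_pmf"
        by (rule ext, rule run_sim_ops_other) (use False Suc.prems o in auto)
      then show ?thesis using Suc False
        by (auto simp: run_ops_append bind_return_pmf bind_return_pmf')
    qed
  qed simp
  then show ?thesis using assms(1) by simp
qed

lemma script_bounds:
  "o' \<in> set (lit_script x) \<Longrightarrow> o' < 11" "o' \<in> set (xor_script x) \<Longrightarrow> o' < 11" "o' \<in> set (arg_script x) \<Longrightarrow> o' < 11"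
  by (auto simp: lit_script_def xor_script_def arg_script_def split: if_splits)

lemma tok_script_bound: "tok_ok k \<Longrightarrow> o' \<in> set (tok_script k) \<Longrightarrow> o' < 11"
  by (cases k) (auto simp: script_bounds)

lemma owners_script_bound: "o' \<in> set (owners_script i M J) \<Longrightarrow> o' < 11"
  by (auto simp: owners_script_def owner_script_def script_bounds split: if_splits)

lemma pattern_script_bound:
  "list_all tok_ok (snd (snd s)) \<Longrightarrow> o' \<in> set (pattern_script s c) \<Longrightarrow> o' < 11"
  by (cases s; cases c)
     (auto simp: pattern_script_def list_all_iff dest: tok_script_bound owners_script_bound split: if_splits)

text \<open>A function of the simulated execution, so privacy carries over as post-processing;
  \<open>rev\<close> anticipates the reversal by the parser.\<close>

definition mechanism :: "params \<Rightarrow> query \<Rightarrow> nat \<Rightarrow> gdb \<Rightarrow> bool list pmf" where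
  "mechanism pp q N D = map_pmf (\<lambda>s. rev (unary (all_scripts (num_owners pp) s))) (sim_run pp (count_before pp q D) N)"

definition pattern_index :: "nat \<Rightarrow> party set \<Rightarrow> nat" where
  "pattern_index n C = (SOME k. k < length (patterns n) \<and> patterns n ! k = pattern_of n C)"

lemma pattern_index: "pattern_index n C < length (patterns n)" "patterns n ! pattern_index n C = pattern_of n C"
proof -
  have "\<exists>k. k < length (patterns n) \<and> patterns n ! k = pattern_of n C"
    using pattern_of_in by (metis in_set_conv_nth)
  from someI_ex[OF this] show "pattern_index n C < length (patterns n)" "patterns n ! pattern_index n C = pattern_of n C"
    by (simp_all add: pattern_index_def)
qed

definition simulator :: "nat \<Rightarrow> (server \<Rightarrow> nat \<Rightarrow> com) \<Rightarrow> party set \<Rightarrow> com" where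
  "simulator n sims C = interp_prog (sim_ops (length (patterns n)) (pattern_index n C) (sims (server_of (fst (pattern_of n C)))))"

lemma sim_ops_ok: "(\<And>k. ppt (sims k)) \<Longrightarrow> \<forall>op \<in> set (sim_ops m idx sims). op_ok op"
proof -
  assume p: "\<And>k. ppt (sims k)"
  have "op_ok op" if "op \<in> set (base_ops sims)" for op using that p by (auto simp: base_ops_def)
  moreover have "base_ops sims ! (j mod 11) \<in> set (base_ops sims)" for j by (rule nth_mem) simp
  ultimately show ?thesis by (auto simp: sim_ops_def)
qed

lemma sim_ops_nonempty: "m > 0 \<Longrightarrow> sim_ops m idx sims \<noteq> []"
  by (simp add: sim_ops_def)

lemma patterns_nonempty: "length (patterns n) > 0"
  using pattern_of_in[of n] by (metis length_greater_0_conv empty_iff empty_set)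

lemma ppt_simulator: "(\<And>i k. ppt (sims i k)) \<Longrightarrow> ppt (simulator n sims C)"
  unfolding simulator_def by (intro interp_prog(1) sim_ops_ok sim_ops_nonempty patterns_nonempty)

lemma exec_simulator:
  assumes "\<And>i k. ppt (sims i k)" "list_all tok_ok (snd (snd s))"
  shows "exec (simulator n sims C) (enc_nat \<kappa> @ enc_bits (rev (unary (all_scripts n s))) @ x) =
    map_pmf fst (run_ops \<kappa> (base_ops (sims (server_of (fst (pattern_of n C))))) (pattern_script s (pattern_of n C)) ([], rev x, [], []))"
proof -
  let ?m = "length (patterns n)" and ?idx = "pattern_index n C" and ?sims = "sims (server_of (fst (pattern_of n C)))"
  have b: "k < ?m \<Longrightarrow> o' \<in> set (pattern_script s (patterns n ! k)) \<Longrightarrow> o' < 11" for k o'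
    by (rule pattern_script_bound[OF assms(2)])
  have "o' < 11 * ?m" if o': "o' \<in> set (all_scripts n s)" for o'
  proof -
    obtain k o'' where "k < ?m" "o'' \<in> set (pattern_script s (patterns n ! k))" "o' = 11 * k + o''"
      using o' by (auto simp: all_scripts_def)
    with b[of k o''] show ?thesis by simp
  qed
  then have d: "decode (length (sim_ops ?m ?idx ?sims)) 0 (unary (all_scripts n s)) = all_scripts n s"
    by (intro decode_unary) (simp add: sim_ops_def)
  have "exec (simulator n sims C) (enc_nat \<kappa> @ enc_bits (rev (unary (all_scripts n s))) @ x) =
    map_pmf fst (run_ops \<kappa> (sim_ops ?m ?idx ?sims) (all_scripts n s) ([], rev x, [], []))"
    unfolding simulator_def using interp_prog(2)[OF sim_ops_nonempty[OF patterns_nonempty] sim_ops_ok[OF assms(1)]]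
    by (simp add: d)
  also have "run_ops \<kappa> (sim_ops ?m ?idx ?sims) (all_scripts n s) ([], rev x, [], []) =
     run_ops \<kappa> (base_ops ?sims) (pattern_script s (patterns n ! ?idx)) ([], rev x, [], [])"
    unfolding all_scripts_def using b by (intro run_all pattern_index) auto
  finally show ?thesis by (simp add: pattern_index)
qed


subsection \<open>Invariants of the simulated execution\<close>

definition sim_ok :: "params \<Rightarrow> nat \<Rightarrow> sim_state \<Rightarrow> bool" where
  "sim_ok pp N s \<longleftrightarrow> list_all tok_ok (snd (snd s)) \<and> map fst (fst (snd s)) = [1..<Suc N] \<and>
     (\<forall>x \<in> set (fst (snd s)). map (map length) (snd x) = batch_shapes pp)"

lemma sim_call_ok: "s' \<in> set_pmf (sim_call k d arg upd pre post s) \<Longrightarrow> sim_ok pp N s \<Longrightarrow> k < 3 \<Longrightarrow> sim_ok pp N s'"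
  by (cases s) (auto simp: sim_call_def sim_ok_def)

lemma sim_run_ok: "s \<in> set_pmf (sim_run pp cs N) \<Longrightarrow> sim_ok pp N s"
proof (induction N arbitrary: s)
  case 0
  then show ?case by (auto simp: sim_start_def sim_ok_def)
next
  case (Suc N)
  then obtain s0 where s0: "s0 \<in> set_pmf (sim_run pp cs N)" "s \<in> set_pmf (sim_step pp cs (Suc N) s0)" by auto
  obtain s1 s2 s3 where s1: "s1 \<in> set_pmf (sim_upload pp (Suc N) s0)" and s2: "s2 \<in> set_pmf (sim_transform pp s1)"
    and s3: "s3 \<in> set_pmf (if interval pp dvd Suc N then sim_shrink pp (cs (Suc N)) s2 else return_pmf s2)"
    and s4: "s \<in> set_pmf (if flush_interval pp dvd Suc N then sim_flush pp s3 else return_pmf s3)"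
    using s0(2) unfolding sim_step_def set_bind_pmf by blast
  have "sim_ok pp (Suc N) s1"
  proof -
    obtain \<sigma> M ks where e: "s0 = (\<sigma>, M, ks)" by (metis prod.exhaust)
    obtain Rs where "Rs \<in> set_pmf (unif_each (batch_shapes pp))"
      "s1 = (receive pp (concat Rs) \<sigma>, M @ [(Suc N, Rs)], ks @ [Lit (enc_tuples (concat Rs))])"
      using s1 by (auto simp: sim_upload_def e)
    then show ?thesis using Suc.IH[OF s0(1)] set_unif_each[of Rs "batch_shapes pp"] unfolding sim_ok_def e by simp
  qed
  with s2 have "sim_ok pp (Suc N) s2" unfolding sim_transform_def by (rule sim_call_ok) simp
  then have "sim_ok pp (Suc N) s3" using s3 by (auto simp: sim_shrink_def split: if_splits dest: sim_call_ok)
  then show ?case using s4 by (auto simp: sim_flush_def split: if_splits dest: sim_call_ok)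
qed

lemma sim_ok_masks:
  assumes "D \<in> valid_dbs pp" "sim_ok pp N s" shows "good_masks pp D (fst (snd s))"
  unfolding good_masks_def
proof (intro ballI, clarify)
  fix t Rs j assume tR: "(t, Rs) \<in> set (fst (snd s))" and j: "j < num_owners pp"
  have "map fst (fst (snd s)) = [1..<Suc N]" using assms(2) unfolding sim_ok_def by blast
  moreover have "t \<in> set (map fst (fst (snd s)))" using tR by force
  ultimately have "t \<in> set [1..<Suc N]" by (simp only:)
  then have t: "t \<ge> 1" by auto
  have "map (map length) Rs = batch_shapes pp" using tR assms(2) unfolding sim_ok_def by force
  then have "map (map length) Rs ! j = batch_shapes pp ! j" and "length (map (map length) Rs) = length (batch_shapes pp)" by simp_all
  then have "map length (Rs ! j) = replicate (caps pp ! j) (Suc (rec_width pp))"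
    using j by (simp add: batch_shapes_def)
  then show "map length (owner_batch pp D t j) = map length (Rs ! j)"
    using valid_batches(2)[OF assms(1) t j] by simp
qed

lemma run_pattern_script:
  assumes "D \<in> valid_dbs pp" "sim_ok pp N (\<sigma>, M, ks)" and J: "\<forall>j \<in> set J. j < num_owners pp"
  shows "map_pmf fst (run_ops \<kappa> (base_ops sims) (pattern_script (\<sigma>, M, ks) (so, J))
      ([], rev (concat (map (owner_data pp N D) J)), [], [])) =
    map_pmf (\<lambda>w. concat (map (\<lambda>j. owner_views (server_of so) pp D M ! j) J) @ (if so = None then [] else w)) (expand \<kappa> sims ks)"
proof -
  have g: "good_masks pp D M" using sim_ok_masks[OF assms(1,2)] by simp
  have M: "map fst M = [1..<Suc N]" and ks: "list_all tok_ok ks" using assms(2) by (auto simp: sim_ok_def)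
  have v: "concat (map (\<lambda>j. concat (map (batch_view i pp D j) M)) J) = concat (map (\<lambda>j. owner_views i pp D M ! j) J)" for i
    using J by (intro arg_cong[where f = concat] map_cong) (auto simp: owner_views_def)
  have ow: "run_ops \<kappa> (base_ops sims) (owners_script i M J) (out, rev (concat (map (owner_data pp N D) J)), [], []) =
    return_pmf (concat (map (\<lambda>j. owner_views i pp D M ! j) J) @ out, [], [], [])" for i out
    using rn_owners[OF g J M, of \<kappa> sims i out "[]"] by (simp only: v append_Nil2)
  show ?thesis
    by (cases so) (simp_all add: pattern_script_def run_ops_append rn_toks[OF ks] bind_map_pmf ow map_bind_pmf
        bind_return_pmf map_pmf_def bind_assoc_pmf)
qed


subsection \<open>Views of the owners\<close>

text \<open>The owners only take part in the upload, so their views do not depend on the protocols.\<close>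

definition owners_of :: "nat \<Rightarrow> exec_state \<Rightarrow> bool list list" where
  "owners_of n e = map (\<lambda>j. snd e (Owner j)) [0..<n]"

lemma owners_call_phase: "map_pmf (owners_of n) (call_phase \<pi> Z inp upd pre post \<kappa> e) = return_pmf (owners_of n e)"
proof -
  have "owners_of n e' = owners_of n e" if "e' \<in> set_pmf (call_phase \<pi> Z inp upd pre post \<kappa> e)" for e'
    using that by (cases e) (auto simp: call_phase_def owners_of_def observe_def)
  then have "map_pmf (owners_of n) (call_phase \<pi> Z inp upd pre post \<kappa> e) =
      map_pmf (\<lambda>_. owners_of n e) (call_phase \<pi> Z inp upd pre post \<kappa> e)"
    by (intro map_pmf_cong refl) auto
  then show ?thesis by (simp add: map_pmf_const)
qed

lemma owners_bind_call:
  "map_pmf (owners_of n) (bind_pmf Q (call_phase \<pi> Z inp upd pre post \<kappa>)) = map_pmf (owners_of n) Q"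
  by (simp add: map_bind_pmf owners_call_phase map_pmf_def[symmetric])

text \<open>The hybrid argument is set up for a corrupted server. When only owners are corrupted,
  this exchanges the real protocols for ideal ones exactly.\<close>

lemma owners_run:
  "map_pmf (owners_of n) (run pp \<pi>T \<pi>S \<pi>F \<kappa> N D) = map_pmf (owners_of n) (run pp \<rho>T \<rho>S \<rho>F \<kappa> N D)"
proof (induction N)
  case (Suc N)
  define K where "K o' = map_pmf (\<lambda>ps. map (\<lambda>j. o' ! j @ enc_tuples (owner_batch pp D (Suc N) j) @
      enc_tuples (fst (ps ! j)) @ enc_tuples (snd (ps ! j))) [0..<n])
      (share_each (map (owner_batch pp D (Suc N)) [0..<num_owners pp]))" for o' :: "bool list list"
  have up: "map_pmf (owners_of n) (upload pp D (Suc N) e) = K (owners_of n e)" for e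
    by (cases e) (auto intro!: map_pmf_cong simp add: upload_eq K_def map_pmf_comp owners_of_def Let_def)
  have st: "map_pmf (owners_of n) (time_step pp \<tau>T \<tau>S \<tau>F \<kappa> D (Suc N) e) = K (owners_of n e)" for \<tau>T \<tau>S \<tau>F e
  proof -
    have "time_step pp \<tau>T \<tau>S \<tau>F \<kappa> D (Suc N) e =
      (let Q1 = bind_pmf (upload pp D (Suc N) e) (transform_phase pp \<tau>T \<kappa>);
           Q2 = (if interval pp dvd Suc N then bind_pmf Q1 (shrink_phase \<tau>S \<kappa>) else Q1)
       in if flush_interval pp dvd Suc N then bind_pmf Q2 (flush_phase \<tau>F \<kappa>) else Q2)"
      by (simp add: time_step_def transform_phase shrink_phase flush_phase bind_assoc_pmf bind_return_pmf bind_return_pmf' Let_def)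
    then show ?thesis
      by (simp add: Let_def transform_phase_def shrink_phase_def flush_phase_def owners_bind_call up)
  qed
  have "map_pmf (owners_of n) (run pp \<tau>T \<tau>S \<tau>F \<kappa> (Suc N) D) = bind_pmf (map_pmf (owners_of n) (run pp \<tau>T \<tau>S \<tau>F \<kappa> N D)) K" for \<tau>T \<tau>S \<tau>F
    by (simp add: map_bind_pmf st bind_map_pmf)
  then show ?case by (simp only: Suc.IH)
qed simp

lemma adversary_view_proj:
  assumes "admissible C" "pattern_of n C = (so, J)" "so = Some i \<or> so = None \<and> i = S0"
  shows "adversary_view n C (snd e) = (case proj i n e of (\<sigma>, os, w) \<Rightarrow>
     concat (map (\<lambda>j. os ! j) J) @ (if so = None then [] else w))"
proof -
  have J: "J = filter (\<lambda>j. Owner j \<in> C) [0..<n]"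
    and so: "so = (if Server S0 \<in> C then Some S0 else if Server S1 \<in> C then Some S1 else None)"
    using assms(2) by (auto simp: pattern_of_def)
  have "concat (map (\<lambda>j. map (\<lambda>j. snd e (Owner j)) [0..<n] ! j) J) = concat (map (snd e) (filter (\<lambda>p. p \<in> C) (map Owner [0..<n])))"
    unfolding J by (intro arg_cong[where f = concat]) (simp add: filter_map o_def)
  moreover have "concat (map (snd e) (filter (\<lambda>p. p \<in> C) [Server S0, Server S1])) = (if so = None then [] else snd e (Server i))"
    using assms(1,3) so by (auto simp: admissible_def split: if_splits)
  ultimately show ?thesis by (simp add: adversary_view_def proj_def)
qed

theorem theorem7:
  fixes pp :: params and q :: query
    and \<pi>T :: "(transform_in, transform_out) two_pc"
    and \<pi>S :: "(shrink_in, shrink_out) two_pc"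
    and \<pi>F :: "(tuple list, tuple list) two_pc"
  assumes "eps pp > 0" and "budget pp > 0" and "trunc pp > 0"
    and "interval pp > 0" and "flush_interval pp > 0"
    and "interval pp * out_size pp < 2 ^ 32"
    and "truncated_query (trunc pp) (row_width pp) q"
    and "secure_2pc transform_shape enc_transform_in enc_transform_out (transform_fun pp q) \<pi>T"
    and "secure_2pc shrink_shape enc_shrink_in enc_shrink_out (shrink_fun pp) \<pi>S"
    and "secure_2pc (map length) enc_tuples enc_tuples (flush_fun pp) \<pi>F"
  shows "sim_cdp (eps pp) (num_owners pp) (valid_dbs pp) (owner_data pp)
           (incshrink_timer pp \<pi>T \<pi>S \<pi>F)"
proof -
  let ?n = "num_owners pp"
  have "\<exists>SimT. \<forall>i. simulates i transform_shape enc_transform_in enc_transform_out (transform_fun pp q) \<pi>T (SimT i)"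
    "\<exists>SimS. \<forall>i. simulates i shrink_shape enc_shrink_in enc_shrink_out (shrink_fun pp) \<pi>S (SimS i)"
    "\<exists>SimF. \<forall>i. simulates i (map length) enc_tuples enc_tuples (flush_fun pp) \<pi>F (SimF i)"
    by (intro choice allI secure_2pc_simulates assms)+
  then obtain SimT SimS SimF where
    simT: "\<And>i. simulates i transform_shape enc_transform_in enc_transform_out (transform_fun pp q) \<pi>T (SimT i)"
    and simS: "\<And>i. simulates i shrink_shape enc_shrink_in enc_shrink_out (shrink_fun pp) \<pi>S (SimS i)"
    and simF: "\<And>i. simulates i (map length) enc_tuples enc_tuples (flush_fun pp) \<pi>F (SimF i)"
    by blast
  define sims where "sims i k = (if k = 0 then SimT i else if k = 1 then SimS i else SimF i)" for i and k :: nat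
  have ppt: "ppt (sims i k)" for i k
    using simT[of i] simS[of i] simF[of i] by (simp add: sims_def simulates_def)
  define idT where "idT i = ideal_2pc i enc_transform_in enc_transform_out (transform_fun pp q) (SimT i)" for i
  define idS where "idS i = ideal_2pc i enc_shrink_in enc_shrink_out (shrink_fun pp) (SimS i)" for i
  define idF where "idF i = ideal_2pc i enc_tuples enc_tuples (flush_fun pp) (SimF i)" for i
  let ?sim = "\<lambda>C \<kappa> N D. do { out \<leftarrow> mechanism pp q N D;
     exec (simulator ?n sims C) (enc_nat \<kappa> @ enc_bits out @ concat (map (owner_data pp N D) (filter (\<lambda>j. Owner j \<in> C) [0..<?n]))) }"

  have privacy: "eps_dp (eps pp) (mechanism pp q N)" for N
    unfolding eps_dp_def
  proof (intro allI impI)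
    fix D D' Out assume "neighboring D D'"
    from sim_run_private[OF assms(1,2,7) this]
    have "dp_le (eps pp) (mechanism pp q N D) (mechanism pp q N D')"
      unfolding mechanism_def map_pmf_def by (intro dp_le_postprocess) (use assms(1) in auto)
    then show "measure_pmf.prob (mechanism pp q N D) Out \<le> exp (eps pp) * measure_pmf.prob (mechanism pp q N D') Out"
      by (rule dp_le_prob)
  qed

  \<comment> \<open>Both corruption types at once: \<open>i\<close> is the corrupted server, or
    \<open>S0\<close> by the same convention as in \<open>server_of\<close>.\<close>
  have ideal: "map_pmf (\<lambda>e. adversary_view ?n C (snd e)) (run pp (idT i) (idS i) (idF i) \<kappa> N D) = ?sim C \<kappa> N D"
    if D: "D \<in> valid_dbs pp" and C: "admissible C" "pattern_of ?n C = (so, J)" and so: "so = Some i \<or> so = None \<and> i = S0"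
    for C \<kappa> N D so J i
  proof -
    let ?g = "\<lambda>(\<sigma> :: sstate, os, w). concat (map (\<lambda>j. os ! j) J) @ (if so = None then [] else w)"
    have J: "J = filter (\<lambda>j. Owner j \<in> C) [0..<?n]" using C(2) by (simp add: pattern_of_def)
    have i: "server_of so = i" using so by auto
    have "related i pp D \<kappa> (sims i) (plain_run pp D N) (count_after pp q D N)
        (run pp (idT i) (idS i) (idF i) \<kappa> N D) (sim_run pp (count_before pp q D) N)"
      using rel_run[OF D assms(4,6,7), of i \<kappa> "sims i" N] by (simp add: sims_def idT_def idS_def idF_def)
    then have proj: "map_pmf (proj i ?n) (run pp (idT i) (idS i) (idF i) \<kappa> N D) =
        bind_pmf (sim_run pp (count_before pp q D) N) (fill i pp D \<kappa> (sims i))"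
      by (simp add: related_def)
    have "map_pmf (\<lambda>e. ?g (proj i ?n e)) (run pp (idT i) (idS i) (idF i) \<kappa> N D) =
        map_pmf ?g (map_pmf (proj i ?n) (run pp (idT i) (idS i) (idF i) \<kappa> N D))"
      by (simp only: map_pmf_comp)
    also have "\<dots> = map_pmf ?g (bind_pmf (sim_run pp (count_before pp q D) N) (fill i pp D \<kappa> (sims i)))"
      by (simp only: proj)
    also have "\<dots> = bind_pmf (sim_run pp (count_before pp q D) N) (\<lambda>s. exec (simulator ?n sims C)
        (enc_nat \<kappa> @ enc_bits (rev (unary (all_scripts ?n s))) @ concat (map (owner_data pp N D) J)))"
      unfolding map_bind_pmf
    proof (rule bind_pmf_cong[OF refl])
      fix s assume "s \<in> set_pmf (sim_run pp (count_before pp q D) N)"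
      then have ok: "sim_ok pp N s" by (rule sim_run_ok)
      obtain \<sigma> M ks where s: "s = (\<sigma>, M, ks)" by (metis prod.exhaust)
      have "\<forall>j\<in>set J. j < ?n" by (auto simp: J)
      from run_pattern_script[OF D ok[unfolded s] this, of \<kappa> "sims i" so]
      show "map_pmf ?g (fill i pp D \<kappa> (sims i) s) = exec (simulator ?n sims C)
        (enc_nat \<kappa> @ enc_bits (rev (unary (all_scripts ?n s))) @ concat (map (owner_data pp N D) J))"
        using exec_simulator[where s = s and n = ?n and C = C and \<kappa> = \<kappa> and sims = sims and x = "concat (map (owner_data pp N D) J)", OF ppt] ok
        by (simp add: C(2) i s fill_def map_pmf_comp sim_ok_def)
    qed
    also have "\<dots> = ?sim C \<kappa> N D"
      by (simp add: mechanism_def bind_map_pmf J)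
    finally show ?thesis
      using adversary_view_proj[OF C so] by simp
  qed

  have main: "\<exists>\<mu>. negligible \<mu> \<and> (\<forall>\<kappa>. prob_one A \<kappa> (map_pmf (adversary_view ?n C) (incshrink_timer pp \<pi>T \<pi>S \<pi>F \<kappa> N D))
       \<le> prob_one A \<kappa> (?sim C \<kappa> N D) + \<mu> \<kappa>)"
    if D: "D \<in> valid_dbs pp" and adm: "admissible C" and A: "adversary A" for C N A D
  proof -
    obtain so J where p: "pattern_of ?n C = (so, J)" by force
    show ?thesis
    proof (cases so)
      case (Some i)
      then have C1: "Server i \<in> C" using p by (auto simp: pattern_of_def split: if_splits)
      then have C2: "Server j \<notin> C" if "j \<noteq> i" for j
        using that adm by (cases i; cases j) (auto simp: admissible_def)
      obtain \<mu> where "negligible \<mu>" and \<mu>: "\<And>\<kappa>. \<bar>prob_one A \<kappa> (map_pmf (adversary_view ?n C) (incshrink_timer pp \<pi>T \<pi>S \<pi>F \<kappa> N D)) -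
         prob_one A \<kappa> (map_pmf (adversary_view ?n C) (incshrink_timer pp (idT i) (idS i) (idF i) \<kappa> N D))\<bar> \<le> \<mu> \<kappa>"
        using incshrink_hybrid[OF assms(1,2,8,9,10) simT simS simF A C1 C2, of N D] unfolding idT_def idS_def idF_def by blast
      moreover have "map_pmf (adversary_view ?n C) (incshrink_timer pp (idT i) (idS i) (idF i) \<kappa> N D) = ?sim C \<kappa> N D" for \<kappa>
        using ideal[OF D adm p, of i \<kappa> N] Some by (simp add: incshrink_timer_def map_pmf_comp)
      moreover have "a \<le> b + m" if "\<bar>a - b\<bar> \<le> m" for a b m :: real using that by linarith
      ultimately show ?thesis by (intro exI[of _ \<mu>]) simp
    next
      case None
      have v: "adversary_view ?n C (snd e) = concat (map (\<lambda>j. owners_of ?n e ! j) J)" for e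
        using adversary_view_proj[OF adm p, of S0 e] None by (simp add: proj_def owners_of_def)
      have "map_pmf (adversary_view ?n C) (incshrink_timer pp \<pi>T \<pi>S \<pi>F \<kappa> N D) = ?sim C \<kappa> N D" for \<kappa>
      proof -
        have "map_pmf (adversary_view ?n C) (incshrink_timer pp \<pi>T \<pi>S \<pi>F \<kappa> N D) =
            map_pmf (\<lambda>os. concat (map (\<lambda>j. os ! j) J)) (map_pmf (owners_of ?n) (run pp \<pi>T \<pi>S \<pi>F \<kappa> N D))"
          by (simp add: incshrink_timer_def map_pmf_comp v)
        \<comment> \<open>Without server views nothing computational is left to hide, so the two
          worlds coincide and the negligible function is zero.\<close>
        also have "\<dots> = map_pmf (\<lambda>os. concat (map (\<lambda>j. os ! j) J)) (map_pmf (owners_of ?n) (run pp (idT S0) (idS S0) (idF S0) \<kappa> N D))"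
          by (rule arg_cong[OF owners_run])
        also have "\<dots> = ?sim C \<kappa> N D"
          using ideal[OF D adm p, of S0 \<kappa> N] None by (simp add: map_pmf_comp v)
        finally show ?thesis .
      qed
      then show ?thesis by (intro exI[of _ "\<lambda>_. 0"]) simp
    qed
  qed

  show ?thesis
    unfolding sim_cdp_def
  proof (intro exI[of _ "mechanism pp q"] exI[of _ "simulator ?n sims"] conjI allI impI ballI)
    show "eps_dp (eps pp) (mechanism pp q N)" for N by (rule privacy)
    show "ppt (simulator ?n sims C)" for C by (rule ppt_simulator[OF ppt])
  qed (rule main)
qed

end
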